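(* Let $n\ge1$ and $g>0$. Let $\mathcal{S}_n=\rho_0Q_{z_1}\cdots Q_{z_n}$, i.e. for $f\in\mathbb{C}[\mathbf{x}]^{S_n}$, $\mathcal{S}_nf=[Q_{z_1}\cdots Q_{z_n}f](1,\dots,1)$, a polynomial in $z_1,\dots,z_n$. Then for every partition $\lambda=(\lambda_1,\dots,\lambda_n)$, $\lambda_1\ge\dots\ge\lambda_n\ge0$, $$\mathcal{S}_n:\ P_\lambda^{(1/g)}(\mathbf{x})\ \mapsto\ c_\lambda\prod_{k=1}^n q_\lambda(z_k),$$ where $q_\lambda(z)$ is the eigenvalue of $Q_z$ on $P_\lambda^{(1/g)}$ ($Q_zP_\lambda^{(1/g)}=q_\lambda(z)P_\lambda^{(1/g)}$) and $$c_\lambda=P_\lambda^{(1/g)}(1,\dots,1)=\prod_{1\le i<j\le n}\frac{(g(j-i+1))_{\lambda_{i,j}}}{(g(j-i))_{\lambda_{i,j}}}\,.$$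
   Context: Notation: $\lambda_{i,j}=\lambda_i-\lambda_j$; $(\alpha)_k=\alpha(\alpha+1)\cdots(\alpha+k-1)$ is the Pochhammer symbol; $\Delta_n(\mathbf{x})=\prod_{1\le i<j\le n}(x_j-x_i)$; $\mathbb{C}[\mathbf{x}]^{S_n}$ is the ring of symmetric polynomials in $\mathbf{x}=(x_1,\dots,x_n)$; $\rho_0:f\mapsto f(1,\dots,1)$ is evaluation at $\mathbf{x}=(1,\dots,1)$. The operator $Q_z$. For $g>0$, real $z>1$, and reals $0<y_1<\dots<y_n$, and $p\in\mathbb{C}[\mathbf{x}]^{S_n}$ put $$[Q_zp](\mathbf{y})=\frac{\Gamma(ng)}{\Gamma(g)^n}\,\frac{(z-1)^{1-ng}}{\Delta_n(\mathbf{y})\prod_{i=1}^n y_i^{g-1}}\int_{\Omega_{\mathbf{x}}}d\mathbf{x}\;\delta(x_1\cdots x_n-z\,y_1\cdots y_n)\,\Delta_n(\mathbf{x})\Big[\prod_{i=1}^n\xi_i^{g-1}\Big]p(\mathbf{x}),$$ where $\Omega_{\mathbf{x}}=\{\mathbf{x}\in\mathbb{R}^n: 0<y_1<x_1<y_2<\dots<x_{n-1}<y_n<x_n<\infty\}$, $\xi_i=\prod_{k=1}^n(x_k-y_i)\big/\prod_{k\ne i}(y_k-y_i)>0$, and $\delta$ is the Dirac delta function (so $\int\delta(h(\mathbf x))F(\mathbf x)d\mathbf x=\int_{\{h=0\}}F\,dS/|\nabla h|$). The function $[Q_zp](\mathbf{y})$ is a polynomial in $z$ and a symmetric polynomial in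 $\mathbf{y}$; accordingly $Q_z$ is extended to all $z\in\mathbb{C}$ and (renaming $\mathbf{y}$ as $\mathbf{x}$) regarded as a linear operator on $\mathbb{C}[\mathbf{x}]^{S_n}$. The Jack polynomials are eigenfunctions of $Q_z$, with eigenvalues $q_\lambda(z)\in\mathbb{C}(g)[z]$. Jack polynomials. For partitions $\mu,\lambda$ with $n$ parts (zeros allowed), $\mu\preceq\lambda$ means $\sum_{j=1}^n\mu_j=\sum_{j=1}^n\lambda_j$ and $\sum_{j=1}^k\mu_j\le\sum_{j=1}^k\lambda_j$ for $k=1,\dots,n-1$. $m_\lambda(\mathbf{x})$ is the sum of $x_1^{\nu_1}\cdots x_n^{\nu_n}$ over all distinct permutations $\nu$ of $\lambda$. The Jack polynomials $P_\lambda^{(1/g)}(\mathbf{x})\in\mathbb{C}(g)[\mathbf{x}]^{S_n}$ are the unique symmetric polynomials of the form $P_\lambda^{(1/g)}=m_\lambda+\sum_{\mu\prec\lambda}v_{\lambda\mu}(g)m_\mu$ such that $D(u;g)P_\lambda^{(1/g)}=\big[\prod_{i=1}^n(\lambda_i+(n-i)g+u)\big]P_\lambda^{(1/g)}$, where $$D(u;g)=\frac{(-1)^{n(n-1)/2}}{\Delta_n(\mathbf{x})}\det\Big[x_i^{n-j}\Big(x_i\frac{\partial}{\partial x_i}+(n-j)g+u\Big)\Big]_{i,j=1}^n .$$ *)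

theory Defs
  imports
    "HOL-Analysis.Analysis"
    "HOL-Computational_Algebra.Polynomial"
    "HOL-Combinatorics.Permutations"
    "HOL-Library.Poly_Mapping"
begin

(* All indices run over 0, ..., n - 1 instead of 1, ..., n. *)

section \<open>Polynomials in the variables x 0, ..., x (n - 1)\<close>

text \<open>
  A multivariate polynomial is a finitely supported map from exponent vectors to coefficients;
  the product on this type is the convolution product, i.e. multiplication of polynomials.
\<close>

type_synonym mpoly = "(nat \<Rightarrow>\<^sub>0 nat) \<Rightarrow>\<^sub>0 complex"

definition const :: "complex \<Rightarrow> mpoly" where
  "const c = Poly_Mapping.single 0 c"

definition var :: "nat \<Rightarrow> mpoly" where
  "var i = Poly_Mapping.single (Poly_Mapping.single i 1) 1"

definition eval_mpoly :: "(nat \<Rightarrow> complex) \<Rightarrow> mpoly \<Rightarrow> complex" where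
  "eval_mpoly x p =
     (\<Sum>m\<in>Poly_Mapping.keys p. Poly_Mapping.lookup p m *
        (\<Prod>i\<in>Poly_Mapping.keys m. x i ^ Poly_Mapping.lookup m i))"

definition partial :: "nat \<Rightarrow> mpoly \<Rightarrow> mpoly" where
  "partial i p =
     (\<Sum>m\<in>Poly_Mapping.keys p. Poly_Mapping.single (m - Poly_Mapping.single i 1)
        (of_nat (Poly_Mapping.lookup m i) * Poly_Mapping.lookup p m))"

definition sym_polys :: "nat \<Rightarrow> mpoly set" where
  "sym_polys n = {p. (\<forall>m\<in>Poly_Mapping.keys p. Poly_Mapping.keys m \<subseteq> {..<n}) \<and>
     (\<forall>\<sigma> m. \<sigma> permutes {..<n} \<longrightarrow>
        Poly_Mapping.lookup p (Poly_Mapping.map_key \<sigma> m) = Poly_Mapping.lookup p m)}"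

section \<open>Jack polynomials\<close>

definition is_partition :: "nat \<Rightarrow> nat list \<Rightarrow> bool" where
  "is_partition n lam \<longleftrightarrow> length lam = n \<and> sorted_wrt (\<ge>) lam"

definition dominated :: "nat \<Rightarrow> nat list \<Rightarrow> nat list \<Rightarrow> bool" where
  "dominated n mu lam \<longleftrightarrow> sum_list mu = sum_list lam \<and>
     (\<forall>k\<in>{1..<n}. sum_list (take k mu) \<le> sum_list (take k lam))"

definition monomial_sym :: "nat \<Rightarrow> nat list \<Rightarrow> mpoly" where
  "monomial_sym n lam = (\<Sum>nu\<in>{nu. mset nu = mset lam}. \<Prod>i<n. var i ^ (nu ! i))"

definition vandermonde :: "nat \<Rightarrow> (nat \<Rightarrow> 'a) \<Rightarrow> 'a::comm_ring_1" where
  "vandermonde n x = (\<Prod>j<n. \<Prod>i<j. x j - x i)"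

definition D_entry :: "nat \<Rightarrow> real \<Rightarrow> complex \<Rightarrow> nat \<Rightarrow> nat \<Rightarrow> mpoly \<Rightarrow> mpoly" where
  "D_entry n g u i j f = var i ^ (n - 1 - j) *
     (var i * partial i f + const (of_real (real (n - 1 - j) * g) + u) * f)"

text \<open>
  The determinant of the matrix of operators, applied to \<open>f\<close>. Entries in different rows act on
  different variables and hence commute, so the order of composition is immaterial.
\<close>

definition D_det :: "nat \<Rightarrow> real \<Rightarrow> complex \<Rightarrow> mpoly \<Rightarrow> mpoly" where
  "D_det n g u f = (\<Sum>\<sigma> | \<sigma> permutes {..<n}.
     of_int (sign \<sigma>) * foldr (\<lambda>i. D_entry n g u i (\<sigma> i)) [0..<n] f)"

text \<open>
  For symmetric \<open>f\<close> the determinant yields an antisymmetric polynomial, so that the division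
  by the Vandermonde product is exact.
\<close>

definition D_op :: "nat \<Rightarrow> real \<Rightarrow> complex \<Rightarrow> mpoly \<Rightarrow> mpoly" where
  "D_op n g u f =
     (THE r. vandermonde n var * r = (-1) ^ (n * (n - 1) div 2) * D_det n g u f)"

text \<open>
  The Jack polynomial \<open>P\<close> with parameter \<open>1 / g\<close>. For a real number \<open>g > 0\<close> the numbers
  \<open>\<lambda>\<^sub>i + (n - i) g\<close> are strictly decreasing in \<open>i\<close>, so distinct partitions have distinct
  eigenvalues and the characterization is already unique for this fixed value of \<open>g\<close>;
  there is no need to pass through coefficients that are rational functions of \<open>g\<close>.
\<close>

definition jack :: "nat \<Rightarrow> real \<Rightarrow> nat list \<Rightarrow> mpoly" where
  "jack n g lam = (THE P. P \<in> sym_polys n \<and>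
     (\<exists>v. P = monomial_sym n lam +
        (\<Sum>mu | is_partition n mu \<and> dominated n mu lam \<and> mu \<noteq> lam. const (v mu) * monomial_sym n mu)) \<and>
     (\<forall>u. D_op n g u P =
        const (\<Prod>i<n. of_nat (lam ! i) + of_real (real (n - 1 - i) * g) + u) * P))"

section \<open>The operator \<open>Q\<close>\<close>

definition pderiv_at :: "nat \<Rightarrow> ((nat \<Rightarrow> real) \<Rightarrow> real) \<Rightarrow> (nat \<Rightarrow> real) \<Rightarrow> real" where
  "pderiv_at i h x = deriv (\<lambda>t. h (x(i := t))) (x i)"

definition grad_norm :: "nat \<Rightarrow> ((nat \<Rightarrow> real) \<Rightarrow> real) \<Rightarrow> (nat \<Rightarrow> real) \<Rightarrow> real" where
  "grad_norm n h x = sqrt (\<Sum>i<n. (pderiv_at i h x)\<^sup>2)"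

text \<open>
  The integral of \<open>F\<close> with respect to the surface measure of the graph \<open>x\<^sub>n = \<phi> (x\<^sub>1, \<dots>, x\<^sub>n\<^sub>-\<^sub>1)\<close>
  in \<open>n\<close>-dimensional Euclidean space, the surface element being
  \<open>dS = sqrt (1 + (grad \<phi>)\<^sup>2) dx\<^sub>1 \<dots> dx\<^sub>n\<^sub>-\<^sub>1\<close>. For \<open>n = 1\<close> the graph is a single point of mass 1.
\<close>

definition graph_integral ::
  "nat \<Rightarrow> ((nat \<Rightarrow> real) \<Rightarrow> real) \<Rightarrow> ((nat \<Rightarrow> real) \<Rightarrow> complex) \<Rightarrow> complex" where
  "graph_integral n \<phi> F = (LINT x | (\<Pi>\<^sub>M i\<in>{..<n - 1}. lborel).
     of_real (sqrt (1 + (grad_norm (n - 1) \<phi> x)\<^sup>2)) * F (x(n - 1 := \<phi> x)))"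

text \<open>The interlacing region \<open>y\<^sub>1 < x\<^sub>1 < y\<^sub>2 < \<dots> < x\<^sub>n\<^sub>-\<^sub>1 < y\<^sub>n < x\<^sub>n\<close>.\<close>

definition Omega :: "nat \<Rightarrow> (nat \<Rightarrow> real) \<Rightarrow> (nat \<Rightarrow> real) set" where
  "Omega n y = {x. (\<forall>i<n. y i < x i) \<and> (\<forall>i. Suc i < n \<longrightarrow> x i < y (Suc i))}"

text \<open>
  The integral of \<open>\<delta> (x\<^sub>1 \<dots> x\<^sub>n - c) F x\<close> over \<open>Omega n y\<close>, where the \<open>y i\<close> are positive, as the
  integral of \<open>F / norm (grad h)\<close> over the hypersurface \<open>h x = 0\<close> with \<open>h x = x\<^sub>1 \<dots> x\<^sub>n - c\<close>.
  All coordinates are positive on \<open>Omega n y\<close>, so there the hypersurface is the graph of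
  \<open>x\<^sub>n = c / (x\<^sub>1 \<dots> x\<^sub>n\<^sub>-\<^sub>1)\<close>.
\<close>

definition delta_integral ::
  "nat \<Rightarrow> (nat \<Rightarrow> real) \<Rightarrow> real \<Rightarrow> ((nat \<Rightarrow> real) \<Rightarrow> complex) \<Rightarrow> complex" where
  "delta_integral n y c F =
     graph_integral n (\<lambda>x. c / (\<Prod>i<n - 1. x i))
       (\<lambda>x. indicator (Omega n y) x * F x / of_real (grad_norm n (\<lambda>x. (\<Prod>i<n. x i) - c) x))"

definition xi :: "nat \<Rightarrow> (nat \<Rightarrow> real) \<Rightarrow> (nat \<Rightarrow> real) \<Rightarrow> nat \<Rightarrow> real" where
  "xi n y x i = (\<Prod>k<n. x k - y i) / (\<Prod>k\<in>{..<n} - {i}. y k - y i)"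

definition Q_integral :: "nat \<Rightarrow> real \<Rightarrow> real \<Rightarrow> mpoly \<Rightarrow> (nat \<Rightarrow> real) \<Rightarrow> complex" where
  "Q_integral n g z p y =
     of_real (Gamma (real n * g) / Gamma g ^ n *
       ((z - 1) powr (1 - real n * g) / (vandermonde n y * (\<Prod>i<n. y i powr (g - 1))))) *
     delta_integral n y (z * (\<Prod>i<n. y i))
       (\<lambda>x. of_real (vandermonde n x * (\<Prod>i<n. xi n y x i powr (g - 1))) *
          eval_mpoly (\<lambda>i. of_real (x i)) p)"

text \<open>
  \<open>Q_integral n g z p y\<close> is polynomial in \<open>z\<close> and symmetric polynomial in \<open>y\<close>: \<open>Q_poly n g p\<close>
  is this polynomial, written as a polynomial in \<open>z\<close> with coefficients in \<open>sym_polys n\<close>.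
\<close>

definition Q_poly :: "nat \<Rightarrow> real \<Rightarrow> mpoly \<Rightarrow> mpoly poly" where
  "Q_poly n g p = (THE r. (\<forall>k. coeff r k \<in> sym_polys n) \<and>
     (\<forall>z y. z > 1 \<and> strict_mono_on {..<n} y \<and> (\<forall>i<n. 0 < y i) \<longrightarrow>
        eval_mpoly (\<lambda>i. of_real (y i)) (poly r (const (of_real z))) = Q_integral n g z p y))"

definition Q_op :: "nat \<Rightarrow> real \<Rightarrow> complex \<Rightarrow> mpoly \<Rightarrow> mpoly" where
  "Q_op n g z p = poly (Q_poly n g p) (const z)"

definition S_op :: "nat \<Rightarrow> real \<Rightarrow> (nat \<Rightarrow> complex) \<Rightarrow> mpoly \<Rightarrow> complex" where
  "S_op n g z f = eval_mpoly (\<lambda>_. 1) (foldr (\<lambda>k. Q_op n g (z k)) [0..<n] f)"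

end

theory Submission
  imports Defs "Jordan_Normal_Form.Determinant" "HOL-Computational_Algebra.Polynomial_FPS"
begin

text \<open>
  \<open>Q_op\<close> commutes with scalars once \<open>Q_poly\<close> is known to exist, so the eigenvalues multiply and it
  remains to evaluate the Jack polynomial at \<open>(1, \<dots>, 1)\<close>.

  Jack polynomials: \<open>D\<close> is triangular for the dominance order, and its action on the Cauchy kernel
  \<open>\<Prod>i j. (1 - x i * y j) powr (- g)\<close> is symmetric in \<open>x\<close> and \<open>y\<close>. Since the kernel is a positive
  combination of products of power sums, an eigenbasis of one operator \<open>D u\<close> diagonalizes the kernel
  and hence all of them.

  Evaluation: \<open>D u\<close> with \<open>u = a - (n - 1) g\<close> multiplies \<open>\<Prod>i. (1 - x i) powr (- a)\<close> by a constant and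
  shifts \<open>a\<close> to \<open>a + 1\<close>. This determines the coefficients of this series in the Jack basis up to a factor
  independent of \<open>a\<close>. The cases \<open>a = n g\<close> and \<open>a = (n - 1) g\<close> are the Cauchy kernel at \<open>(1, \<dots>, 1)\<close>
  and \<open>(1, \<dots>, 1, 0)\<close>, which yields a recursion in \<open>n\<close>.

  Existence of \<open>Q_poly\<close>: in the coordinates \<open>w i = \<xi> i / y i\<close> the integral runs over the simplex
  \<open>sum w = z - 1\<close> with a Dirichlet density. By Lagrange interpolation and Newton's identities a symmetric
  polynomial in \<open>x\<close> is a polynomial in \<open>y\<close> and \<open>w\<close>, and the Dirichlet moments are polynomial in \<open>z\<close>.
\<close>

text \<open>The hypothesis describes \<open>Q_op\<close> on the Jack polynomial only, and
  \<open>Q_op\<close> is a definite description, about which nothing follows for a multiple of that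
  polynomial unless the described object exists; this is the sole purpose of the integral
  computation. The definition of \<open>jack\<close> asks for one eigenvector of \<open>D u\<close>
  for all \<open>u\<close>, while triangularity gives an eigenbasis for a single \<open>u0\<close>
  that separates the partitions of one size. Commutation of the \<open>D u\<close> is not computed.
  Instead, let B be the matrix of the kernel and e that of \<open>D u\<close>: the symmetry of the
  action says that the product B e is symmetric. For \<open>u0\<close> this makes B diagonal; for
  any other \<open>u\<close> the triangular e can then have no entry off the diagonal. Positivity of
  the power sum coefficients keeps the diagonal of B away from 0. At \<open>(1, ..., 1, 0)\<close> a
  Jack polynomial with positive last part vanishes, so the recursion is silent there; such parts are
  first reduced by splitting off the product of the variables. The Jacobian of the coordinates
  \<open>w\<close> is not expanded as a determinant: one \<open>x k\<close> at a time is traded for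
  its weight, by Fubini and a substitution on the line.\<close>

abbreviation lookup where "lookup \<equiv> Poly_Mapping.lookup"
abbreviation keys where "keys \<equiv> Poly_Mapping.keys"
abbreviation single where "single \<equiv> Poly_Mapping.single"
abbreviation map_key where "map_key \<equiv> Poly_Mapping.map_key"

section \<open>Evaluation of polynomials\<close>

definition meval :: "(nat \<Rightarrow> complex) \<Rightarrow> (nat \<Rightarrow>\<^sub>0 nat) \<Rightarrow> complex" where
  "meval x m = (\<Prod>i\<in>keys m. x i ^ lookup m i)"

lemma meval_superset:
  "finite B \<Longrightarrow> keys m \<subseteq> B \<Longrightarrow> meval x m = (\<Prod>i\<in>B. x i ^ lookup m i)"
  unfolding meval_def by (rule prod.mono_neutral_left) (auto simp: in_keys_iff)

lemma meval_0 [simp]: "meval x 0 = 1"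
  by (simp add: meval_def)

lemma meval_add: "meval x (a + b) = meval x a * meval x b"
proof -
  let ?B = "keys a \<union> keys b"
  have "meval x (a + b) = (\<Prod>i\<in>?B. x i ^ lookup (a + b) i)"
    by (rule meval_superset) (auto simp: Poly_Mapping.keys_add)
  also have "\<dots> = meval x a * meval x b"
    by (simp add: meval_superset[of ?B] lookup_add power_add prod.distrib)
  finally show ?thesis .
qed

lemma eval_mpoly_superset:
  assumes "finite S" "keys p \<subseteq> S"
  shows "eval_mpoly x p = (\<Sum>m\<in>S. lookup p m * meval x m)"
  unfolding eval_mpoly_def meval_def
  using assms by (intro sum.mono_neutral_left) (auto simp: in_keys_iff)

lemma eval_mpoly_add: "eval_mpoly x (p + q) = eval_mpoly x p + eval_mpoly x q"
proof -
  let ?S = "keys p \<union> keys q"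
  have "eval_mpoly x (p + q) = (\<Sum>m\<in>?S. lookup (p + q) m * meval x m)"
    by (rule eval_mpoly_superset) (auto simp: Poly_Mapping.keys_add)
  then show ?thesis
    by (simp add: eval_mpoly_superset[of ?S] lookup_add sum.distrib ring_distribs)
qed

lemma eval_mpoly_zero [simp]: "eval_mpoly x 0 = 0"
  by (simp add: eval_mpoly_def)

lemma eval_mpoly_sum: "eval_mpoly x (sum f A) = (\<Sum>a\<in>A. eval_mpoly x (f a))"
  by (induction A rule: infinite_finite_induct) (auto simp: eval_mpoly_add)

lemma eval_mpoly_single: "eval_mpoly x (single m c) = c * meval x m"
  by (subst eval_mpoly_superset[of "{m}"]) auto

lemma mpoly_eq_sum: "p = (\<Sum>m\<in>keys p. single m (lookup p m))"
  by (rule poly_mapping_eqI) (auto simp: lookup_sum lookup_single when_def in_keys_iff)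

lemma eval_mpoly_mult: "eval_mpoly x (p * q) = eval_mpoly x p * eval_mpoly x q"
proof -
  have "p * q = (\<Sum>a\<in>keys p. single a (lookup p a)) *
    (\<Sum>b\<in>keys q. single b (lookup q b))"
    by (simp add: mpoly_eq_sum[symmetric])
  also have "eval_mpoly x \<dots> = (\<Sum>a\<in>keys p. \<Sum>b\<in>keys q.
     lookup p a * lookup q b * (meval x a * meval x b))"
    by (simp add: sum_product mult_single eval_mpoly_sum eval_mpoly_single meval_add)
  also have "\<dots> = eval_mpoly x p * eval_mpoly x q"
    by (simp add: eval_mpoly_superset[OF finite_keys order_refl] sum_product algebra_simps)
  finally show ?thesis .
qed

lemma eval_mpoly_one [simp]: "eval_mpoly x 1 = 1"
  using eval_mpoly_single[of x 0 1] by simp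

lemma eval_mpoly_uminus: "eval_mpoly x (- p) = - eval_mpoly x p"
  using eval_mpoly_add[of x p "- p"] by (simp add: eq_neg_iff_add_eq_0 add.commute)

lemma eval_mpoly_minus: "eval_mpoly x (p - q) = eval_mpoly x p - eval_mpoly x q"
  using eval_mpoly_add[of x p "- q"] by (simp add: eval_mpoly_uminus)

lemma eval_mpoly_prod: "eval_mpoly x (prod f A) = (\<Prod>a\<in>A. eval_mpoly x (f a))"
  by (induction A rule: infinite_finite_induct) (auto simp: eval_mpoly_mult)

lemma eval_mpoly_power: "eval_mpoly x (p ^ k) = eval_mpoly x p ^ k"
  by (induction k) (auto simp: eval_mpoly_mult)

lemma eval_mpoly_const [simp]: "eval_mpoly x (const c) = c"
  by (simp add: const_def eval_mpoly_single)

lemma eval_mpoly_var [simp]: "eval_mpoly x (var i) = x i"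
  by (simp add: var_def eval_mpoly_single meval_def)

lemma eval_mpoly_of_int [simp]: "eval_mpoly x (of_int k) = of_int k"
proof -
  have "of_int k = const (of_int k)"
    by (simp add: const_def)
  then show ?thesis by (simp only: eval_mpoly_const)
qed

lemma const_0 [simp]: "const 0 = 0" and const_1 [simp]: "const 1 = 1"
  by (simp_all add: const_def)

lemma const_add: "const (a + b) = const a + const b"
  by (simp add: const_def single_add)

lemma const_mult: "const (a * b) = const a * const b"
  by (simp add: const_def mult_single)

lemma const_uminus: "const (- a) = - const a"
  by (simp add: const_def single_uminus)

lemma const_minus: "const (a - b) = const a - const b"
  by (simp add: const_def single_diff)

lemma const_sum: "const (sum f A) = (\<Sum>a\<in>A. const (f a))"
  by (induction A rule: infinite_finite_induct) (auto simp: const_add)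

lemma const_of_int [simp]: "const (of_int k) = of_int k"
  by (simp add: const_def)

lemma lookup_single_mult: "lookup (single a c * p) (a + b) = c * lookup p b"
  for a b :: "nat \<Rightarrow>\<^sub>0 nat" and c :: complex
proof -
  have "single a c * p = (\<Sum>m\<in>keys p. single (a + m) (c * lookup p m))"
    by (subst mpoly_eq_sum[of p]) (simp add: sum_distrib_left mult_single)
  then show ?thesis
    by (auto simp: lookup_sum lookup_single when_def in_keys_iff)
qed

lemma lookup_const_mult [simp]: "lookup (const c * p) b = c * lookup p b"
  using lookup_single_mult[of 0 c p b] by (simp add: const_def)

lemma lookup_single_mult_eq_0:
  fixes a b :: "nat \<Rightarrow>\<^sub>0 nat" and c :: complex
  assumes "\<And>m. m \<in> keys p \<Longrightarrow> b \<noteq> a + m"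
  shows "lookup (single a c * p) b = 0"
proof -
  have "single a c * p = (\<Sum>m\<in>keys p. single (a + m) (c * lookup p m))"
    by (subst mpoly_eq_sum[of p]) (simp add: sum_distrib_left mult_single)
  then show ?thesis
    using assms by (simp add: lookup_sum lookup_single when_def)
      (rule sum.neutral, auto)
qed

section \<open>Exponent vectors\<close>

definition expvec :: "nat \<Rightarrow> (nat \<Rightarrow> nat) \<Rightarrow> (nat \<Rightarrow>\<^sub>0 nat)" where
  "expvec n a = (\<Sum>i<n. single i (a i))"

lemma lookup_expvec: "lookup (expvec n a) i = (if i < n then a i else 0)"
  by (auto simp: expvec_def lookup_sum lookup_single when_def)

lemma keys_expvec: "keys (expvec n a) \<subseteq> {..<n}"
  by (auto simp: in_keys_iff lookup_expvec split: if_splits)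

lemma expvec_lookup: "keys m \<subseteq> {..<n} \<Longrightarrow> expvec n (lookup m) = m"
  by (rule poly_mapping_eqI) (auto simp: lookup_expvec in_keys_iff subset_iff)

lemma expvec_eq_iff: "expvec n a = expvec n b \<longleftrightarrow> (\<forall>i<n. a i = b i)"
  by (auto simp: poly_mapping_eq_iff lookup_expvec fun_eq_iff)

lemma expvec_add: "expvec n a + expvec n b = expvec n (\<lambda>i. a i + b i)"
  by (rule poly_mapping_eqI) (auto simp: lookup_expvec lookup_add)

lemma meval_expvec: "meval x (expvec n a) = (\<Prod>i<n. x i ^ a i)"
proof -
  have "meval x (expvec n a) = (\<Prod>i<n. x i ^ lookup (expvec n a) i)"
    by (rule meval_superset) (auto simp: keys_expvec)
  then show ?thesis by (simp add: lookup_expvec)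
qed

lemma var_power: "var i ^ k = single (single i k) 1"
proof (induction k)
  case (Suc k)
  have "single i (Suc 0) + single i k = single i (Suc k)"
    by (metis plus_1_eq_Suc single_add One_nat_def)
  then have "var i * single (single i k) 1 = single (single i (Suc k)) 1"
    by (simp add: var_def mult_single)
  then show ?case by (simp only: power_Suc Suc)
qed auto

lemma prod_single:
  "finite A \<Longrightarrow> (\<Prod>i\<in>A. single (f i) (1::complex)) = single (\<Sum>i\<in>A. f i :: nat \<Rightarrow>\<^sub>0 nat) 1"
  by (induction A rule: finite_induct) (auto simp: mult_single)

lemma prod_var_power: "(\<Prod>i<n. var i ^ a i) = single (expvec n a) 1"
  by (simp add: var_power prod_single expvec_def)

lemma map_key_expvec:
  assumes "\<sigma> permutes {..<n}"
  shows "map_key \<sigma> (expvec n a) = expvec n (\<lambda>i. a (\<sigma> i))"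
proof (rule poly_mapping_eqI)
  fix i
  have "lookup (map_key \<sigma> (expvec n a)) i = lookup (expvec n a) (\<sigma> i)"
    by (simp add: map_key.rep_eq[OF permutes_inj[OF assms]])
  also have "\<sigma> i < n \<longleftrightarrow> i < n"
    using permutes_in_image[OF assms, of i] by auto
  then have "lookup (expvec n a) (\<sigma> i) = lookup (expvec n (\<lambda>i. a (\<sigma> i))) i"
    by (simp add: lookup_expvec)
  finally show "lookup (map_key \<sigma> (expvec n a)) i = \<dots>" .
qed

section \<open>Polynomials in the first \<open>n\<close> variables\<close>

definition in_vars :: "nat \<Rightarrow> mpoly \<Rightarrow> bool" where
  "in_vars n p \<longleftrightarrow> (\<forall>m\<in>keys p. keys m \<subseteq> {..<n})"

lemma in_vars_zero [simp]: "in_vars n 0"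
  by (simp add: in_vars_def)

lemma in_vars_add: "in_vars n p \<Longrightarrow> in_vars n q \<Longrightarrow> in_vars n (p + q)"
  unfolding in_vars_def using Poly_Mapping.keys_add by fast

lemma in_vars_uminus: "in_vars n p \<Longrightarrow> in_vars n (- p)"
  unfolding in_vars_def by (simp add: in_keys_iff)

lemma in_vars_minus: "in_vars n p \<Longrightarrow> in_vars n q \<Longrightarrow> in_vars n (p - q)"
  using in_vars_add[OF _ in_vars_uminus, of n p q] by simp

lemma in_vars_single: "keys m \<subseteq> {..<n} \<Longrightarrow> in_vars n (single m c)"
  by (simp add: in_vars_def)

lemma in_vars_single_expvec [simp]: "in_vars n (single (expvec n a) c)"
  by (simp add: in_vars_single keys_expvec)

lemma in_vars_const [simp]: "in_vars n (const c)"
  by (simp add: const_def in_vars_single)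

lemma in_vars_one [simp]: "in_vars n 1"
  by (metis const_1 in_vars_const)

lemma in_vars_var [simp]: "i < n \<Longrightarrow> in_vars n (var i)"
  by (simp add: var_def in_vars_single)

lemma in_vars_mult: "in_vars n p \<Longrightarrow> in_vars n q \<Longrightarrow> in_vars n (p * q)"
  unfolding in_vars_def
proof
  fix m assume *: "\<forall>m\<in>keys p. keys m \<subseteq> {..<n}"
    "\<forall>m\<in>keys q. keys m \<subseteq> {..<n}" and "m \<in> keys (p * q)"
  then obtain a b where "a \<in> keys p" "b \<in> keys q" "m = a + b"
    using Poly_Mapping.keys_mult[of p q] by blast
  then show "keys m \<subseteq> {..<n}" using * Poly_Mapping.keys_add[of a b] by blast
qed

lemma in_vars_sum: "(\<And>a. a \<in> A \<Longrightarrow> in_vars n (f a)) \<Longrightarrow> in_vars n (sum f A)"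
  by (induction A rule: infinite_finite_induct) (auto simp: in_vars_add)

lemma in_vars_prod: "(\<And>a. a \<in> A \<Longrightarrow> in_vars n (f a)) \<Longrightarrow> in_vars n (prod f A)"
  by (induction A rule: infinite_finite_induct) (auto simp: in_vars_mult)

lemma in_vars_power: "in_vars n p \<Longrightarrow> in_vars n (p ^ k)"
  by (induction k) (auto simp: in_vars_mult)

lemma in_vars_eqI:
  assumes "in_vars n p" "in_vars n q" "\<And>a. lookup p (expvec n a) = lookup q (expvec n a)"
  shows "p = q"
proof (rule poly_mapping_eqI)
  fix m
  show "lookup p m = lookup q m"
  proof (cases "m \<in> keys p \<or> m \<in> keys q")
    case True
    then have "keys m \<subseteq> {..<n}" using assms(1,2) by (auto simp: in_vars_def)
    then show ?thesis using assms(3)[of "lookup m"] by (simp add: expvec_lookup)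
  qed (auto simp: in_keys_iff)
qed

text \<open>Reduction modulo \<open>N\<close> reads off the lowest digit; the quotients are shorter
  expansions, to which the induction hypothesis applies.\<close>

lemma base_expansion_inj:
  fixes a b :: "nat \<Rightarrow> nat"
  assumes "\<And>i. i < n \<Longrightarrow> a i < N" "\<And>i. i < n \<Longrightarrow> b i < N"
    "(\<Sum>i<n. a i * N ^ i) = (\<Sum>i<n. b i * N ^ i)" "i < n"
  shows "a i = b i"
  using assms
proof (induction n arbitrary: a b i)
  case (Suc n)
  have *: "(\<Sum>i<Suc n. c i * N ^ i) = c 0 + N * (\<Sum>i<n. c (Suc i) * N ^ i)" for c :: "nat \<Rightarrow> nat"
    by (simp only: sum.lessThan_Suc_shift sum_distrib_left power_Suc power_0 mult_1_right) (simp add: mult_ac)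
  have eq: "a 0 + N * (\<Sum>i<n. a (Suc i) * N ^ i) = b 0 + N * (\<Sum>i<n. b (Suc i) * N ^ i)"
    using Suc.prems(3) unfolding * .
  have lt: "a 0 < N" "b 0 < N" using Suc.prems(1,2) by blast+
  have "(a 0 + N * (\<Sum>i<n. a (Suc i) * N ^ i)) mod N = a 0"
    "(b 0 + N * (\<Sum>i<n. b (Suc i) * N ^ i)) mod N = b 0"
    using lt by simp_all
  then have 0: "a 0 = b 0"
    unfolding eq by simp
  with eq lt have "(\<Sum>i<n. a (Suc i) * N ^ i) = (\<Sum>i<n. b (Suc i) * N ^ i)" by simp
  then have "a (Suc j) = b (Suc j)" if "j < n" for j
    by (intro Suc.IH[of "\<lambda>i. a (Suc i)" "\<lambda>i. b (Suc i)" j]) (use Suc.prems(1,2) that in \<open>blast+\<close>)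
  with 0 show ?case using Suc.prems(4) by (cases i) auto
qed auto

text \<open>Kronecker's substitution \<open>x i = s ^ N ^ i\<close> reduces the claim to one variable.\<close>

lemma mpoly_zeroI:
  assumes vars: "in_vars n p"
    and zero: "\<And>x::nat \<Rightarrow> real. strict_mono_on {..<n} x \<Longrightarrow> (\<And>i. i < n \<Longrightarrow> 0 < x i) \<Longrightarrow>
      eval_mpoly (\<lambda>i. of_real (x i)) p = 0"
  shows "p = 0"
proof -
  \<comment> \<open>\<open>N\<close> exceeds every exponent, so the exponents of a monomial are the
    base \<open>N\<close> digits of its image. The summand 2 instead of 1 also gives
    \<open>N \<ge> 2\<close>, which makes \<open>s ^ N ^ i\<close> strictly increasing in
    \<open>i\<close>.\<close>
  define N where "N = Max (insert 0 (\<Union>m\<in>keys p. lookup m ` {..<n})) + 2"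
  have N: "lookup m i < N" if "m \<in> keys p" "i < n" for m i
  proof -
    have "lookup m i \<le> Max (insert 0 (\<Union>m\<in>keys p. lookup m ` {..<n}))"
      using that by (intro Max_ge) auto
    then show ?thesis by (simp add: N_def)
  qed
  have N2: "N \<ge> 2" by (simp add: N_def)
  define e where "e m = (\<Sum>i<n. lookup m i * N ^ i)" for m :: "nat \<Rightarrow>\<^sub>0 nat"
  have inj: "inj_on e (keys p)"
  proof (rule inj_onI)
    fix m m' assume m: "m \<in> keys p" "m' \<in> keys p" "e m = e m'"
    have "lookup m i = lookup m' i" if "i < n" for i
      by (rule base_expansion_inj[of n _ N]) (use m N that in \<open>auto simp: e_def\<close>)
    then have "expvec n (lookup m) = expvec n (lookup m')"
      by (simp add: expvec_eq_iff)
    then show "m = m'"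
      using m vars by (simp add: expvec_lookup in_vars_def)
  qed
  define q where "q = (\<Sum>m\<in>keys p. Polynomial.monom (lookup p m) (e m))"
  have root: "poly q (of_real s) = 0" if "s > 1" for s :: real
  proof -
    define x where "x i = s ^ N ^ i" for i
    have mono: "strict_mono_on {..<n} x"
      using that N2 by (auto simp: strict_mono_on_def x_def intro!: power_strict_increasing)
    have pos: "0 < x i" for i using that by (simp add: x_def)
    have "poly q (of_real s) = (\<Sum>m\<in>keys p. lookup p m * of_real s ^ e m)"
      by (simp add: q_def poly_sum poly_monom)
    also have "\<dots> = eval_mpoly (\<lambda>i. of_real (x i)) p"
      unfolding eval_mpoly_superset[OF finite_keys order_refl]
    proof (rule sum.cong)
      fix m assume "m \<in> keys p"
      then have "keys m \<subseteq> {..<n}" using vars by (auto simp: in_vars_def)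
      then have "meval (\<lambda>i. of_real (x i)) m = (\<Prod>i<n. of_real (x i) ^ lookup m i)"
        by (intro meval_superset) auto
      also have "\<dots> = of_real s ^ e m"
        by (simp add: x_def e_def power_sum mult.commute flip: power_mult)
      finally show "lookup p m * of_real s ^ e m = lookup p m * meval (\<lambda>i. of_real (x i)) m"
        by simp
    qed auto
    also have "\<dots> = 0" using mono pos by (rule zero)
    finally show ?thesis .
  qed
  have "infinite (of_real ` {1::real<..} :: complex set)"
    by (subst finite_image_iff) (auto simp: inj_on_def infinite_Ioi)
  then have "q = 0"
    using root poly_roots_finite[of q] finite_subset[of "of_real ` {1::real<..}" "{x. poly q x = 0}"] by auto
  have "lookup p m = 0" if "m \<in> keys p" for m
  proof -
    have "coeff q (e m) = (\<Sum>m'\<in>keys p. if e m' = e m then lookup p m' else 0)"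
      by (simp add: q_def coeff_sum)
    also have "\<dots> = (\<Sum>m'\<in>keys p. if m' = m then lookup p m' else 0)"
      using inj that by (intro sum.cong) (auto simp: inj_on_def)
    also have "\<dots> = lookup p m" using that by simp
    finally show ?thesis using \<open>q = 0\<close> by simp
  qed
  then show "p = 0" by (intro poly_mapping_eqI) (auto simp: in_keys_iff)
qed

text \<open>Equality is tested only at increasing positive real points because these are the points
  where the Vandermonde product can be divided out and where the integral that defines
  \<open>Q\<close> is prescribed.\<close>

lemma mpoly_eqI_eval:
  assumes "in_vars n p" "in_vars n q"
    and "\<And>x::nat \<Rightarrow> real. strict_mono_on {..<n} x \<Longrightarrow> (\<And>i. i < n \<Longrightarrow> 0 < x i) \<Longrightarrow>
      eval_mpoly (\<lambda>i. of_real (x i)) p = eval_mpoly (\<lambda>i. of_real (x i)) q"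
  shows "p = q"
  using mpoly_zeroI[of n "p - q"] assms by (simp add: in_vars_minus eval_mpoly_minus)

section \<open>Symmetric polynomials\<close>

lemma sym_polys_iff: "p \<in> sym_polys n \<longleftrightarrow> in_vars n p \<and>
  (\<forall>\<sigma> a. \<sigma> permutes {..<n} \<longrightarrow>
     lookup p (expvec n (\<lambda>i. a (\<sigma> i))) = lookup p (expvec n a))"
proof (intro iffI conjI allI impI)
  assume p: "p \<in> sym_polys n"
  then show "in_vars n p" by (auto simp: sym_polys_def in_vars_def)
  fix \<sigma> a assume "\<sigma> permutes {..<n}"
  then show "lookup p (expvec n (\<lambda>i. a (\<sigma> i))) = lookup p (expvec n a)"
    using p by (auto simp: sym_polys_def simp flip: map_key_expvec)
next
  assume *: "in_vars n p \<and>
  (\<forall>\<sigma> a. \<sigma> permutes {..<n} \<longrightarrow>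
     lookup p (expvec n (\<lambda>i. a (\<sigma> i))) = lookup p (expvec n a))"
  have "lookup p (map_key \<sigma> m) = lookup p m"
    if \<sigma>: "\<sigma> permutes {..<n}" for \<sigma> m
  proof (cases "keys m \<subseteq> {..<n}")
    case True
    then show ?thesis
      using * \<sigma> map_key_expvec[OF \<sigma>, of "lookup m"] by (auto simp: expvec_lookup)
  next
    case False
    then obtain i where i: "i \<in> keys m" "i \<ge> n" by (auto simp: subset_iff not_less)
    have "\<sigma> i = i" using \<sigma> i by (auto simp: permutes_def)
    then have "i \<in> keys (map_key \<sigma> m)"
      using i by (simp add: in_keys_iff map_key.rep_eq[OF permutes_inj[OF \<sigma>]])
    then have "m \<notin> keys p" "map_key \<sigma> m \<notin> keys p"
      using i * unfolding in_vars_def by (meson lessThan_iff not_less subsetD)+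
    then show ?thesis by (simp add: in_keys_iff)
  qed
  then show "p \<in> sym_polys n" using * by (auto simp: sym_polys_def in_vars_def)
qed

lemma eval_mpoly_cong_in_vars:
  assumes "in_vars n p" "\<And>i. i < n \<Longrightarrow> x i = y i"
  shows "eval_mpoly x p = eval_mpoly y p"
  unfolding eval_mpoly_superset[OF finite_keys order_refl]
proof (rule sum.cong)
  fix m assume "m \<in> keys p"
  then have "keys m \<subseteq> {..<n}" using assms(1) by (auto simp: in_vars_def)
  then have "meval x m = meval y m" unfolding meval_def using assms(2) by (intro prod.cong) auto
  then show "lookup p m * meval x m = lookup p m * meval y m" by simp
qed auto

lemma map_key_inv:
  assumes "\<sigma> permutes S"
  shows "map_key \<sigma> (map_key (inv_into UNIV \<sigma>) m) = m"
    "map_key (inv_into UNIV \<sigma>) (map_key \<sigma> m) = m"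
  using permutes_inj[OF assms] permutes_inj[OF permutes_inv[OF assms]] permutes_inverses[OF assms]
  by (auto intro!: poly_mapping_eqI simp: map_key.rep_eq)

lemma meval_permute:
  assumes "\<sigma> permutes S"
  shows "meval (\<lambda>i. x (\<sigma> i)) m = meval x (map_key (inv_into UNIV \<sigma>) m)"
proof -
  let ?m = "map_key (inv_into UNIV \<sigma>) m"
  have lk: "lookup ?m i = lookup m (inv_into UNIV \<sigma> i)" for i
    by (simp add: map_key.rep_eq[OF permutes_inj[OF permutes_inv[OF assms]]])
  have "meval x ?m = (\<Prod>i\<in>\<sigma> ` keys m. x i ^ lookup ?m i)"
  proof (rule meval_superset)
    show "keys ?m \<subseteq> \<sigma> ` keys m"
    proof
      fix i assume "i \<in> keys ?m"
      then have "inv_into UNIV \<sigma> i \<in> keys m" by (simp add: lk in_keys_iff)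
      then show "i \<in> \<sigma> ` keys m"
        using permutes_inverses(1)[OF assms, of i] by (metis image_eqI)
    qed
  qed auto
  also have "\<dots> = meval (\<lambda>i. x (\<sigma> i)) m"
    unfolding meval_def using permutes_inverses[OF assms] permutes_inj_on[OF assms]
    by (subst prod.reindex) (auto simp: lk)
  finally show ?thesis by simp
qed

lemma eval_mpoly_permute:
  assumes "\<sigma> permutes S"
    and "\<And>m. lookup p (map_key (inv_into UNIV \<sigma>) m) = lookup p m"
  shows "eval_mpoly (\<lambda>i. x (\<sigma> i)) p = eval_mpoly x p"
  unfolding eval_mpoly_superset[OF finite_keys order_refl] meval_permute[OF assms(1)]
  by (rule sum.reindex_bij_witness[of _ "map_key \<sigma>" "map_key (inv_into UNIV \<sigma>)"])
     (use assms(2) assms(2)[of "map_key \<sigma> _"] in \<open>simp_all add: in_keys_iff map_key_inv[OF assms(1)]\<close>)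

lemma eval_sym_permute:
  assumes "p \<in> sym_polys n" "\<sigma> permutes {..<n}"
  shows "eval_mpoly (\<lambda>i. x (\<sigma> i)) p = eval_mpoly x p"
  using assms permutes_inv[OF assms(2)] by (intro eval_mpoly_permute) (auto simp: sym_polys_def)

text \<open>The substitution of \<open>x (\<sigma> i)\<close> for \<open>x i\<close>; exponent
  vectors move by the inverse permutation. It turns an identity between values into one between
  coefficients, which is what \<open>sym_polys\<close> asks for.\<close>

definition permute_vars :: "(nat \<Rightarrow> nat) \<Rightarrow> mpoly \<Rightarrow> mpoly" where
  "permute_vars \<sigma> p = (\<Sum>m\<in>keys p. single (map_key (inv_into UNIV \<sigma>) m) (lookup p m))"

lemma eval_permute_vars:
  "\<sigma> permutes S \<Longrightarrow> eval_mpoly x (permute_vars \<sigma> p) = eval_mpoly (\<lambda>i. x (\<sigma> i)) p"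
  by (simp add: permute_vars_def eval_mpoly_sum eval_mpoly_single meval_permute
      eval_mpoly_superset[OF finite_keys order_refl, of _ p])

lemma lookup_permute_vars:
  assumes "\<sigma> permutes S"
  shows "lookup (permute_vars \<sigma> p) m = lookup p (map_key \<sigma> m)"
proof -
  have "map_key (inv_into UNIV \<sigma>) m' = m \<longleftrightarrow> m' = map_key \<sigma> m" for m'
    using map_key_inv[OF assms] by metis
  then show ?thesis
    by (auto simp: permute_vars_def lookup_sum lookup_single when_def in_keys_iff)
qed

lemma in_vars_permute_vars:
  assumes "\<sigma> permutes {..<n}" "in_vars n p"
  shows "in_vars n (permute_vars \<sigma> p)"
  unfolding permute_vars_def
proof (intro in_vars_sum in_vars_single)
  fix m assume "m \<in> keys p"
  then have "map_key (inv_into UNIV \<sigma>) m = expvec n (\<lambda>i. lookup m (inv_into UNIV \<sigma> i))"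
    using map_key_expvec[OF permutes_inv[OF assms(1)], of "lookup m"] assms(2)
    by (auto simp: in_vars_def expvec_lookup)
  then show "keys (map_key (inv_into UNIV \<sigma>) m) \<subseteq> {..<n}"
    by (simp add: keys_expvec)
qed

text \<open>Since only increasing \<open>x\<close> have to be tested, a quotient by the Vandermonde
  product can be treated by dividing values.\<close>

lemma sym_polysI_eval:
  assumes "in_vars n p" "\<And>\<sigma> x. \<sigma> permutes {..<n} \<Longrightarrow> strict_mono_on {..<n} x \<Longrightarrow>
      eval_mpoly (\<lambda>i. of_real (x (\<sigma> i) :: real)) p = eval_mpoly (\<lambda>i. of_real (x i)) p"
  shows "p \<in> sym_polys n"
proof -
  have "permute_vars \<sigma> p = p" if "\<sigma> permutes {..<n}" for \<sigma>
    using that assms by (intro mpoly_eqI_eval[of n]) (auto simp: in_vars_permute_vars eval_permute_vars)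
  then have "lookup p (map_key \<sigma> m) = lookup p m"
    if "\<sigma> permutes {..<n}" for \<sigma> m
    using that lookup_permute_vars[OF that, of p m] by simp
  then show ?thesis using assms(1) by (auto simp: sym_polys_def in_vars_def)
qed

lemma sym_polys_in_vars: "p \<in> sym_polys n \<Longrightarrow> in_vars n p"
  by (simp add: sym_polys_iff)

lemma sym_polys_eval_iff:
  "p \<in> sym_polys n \<longleftrightarrow> in_vars n p \<and>
    (\<forall>\<sigma> x. \<sigma> permutes {..<n} \<longrightarrow> eval_mpoly (\<lambda>i. x (\<sigma> i)) p = eval_mpoly x p)"
proof (intro iffI conjI allI impI; (elim conjE)?)
  assume p: "in_vars n p" "\<forall>\<sigma> x. \<sigma> permutes {..<n} \<longrightarrow> eval_mpoly (\<lambda>i. x (\<sigma> i)) p = eval_mpoly x p"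
  show "p \<in> sym_polys n"
  proof (rule sym_polysI_eval[OF p(1)])
    fix \<sigma> and x :: "nat \<Rightarrow> real" assume "\<sigma> permutes {..<n}"
    then show "eval_mpoly (\<lambda>i. of_real (x (\<sigma> i))) p = eval_mpoly (\<lambda>i. of_real (x i)) p"
      using p(2)[rule_format, of \<sigma> "\<lambda>i. of_real (x i)"] by simp
  qed
qed (auto intro: eval_sym_permute sym_polys_in_vars)

lemma sym_polys_mult: "p \<in> sym_polys n \<Longrightarrow> q \<in> sym_polys n \<Longrightarrow> p * q \<in> sym_polys n"
  unfolding sym_polys_eval_iff by (auto simp: in_vars_mult eval_mpoly_mult)

lemma sym_polys_add: "p \<in> sym_polys n \<Longrightarrow> q \<in> sym_polys n \<Longrightarrow> p + q \<in> sym_polys n"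
  unfolding sym_polys_eval_iff by (auto simp: in_vars_add eval_mpoly_add)

lemma sym_polys_minus: "p \<in> sym_polys n \<Longrightarrow> q \<in> sym_polys n \<Longrightarrow> p - q \<in> sym_polys n"
  unfolding sym_polys_eval_iff by (auto simp: in_vars_minus eval_mpoly_minus)

lemma sym_polys_const [simp]: "const c \<in> sym_polys n"
  unfolding sym_polys_eval_iff by simp

lemma sym_polys_zero [simp]: "0 \<in> sym_polys n" and sym_polys_one [simp]: "1 \<in> sym_polys n"
  using sym_polys_const[of 0 n] sym_polys_const[of 1 n] by simp_all

lemma sym_polys_sum: "(\<And>a. a \<in> A \<Longrightarrow> f a \<in> sym_polys n) \<Longrightarrow> sum f A \<in> sym_polys n"
  by (induction A rule: infinite_finite_induct) (auto simp: sym_polys_add)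

section \<open>Determinants and the Vandermonde product\<close>

text \<open>The Leibniz formula over functions has the shape of \<open>D_det\<close> and serves
  polynomials and power series alike; \<open>ddet_eq_det\<close> transports the laws of matrix
  determinants.\<close>

definition ddet :: "nat \<Rightarrow> (nat \<Rightarrow> nat \<Rightarrow> 'a) \<Rightarrow> 'a::comm_ring_1" where
  "ddet n f = (\<Sum>\<sigma> | \<sigma> permutes {..<n}. of_int (sign \<sigma>) * (\<Prod>i<n. f i (\<sigma> i)))"

lemma ddet_eq_det: "ddet n f = det (mat n n (\<lambda>(i, j). f i j))"
proof -
  have "det (mat n n (\<lambda>(i, j). f i j)) = (\<Sum>\<sigma> | \<sigma> permutes {..<n}. of_int (sign \<sigma>) * (\<Prod>i<n. mat n n (\<lambda>(i, j). f i j) $$ (i, \<sigma> i)))"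
    by (subst det_def'[of _ n]) (auto simp: lessThan_atLeast0)
  also have "\<dots> = ddet n f"
    unfolding ddet_def
  proof (intro sum.cong refl arg_cong2[of _ _ _ _ "(*)"] prod.cong)
    fix \<sigma> i assume "\<sigma> \<in> {\<sigma>. \<sigma> permutes {..<n}}" "i \<in> {..<n}"
    then have "\<sigma> i < n" using permutes_in_image[of \<sigma> "{..<n}" i] by auto
    then show "mat n n (\<lambda>(i, j). f i j) $$ (i, \<sigma> i) = f i (\<sigma> i)"
      using \<open>i \<in> _\<close> by simp
  qed
  finally show ?thesis by simp
qed

lemma ddet_cong:
  assumes "\<And>i j. i < n \<Longrightarrow> j < n \<Longrightarrow> f i j = h i j"
  shows "ddet n f = ddet n h"
  unfolding ddet_eq_det by (rule arg_cong[of _ _ det], rule eq_matI) (auto simp: assms)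

lemma ddet_mult:
  "ddet n (\<lambda>i j. \<Sum>k<n. f i k * h k j) = ddet n f * ddet n h"
proof -
  have "mat n n (\<lambda>(i, j). \<Sum>k<n. f i k * h k j) = mat n n (\<lambda>(i, j). f i j) * mat n n (\<lambda>(i, j). h i j)"
    by (rule eq_matI) (auto simp: scalar_prod_def lessThan_atLeast0)
  then show ?thesis
    unfolding ddet_eq_det by (simp add: det_mult[of _ n])
qed

lemma ddet_transpose: "ddet n (\<lambda>i j. f j i) = ddet n f"
proof -
  have "mat n n (\<lambda>(i, j). f j i) = transpose_mat (mat n n (\<lambda>(i, j). f i j))"
    by (rule eq_matI) auto
  then show ?thesis
    unfolding ddet_eq_det by (simp add: det_transpose[of _ n])
qed

lemma ddet_scale_rows: "ddet n (\<lambda>i j. c i * f i j) = (\<Prod>i<n. c i) * ddet n f"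
  by (simp add: ddet_def prod.distrib sum_distrib_left mult_ac)

lemma ddet_scale_cols: "ddet n (\<lambda>i j. c j * f i j) = (\<Prod>j<n. c j) * ddet n f"
  using ddet_scale_rows[of n c "\<lambda>i j. f j i"] ddet_transpose[of n "\<lambda>i j. c i * f j i"] ddet_transpose[of n f]
  by simp

lemma ddet_diag:
  assumes "\<And>i j. i < n \<Longrightarrow> j < n \<Longrightarrow> i \<noteq> j \<Longrightarrow> f i j = 0"
  shows "ddet n f = (\<Prod>i<n. f i i)"
proof -
  have "det (mat n n (\<lambda>(i, j). f i j)) = prod_list (diag_mat (mat n n (\<lambda>(i, j). f i j)))"
    by (rule det_upper_triangular) (auto simp: assms upper_triangular_def)
  then show ?thesis
    by (simp add: ddet_eq_det prod_list_diag_prod lessThan_atLeast0)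
qed

lemma ddet_upper:
  assumes "\<And>i j. i < n \<Longrightarrow> j < i \<Longrightarrow> f i j = 0"
  shows "ddet n f = (\<Prod>i<n. f i i)"
proof -
  have "det (mat n n (\<lambda>(i, j). f i j)) = prod_list (diag_mat (mat n n (\<lambda>(i, j). f i j)))"
    by (rule det_upper_triangular) (auto simp: assms upper_triangular_def)
  then show ?thesis
    by (simp add: ddet_eq_det prod_list_diag_prod lessThan_atLeast0)
qed

lemma ddet_lower:
  assumes "\<And>i j. j < n \<Longrightarrow> i < j \<Longrightarrow> f i j = 0"
  shows "ddet n f = (\<Prod>i<n. f i i)"
  using ddet_upper[of n "\<lambda>i j. f j i"] ddet_transpose[of n f] assms by simp

lemma ddet_expand_last_row:
  "ddet (Suc n) f = (\<Sum>j\<le>n. (-1) ^ (n + j) * f n j * ddet n (\<lambda>i k. f i (if k < j then k else Suc k)))"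
proof -
  let ?A = "mat (Suc n) (Suc n) (\<lambda>(i, j). f i j)"
  have "ddet (Suc n) f = (\<Sum>j<Suc n. ?A $$ (n, j) * cofactor ?A n j)"
    unfolding ddet_eq_det by (rule laplace_expansion_row[of _ "Suc n"]) auto
  also have "\<dots> = (\<Sum>j\<le>n. (-1) ^ (n + j) * f n j * ddet n (\<lambda>i k. f i (if k < j then k else Suc k)))"
    unfolding lessThan_Suc_atMost
  proof (rule sum.cong[OF refl])
    fix j assume j: "j \<in> {..n}"
    have "mat_delete ?A n j = mat n n (\<lambda>(i, k). f i (if k < j then k else Suc k))"
      by (rule eq_matI) (use j in \<open>auto simp: mat_delete_def\<close>)
    then show "?A $$ (n, j) * cofactor ?A n j =
        (-1) ^ (n + j) * f n j * ddet n (\<lambda>i k. f i (if k < j then k else Suc k))"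
      using j by (simp add: cofactor_def ddet_eq_det)
  qed
  finally show ?thesis .
qed

lemma vandermonde_Suc: "vandermonde (Suc n) x = vandermonde n x * (\<Prod>i<n. x n - x i)"
  by (simp add: vandermonde_def)

lemma prod_minus_swap: "(\<Prod>i<n. x i - c) = (-1) ^ n * (\<Prod>i<n. c - x i :: 'a::comm_ring_1)"
proof -
  have "(\<Prod>i<n. x i - c) = (\<Prod>i<n. (-1) * (c - x i))"
    by (rule prod.cong) auto
  then show ?thesis by (simp add: prod.distrib del: mult_minus1 mult_minus_left)
qed

text \<open>The unitriangular matrix \<open>U\<close> subtracts from every column \<open>x n\<close>
  times the next one. The last row becomes \<open>(0, ..., 0, 1)\<close>, and in the other rows the
  remaining columns acquire the factor \<open>x i - x n\<close>.\<close>

lemma vandermonde_ddet: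
  "ddet n (\<lambda>i j. x i ^ (n - 1 - j)) = (-1) ^ (n * (n - 1) div 2) * vandermonde n x"
proof (induction n)
  case 0
  then show ?case by (simp add: ddet_def vandermonde_def)
next
  case (Suc n)
  define U where "U k j = (if k = j then 1 else if k = Suc j then - x n else 0)" for k j
  have U: "ddet (Suc n) U = 1"
    by (subst ddet_lower) (auto simp: U_def)
  have step: "(\<Sum>k<Suc n. x i ^ (n - k) * U k j) = (if j < n then (x i - x n) * x i ^ (n - 1 - j) else 1)"
    if "i \<le> n" "j \<le> n" for i j
  proof -
    have "(\<Sum>k<Suc n. x i ^ (n - k) * U k j) = (\<Sum>k<Suc n. (if k = j then x i ^ (n - k) else 0) + (if k = Suc j then - x n * x i ^ (n - k) else 0))"
      by (intro sum.cong) (auto simp: U_def)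
    also have "\<dots> = x i ^ (n - j) + (if Suc j < Suc n then - x n * x i ^ (n - Suc j) else 0)"
      using that by (simp add: sum.distrib del: sum.lessThan_Suc)
    also have "\<dots> = (if j < n then (x i - x n) * x i ^ (n - 1 - j) else 1)"
    proof (cases "j < n")
      case True
      then obtain d where "n = Suc (j + d)" using less_imp_Suc_add by blast
      then show ?thesis by (simp add: algebra_simps)
    qed (use that in simp)
    finally show ?thesis .
  qed
  have "ddet (Suc n) (\<lambda>i j. x i ^ (n - j)) = ddet (Suc n) (\<lambda>i j. \<Sum>k<Suc n. x i ^ (n - k) * U k j)"
    by (simp only: ddet_mult U mult_1_right)
  also have "\<dots> = ddet (Suc n) (\<lambda>i j. if j < n then (x i - x n) * x i ^ (n - 1 - j) else 1)"
    by (rule ddet_cong) (use step in simp)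
  also have "\<dots> = (\<Sum>j\<le>n. if j = n then ddet n (\<lambda>i k. (x i - x n) * x i ^ (n - 1 - k)) else 0)"
    unfolding ddet_expand_last_row
    by (intro sum.cong) (auto intro!: ddet_cong simp flip: mult_2)
  also have "\<dots> = (\<Prod>i<n. x i - x n) * ddet n (\<lambda>i k. x i ^ (n - 1 - k))"
    by (simp add: ddet_scale_rows)
  also have "\<dots> = (-1) ^ (n + n * (n - 1) div 2) * vandermonde (Suc n) x"
    unfolding Suc prod_minus_swap vandermonde_Suc power_add by (simp add: mult_ac)
  also have "n + n * (n - 1) div 2 = Suc n * (Suc n - 1) div 2"
    by (cases n) (auto simp: algebra_simps)
  finally show ?case by simp
qed

text \<open>Subtracting the last row from the others turns \<open>p j\<close> at \<open>x i\<close>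
  into \<open>x i - x n\<close> times a synthetic quotient, again a polynomial in
  \<open>x i\<close>; hence the induction over arbitrary families \<open>p\<close>. Nothing is
  cancelled, so any commutative ring will do.\<close>

lemma vandermonde_dvd_ddet:
  fixes x :: "nat \<Rightarrow> 'a::comm_ring_1" and p :: "nat \<Rightarrow> 'a poly"
  shows "vandermonde n x dvd ddet n (\<lambda>i j. poly (p j) (x i))"
proof (induction n arbitrary: p)
  case 0
  then show ?case by (simp add: vandermonde_def)
next
  case (Suc n)
  define L where "L i k = (if i = k \<or> k = n then 1 else 0 :: 'a)" for i k
  define q where "q j = synthetic_div (p j) (x n)" for j
  have q: "poly (p j) c = (c - x n) * poly (q j) c + poly (p j) (x n)" for j c
    using arg_cong[OF synthetic_div_correct'[of "x n" "p j"], of "\<lambda>r. poly r c"]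
    by (simp add: q_def algebra_simps)
  define B where "B i j = (if i < n then (x i - x n) * poly (q j) (x i) else poly (p j) (x n))" for i j
  have step: "poly (p j) (x i) = (\<Sum>k<Suc n. L i k * B k j)" if "i < Suc n" for i j
  proof -
    have "(\<Sum>k<n. L i k * B k j) = (\<Sum>k<n. if k = i then B i j else 0)"
      by (rule sum.cong) (auto simp: L_def)
    then have "(\<Sum>k<Suc n. L i k * B k j) = (\<Sum>k<n. if k = i then B i j else 0) + B n j"
      by (simp add: L_def)
    also have "\<dots> = poly (p j) (x i)"
      using that by (cases "i < n") (auto simp: B_def less_Suc_eq q[of j "x i"])
    finally show ?thesis ..
  qed
  have "ddet (Suc n) (\<lambda>i j. poly (p j) (x i)) = ddet (Suc n) (\<lambda>i j. \<Sum>k<Suc n. L i k * B k j)"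
    by (rule ddet_cong) (use step in simp)
  also have "\<dots> = ddet (Suc n) B"
  proof -
    have "ddet (Suc n) L = 1"
      by (subst ddet_upper) (auto simp: L_def)
    then show ?thesis by (simp only: ddet_mult mult_1)
  qed
  also have "\<dots> = (\<Sum>j\<le>n. (-1) ^ (n + j) * B n j *
      ((\<Prod>i<n. x i - x n) * ddet n (\<lambda>i k. poly (q (if k < j then k else Suc k)) (x i))))"
    unfolding ddet_expand_last_row ddet_scale_rows[symmetric]
    by (intro sum.cong refl arg_cong2[of _ _ _ _ "(*)"] ddet_cong) (auto simp: B_def)
  also have "vandermonde (Suc n) x dvd \<dots>"
  proof (rule dvd_sum, rule dvd_mult)
    fix j
    have "vandermonde n x dvd ddet n (\<lambda>i k. poly (q (if k < j then k else Suc k)) (x i))"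
      by (rule Suc)
    moreover have "(\<Prod>i<n. x n - x i) dvd (\<Prod>i<n. x i - x n)"
      by (simp add: prod_minus_swap)
    ultimately show "vandermonde (Suc n) x dvd (\<Prod>i<n. x i - x n) * ddet n (\<lambda>i k. poly (q (if k < j then k else Suc k)) (x i))"
      unfolding vandermonde_Suc mult.commute[of "vandermonde n x"] by (intro mult_dvd_mono)
  qed
  finally show ?case .
qed

section \<open>The operator \<open>D\<close> on monomials\<close>

text \<open>The scalar by which the term \<open>\<sigma>\<close> of the determinant acts on the
  monomial with exponents \<open>a\<close>; the exponents themselves are raised by
  \<open>n - 1 - \<sigma> i\<close>.\<close>

definition D_coef :: "nat \<Rightarrow> real \<Rightarrow> complex \<Rightarrow> (nat \<Rightarrow> nat) \<Rightarrow> (nat \<Rightarrow> nat) \<Rightarrow> complex" where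
  "D_coef n g u a \<sigma> = (\<Prod>i<n. of_nat (a i) + of_real (real (n - 1 - \<sigma> i) * g) + u)"

lemma partial_superset:
  assumes "finite S" "keys p \<subseteq> S"
  shows "partial i p = (\<Sum>m\<in>S. single (m - single i 1)
        (of_nat (lookup m i) * lookup p m))"
  unfolding partial_def using assms by (intro sum.mono_neutral_left) (auto simp: in_keys_iff)

lemma partial_add: "partial i (p + q) = partial i p + partial i q"
proof -
  let ?S = "keys p \<union> keys q"
  have "partial i (p + q) = (\<Sum>m\<in>?S. single (m - single i 1)
        (of_nat (lookup m i) * lookup (p + q) m))"
    by (rule partial_superset) (auto simp: Poly_Mapping.keys_add)
  then show ?thesis
    by (simp add: partial_superset[of ?S] lookup_add sum.distrib ring_distribs single_add)
qed

lemma D_entry_add: "D_entry n g u i j (p + q) = D_entry n g u i j p + D_entry n g u i j q"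
  by (simp add: D_entry_def partial_add algebra_simps)

lemma var_times_partial_single:
  "var i * partial i (single m c) = single m (of_nat (lookup m i) * c)"
proof -
  have "partial i (single m c) = single (m - single i 1) (of_nat (lookup m i) * c)"
    by (subst partial_superset[of "{m}"]) auto
  moreover have "single i 1 + (m - single i 1) = m" if "lookup m i \<noteq> 0"
    using that by (intro poly_mapping_eqI) (auto simp: lookup_add lookup_minus lookup_single when_def)
  ultimately show ?thesis
    by (cases "lookup m i = 0") (auto simp: var_def mult_single)
qed

lemma D_entry_single:
  "D_entry n g u i j (single m c) =
    single (m + single i (n - 1 - j))
      (c * (of_nat (lookup m i) + of_real (real (n - 1 - j) * g) + u))"
  by (simp add: D_entry_def var_times_partial_single var_power const_def mult_single single_add[symmetric] algebra_simps)

lemma foldr_D_entry_add: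
  "foldr (\<lambda>i. D_entry n g u i (\<sigma> i)) xs (p + q) =
   foldr (\<lambda>i. D_entry n g u i (\<sigma> i)) xs p + foldr (\<lambda>i. D_entry n g u i (\<sigma> i)) xs q"
  by (induction xs) (auto simp: D_entry_add)

lemma D_entry_zero: "D_entry n g u i j 0 = 0"
  using D_entry_single[of n g u i j 0 0] by simp

lemma foldr_D_entry_zero: "foldr (\<lambda>i. D_entry n g u i (\<sigma> i)) xs 0 = 0"
  by (induction xs) (auto simp: D_entry_zero)

lemma foldr_D_entry_single:
  assumes "distinct xs"
  shows "foldr (\<lambda>i. D_entry n g u i (\<sigma> i)) xs (single m c) =
    single (m + (\<Sum>i\<in>set xs. single i (n - 1 - \<sigma> i)))
      (c * (\<Prod>i\<in>set xs. of_nat (lookup m i) + of_real (real (n - 1 - \<sigma> i) * g) + u))"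
  using assms
proof (induction xs)
  case (Cons i xs)
  then have "lookup (m + (\<Sum>i\<in>set xs. single i (n - 1 - \<sigma> i))) i = lookup m i"
    by (auto simp: lookup_add lookup_sum lookup_single when_def intro!: sum.neutral)
  with Cons show ?case by (simp add: D_entry_single add_ac mult_ac)
qed auto

lemma foldr_D_entry_expvec:
  "foldr (\<lambda>i. D_entry n g u i (\<sigma> i)) [0..<n] (single (expvec n a) c) =
    single (expvec n (\<lambda>i. a i + (n - 1 - \<sigma> i))) (c * D_coef n g u a \<sigma>)"
proof -
  have "(\<Sum>i\<in>set [0..<n]. single i (n - 1 - \<sigma> i)) = expvec n (\<lambda>i. n - 1 - \<sigma> i)"
    by (simp add: expvec_def lessThan_atLeast0)
  moreover have "(\<Prod>i\<in>set [0..<n]. of_nat (lookup (expvec n a) i) + of_real (real (n - 1 - \<sigma> i) * g) + u) = D_coef n g u a \<sigma>"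
    by (simp add: D_coef_def lookup_expvec lessThan_atLeast0)
  ultimately show ?thesis
    by (subst foldr_D_entry_single) (simp_all add: expvec_add)
qed

lemma D_det_single:
  "D_det n g u (single (expvec n a) c) = (\<Sum>\<sigma> | \<sigma> permutes {..<n}.
     single (expvec n (\<lambda>i. a i + (n - 1 - \<sigma> i))) (of_int (sign \<sigma>) * c * D_coef n g u a \<sigma>))"
  unfolding D_det_def foldr_D_entry_expvec
  by (intro sum.cong refl) (simp flip: single_of_int add: mult_single mult_ac)

lemma D_det_add: "D_det n g u (p + q) = D_det n g u p + D_det n g u q"
  by (simp add: D_det_def foldr_D_entry_add ring_distribs sum.distrib)

lemma D_det_zero [simp]: "D_det n g u 0 = 0"
  by (simp add: D_det_def foldr_D_entry_zero)

lemma D_det_sum: "D_det n g u (sum f A) = (\<Sum>a\<in>A. D_det n g u (f a))"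
  by (induction A rule: infinite_finite_induct) (auto simp: D_det_add)

lemma in_vars_eq_sum:
  assumes "in_vars n p"
  shows "p = (\<Sum>m\<in>keys p. single (expvec n (lookup m)) (lookup p m))"
  by (subst mpoly_eq_sum) (use assms in \<open>auto simp: in_vars_def expvec_lookup intro!: sum.cong\<close>)

lemma D_det_eq:
  assumes "in_vars n p"
  shows "D_det n g u p = (\<Sum>m\<in>keys p. \<Sum>\<sigma> | \<sigma> permutes {..<n}.
     single (expvec n (\<lambda>i. lookup m i + (n - 1 - \<sigma> i)))
       (of_int (sign \<sigma>) * lookup p m * D_coef n g u (lookup m) \<sigma>))"
  by (subst in_vars_eq_sum[OF assms]) (simp add: D_det_sum D_det_single)

lemma in_vars_D_det: "in_vars n p \<Longrightarrow> in_vars n (D_det n g u p)"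
  by (subst D_det_eq) (auto intro!: in_vars_sum)

lemma D_det_const_mult:
  assumes "in_vars n p"
  shows "D_det n g u (const c * p) = const c * D_det n g u p"
proof -
  have "const c * p = (\<Sum>m\<in>keys p. single (expvec n (lookup m)) (c * lookup p m))"
    by (subst in_vars_eq_sum[OF assms]) (simp add: sum_distrib_left const_def mult_single)
  then show ?thesis
    by (simp add: D_det_sum D_det_single D_det_eq[OF assms] sum_distrib_left const_def mult_single mult_ac)
qed

text \<open>The weight \<open>W\<close> is left general because the same extraction of coefficients
  serves \<open>D_det\<close>, with \<open>W = D_coef\<close>, and the product with the Vandermonde
  determinant, with \<open>W = 1\<close>. Comparing the two is the way to the coefficients of the
  quotient \<open>D_op\<close>.\<close>

lemma lookup_shift_sum:
  fixes W :: "(nat \<Rightarrow> nat) \<Rightarrow> (nat \<Rightarrow> nat) \<Rightarrow> complex"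
  assumes "in_vars n p" and W: "\<And>a b \<sigma>. (\<And>i. i < n \<Longrightarrow> a i = b i) \<Longrightarrow> W a \<sigma> = W b \<sigma>"
  shows "lookup (\<Sum>m\<in>keys p. \<Sum>\<sigma> | \<sigma> permutes {..<n}.
     single (expvec n (\<lambda>i. lookup m i + (n - 1 - \<sigma> i)))
       (of_int (sign \<sigma>) * lookup p m * W (lookup m) \<sigma>)) (expvec n b) = (\<Sum>\<sigma> | \<sigma> permutes {..<n} \<and> (\<forall>i<n. n - 1 - \<sigma> i \<le> b i).
     of_int (sign \<sigma>) * lookup p (expvec n (\<lambda>i. b i - (n - 1 - \<sigma> i))) *
       W (\<lambda>i. b i - (n - 1 - \<sigma> i)) \<sigma>)"
proof -
  have *: "(\<Sum>m\<in>keys p. if expvec n (\<lambda>i. lookup m i + (n - 1 - \<sigma> i)) = expvec n b then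
       of_int (sign \<sigma>) * lookup p m * W (lookup m) \<sigma> else 0) =
     (if \<forall>i<n. n - 1 - \<sigma> i \<le> b i then
        of_int (sign \<sigma>) * lookup p (expvec n (\<lambda>i. b i - (n - 1 - \<sigma> i))) *
        W (\<lambda>i. b i - (n - 1 - \<sigma> i)) \<sigma> else 0)" (is "?L = ?R") for \<sigma>
  proof (cases "\<forall>i<n. n - 1 - \<sigma> i \<le> b i")
    case True
    let ?m = "expvec n (\<lambda>i. b i - (n - 1 - \<sigma> i))"
    have "?L = (\<Sum>m\<in>keys p. if m = ?m then of_int (sign \<sigma>) * lookup p m * W (lookup m) \<sigma> else 0)"
    proof (rule sum.cong[OF refl])
      fix m assume "m \<in> keys p"
      then have m: "m = expvec n (lookup m)"
        using assms(1) by (simp add: in_vars_def expvec_lookup)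
      have "m = ?m \<longleftrightarrow> (\<forall>i<n. lookup m i = b i - (n - 1 - \<sigma> i))"
        by (subst m) (simp add: expvec_eq_iff)
      also have "\<dots> \<longleftrightarrow> expvec n (\<lambda>i. lookup m i + (n - 1 - \<sigma> i)) = expvec n b"
        unfolding expvec_eq_iff using True by (intro iff_allI imp_cong) auto
      finally show "(if expvec n (\<lambda>i. lookup m i + (n - 1 - \<sigma> i)) = expvec n b then
         of_int (sign \<sigma>) * lookup p m * W (lookup m) \<sigma> else 0) =
        (if m = ?m then of_int (sign \<sigma>) * lookup p m * W (lookup m) \<sigma> else 0)"
        by simp
    qed
    also have "\<dots> = of_int (sign \<sigma>) * lookup p ?m * W (lookup ?m) \<sigma>"
      by (simp add: in_keys_iff)
    also have "W (lookup ?m) \<sigma> = W (\<lambda>i. b i - (n - 1 - \<sigma> i)) \<sigma>"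
      by (rule W) (simp add: lookup_expvec)
    finally show ?thesis using True by simp
  next
    case False
    then obtain i where "i < n" "\<not> n - 1 - \<sigma> i \<le> b i" by blast
    then have "expvec n (\<lambda>i. lookup m i + (n - 1 - \<sigma> i)) \<noteq> expvec n b" for m
      by (auto simp: expvec_eq_iff intro!: exI[of _ i])
    then show ?thesis using False by auto
  qed
  have "lookup (\<Sum>m\<in>keys p. \<Sum>\<sigma> | \<sigma> permutes {..<n}.
     single (expvec n (\<lambda>i. lookup m i + (n - 1 - \<sigma> i)))
       (of_int (sign \<sigma>) * lookup p m * W (lookup m) \<sigma>)) (expvec n b) = (\<Sum>\<sigma> | \<sigma> permutes {..<n}.
     (if \<forall>i<n. n - 1 - \<sigma> i \<le> b i then
        of_int (sign \<sigma>) * lookup p (expvec n (\<lambda>i. b i - (n - 1 - \<sigma> i))) *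
        W (\<lambda>i. b i - (n - 1 - \<sigma> i)) \<sigma> else 0))"
    by (subst sum.swap) (simp only: lookup_sum lookup_single when_def *)
  also have "\<dots> = (\<Sum>\<sigma> \<in> {\<sigma>. \<sigma> permutes {..<n}} \<inter> {\<sigma>. \<forall>i<n. n - 1 - \<sigma> i \<le> b i}.
        of_int (sign \<sigma>) * lookup p (expvec n (\<lambda>i. b i - (n - 1 - \<sigma> i))) *
        W (\<lambda>i. b i - (n - 1 - \<sigma> i)) \<sigma>)"
    by (subst sum.inter_restrict) (simp_all add: finite_permutations)
  also have "{\<sigma>. \<sigma> permutes {..<n}} \<inter> {\<sigma>. \<forall>i<n. n - 1 - \<sigma> i \<le> b i} = {\<sigma>. \<sigma> permutes {..<n} \<and> (\<forall>i<n. n - 1 - \<sigma> i \<le> b i)}"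
    by auto
  finally show ?thesis .
qed

lemma lookup_D_det:
  assumes "in_vars n p"
  shows "lookup (D_det n g u p) (expvec n b) = (\<Sum>\<sigma> | \<sigma> permutes {..<n} \<and> (\<forall>i<n. n - 1 - \<sigma> i \<le> b i).
     of_int (sign \<sigma>) * lookup p (expvec n (\<lambda>i. b i - (n - 1 - \<sigma> i))) *
       D_coef n g u (\<lambda>i. b i - (n - 1 - \<sigma> i)) \<sigma>)"
  unfolding D_det_eq[OF assms]
  by (rule lookup_shift_sum[OF assms]) (auto simp: D_coef_def intro!: prod.cong)

lemma vandermonde_times:
  assumes "in_vars n r"
  shows "(-1) ^ (n * (n - 1) div 2) * (vandermonde n var * r) =
    (\<Sum>m\<in>keys r. \<Sum>\<sigma> | \<sigma> permutes {..<n}.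
     single (expvec n (\<lambda>i. lookup m i + (n - 1 - \<sigma> i)))
       (of_int (sign \<sigma>) * lookup r m))"
proof -
  have "(-1) ^ (n * (n - 1) div 2) * (vandermonde n var * r) = ddet n (\<lambda>i j. var i ^ (n - 1 - j)) * r"
    by (simp only: vandermonde_ddet mult_ac)
  also have "\<dots> = (\<Sum>\<sigma> | \<sigma> permutes {..<n}. single (expvec n (\<lambda>i. n - 1 - \<sigma> i)) (of_int (sign \<sigma>))) * r"
    unfolding ddet_def prod_var_power
    by (intro arg_cong2[of _ _ _ _ "(*)"] sum.cong refl) (simp flip: single_of_int add: mult_single)
  also have "\<dots> = (\<Sum>m\<in>keys r. \<Sum>\<sigma> | \<sigma> permutes {..<n}.
     single (expvec n (\<lambda>i. lookup m i + (n - 1 - \<sigma> i)))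
       (of_int (sign \<sigma>) * lookup r m))"
    by (subst in_vars_eq_sum[OF assms], subst mult.commute)
      (simp add: sum_product mult_single expvec_add mult_ac)
  finally show ?thesis .
qed

lemma lookup_vandermonde_times:
  assumes "in_vars n r"
  shows "lookup ((-1) ^ (n * (n - 1) div 2) * (vandermonde n var * r)) (expvec n b) =
    (\<Sum>\<sigma> | \<sigma> permutes {..<n} \<and> (\<forall>i<n. n - 1 - \<sigma> i \<le> b i).
     of_int (sign \<sigma>) * lookup r (expvec n (\<lambda>i. b i - (n - 1 - \<sigma> i))))"
  using lookup_shift_sum[OF assms, of "\<lambda>_ _. 1" b] unfolding vandermonde_times[OF assms] by simp

section \<open>Exactness of the division by the Vandermonde product\<close>

lemma ddet_permute_rows:
  assumes "\<sigma> permutes {..<n}"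
  shows "ddet n (\<lambda>i j. f (\<sigma> i) j) = of_int (sign \<sigma>) * ddet n f"
proof -
  have "mat n n (\<lambda>(i, j). f (\<sigma> i) j) = mat n n (\<lambda>(i, j). mat n n (\<lambda>(i, j). f i j) $$ (\<sigma> i, j))"
    using permutes_in_image[OF assms] by (intro eq_matI) auto
  then show ?thesis
    unfolding ddet_eq_det using assms
    by (simp add: det_permute_rows[of "mat n n (\<lambda>(i, j). f i j)" n \<sigma>] lessThan_atLeast0)
qed

lemma eval_ddet: "eval_mpoly x (ddet n f) = ddet n (\<lambda>i j. eval_mpoly x (f i j))"
  by (simp add: ddet_def eval_mpoly_sum eval_mpoly_mult eval_mpoly_prod)

lemma sum_map_key_sym:
  assumes "p \<in> sym_polys n" "\<sigma> permutes {..<n}"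
  shows "(\<Sum>m\<in>keys p. F m) = (\<Sum>m\<in>keys p. F (map_key \<sigma> m))"
proof (rule sum.reindex_bij_witness[of _ "map_key \<sigma>" "map_key (inv_into UNIV \<sigma>)"])
  fix m assume m: "m \<in> keys p"
  show "map_key (inv_into UNIV \<sigma>) m \<in> keys p"
    "map_key \<sigma> m \<in> keys p"
    using m assms permutes_inv[OF assms(2)] by (auto simp: in_keys_iff sym_polys_def)
qed (auto simp: map_key_inv[OF assms(2)])

text \<open>Symmetry of \<open>p\<close> allows every exponent vector to be rearranged by any
  \<open>\<tau>\<close>; summing over all \<open>\<tau>\<close> accounts for \<open>fact n\<close>.
  With \<open>\<tau> = \<rho> \<circ> \<sigma>\<close> the scalar \<open>D_coef\<close> no longer
  depends on \<open>\<sigma>\<close>, and the sum over \<open>\<sigma>\<close> closes up to a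
  determinant of powers, which is antisymmetric and divisible by the Vandermonde product.\<close>

lemma D_det_sym_eq:
  assumes p: "p \<in> sym_polys n"
  shows "of_nat (fact n) * D_det n g u p = (\<Sum>m\<in>keys p. \<Sum>\<rho> | \<rho> permutes {..<n}.
     const (lookup p m * D_coef n g u (\<lambda>i. lookup m (\<rho> i)) id) *
     ddet n (\<lambda>i j. var i ^ (lookup m (\<rho> j) + (n - 1 - j))))"
proof -
  define T where "T m \<tau> \<sigma> = single (expvec n (\<lambda>i. lookup m (\<tau> i) + (n - 1 - \<sigma> i)))
       (of_int (sign \<sigma>) * lookup p m * D_coef n g u (\<lambda>i. lookup m (\<tau> i)) \<sigma>)" for m \<tau> \<sigma>
  let ?P = "{\<sigma>. \<sigma> permutes {..<n}}"
  have 1: "D_det n g u p = (\<Sum>m\<in>keys p. \<Sum>\<sigma>\<in>?P. T m \<tau> \<sigma>)" if \<tau>: "\<tau> \<in> ?P" for \<tau>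
  proof -
    have "lookup p (map_key \<tau> m) = lookup p m" for m
      using p \<tau> by (auto simp: sym_polys_def)
    moreover have "lookup (map_key \<tau> m) = (\<lambda>i. lookup m (\<tau> i))" for m :: "nat \<Rightarrow>\<^sub>0 nat"
      using \<tau> by (simp add: map_key.rep_eq[OF permutes_inj] o_def)
    ultimately show ?thesis
      using \<tau> by (subst D_det_eq[OF sym_polys_in_vars[OF p]], subst sum_map_key_sym[OF p, of \<tau>])
        (auto simp: T_def)
  qed
  have "of_nat (fact n) * D_det n g u p = (\<Sum>\<tau>\<in>?P. D_det n g u p)"
    using card_permutations[of "{..<n}" n] by simp
  also have "\<dots> = (\<Sum>\<tau>\<in>?P. \<Sum>m\<in>keys p. \<Sum>\<sigma>\<in>?P. T m \<tau> \<sigma>)"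
    by (rule sum.cong) (simp_all add: 1)
  also have "\<dots> = (\<Sum>m\<in>keys p. \<Sum>\<sigma>\<in>?P. \<Sum>\<tau>\<in>?P. T m \<tau> \<sigma>)"
    by (subst sum.swap) (rule sum.cong[OF refl], rule sum.swap)
  also have "\<dots> = (\<Sum>m\<in>keys p. \<Sum>\<sigma>\<in>?P. \<Sum>\<rho>\<in>?P. T m (\<rho> \<circ> \<sigma>) \<sigma>)"
  proof (rule sum.cong[OF refl], rule sum.cong[OF refl])
    fix m \<sigma> assume "\<sigma> \<in> ?P"
    then show "(\<Sum>\<tau>\<in>?P. T m \<tau> \<sigma>) = (\<Sum>\<rho>\<in>?P. T m (\<rho> \<circ> \<sigma>) \<sigma>)"
      using sum_permutations_compose_right[of \<sigma> "{..<n}" "\<lambda>\<tau>. T m \<tau> \<sigma>"] by simp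
  qed
  also have "\<dots> = (\<Sum>m\<in>keys p. \<Sum>\<rho>\<in>?P. \<Sum>\<sigma>\<in>?P. T m (\<rho> \<circ> \<sigma>) \<sigma>)"
    by (rule sum.cong[OF refl], rule sum.swap)
  also have "\<dots> = (\<Sum>m\<in>keys p. \<Sum>\<rho>\<in>?P.
     const (lookup p m * D_coef n g u (\<lambda>i. lookup m (\<rho> i)) id) *
     ddet n (\<lambda>i j. var i ^ (lookup m (\<rho> j) + (n - 1 - j))))"
  proof (rule sum.cong[OF refl], rule sum.cong[OF refl])
    fix m :: "nat \<Rightarrow>\<^sub>0 nat" and \<rho> :: "nat \<Rightarrow> nat"
    have "D_coef n g u (\<lambda>i. lookup m ((\<rho> \<circ> \<sigma>) i)) \<sigma> = D_coef n g u (\<lambda>i. lookup m (\<rho> i)) id"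
      if "\<sigma> \<in> ?P" for \<sigma>
    proof -
      have "bij_betw \<sigma> {..<n} {..<n}" using that by (auto intro: permutes_imp_bij)
      from prod.reindex_bij_betw[OF this, of "\<lambda>i. of_nat (lookup m (\<rho> i)) + of_real (real (n - 1 - i) * g) + u"]
      show ?thesis by (simp add: D_coef_def)
    qed
    then show "(\<Sum>\<sigma>\<in>?P. T m (\<rho> \<circ> \<sigma>) \<sigma>) =
     const (lookup p m * D_coef n g u (\<lambda>i. lookup m (\<rho> i)) id) *
     ddet n (\<lambda>i j. var i ^ (lookup m (\<rho> j) + (n - 1 - j)))"
      unfolding ddet_def prod_var_power sum_distrib_left
      by (intro sum.cong refl) (simp add: T_def const_def mult_single mult_ac flip: single_of_int)
  qed
  finally show ?thesis .
qed

lemma of_nat_fact_const: "of_nat (fact n) = const (fact n)"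
  by (simp add: const_def flip: single_of_nat)

lemma vandermonde_dvd_D_det:
  assumes "p \<in> sym_polys n"
  shows "vandermonde n var dvd D_det n g u p"
proof -
  have "vandermonde n var dvd ddet n (\<lambda>i j. var i ^ e j)" for e :: "nat \<Rightarrow> nat"
    using vandermonde_dvd_ddet[of n var "\<lambda>j. Polynomial.monom 1 (e j)"] by (simp add: poly_monom)
  then have "vandermonde n var dvd of_nat (fact n) * D_det n g u p"
    unfolding D_det_sym_eq[OF assms] by (intro dvd_sum dvd_mult) auto
  then have "vandermonde n var dvd const (1 / fact n) * (of_nat (fact n) * D_det n g u p)"
    by (rule dvd_mult)
  also have "const (1 / fact n) * (of_nat (fact n) * D_det n g u p) = D_det n g u p"
    unfolding of_nat_fact_const by (simp add: mult.assoc[symmetric] const_mult[symmetric])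
  finally show ?thesis .
qed

lemma vandermonde_nonzero:
  fixes x :: "nat \<Rightarrow> 'a::idom"
  assumes "inj_on x {..<n}"
  shows "vandermonde n x \<noteq> 0"
proof -
  have "x j - x i \<noteq> 0" if "j < n" "i < j" for i j
    using assms that inj_on_eq_iff[OF assms, of i j] by simp
  then show ?thesis unfolding vandermonde_def by (simp add: prod_zero_iff)
qed

lemma inj_var: "inj var"
proof (rule injI)
  fix i j assume "var i = var j"
  then have "keys (var i) = keys (var j)" by simp
  then have "single i (1::nat) = single j 1" by (simp add: var_def)
  then have "keys (single i (1::nat)) = keys (single j (1::nat))" by (rule arg_cong)
  then show "i = j" by simp
qed

lemma vandermonde_var_nonzero [simp]: "vandermonde n var \<noteq> 0"
  by (rule vandermonde_nonzero) (use inj_var in \<open>auto simp: inj_on_def inj_def\<close>)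

text \<open>The substitution of 0 for all variables from \<open>k\<close> on, hence a ring
  homomorphism. It bounds the variables of the quotient \<open>D_op\<close> and later removes the
  last variable of a Jack polynomial.\<close>

definition restrict_vars :: "nat \<Rightarrow> mpoly \<Rightarrow> mpoly" where
  "restrict_vars k p = (\<Sum>m | m \<in> keys p \<and> keys m \<subseteq> {..<k}. single m (lookup p m))"

lemma lookup_restrict_vars:
  "lookup (restrict_vars k p) m = (if keys m \<subseteq> {..<k} then lookup p m else 0)"
  by (auto simp: restrict_vars_def lookup_sum lookup_single when_def in_keys_iff)

lemma restrict_vars_add: "restrict_vars k (p + q) = restrict_vars k p + restrict_vars k q"
  by (rule poly_mapping_eqI) (simp add: lookup_restrict_vars lookup_add)

lemma restrict_vars_zero [simp]: "restrict_vars k 0 = 0"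
  by (rule poly_mapping_eqI) (simp add: lookup_restrict_vars)

lemma restrict_vars_sum: "restrict_vars k (sum f A) = (\<Sum>a\<in>A. restrict_vars k (f a))"
  by (induction A rule: infinite_finite_induct) (auto simp: restrict_vars_add)

lemma restrict_vars_single:
  "restrict_vars k (single m c) = (if keys m \<subseteq> {..<k} then single m c else 0)"
  by (rule poly_mapping_eqI) (auto simp: lookup_restrict_vars lookup_single when_def)

lemma in_vars_restrict_vars [simp]: "in_vars k (restrict_vars k p)"
  unfolding in_vars_def by (metis in_keys_iff lookup_restrict_vars)

lemma restrict_vars_id: "in_vars k p \<Longrightarrow> restrict_vars k p = p"
  by (rule poly_mapping_eqI) (auto simp: in_vars_def in_keys_iff lookup_restrict_vars)

lemma keys_add_nat: "keys (a + b) = keys a \<union> keys (b :: nat \<Rightarrow>\<^sub>0 nat)"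
  by (auto simp: in_keys_iff lookup_add)

lemma restrict_vars_mult: "restrict_vars k (p * q) = restrict_vars k p * restrict_vars k q"
proof -
  have *: "restrict_vars k (\<Sum>b\<in>B. \<Sum>a\<in>A. f a b) = (\<Sum>b\<in>B. \<Sum>a\<in>A. restrict_vars k (f a b))"
    for A B :: "(nat \<Rightarrow>\<^sub>0 nat) set" and f
    by (simp add: restrict_vars_sum)
  let ?s = "\<lambda>p m. single m (lookup p m)"
  have "restrict_vars k (p * q) = (\<Sum>a\<in>keys p. \<Sum>b\<in>keys q. restrict_vars k (?s p a * ?s q b))"
    by (subst mpoly_eq_sum[of p], subst mpoly_eq_sum[of q]) (simp only: sum_product restrict_vars_sum)
  also have "\<dots> = (\<Sum>a\<in>keys p. \<Sum>b\<in>keys q. restrict_vars k (?s p a) * restrict_vars k (?s q b))"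
    by (intro sum.cong refl) (auto simp: restrict_vars_single mult_single keys_add_nat)
  also have "\<dots> = restrict_vars k (\<Sum>a\<in>keys p. ?s p a) * restrict_vars k (\<Sum>b\<in>keys q. ?s q b)"
    by (simp only: restrict_vars_sum sum_product)
  finally show ?thesis by (simp only: mpoly_eq_sum[symmetric])
qed

lemma in_vars_vandermonde [simp]: "in_vars n (vandermonde n var)"
  unfolding vandermonde_def by (intro in_vars_prod in_vars_minus) auto

lemma in_vars_sign_power [simp]: "in_vars n ((-1) ^ k)"
  by (intro in_vars_power in_vars_uminus) simp

lemma D_op_ex1:
  assumes "p \<in> sym_polys n"
  shows "\<exists>!r. vandermonde n var * r = (-1) ^ (n * (n - 1) div 2) * D_det n g u p"
proof -
  have "vandermonde n var dvd (-1) ^ (n * (n - 1) div 2) * D_det n g u p"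
    using vandermonde_dvd_D_det[OF assms] by (rule dvd_mult)
  then obtain r where "(-1) ^ (n * (n - 1) div 2) * D_det n g u p = vandermonde n var * r" by (rule dvdE)
  then show ?thesis
    by (intro ex1I[of _ r]) (metis mult_left_cancel vandermonde_var_nonzero)+
qed

lemma D_op_eq:
  assumes "p \<in> sym_polys n"
  shows "vandermonde n var * D_op n g u p = (-1) ^ (n * (n - 1) div 2) * D_det n g u p"
  unfolding D_op_def using theI'[OF D_op_ex1[OF assms]] .

lemma D_op_unique:
  assumes "p \<in> sym_polys n" "vandermonde n var * r = (-1) ^ (n * (n - 1) div 2) * D_det n g u p"
  shows "D_op n g u p = r"
  using D_op_ex1[OF assms(1)] D_op_eq[OF assms(1)] assms(2) by blast

text \<open>Dropping the terms in further variables is multiplicative and changes neither the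
  Vandermonde product nor the numerator, so the reduced quotient is a quotient too; and the quotient
  is unique.\<close>

lemma in_vars_D_op:
  assumes "p \<in> sym_polys n"
  shows "in_vars n (D_op n g u p)"
proof -
  have "vandermonde n var * restrict_vars n (D_op n g u p) = restrict_vars n (vandermonde n var * D_op n g u p)"
    by (simp add: restrict_vars_mult restrict_vars_id)
  also have "\<dots> = (-1) ^ (n * (n - 1) div 2) * D_det n g u p"
    unfolding D_op_eq[OF assms] using assms
    by (intro restrict_vars_id in_vars_mult in_vars_D_det) (auto simp: sym_polys_in_vars)
  finally have "D_op n g u p = restrict_vars n (D_op n g u p)"
    by (intro D_op_unique assms)
  then show ?thesis using in_vars_restrict_vars by metis
qed

lemma eval_vandermonde_permute:
  assumes "\<sigma> permutes {..<n}"
  shows "vandermonde n (\<lambda>i. x (\<sigma> i) :: complex) = of_int (sign \<sigma>) * vandermonde n x"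
proof -
  have "(-1) ^ (n * (n - 1) div 2) * vandermonde n (\<lambda>i. x (\<sigma> i)) =
    (-1) ^ (n * (n - 1) div 2) * (of_int (sign \<sigma>) * vandermonde n x)"
    using ddet_permute_rows[OF assms, of "\<lambda>i j. x i ^ (n - 1 - j)"]
    unfolding vandermonde_ddet[of n "\<lambda>i. x (\<sigma> i)"] vandermonde_ddet[of n x] by (simp add: mult_ac)
  then show ?thesis by simp
qed

lemma eval_vandermonde: "eval_mpoly x (vandermonde n var) = vandermonde n x"
  by (simp add: vandermonde_def eval_mpoly_prod eval_mpoly_minus)

lemma eval_D_det_permute:
  assumes "\<sigma> permutes {..<n}" "p \<in> sym_polys n"
  shows "eval_mpoly (\<lambda>i. x (\<sigma> i)) (D_det n g u p) = of_int (sign \<sigma>) * eval_mpoly x (D_det n g u p)"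
proof -
  have *: "fact n * eval_mpoly y (D_det n g u p) = (\<Sum>m\<in>keys p. \<Sum>\<rho> | \<rho> permutes {..<n}.
     lookup p m * D_coef n g u (\<lambda>i. lookup m (\<rho> i)) id *
     ddet n (\<lambda>i j. y i ^ (lookup m (\<rho> j) + (n - 1 - j))))" for y
    using arg_cong[OF D_det_sym_eq[OF assms(2), of g u], of "eval_mpoly y"]
    unfolding of_nat_fact_const
    by (simp add: eval_mpoly_mult eval_mpoly_sum eval_ddet eval_mpoly_power)
  have "fact n * eval_mpoly (\<lambda>i. x (\<sigma> i)) (D_det n g u p) = of_int (sign \<sigma>) * (fact n * eval_mpoly x (D_det n g u p))"
    unfolding * sum_distrib_left
    by (intro sum.cong refl) (simp add: ddet_permute_rows[OF assms(1), of "\<lambda>i j. x i ^ e j" for e] mult_ac)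
  then show ?thesis by simp
qed

lemma vandermonde_increasing_nonzero:
  "strict_mono_on {..<n} x \<Longrightarrow> vandermonde n (\<lambda>i. complex_of_real (x i)) \<noteq> 0"
  by (rule vandermonde_nonzero) (auto simp: inj_on_def strict_mono_on_eqD)

lemma D_op_sym:
  assumes "p \<in> sym_polys n"
  shows "D_op n g u p \<in> sym_polys n"
proof (rule sym_polysI_eval[OF in_vars_D_op[OF assms]])
  fix \<sigma> and x :: "nat \<Rightarrow> real" assume \<sigma>: "\<sigma> permutes {..<n}" and x: "strict_mono_on {..<n} x"
  let ?x = "\<lambda>i. complex_of_real (x i)"
  have eq: "vandermonde n y * eval_mpoly y (D_op n g u p) = (-1) ^ (n * (n - 1) div 2) * eval_mpoly y (D_det n g u p)" for y
    using arg_cong[OF D_op_eq[OF assms, of g u], of "eval_mpoly y"]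
    by (simp add: eval_mpoly_mult eval_vandermonde eval_mpoly_power eval_mpoly_uminus)
  have "of_int (sign \<sigma>) * (vandermonde n ?x * eval_mpoly (\<lambda>i. ?x (\<sigma> i)) (D_op n g u p)) =
    of_int (sign \<sigma>) * (vandermonde n ?x * eval_mpoly ?x (D_op n g u p))"
    using eq[of "\<lambda>i. ?x (\<sigma> i)"] eq[of ?x]
    by (simp add: eval_vandermonde_permute[OF \<sigma>, of ?x] eval_D_det_permute[OF \<sigma> assms, of ?x] mult_ac)
  then show "eval_mpoly (\<lambda>i. ?x (\<sigma> i)) (D_op n g u p) = eval_mpoly ?x (D_op n g u p)"
    using vandermonde_increasing_nonzero[OF x] by (auto simp: sign_def split: if_splits)
qed

lemma D_op_add:
  assumes "p \<in> sym_polys n" "q \<in> sym_polys n"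
  shows "D_op n g u (p + q) = D_op n g u p + D_op n g u q"
  using assms by (intro D_op_unique) (auto simp: sym_polys_add D_op_eq D_det_add ring_distribs)

lemma D_op_const_mult:
  assumes "p \<in> sym_polys n"
  shows "D_op n g u (const c * p) = const c * D_op n g u p"
  using assms D_op_eq[OF assms, of g u]
  by (intro D_op_unique) (auto simp: sym_polys_mult D_det_const_mult sym_polys_in_vars mult.left_commute)

lemma D_op_zero [simp]: "D_op n g u 0 = 0"
  by (rule D_op_unique) auto

lemma D_op_sum:
  assumes "\<And>a. a \<in> A \<Longrightarrow> f a \<in> sym_polys n"
  shows "D_op n g u (sum f A) = (\<Sum>a\<in>A. D_op n g u (f a))"
  using assms by (induction A rule: infinite_finite_induct) (auto simp: D_op_add sym_polys_sum)

section \<open>Triangularity of \<open>D\<close>\<close>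

text \<open>Dominance of exponent vectors that need not be sorted, whence the quantification over all
  sets of positions.\<close>

definition exp_dom :: "nat \<Rightarrow> (nat \<Rightarrow> nat) \<Rightarrow> (nat \<Rightarrow> nat) \<Rightarrow> bool" where
  "exp_dom n a l \<longleftrightarrow> (\<Sum>i<n. a i) = (\<Sum>i<n. l i) \<and>
     (\<forall>A\<subseteq>{..<n}. (\<Sum>i\<in>A. a i) \<le> (\<Sum>i<card A. l i))"

definition decr :: "nat \<Rightarrow> (nat \<Rightarrow> nat) \<Rightarrow> bool" where
  "decr n a \<longleftrightarrow> (\<forall>i j. i \<le> j \<longrightarrow> j < n \<longrightarrow> a j \<le> a i)"

lemma decr_sum_le:
  assumes "decr n a" "A \<subseteq> {..<n}"
  shows "(\<Sum>i\<in>A. a i) \<le> (\<Sum>i<card A. a i)"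
  using assms
proof (induction n arbitrary: A)
  case (Suc n)
  have fin: "finite A" using Suc.prems finite_subset by blast
  have d: "decr n a" using Suc.prems by (auto simp: decr_def)
  show ?case
  proof (cases "n \<in> A")
    case True
    define B where "B = A - {n}"
    have B: "B \<subseteq> {..<n}" "A = insert n B" "n \<notin> B" "finite B"
      using Suc.prems True fin by (auto simp: B_def less_Suc_eq)
    have "card B \<le> n" using card_mono[OF _ B(1)] by simp
    then have "a n \<le> a (card B)" using Suc.prems by (auto simp: decr_def)
    then show ?thesis using Suc.IH[OF d B(1)] B by simp
  next
    case False
    then have "A \<subseteq> {..<n}" using Suc.prems by (auto simp: less_Suc_eq)
    then show ?thesis using Suc.IH d by blast
  qed
qed auto

lemma exp_dom_permute:
  assumes "\<sigma> permutes {..<n}" "exp_dom n a l"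
  shows "exp_dom n (\<lambda>i. a (\<sigma> i)) l"
  unfolding exp_dom_def
proof (intro conjI allI impI)
  show "(\<Sum>i<n. a (\<sigma> i)) = (\<Sum>i<n. l i)"
    using sum.permute[OF assms(1), of a] assms(2) by (simp add: exp_dom_def o_def)
  fix A assume A: "A \<subseteq> {..<n}"
  have inj: "inj_on \<sigma> A" using permutes_inj_on[OF assms(1)] .
  have "(\<Sum>i\<in>A. a (\<sigma> i)) = (\<Sum>i\<in>\<sigma> ` A. a i)" using inj by (simp add: sum.reindex)
  also have "\<dots> \<le> (\<Sum>i<card (\<sigma> ` A). l i)"
    using assms A permutes_in_image[OF assms(1)] unfolding exp_dom_def by (metis image_mono permutes_image)
  finally show "(\<Sum>i\<in>A. a (\<sigma> i)) \<le> (\<Sum>i<card A. l i)" using inj by (simp add: card_image)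
qed

lemma exp_dom_permute_iff:
  assumes "\<sigma> permutes {..<n}"
  shows "exp_dom n (\<lambda>i. a (\<sigma> i)) l \<longleftrightarrow> exp_dom n a l"
  using exp_dom_permute[OF assms, of a l] exp_dom_permute[OF permutes_inv[OF assms], of "\<lambda>i. a (\<sigma> i)" l]
  by (auto simp: permutes_inverses[OF assms])

lemma exp_dom_cong: "(\<And>i. i < n \<Longrightarrow> a i = b i) \<Longrightarrow> exp_dom n a l \<longleftrightarrow> exp_dom n b l"
  unfolding exp_dom_def
  by (intro arg_cong2[of _ _ _ _ "(\<and>)"] all_cong1 imp_cong refl arg_cong2[of _ _ _ _ "(=)"]
      arg_cong2[of _ _ _ _ "(\<le>)"] sum.cong) auto

lemma exp_dom_decr_iff:
  assumes "decr n a"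
  shows "exp_dom n a l \<longleftrightarrow> (\<Sum>i<n. a i) = (\<Sum>i<n. l i) \<and> (\<forall>k\<le>n. (\<Sum>i<k. a i) \<le> (\<Sum>i<k. l i))"
proof (intro iffI conjI allI impI; (elim conjE)?)
  show "(\<Sum>i<k. a i) \<le> (\<Sum>i<k. l i)" if "exp_dom n a l" "k \<le> n" for k
    using that unfolding exp_dom_def by (metis card_lessThan lessThan_subset_iff)
  assume *: "(\<Sum>i<n. a i) = (\<Sum>i<n. l i)" "\<forall>k\<le>n. (\<Sum>i<k. a i) \<le> (\<Sum>i<k. l i)"
  have "(\<Sum>i\<in>A. a i) \<le> (\<Sum>i<card A. l i)" if "A \<subseteq> {..<n}" for A
  proof -
    have "card A \<le> n" using card_mono[OF _ that] by simp
    then show ?thesis using *(2) decr_sum_le[OF assms that] order_trans by blast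
  qed
  then show "exp_dom n a l" using * by (simp add: exp_dom_def)
qed (simp add: exp_dom_def)

text \<open>The pairing with \<open>(n - 1, ..., 1, 0)\<close>. It is strictly monotone for
  dominance, so an exponent of maximal weight can stand in for a maximal element of the partial
  order.\<close>

definition weight :: "nat \<Rightarrow> (nat \<Rightarrow> nat) \<Rightarrow> nat" where
  "weight n a = (\<Sum>i<n. (n - 1 - i) * a i)"

text \<open>Swapping an ascent \<open>a i < a j\<close> with \<open>i < j\<close> would raise the
  weight by \<open>(j - i) * (a j - a i)\<close>.\<close>

lemma decr_if_weight_maximal:
  assumes "\<And>\<sigma>. \<sigma> permutes {..<n} \<Longrightarrow> weight n (\<lambda>i. a (\<sigma> i)) \<le> weight n a"
  shows "decr n a"
  unfolding decr_def
proof (intro allI impI)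
  fix i j assume ij: "i \<le> j" "j < n"
  show "a j \<le> a i"
  proof (rule ccontr)
    assume "\<not> a j \<le> a i"
    then have lt: "a i < a j" "i < j" using ij by (auto simp: le_less)
    let ?t = "Transposition.transpose i j"
    have p: "?t permutes {..<n}" using ij by (intro permutes_swap_id) auto
    have split: "(\<Sum>k<n. (n - 1 - k) * c k) = (n - 1 - i) * c i + (n - 1 - j) * c j + (\<Sum>k\<in>{..<n} - {i, j}. (n - 1 - k) * c k)"
      for c :: "nat \<Rightarrow> nat"
    proof -
      have "{..<n} - {i} - {j} = {..<n} - {i, j}" by auto
      then show ?thesis
        using lt ij sum.remove[of "{..<n}" i "\<lambda>k. (n - 1 - k) * c k"] sum.remove[of "{..<n} - {i}" j "\<lambda>k. (n - 1 - k) * c k"]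
        by simp
    qed
    obtain d where d: "n - 1 - i = (n - 1 - j) + Suc d"
      using lt ij by (intro that[of "j - i - 1"]) simp
    have "(\<Sum>k\<in>{..<n} - {i, j}. (n - 1 - k) * a (?t k)) = (\<Sum>k\<in>{..<n} - {i, j}. (n - 1 - k) * a k)"
      by (rule sum.cong) (auto simp: Transposition.transpose_def)
    then have "weight n (\<lambda>k. a (?t k)) + (n - 1 - i) * a i + (n - 1 - j) * a j
        = weight n a + (n - 1 - i) * a j + (n - 1 - j) * a i"
      unfolding weight_def split by simp
    moreover have "(n - 1 - i) * a i + (n - 1 - j) * a j < (n - 1 - i) * a j + (n - 1 - j) * a i"
    proof -
      have "Suc d * a i < Suc d * a j" using lt by (simp only: mult_less_cancel1) simp
      then show ?thesis unfolding d by (simp only: ring_distribs)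
    qed
    ultimately show False using assms[OF p] by linarith
  qed
qed

section \<open>Shifts of exponents by differences of staircases\<close>

context
  fixes n :: nat and \<sigma> :: "nat \<Rightarrow> nat"
  assumes \<sigma>: "\<sigma> permutes {..<n}"
begin

lemma partial_sum_delta_le:
  assumes "k \<le> n"
  shows "(\<Sum>i<k. n - 1 - \<sigma> i) \<le> (\<Sum>i<k. n - 1 - i)"
proof -
  have inj: "inj_on \<sigma> {..<k}" using permutes_inj_on[OF \<sigma>] .
  have "\<sigma> ` {..<k} \<subseteq> {..<n}" using permutes_in_image[OF \<sigma>] assms by fastforce
  moreover have "decr n (\<lambda>i. n - 1 - i)" by (auto simp: decr_def)
  ultimately have "(\<Sum>i\<in>\<sigma> ` {..<k}. n - 1 - i) \<le> (\<Sum>i<card (\<sigma> ` {..<k}). n - 1 - i)"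
    by (rule decr_sum_le[rotated])
  then show ?thesis using inj by (simp add: sum.reindex card_image)
qed

lemma shift_partial_sum:
  assumes "\<forall>i<n. n - 1 - \<sigma> i \<le> a i + (n - 1 - i)" "k \<le> n"
  shows "(\<Sum>i<k. a i + (n - 1 - i) - (n - 1 - \<sigma> i)) + (\<Sum>i<k. n - 1 - \<sigma> i) = (\<Sum>i<k. a i) + (\<Sum>i<k. n - 1 - i)"
  unfolding sum.distrib[symmetric]
proof (rule sum.cong[OF refl])
  fix i assume "i \<in> {..<k}"
  then have "n - 1 - \<sigma> i \<le> a i + (n - 1 - i)" using assms by simp
  then show "a i + (n - 1 - i) - (n - 1 - \<sigma> i) + (n - 1 - \<sigma> i) = a i + (n - 1 - i)" by (rule le_add_diff_inverse2)
qed

lemma shift_total: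
  assumes "\<forall>i<n. n - 1 - \<sigma> i \<le> a i + (n - 1 - i)"
  shows "(\<Sum>i<n. a i + (n - 1 - i) - (n - 1 - \<sigma> i)) = (\<Sum>i<n. a i)"
  using shift_partial_sum[OF assms order_refl] sum.permute[OF \<sigma>, of "\<lambda>i. n - 1 - i"] by (simp add: o_def)

lemma shift_partial_sum_ge:
  assumes "\<forall>i<n. n - 1 - \<sigma> i \<le> a i + (n - 1 - i)" "k \<le> n"
  shows "(\<Sum>i<k. a i) \<le> (\<Sum>i<k. a i + (n - 1 - i) - (n - 1 - \<sigma> i))"
  using shift_partial_sum[OF assms] partial_sum_delta_le[OF assms(2)] by linarith

lemma shift_id:
  assumes "\<And>i. i < n \<Longrightarrow> n - 1 - \<sigma> i = n - 1 - i"
  shows "\<sigma> = id"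
proof
  fix i
  show "\<sigma> i = id i"
  proof (cases "i < n")
    case True
    then have "\<sigma> i < n" using permutes_in_image[OF \<sigma>] by auto
    then show ?thesis using assms[OF True] True by simp
  qed (use \<sigma> in \<open>auto simp: permutes_def\<close>)
qed

text \<open>With \<open>\<delta> i = n - 1 - i\<close>, the gain is the inner product of
  \<open>\<delta>\<close> and \<open>\<delta> - \<delta> \<circ> \<sigma>\<close>. As
  \<open>\<delta>\<close> and \<open>\<delta> \<circ> \<sigma>\<close> have the same norm, it is
  half the squared norm of their difference.\<close>

lemma shift_weight:
  assumes "\<forall>i<n. n - 1 - \<sigma> i \<le> a i + (n - 1 - i)" "\<sigma> \<noteq> id"
  shows "weight n a < weight n (\<lambda>i. a i + (n - 1 - i) - (n - 1 - \<sigma> i))"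
proof -
  let ?d = "\<lambda>i. int (n - 1 - i)"
  obtain i where i: "i < n" "n - 1 - \<sigma> i \<noteq> n - 1 - i" using shift_id assms(2) by blast
  have sq: "(\<Sum>i<n. ?d (\<sigma> i) ^ 2) = (\<Sum>i<n. ?d i ^ 2)"
    using sum.permute[OF \<sigma>, of "\<lambda>i. ?d i ^ 2"] by (simp add: o_def)
  have "0 < (\<Sum>i<n. (?d i - ?d (\<sigma> i)) ^ 2)"
    using i by (intro sum_pos2[of _ i]) auto
  also have "\<dots> = (\<Sum>i<n. ?d (\<sigma> i) ^ 2) - (\<Sum>i<n. ?d i ^ 2) + 2 * (\<Sum>i<n. ?d i * (?d i - ?d (\<sigma> i)))"
    unfolding sum_distrib_left sum_subtractf[symmetric] sum.distrib[symmetric]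
  proof (rule sum.cong[OF refl])
    have "(x - y)\<^sup>2 = y\<^sup>2 - x\<^sup>2 + 2 * (x * (x - y))" for x y :: int
      by (simp add: power2_eq_square algebra_simps)
    then show "(?d i - ?d (\<sigma> i))\<^sup>2 = (?d (\<sigma> i))\<^sup>2 - (?d i)\<^sup>2 + 2 * (?d i * (?d i - ?d (\<sigma> i)))" for i .
  qed
  finally have "0 < (\<Sum>i<n. ?d i * (?d i - ?d (\<sigma> i)))" by (simp only: sq)
  moreover have "int (weight n (\<lambda>i. a i + (n - 1 - i) - (n - 1 - \<sigma> i))) = int (weight n a) + (\<Sum>i<n. ?d i * (?d i - ?d (\<sigma> i)))"
    unfolding weight_def of_nat_sum sum.distrib[symmetric]
  proof (rule sum.cong[OF refl])
    fix i assume "i \<in> {..<n}"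
    then have "n - 1 - \<sigma> i \<le> a i + (n - 1 - i)" using assms(1) by simp
    then have "int (a i + (n - 1 - i) - (n - 1 - \<sigma> i)) = int (a i) + ?d i - ?d (\<sigma> i)" by linarith
    then show "int ((n - 1 - i) * (a i + (n - 1 - i) - (n - 1 - \<sigma> i))) = int ((n - 1 - i) * a i) + ?d i * (?d i - ?d (\<sigma> i))"
      by (simp only: of_nat_mult) (simp add: algebra_simps)
  qed
  ultimately show ?thesis by linarith
qed

end

text \<open>The exponent vector that the term \<open>\<sigma>\<close> carries to
  \<open>a i + (n - 1 - i)\<close>, the place where the coefficient belonging to \<open>a\<close> is
  read off.\<close>

abbreviation shift :: "nat \<Rightarrow> (nat \<Rightarrow> nat) \<Rightarrow> (nat \<Rightarrow> nat) \<Rightarrow> nat \<Rightarrow> nat" where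
  "shift n a \<sigma> \<equiv> (\<lambda>i. a i + (n - 1 - i) - (n - 1 - \<sigma> i))"

lemma sum_only_id:
  fixes n :: nat and a :: "nat \<Rightarrow> nat"
  assumes "\<And>\<sigma>. \<sigma> permutes {..<n} \<Longrightarrow> \<sigma> \<noteq> id \<Longrightarrow> \<forall>i<n. n - 1 - \<sigma> i \<le> a i + (n - 1 - i) \<Longrightarrow> F \<sigma> = 0"
  shows "(\<Sum>\<sigma> | \<sigma> permutes {..<n} \<and> (\<forall>i<n. n - 1 - \<sigma> i \<le> a i + (n - 1 - i)). F \<sigma>) = F id"
proof -
  let ?S = "{\<sigma>. \<sigma> permutes {..<n} \<and> (\<forall>i<n. n - 1 - \<sigma> i \<le> a i + (n - 1 - i))}"
  have "?S \<subseteq> {\<sigma>. \<sigma> permutes {..<n}}" by blast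
  then have "finite ?S" using finite_subset finite_permutations[OF finite_lessThan[of n]] by blast
  moreover have "id \<in> ?S" by (simp only: mem_Collect_eq permutes_id id_apply) (simp only: le_add2 simp_thms)
  ultimately have "(\<Sum>\<sigma>\<in>?S. F \<sigma>) = (\<Sum>\<sigma>\<in>{id}. F \<sigma>)"
    using assms by (intro sum.mono_neutral_right) blast+
  then show ?thesis by simp
qed

lemma lookup_D_det_leading:
  assumes "in_vars n p"
    and "\<And>\<sigma>. \<sigma> permutes {..<n} \<Longrightarrow> \<sigma> \<noteq> id \<Longrightarrow> \<forall>i<n. n - 1 - \<sigma> i \<le> a i + (n - 1 - i) \<Longrightarrow>
      lookup p (expvec n (shift n a \<sigma>)) = 0"
  shows "lookup (D_det n g u p) (expvec n (\<lambda>i. a i + (n - 1 - i))) =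
    lookup p (expvec n a) * D_coef n g u a id"
  unfolding lookup_D_det[OF assms(1)] by (subst sum_only_id) (use assms(2) in auto)

lemma lookup_vandermonde_leading:
  assumes "in_vars n p"
    and "\<And>\<sigma>. \<sigma> permutes {..<n} \<Longrightarrow> \<sigma> \<noteq> id \<Longrightarrow> \<forall>i<n. n - 1 - \<sigma> i \<le> a i + (n - 1 - i) \<Longrightarrow>
      lookup p (expvec n (shift n a \<sigma>)) = 0"
  shows "lookup ((-1) ^ (n * (n - 1) div 2) * (vandermonde n var * p)) (expvec n (\<lambda>i. a i + (n - 1 - i))) =
    lookup p (expvec n a)"
  unfolding lookup_vandermonde_times[OF assms(1)] by (subst sum_only_id) (use assms(2) in auto)

lemma D_op_eq':
  assumes "p \<in> sym_polys n"
  shows "(-1) ^ (n * (n - 1) div 2) * (vandermonde n var * D_op n g u p) = D_det n g u p"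
  unfolding D_op_eq[OF assms] by (simp add: mult.assoc[symmetric] power_add[symmetric] flip: mult_2)

definition supp_exp_dom :: "nat \<Rightarrow> (nat \<Rightarrow> nat) \<Rightarrow> mpoly \<Rightarrow> bool" where
  "supp_exp_dom n l p \<longleftrightarrow> (\<forall>a. lookup p (expvec n a) \<noteq> 0 \<longrightarrow> exp_dom n a l)"

lemma weight_cong: "(\<And>i. i < n \<Longrightarrow> a i = b i) \<Longrightarrow> weight n a = weight n b"
  unfolding weight_def by (rule sum.cong) auto

text \<open>An exponent of maximal weight within a permutation-invariant class \<open>Q\<close> is
  automatically weakly decreasing, because its rearrangements occur in \<open>p\<close> and belong
  to \<open>Q\<close> as well.\<close>

lemma maximal_monomial:
  assumes p: "p \<in> sym_polys n"
    and Q: "\<And>\<sigma> a. \<sigma> permutes {..<n} \<Longrightarrow> Q a \<Longrightarrow> Q (\<lambda>i. a (\<sigma> i))"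
    and Q': "\<And>a b. (\<And>i. i < n \<Longrightarrow> a i = b i) \<Longrightarrow> Q a \<Longrightarrow> Q b"
    and ex: "lookup p (expvec n c) \<noteq> 0" "Q c"
  obtains a where "lookup p (expvec n a) \<noteq> 0" "Q a" "decr n a"
    "\<And>b. lookup p (expvec n b) \<noteq> 0 \<Longrightarrow> Q b \<Longrightarrow> weight n b \<le> weight n a"
proof -
  define M where "M = {m \<in> keys p. Q (lookup m)}"
  have "finite M" by (simp add: M_def)
  moreover have "expvec n c \<in> M"
    using ex(1) Q'[OF _ ex(2), of "lookup (expvec n c)"] by (auto simp: M_def in_keys_iff lookup_expvec)
  ultimately obtain m where m: "m \<in> M" "\<And>m'. m' \<in> M \<Longrightarrow> weight n (lookup m') \<le> weight n (lookup m)"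
    using Max_ge[of "(\<lambda>m. weight n (lookup m)) ` M"] Max_in[of "(\<lambda>m. weight n (lookup m)) ` M"]
    by (metis (no_types, lifting) empty_iff finite_imageI imageE image_eqI)
  define a where "a = lookup m"
  have ma: "expvec n a = m" using m(1) sym_polys_in_vars[OF p] by (auto simp: M_def a_def in_vars_def expvec_lookup)
  have max: "weight n b \<le> weight n a" if "lookup p (expvec n b) \<noteq> 0" "Q b" for b
  proof -
    have "expvec n b \<in> M"
      using that(1) Q'[OF _ that(2), of "lookup (expvec n b)"] by (auto simp: M_def in_keys_iff lookup_expvec)
    then have "weight n (lookup (expvec n b)) \<le> weight n a" using m(2) a_def by blast
    moreover have "weight n (lookup (expvec n b)) = weight n b"
      by (rule weight_cong) (simp add: lookup_expvec)
    ultimately show ?thesis by simp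
  qed
  have a: "lookup p (expvec n a) \<noteq> 0" "Q a"
    using m(1) unfolding ma by (auto simp: M_def in_keys_iff a_def)
  have "decr n a"
    by (rule decr_if_weight_maximal, rule max) (use p a Q in \<open>auto simp: sym_polys_iff\<close>)
  with a max show ?thesis using that by blast
qed

text \<open>Among the offending exponents of \<open>D_op n g u p\<close> take \<open>a\<close> of
  maximal weight. Its proper shifts have larger weight and partial sums at least as large, so they
  offend too and, by maximality, are absent. Only \<open>\<sigma> = id\<close> then contributes on
  both sides of the defining equation, and the coefficient at \<open>a\<close> is a multiple of that
  of \<open>p\<close>, which is zero.\<close>

theorem supp_exp_dom_D_op:
  assumes p: "p \<in> sym_polys n" and supp: "supp_exp_dom n l p"
  shows "supp_exp_dom n l (D_op n g u p)"
proof (rule ccontr)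
  let ?r = "D_op n g u p"
  have r: "?r \<in> sym_polys n" using D_op_sym[OF p] .
  assume "\<not> supp_exp_dom n l ?r"
  then obtain c where c: "lookup ?r (expvec n c) \<noteq> 0" "\<not> exp_dom n c l"
    by (auto simp: supp_exp_dom_def)
  obtain a where a: "lookup ?r (expvec n a) \<noteq> 0" "\<not> exp_dom n a l" "decr n a"
    and max: "\<And>b. lookup ?r (expvec n b) \<noteq> 0 \<Longrightarrow> \<not> exp_dom n b l \<Longrightarrow> weight n b \<le> weight n a"
  proof (rule maximal_monomial[OF r, of "\<lambda>a. \<not> exp_dom n a l"])
    show "\<not> exp_dom n b l" if "\<And>i. i < n \<Longrightarrow> a i = b i" "\<not> exp_dom n a l" for a b
      using exp_dom_cong[of n a b l] that by blast
  qed (use c exp_dom_permute_iff in auto)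
  have nd: "\<not> exp_dom n (shift n a \<sigma>) l"
    if \<sigma>: "\<sigma> permutes {..<n}" and ge: "\<forall>i<n. n - 1 - \<sigma> i \<le> a i + (n - 1 - i)" for \<sigma>
  proof
    assume d: "exp_dom n (shift n a \<sigma>) l"
    have "(\<Sum>i<k. a i) \<le> (\<Sum>i<k. l i)" if "k \<le> n" for k
    proof -
      have "(\<Sum>i<k. a i) \<le> (\<Sum>i<k. shift n a \<sigma> i)" by (rule shift_partial_sum_ge[OF \<sigma> ge that])
      also have "\<dots> \<le> (\<Sum>i<card {..<k}. l i)"
        using d that unfolding exp_dom_def by (metis lessThan_subset_iff)
      finally show ?thesis by simp
    qed
    moreover have "(\<Sum>i<n. a i) = (\<Sum>i<n. l i)"
      using shift_total[OF \<sigma> ge] d unfolding exp_dom_def by simp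
    ultimately show False using a exp_dom_decr_iff by blast
  qed
  have "lookup ?r (expvec n a) =
    lookup ((-1) ^ (n * (n - 1) div 2) * (vandermonde n var * ?r)) (expvec n (\<lambda>i. a i + (n - 1 - i)))"
  proof (rule lookup_vandermonde_leading[symmetric, OF sym_polys_in_vars[OF r]])
    fix \<sigma> assume \<sigma>: "\<sigma> permutes {..<n}" "\<sigma> \<noteq> id" "\<forall>i<n. n - 1 - \<sigma> i \<le> a i + (n - 1 - i)"
    show "lookup ?r (expvec n (shift n a \<sigma>)) = 0"
      using max[of "shift n a \<sigma>"] nd[OF \<sigma>(1,3)] shift_weight[OF \<sigma>(1,3,2)] by linarith
  qed
  also have "\<dots> = lookup p (expvec n a) * D_coef n g u a id"
    unfolding D_op_eq'[OF p]
  proof (rule lookup_D_det_leading[OF sym_polys_in_vars[OF p]])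
    fix \<sigma> assume \<sigma>: "\<sigma> permutes {..<n}" "\<sigma> \<noteq> id" "\<forall>i<n. n - 1 - \<sigma> i \<le> a i + (n - 1 - i)"
    show "lookup p (expvec n (shift n a \<sigma>)) = 0"
      using supp nd[OF \<sigma>(1,3)] by (auto simp: supp_exp_dom_def)
  qed
  also have "lookup p (expvec n a) = 0"
    using supp a(2) by (auto simp: supp_exp_dom_def)
  finally show False using a(1) by simp
qed

text \<open>A shift never lowers a partial sum; if it is also dominated by \<open>l\<close>, all
  partial sums agree with those of \<open>l\<close>, and so do the entries.\<close>

lemma exp_dom_shift_imp_id:
  assumes l: "decr n l" and \<sigma>: "\<sigma> permutes {..<n}" and ge: "\<forall>i<n. n - 1 - \<sigma> i \<le> l i + (n - 1 - i)"
    and d: "exp_dom n (shift n l \<sigma>) l"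
  shows "\<sigma> = id"
proof -
  have eq: "(\<Sum>i<k. shift n l \<sigma> i) = (\<Sum>i<k. l i)" if "k \<le> n" for k
  proof (rule antisym)
    have "(\<Sum>i<k. shift n l \<sigma> i) \<le> (\<Sum>i<card {..<k}. l i)"
      using d that unfolding exp_dom_def by (metis lessThan_subset_iff)
    then show "(\<Sum>i<k. shift n l \<sigma> i) \<le> (\<Sum>i<k. l i)" by simp
  qed (rule shift_partial_sum_ge[OF \<sigma> ge that])
  show ?thesis
  proof (rule shift_id[OF \<sigma>])
    fix i assume i: "i < n"
    then have "shift n l \<sigma> i = l i" using eq[of i] eq[of "Suc i"] by simp
    then show "n - 1 - \<sigma> i = n - 1 - i" using ge i by (metis add.commute add_diff_cancel_right' le_add_diff_inverse2)
  qed
qed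

theorem lookup_D_op_leading:
  assumes p: "p \<in> sym_polys n" and supp: "supp_exp_dom n l p" and l: "decr n l"
  shows "lookup (D_op n g u p) (expvec n l) = D_coef n g u l id * lookup p (expvec n l)"
proof -
  let ?r = "D_op n g u p"
  have r: "?r \<in> sym_polys n" using D_op_sym[OF p] .
  have rs: "supp_exp_dom n l ?r" using supp_exp_dom_D_op[OF p supp] .
  have "lookup ?r (expvec n l) =
    lookup ((-1) ^ (n * (n - 1) div 2) * (vandermonde n var * ?r)) (expvec n (\<lambda>i. l i + (n - 1 - i)))"
    using exp_dom_shift_imp_id[OF l] rs sym_polys_in_vars[OF r]
    by (subst lookup_vandermonde_leading) (auto simp: supp_exp_dom_def)
  also have "\<dots> = lookup p (expvec n l) * D_coef n g u l id"
    unfolding D_op_eq'[OF p]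
    using exp_dom_shift_imp_id[OF l] supp sym_polys_in_vars[OF p]
    by (subst lookup_D_det_leading) (auto simp: supp_exp_dom_def)
  finally show ?thesis by simp
qed

text \<open>The exponent \<open>a\<close> is fixed before \<open>u\<close> and \<open>d\<close>: a
  common eigenvector of several \<open>D u\<close> shows all its eigenvalues at one and the same
  leading exponent.\<close>

lemma eigenvector_leading:
  assumes p: "p \<in> sym_polys n" "p \<noteq> 0"
  obtains a where "decr n a" "lookup p (expvec n a) \<noteq> 0"
    "\<And>u d. D_op n g u p = const d * p \<Longrightarrow> d = D_coef n g u a id"
proof -
  have pv: "in_vars n p" using sym_polys_in_vars[OF p(1)] .
  obtain m where "m \<in> keys p" using p(2) by (metis ex_in_conv keys_eq_empty)
  then have m: "lookup p (expvec n (lookup m)) \<noteq> 0"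
    using pv by (simp add: in_vars_def expvec_lookup in_keys_iff)
  obtain a where a: "lookup p (expvec n a) \<noteq> 0" "decr n a"
    and max: "\<And>b. lookup p (expvec n b) \<noteq> 0 \<Longrightarrow> weight n b \<le> weight n a"
    by (rule maximal_monomial[OF p(1), of "\<lambda>_. True"]) (use m in auto)
  have 0: "lookup p (expvec n (shift n a \<sigma>)) = 0"
    if \<sigma>: "\<sigma> permutes {..<n}" "\<sigma> \<noteq> id" "\<forall>i<n. n - 1 - \<sigma> i \<le> a i + (n - 1 - i)" for \<sigma>
    using max[of "shift n a \<sigma>"] shift_weight[OF \<sigma>(1,3,2)] by linarith
  have "d = D_coef n g u a id" if "D_op n g u p = const d * p" for u d
  proof -
    have "lookup p (expvec n a) * D_coef n g u a id =
      lookup ((-1) ^ (n * (n - 1) div 2) * (vandermonde n var * (const d * p))) (expvec n (\<lambda>i. a i + (n - 1 - i)))"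
      unfolding that[symmetric] D_op_eq'[OF p(1)] by (rule lookup_D_det_leading[OF pv 0, symmetric])
    also have "\<dots> = d * lookup p (expvec n a)"
      using lookup_vandermonde_leading[OF pv 0] by (simp add: mult.left_commute[of _ "const d"])
    finally show ?thesis using a(1) by simp
  qed
  with a show ?thesis using that by blast
qed

section \<open>Partitions and monomial symmetric polynomials\<close>

lemma sum_list_take_nth: "k \<le> length xs \<Longrightarrow> sum_list (take k xs) = (\<Sum>i<k. xs ! i)"
  for xs :: "nat list"
  by (subst sum_list_sum_nth) (auto simp: lessThan_atLeast0 min_def intro!: sum.cong)

lemma sum_list_nth_lessThan: "length xs = n \<Longrightarrow> sum_list xs = (\<Sum>i<n. xs ! i)"
  for xs :: "nat list"
  using sum_list_take_nth[of n xs] by simp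

lemma is_partition_decr: "is_partition n mu \<Longrightarrow> decr n ((!) mu)"
  unfolding is_partition_def decr_def
  by (metis le_eq_less_or_eq sorted_wrt_nth_less)

lemma is_partitionI: "decr n a \<Longrightarrow> is_partition n (map a [0..<n])"
  by (auto simp: is_partition_def sorted_wrt_iff_nth_less decr_def)

lemma dominated_iff_exp_dom:
  assumes "is_partition n mu" "length lam = n"
  shows "dominated n mu lam \<longleftrightarrow> exp_dom n ((!) mu) ((!) lam)"
proof -
  have len: "length mu = n" using assms by (simp add: is_partition_def)
  have "dominated n mu lam \<longleftrightarrow> (\<Sum>i<n. mu ! i) = (\<Sum>i<n. lam ! i) \<and>
      (\<forall>k\<in>{1..<n}. (\<Sum>i<k. mu ! i) \<le> (\<Sum>i<k. lam ! i))"
    unfolding dominated_def using len assms by (simp add: sum_list_nth_lessThan sum_list_take_nth)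
  also have "\<dots> \<longleftrightarrow> (\<Sum>i<n. mu ! i) = (\<Sum>i<n. lam ! i) \<and>
      (\<forall>k\<le>n. (\<Sum>i<k. mu ! i) \<le> (\<Sum>i<k. lam ! i))"
  proof (rule conj_cong[OF refl], intro iffI allI impI ballI)
    fix k assume *: "(\<Sum>i<n. mu ! i) = (\<Sum>i<n. lam ! i)" "\<forall>k\<in>{1..<n}. (\<Sum>i<k. mu ! i) \<le> (\<Sum>i<k. lam ! i)" "k \<le> n"
    then consider "k = 0" | "k = n" | "k \<in> {1..<n}" by force
    then show "(\<Sum>i<k. mu ! i) \<le> (\<Sum>i<k. lam ! i)" using * by cases auto
  qed auto
  also have "\<dots> \<longleftrightarrow> exp_dom n ((!) mu) ((!) lam)"
    using exp_dom_decr_iff[OF is_partition_decr[OF assms(1)]] by simp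
  finally show ?thesis .
qed

lemma dominated_antisym:
  assumes "is_partition n mu" "is_partition n lam" "dominated n mu lam" "dominated n lam mu"
  shows "mu = lam"
proof (rule nth_equalityI)
  show len: "length mu = length lam" using assms by (simp add: is_partition_def)
  have "(\<Sum>i<k. mu ! i) = (\<Sum>i<k. lam ! i)" if "k \<le> n" for k
  proof -
    have "exp_dom n ((!) mu) ((!) lam)" "exp_dom n ((!) lam) ((!) mu)"
      using assms dominated_iff_exp_dom by (auto simp: is_partition_def)
    then show ?thesis
      using that exp_dom_decr_iff[OF is_partition_decr[OF assms(1)]] exp_dom_decr_iff[OF is_partition_decr[OF assms(2)]]
      by (metis le_antisym)
  qed
  note eq = this
  fix i assume "i < length mu"
  then have "Suc i \<le> n" using assms by (simp add: is_partition_def)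
  then show "mu ! i = lam ! i" using eq[of i] eq[of "Suc i"] by simp
qed

lemma dominated_refl: "dominated n lam lam"
  by (simp add: dominated_def)

lemma dominated_trans: "dominated n a b \<Longrightarrow> dominated n b c \<Longrightarrow> dominated n a c"
  unfolding dominated_def by (metis order_trans)

lemma nth_expvec_eq_iff:
  assumes "length nu = n"
  shows "expvec n ((!) nu) = expvec n a \<longleftrightarrow> nu = map a [0..<n]"
  using assms by (auto simp: expvec_eq_iff list_eq_iff_nth_eq)

lemma finite_mset_eq: "finite {nu. mset nu = mset lam}"
proof (rule finite_subset)
  show "{nu. mset nu = mset lam} \<subseteq> {nu. set nu \<subseteq> set lam \<and> length nu = length lam}"
    using mset_eq_setD mset_eq_length by blast
qed (rule finite_lists_length_eq, simp)

lemma monomial_sym_eq: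
  "monomial_sym n lam = (\<Sum>nu | mset nu = mset lam. single (expvec n ((!) nu)) 1)"
  by (simp add: monomial_sym_def prod_var_power)

lemma lookup_monomial_sym:
  assumes "length lam = n"
  shows "lookup (monomial_sym n lam) (expvec n a) = (if mset (map a [0..<n]) = mset lam then 1 else 0)"
proof -
  have "lookup (monomial_sym n lam) (expvec n a) =
      (\<Sum>nu | mset nu = mset lam. if nu = map a [0..<n] then 1 else 0)"
    unfolding monomial_sym_eq lookup_sum lookup_single when_def
  proof (rule sum.cong[OF refl])
    fix nu assume "nu \<in> {nu. mset nu = mset lam}"
    then have "length nu = n" using assms mset_eq_length by auto
    then show "(if expvec n ((!) nu) = expvec n a then 1 else 0) = (if nu = map a [0..<n] then 1 else (0::complex))"
      by (simp add: nth_expvec_eq_iff)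
  qed
  also have "\<dots> = (if mset (map a [0..<n]) = mset lam then 1 else 0)"
    using finite_mset_eq[of lam] by (simp add: sum.delta')
  finally show ?thesis .
qed

lemma in_vars_monomial_sym [simp]: "in_vars n (monomial_sym n lam)"
  unfolding monomial_sym_eq by (intro in_vars_sum) simp

lemma mset_map_permutes:
  assumes "\<sigma> permutes {..<n}"
  shows "mset (map (\<lambda>i. a (\<sigma> i)) [0..<n]) = mset (map a [0..<n])"
proof -
  have "map (\<lambda>i. a (\<sigma> i)) [0..<n] = permute_list \<sigma> (map a [0..<n])"
    using permutes_in_image[OF assms] by (auto simp: permute_list_def intro!: map_cong)
  then show ?thesis using assms by simp
qed

lemma monomial_sym_sym: "length lam = n \<Longrightarrow> monomial_sym n lam \<in> sym_polys n"
  unfolding sym_polys_iff by (simp add: lookup_monomial_sym mset_map_permutes del: mset_map)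

lemma is_partition_unique:
  assumes "is_partition n mu" "is_partition n nu" "mset mu = mset nu"
  shows "mu = nu"
proof -
  have "sorted (rev mu)" "sorted (rev nu)"
    using assms by (auto simp: is_partition_def sorted_wrt_rev)
  then have "rev mu = rev nu"
    using assms(3) by (metis mset_rev properties_for_sort)
  then show ?thesis by simp
qed

lemma exists_partition:
  obtains mu where "is_partition n mu" "mset mu = mset (map a [0..<n])"
proof
  show "is_partition n (rev (sort (map a [0..<n])))"
    by (simp add: is_partition_def sorted_wrt_rev)
qed simp

lemma lookup_sym_mset:
  assumes "p \<in> sym_polys n" "mset (map a [0..<n]) = mset (map b [0..<n])"
  shows "lookup p (expvec n a) = lookup p (expvec n b)"
proof -
  obtain \<sigma> where \<sigma>: "\<sigma> permutes {..<length (map b [0..<n])}" "permute_list \<sigma> (map b [0..<n]) = map a [0..<n]"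
    using mset_eq_permutation[OF assms(2)] .
  then have s: "\<sigma> permutes {..<n}" by simp
  have "a i = b (\<sigma> i)" if "i < n" for i
  proof -
    have "a i = permute_list \<sigma> (map b [0..<n]) ! i" unfolding \<sigma>(2) using that by simp
    also have "\<dots> = b (\<sigma> i)"
      using permutes_in_image[OF s, of i] that by (simp add: permute_list_nth[OF \<sigma>(1)])
    finally show ?thesis .
  qed
  then have "expvec n a = expvec n (\<lambda>i. b (\<sigma> i))" by (simp add: expvec_eq_iff)
  then show ?thesis using assms(1) s by (simp add: sym_polys_iff)
qed

abbreviation coefp :: "nat \<Rightarrow> mpoly \<Rightarrow> nat list \<Rightarrow> complex" where
  "coefp n p mu \<equiv> lookup p (expvec n ((!) mu))"

lemma map_nth_length: "length mu = n \<Longrightarrow> map ((!) mu) [0..<n] = mu"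
  using map_nth by auto

lemma coefp_monomial_sym:
  assumes "is_partition n mu" "is_partition n nu"
  shows "coefp n (monomial_sym n nu) mu = (if mu = nu then 1 else 0)"
  using assms is_partition_unique[OF assms]
  by (auto simp: lookup_monomial_sym is_partition_def map_nth_length)

lemma sym_polys_eqI:
  assumes p: "p \<in> sym_polys n" and q: "q \<in> sym_polys n"
    and eq: "\<And>mu. is_partition n mu \<Longrightarrow> coefp n p mu = coefp n q mu"
  shows "p = q"
proof (rule in_vars_eqI[of n])
  fix a
  obtain mu where mu: "is_partition n mu" "mset mu = mset (map a [0..<n])"
    using exists_partition .
  then have "mset (map a [0..<n]) = mset (map ((!) mu) [0..<n])"
    by (simp add: is_partition_def map_nth_length)
  then show "lookup p (expvec n a) = lookup q (expvec n a)"
    using lookup_sym_mset[OF p, of a "(!) mu"] lookup_sym_mset[OF q, of a "(!) mu"] eq[OF mu(1)] by simp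
qed (use p q sym_polys_in_vars in auto)

lemma sym_expand:
  assumes p: "p \<in> sym_polys n" and S: "finite S" "\<And>mu. mu \<in> S \<Longrightarrow> is_partition n mu"
    and ne: "\<And>mu. is_partition n mu \<Longrightarrow> coefp n p mu \<noteq> 0 \<Longrightarrow> mu \<in> S"
  shows "p = (\<Sum>mu\<in>S. const (coefp n p mu) * monomial_sym n mu)"
proof (rule sym_polys_eqI[OF p])
  show "(\<Sum>mu\<in>S. const (coefp n p mu) * monomial_sym n mu) \<in> sym_polys n"
    using S by (intro sym_polys_sum sym_polys_mult sym_polys_const monomial_sym_sym) (auto simp: is_partition_def)
  fix mu assume mu: "is_partition n mu"
  have "coefp n (\<Sum>nu\<in>S. const (coefp n p nu) * monomial_sym n nu) mu = (\<Sum>nu\<in>S. if nu = mu then coefp n p nu else 0)"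
    unfolding lookup_sum using S mu by (intro sum.cong refl) (auto simp: coefp_monomial_sym)
  also have "\<dots> = coefp n p mu"
    using S ne[OF mu] by auto
  finally show "coefp n p mu = coefp n (\<Sum>nu\<in>S. const (coefp n p nu) * monomial_sym n nu) mu" ..
qed

definition Par :: "nat \<Rightarrow> nat \<Rightarrow> nat list set" where
  "Par n d = {mu. is_partition n mu \<and> sum_list mu = d}"

lemma finite_Par [simp]: "finite (Par n d)"
proof (rule finite_subset)
  show "Par n d \<subseteq> {xs. set xs \<subseteq> {..d} \<and> length xs = n}"
    using member_le_sum_list by (fastforce simp: Par_def is_partition_def)
qed (rule finite_lists_length_eq, simp)

definition lower :: "nat \<Rightarrow> nat list \<Rightarrow> nat list set" where
  "lower n lam = {mu. is_partition n mu \<and> dominated n mu lam}"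

lemma lower_subset: "lower n lam \<subseteq> Par n (sum_list lam)"
  by (auto simp: lower_def Par_def dominated_def)

lemma finite_lower [simp]: "finite (lower n lam)"
  using lower_subset finite_Par by (rule finite_subset)

text \<open>Every exponent of a symmetric polynomial is a rearrangement of a partition with the same
  coefficient, and \<open>exp_dom\<close> does not see rearrangements.\<close>

lemma supp_exp_dom_iff_lower:
  assumes p: "p \<in> sym_polys n" and lam: "length lam = n"
  shows "supp_exp_dom n ((!) lam) p \<longleftrightarrow> (\<forall>mu. is_partition n mu \<longrightarrow> coefp n p mu \<noteq> 0 \<longrightarrow> mu \<in> lower n lam)"
proof
  assume "supp_exp_dom n ((!) lam) p"
  then show "\<forall>mu. is_partition n mu \<longrightarrow> coefp n p mu \<noteq> 0 \<longrightarrow> mu \<in> lower n lam"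
    using lam by (auto simp: supp_exp_dom_def lower_def dominated_iff_exp_dom)
next
  assume *: "\<forall>mu. is_partition n mu \<longrightarrow> coefp n p mu \<noteq> 0 \<longrightarrow> mu \<in> lower n lam"
  show "supp_exp_dom n ((!) lam) p"
    unfolding supp_exp_dom_def
  proof (intro allI impI)
    fix a assume a: "lookup p (expvec n a) \<noteq> 0"
    obtain mu where mu: "is_partition n mu" "mset mu = mset (map a [0..<n])"
      using exists_partition .
    then have ms: "mset (map a [0..<n]) = mset (map ((!) mu) [0..<n])"
      by (simp add: is_partition_def map_nth_length)
    then have "mu \<in> lower n lam"
      using * mu(1) a lookup_sym_mset[OF p ms] by auto
    then have d: "exp_dom n ((!) mu) ((!) lam)" using lam dominated_iff_exp_dom[of n mu lam] by (simp add: lower_def)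
    obtain \<sigma> where \<sigma>: "\<sigma> permutes {..<length mu}" "permute_list \<sigma> mu = map a [0..<n]"
      using mset_eq_permutation[OF mu(2)[symmetric]] .
    have len: "length mu = n" using mu by (simp add: is_partition_def)
    have "a i = mu ! \<sigma> i" if "i < n" for i
      using permute_list_nth[OF \<sigma>(1), of i] that len unfolding \<sigma>(2) by simp
    then show "exp_dom n a ((!) lam)"
      using exp_dom_cong[of n a "\<lambda>i. mu ! \<sigma> i"] exp_dom_permute[OF _ d, of \<sigma>] \<sigma>(1) len by simp
  qed
qed

section \<open>Eigenvalues of \<open>D\<close>\<close>

definition D_eval :: "nat \<Rightarrow> real \<Rightarrow> nat list \<Rightarrow> complex \<Rightarrow> complex" where
  "D_eval n g lam u = (\<Prod>i<n. of_nat (lam ! i) + of_real (real (n - 1 - i) * g) + u)"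

lemma D_coef_id: "D_coef n g u ((!) lam) id = D_eval n g lam u"
  by (simp add: D_coef_def D_eval_def)

definition D_eval_poly :: "nat \<Rightarrow> real \<Rightarrow> nat list \<Rightarrow> complex poly" where
  "D_eval_poly n g lam = (\<Prod>i<n. [: of_nat (lam ! i) + of_real (real (n - 1 - i) * g), 1:])"

lemma poly_D_eval_poly: "poly (D_eval_poly n g lam) u = D_eval n g lam u"
  by (simp add: D_eval_poly_def D_eval_def poly_prod)

text \<open>For \<open>g > 0\<close> the negated roots \<open>lam ! i + (n - 1 - i) * g\<close>
  decrease strictly in \<open>i\<close>, so the set of roots already determines them in their
  order.\<close>

lemma D_eval_poly_inj:
  assumes "g > 0" "is_partition n mu" "is_partition n nu" "D_eval_poly n g mu = D_eval_poly n g nu"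
  shows "mu = nu"
proof -
  define c where "c l i = real (l ! i) + real (n - 1 - i) * g" for l :: "nat list" and i
  have root: "poly (D_eval_poly n g l) (- of_real r) = 0 \<longleftrightarrow> r \<in> c l ` {..<n}" for l r
  proof -
    have "of_nat (l ! i) + of_real (real (n - 1 - i) * g) + - of_real r = (of_real (c l i - r) :: complex)" for i
      by (simp add: c_def)
    then have "poly (D_eval_poly n g l) (- of_real r) = (\<Prod>i<n. of_real (c l i - r))"
      unfolding poly_D_eval_poly D_eval_def by (simp only:)
    also have "\<dots> = 0 \<longleftrightarrow> (\<exists>i<n. c l i - r = 0)"
      by (simp only: prod_zero_iff finite_lessThan of_real_eq_0_iff lessThan_iff Bex_def)
    finally show ?thesis by (auto simp: image_iff)
  qed
  have mono: "sorted_wrt (>) (map (c l) [0..<n])" if "is_partition n l" for l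
    unfolding sorted_wrt_iff_nth_less
  proof (intro allI impI)
    fix i j assume "i < j" "j < length (map (c l) [0..<n])"
    then have ij: "i < j" "j < n" by auto
    have "l ! j \<le> l ! i" using is_partition_decr[OF that] ij by (auto simp: decr_def)
    moreover have "real (n - 1 - j) * g < real (n - 1 - i) * g"
      using ij assms(1) by (intro mult_strict_right_mono) auto
    ultimately show "map (c l) [0..<n] ! j < map (c l) [0..<n] ! i"
      using ij by (simp add: c_def)
  qed
  have "c mu ` {..<n} = c nu ` {..<n}"
    using root[of mu] root[of nu] assms(4) by auto
  then have "set (map (c mu) [0..<n]) = set (map (c nu) [0..<n])"
    by (simp add: lessThan_atLeast0)
  then have "rev (map (c mu) [0..<n]) = rev (map (c nu) [0..<n])"
    using mono[OF assms(2)] mono[OF assms(3)]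
    by (intro strict_sorted_equal) (auto simp: sorted_wrt_rev)
  then have "map (c mu) [0..<n] = map (c nu) [0..<n]" by simp
  then have "c mu i = c nu i" if "i < n" for i
    using that by simp
  then show ?thesis
    using assms by (intro nth_equalityI) (auto simp: c_def is_partition_def)
qed

lemma D_eval_inj:
  assumes "g > 0" "is_partition n mu" "is_partition n nu" "infinite U"
    "\<And>u. u \<in> U \<Longrightarrow> D_eval n g mu u = D_eval n g nu u"
  shows "mu = nu"
proof (rule D_eval_poly_inj[OF assms(1-3)])
  have "U \<subseteq> {u. poly (D_eval_poly n g mu - D_eval_poly n g nu) u = 0}"
    using assms(5) by (auto simp: poly_D_eval_poly)
  then have "D_eval_poly n g mu - D_eval_poly n g nu = 0"
    using poly_roots_finite finite_subset assms(4) by blast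
  then show "D_eval_poly n g mu = D_eval_poly n g nu" by simp
qed

text \<open>Two distinct partitions share their eigenvalue only at the finitely many roots of a
  nonzero polynomial. A real \<open>u0\<close> is chosen so that the eigenbasis built from it is
  real.\<close>

lemma D_eval_separating:
  assumes "g > 0"
  obtains u0 :: real where "inj_on (\<lambda>mu. D_eval n g mu (of_real u0)) (Par n d)"
proof -
  let ?B = "\<Union>mu\<in>Par n d. \<Union>nu\<in>Par n d - {mu}. {u. poly (D_eval_poly n g mu - D_eval_poly n g nu) u = 0}"
  have "finite ?B"
  proof (intro finite_UN_I finite_Par finite_Diff)
    fix mu nu assume "mu \<in> Par n d" "nu \<in> Par n d - {mu}"
    then have "D_eval_poly n g mu - D_eval_poly n g nu \<noteq> 0"
      using D_eval_poly_inj[OF assms, of n mu nu] by (auto simp: Par_def)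
    then show "finite {u. poly (D_eval_poly n g mu - D_eval_poly n g nu) u = 0}"
      by (rule poly_roots_finite)
  qed
  then have "finite (complex_of_real -` ?B)"
    by (rule finite_vimageI) (simp add: inj_def)
  then obtain u0 where "u0 \<notin> complex_of_real -` ?B"
    using ex_new_if_finite[OF infinite_UNIV_char_0] by blast
  then have ne: "poly (D_eval_poly n g mu - D_eval_poly n g nu) (of_real u0) \<noteq> 0"
    if "mu \<in> Par n d" "nu \<in> Par n d" "mu \<noteq> nu" for mu nu
    using that by blast
  show ?thesis
  proof (rule that[of u0], rule inj_onI, rule ccontr)
    fix mu nu assume "mu \<in> Par n d" "nu \<in> Par n d" "mu \<noteq> nu"
      and eq: "D_eval n g mu (of_real u0) = D_eval n g nu (of_real u0)"
    from ne[OF this(1-3)] eq show False by (simp add: poly_D_eval_poly)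
  qed
qed

section \<open>Symmetry of the determinant of the Cauchy kernel\<close>

lemma sum_coeff_reversed:
  assumes "degree p < n"
  shows "(\<Sum>j<n. coeff p (n - 1 - j) * (f (n - 1 - j) :: 'a::comm_ring_1)) = (\<Sum>k\<le>degree p. coeff p k * f k)"
proof -
  have "(\<Sum>j<n. coeff p (n - 1 - j) * f (n - 1 - j)) = (\<Sum>k<n. coeff p k * f k)"
    by (rule sum.reindex_bij_witness[of _ "\<lambda>k. n - 1 - k" "\<lambda>j. n - 1 - j"]) auto
  also have "\<dots> = (\<Sum>k\<le>degree p. coeff p k * f k)"
    using assms by (intro sum.mono_neutral_right) (auto simp: coeff_eq_0)
  finally show ?thesis .
qed

lemma poly_pderiv_sum: "x * poly (pderiv p) x = (\<Sum>k\<le>degree p. coeff p k * (of_nat k * x ^ k))"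
  for x :: "'a::{comm_ring_1, ring_no_zero_divisors}"
proof -
  have "x * poly (pderiv p) x = (\<Sum>k<degree p. of_nat (Suc k) * coeff p (Suc k) * x ^ Suc k)"
  proof -
    have "poly (pderiv p) x = (\<Sum>k<degree p. coeff (pderiv p) k * x ^ k)"
    proof (cases "degree p = 0")
      case True
      then have "pderiv p = 0" by (metis degree_eq_zeroE pderiv_singleton pderiv_0 pCons_0_0 pderiv_pCons add_0 mult_zero_right)
      then show ?thesis using True by simp
    next
      case False
      have "degree (pderiv p) \<le> degree p - 1" by (rule degree_le) (auto simp: coeff_pderiv coeff_eq_0)
      then have "(\<Sum>k\<le>degree (pderiv p). coeff (pderiv p) k * x ^ k) = (\<Sum>k<degree p. coeff (pderiv p) k * x ^ k)"
        using False by (intro sum.mono_neutral_left) (auto simp: coeff_eq_0)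
      then show ?thesis by (simp add: poly_altdef)
    qed
    then show ?thesis by (simp add: sum_distrib_left coeff_pderiv algebra_simps)
  qed
  also have "\<dots> = (\<Sum>k<Suc (degree p). coeff p k * (of_nat k * x ^ k))"
    unfolding sum.lessThan_Suc_shift by (simp add: algebra_simps)
  finally show ?thesis by (simp add: lessThan_Suc_atMost)
qed

text \<open>The reversal of the polynomial \<open>\<Prod>m. 1 - y m X\<close> is
  \<open>\<Prod>m. Y - y m\<close>; its zeros at the nodes will make a product of matrices
  diagonal.\<close>

lemma reversed_eval_prod:
  fixes y :: "nat \<Rightarrow> 'a::idom"
  assumes "finite S"
  shows "(\<Sum>k\<le>card S. coeff (\<Prod>m\<in>S. [:1, - y m:]) k * Y ^ (card S - k)) = (\<Prod>m\<in>S. Y - y m)"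
  using assms
proof (induction S rule: finite_induct)
  case (insert c S)
  let ?p = "\<Prod>m\<in>S. [:1, - y m:]" and ?d = "card S"
  have deg: "degree ?p \<le> ?d"
    using degree_prod_sum_le[OF insert(1), of "\<lambda>m. [:1, - y m:]"]
      sum_bounded_above[of S "\<lambda>m. degree [:1, - y m:]" 1] by (simp add: degree_pCons_le order_trans)
  have "[:1, - y c:] * ?p = ?p + Polynomial.smult (- y c) (pCons 0 ?p)" by simp
  then have "coeff ([:1, - y c:] * ?p) k = coeff ?p k - y c * coeff (pCons 0 ?p) k" for k
    by (simp only: coeff_add coeff_smult mult_minus_left diff_conv_add_uminus)
  then have "(\<Sum>k\<le>Suc ?d. coeff ([:1, - y c:] * ?p) k * Y ^ (Suc ?d - k)) =
     (\<Sum>k\<le>Suc ?d. coeff ?p k * Y ^ (Suc ?d - k)) - y c * (\<Sum>k\<le>Suc ?d. coeff (pCons 0 ?p) k * Y ^ (Suc ?d - k))"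
    by (simp only: left_diff_distrib sum_subtractf sum_distrib_left mult.assoc)
  also have "(\<Sum>k\<le>Suc ?d. coeff ?p k * Y ^ (Suc ?d - k)) = Y * (\<Sum>k\<le>?d. coeff ?p k * Y ^ (?d - k))"
    using deg by (simp add: coeff_eq_0 sum_distrib_left Suc_diff_le mult_ac)
  also have "(\<Sum>k\<le>Suc ?d. coeff (pCons 0 ?p) k * Y ^ (Suc ?d - k)) = (\<Sum>k\<le>?d. coeff ?p k * Y ^ (?d - k))"
    by (subst sum.atMost_Suc_shift) simp
  finally show ?case
    using insert by (simp add: algebra_simps)
qed simp

context
  fixes n :: nat and y :: "nat \<Rightarrow> 'a::idom"
begin

text \<open>The matrix of coefficients of the polynomials \<open>npoly l\<close> carries the determinant of \<open>D\<close> on the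
  Cauchy kernel into a determinant that is symmetric in \<open>x\<close> and \<open>y\<close>; its own determinant is a
  Vandermonde product.\<close>

private definition "npoly l = (\<Prod>m\<in>{..<n} - {l}. [:1, - y m:])"

private lemma degree_npoly: "l < n \<Longrightarrow> degree (npoly l) < n"
proof -
  assume l: "l < n"
  have "degree (npoly l) \<le> (\<Sum>m\<in>{..<n} - {l}. degree [:1, - y m:])"
    unfolding npoly_def using degree_prod_sum_le[of "{..<n} - {l}" "\<lambda>m. [:1, - y m:]"] by (simp add: o_def)
  also have "\<dots> \<le> card ({..<n} - {l}) * 1"
    by (rule order_trans[OF sum_bounded_above[of _ _ 1]]) (auto simp: degree_pCons_le)
  finally show ?thesis using l by simp
qed

text \<open>With \<open>v k\<close> for \<open>1 / (1 - x * y k)\<close>, the left side evaluates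
  \<open>npoly l\<close> and its Euler derivative at \<open>x\<close>. The product of all
  \<open>v k\<close> times \<open>npoly l\<close> leaves \<open>v l\<close>, and the logarithmic
  derivative of \<open>npoly l\<close> cancels every summand of the sum over \<open>k\<close> except
  the one for \<open>l\<close>.\<close>

private lemma step_row:
  fixes x u :: 'a and v :: "nat \<Rightarrow> 'a"
  assumes v: "\<And>k. k < n \<Longrightarrow> v k * (1 - x * y k) = 1" and l: "l < n"
  shows "(\<Sum>j<n. (x ^ (n - 1 - j) * (of_nat (n - 1 - j) + u + (\<Sum>k<n. x * y k * v k)) * (\<Prod>k<n. v k)) * coeff (npoly l) (n - 1 - j)) =
    v l * (u + x * y l * v l)"
proof -
  let ?\<Phi> = "\<Prod>k<n. v k" and ?S = "\<Sum>k<n. x * y k * v k"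
  have rem: "?\<Phi> = v l * (\<Prod>k\<in>{..<n} - {l}. v k)" using l by (simp add: prod.remove)
  have ev: "?\<Phi> * poly (npoly l) x = v l"
  proof -
    have "(\<Prod>k\<in>{..<n} - {l}. v k) * poly (npoly l) x = (\<Prod>k\<in>{..<n} - {l}. v k * (1 - x * y k))"
      by (simp add: npoly_def poly_prod prod.distrib)
    also have "\<dots> = 1" using v by (intro prod.neutral) auto
    finally show ?thesis by (simp add: rem mult.assoc)
  qed
  have der: "?\<Phi> * (x * poly (pderiv (npoly l)) x) = - v l * (\<Sum>m\<in>{..<n} - {l}. x * y m * v m)"
  proof -
    have "poly (pderiv (npoly l)) x = (\<Sum>m\<in>{..<n} - {l}. (\<Prod>k\<in>{..<n} - {l} - {m}. 1 - x * y k) * (- y m))"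
      by (simp add: npoly_def pderiv_prod poly_sum poly_prod pderiv_pCons mult.commute)
    then have "?\<Phi> * (x * poly (pderiv (npoly l)) x) =
        (\<Sum>m\<in>{..<n} - {l}. ?\<Phi> * (x * ((\<Prod>k\<in>{..<n} - {l} - {m}. 1 - x * y k) * (- y m))))"
      by (simp only: sum_distrib_left)
    also have "\<dots> = (\<Sum>m\<in>{..<n} - {l}. - v l * (x * y m * v m))"
    proof (rule sum.cong[OF refl])
      fix m assume m: "m \<in> {..<n} - {l}"
      have "(\<Prod>k\<in>{..<n} - {l}. v k) = v m * (\<Prod>k\<in>{..<n} - {l} - {m}. v k)"
        using m by (intro prod.remove) auto
      moreover have "(\<Prod>k\<in>{..<n} - {l} - {m}. v k) * (\<Prod>k\<in>{..<n} - {l} - {m}. 1 - x * y k) = 1"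
        unfolding prod.distrib[symmetric] using v by (intro prod.neutral) auto
      ultimately have "?\<Phi> * (\<Prod>k\<in>{..<n} - {l} - {m}. 1 - x * y k) = v l * v m"
        unfolding rem by (simp add: mult.assoc)
      then show "?\<Phi> * (x * ((\<Prod>k\<in>{..<n} - {l} - {m}. 1 - x * y k) * (- y m))) = - v l * (x * y m * v m)"
        by (metis (no_types, lifting) mult.assoc mult.commute mult_minus_left)
    qed
    finally show ?thesis by (simp only: sum_distrib_left)
  qed
  have "(\<Sum>j<n. (x ^ (n - 1 - j) * (of_nat (n - 1 - j) + u + ?S) * ?\<Phi>) * coeff (npoly l) (n - 1 - j)) =
    (\<Sum>j<n. coeff (npoly l) (n - 1 - j) * ((\<lambda>k. x ^ k * (of_nat k + u + ?S) * ?\<Phi>) (n - 1 - j)))"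
    by (simp add: mult_ac)
  also have "\<dots> = (\<Sum>k\<le>degree (npoly l). coeff (npoly l) k * (x ^ k * (of_nat k + u + ?S) * ?\<Phi>))"
    using sum_coeff_reversed[OF degree_npoly[OF l], of "\<lambda>k. x ^ k * (of_nat k + u + ?S) * ?\<Phi>"] by simp
  also have "\<dots> = ?\<Phi> * (\<Sum>k\<le>degree (npoly l). coeff (npoly l) k * (of_nat k * x ^ k)) +
      (u + ?S) * (?\<Phi> * (\<Sum>k\<le>degree (npoly l). coeff (npoly l) k * x ^ k))"
    unfolding sum_distrib_left sum.distrib[symmetric] by (intro sum.cong refl) (simp add: algebra_simps)
  also have "\<dots> = ?\<Phi> * (x * poly (pderiv (npoly l)) x) + (u + ?S) * (?\<Phi> * poly (npoly l) x)"
    by (simp only: poly_pderiv_sum[symmetric] poly_altdef[of "npoly l" x])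
  also have "\<dots> = v l * (u + (?S - (\<Sum>m\<in>{..<n} - {l}. x * y m * v m)))"
    unfolding ev der by (simp add: algebra_simps)
  also have "?S - (\<Sum>m\<in>{..<n} - {l}. x * y m * v m) = x * y l * v l"
    using l by (subst sum.remove[of _ l]) auto
  finally show ?thesis .
qed

private definition "detN = ddet n (\<lambda>j l. coeff (npoly l) (n - 1 - j))"

private lemma det_step:
  fixes x :: "nat \<Rightarrow> 'a" and u :: 'a and v :: "nat \<Rightarrow> nat \<Rightarrow> 'a"
  assumes v: "\<And>i k. i < n \<Longrightarrow> k < n \<Longrightarrow> v i k * (1 - x i * y k) = 1"
  shows "(\<Prod>i<n. \<Prod>k<n. v i k) *
      ddet n (\<lambda>i j. x i ^ (n - 1 - j) * (of_nat (n - 1 - j) + u + (\<Sum>k<n. x i * y k * v i k))) * detN =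
    ddet n (\<lambda>i l. v i l * (u + x i * y l * v i l))"
proof -
  have "ddet n (\<lambda>i l. v i l * (u + x i * y l * v i l)) =
    ddet n (\<lambda>i l. \<Sum>j<n. (x i ^ (n - 1 - j) * (of_nat (n - 1 - j) + u + (\<Sum>k<n. x i * y k * v i k)) * (\<Prod>k<n. v i k)) *
      coeff (npoly l) (n - 1 - j))"
    by (rule ddet_cong) (simp only: step_row[OF v])
  also have "\<dots> = ddet n (\<lambda>i j. (\<Prod>k<n. v i k) * (x i ^ (n - 1 - j) * (of_nat (n - 1 - j) + u + (\<Sum>k<n. x i * y k * v i k)))) * detN"
    unfolding ddet_mult detN_def by (simp only: mult.commute)
  finally show ?thesis by (simp only: ddet_scale_rows mult.assoc)
qed

private lemma prod_prod_minus:
  "(\<Prod>l<n. \<Prod>m\<in>{..<n} - {l}. y l - y m) = (-1) ^ (n * (n - 1) div 2) * (vandermonde n y * vandermonde n y)"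
proof (induction n)
  case (Suc N)
  have "(\<Prod>l<Suc N. \<Prod>m\<in>{..<Suc N} - {l}. y l - y m) = (\<Prod>l<N. (y l - y N) * (\<Prod>m\<in>{..<N} - {l}. y l - y m)) * (\<Prod>m<N. y N - y m)"
  proof -
    have "{..<Suc N} - {l} = insert N ({..<N} - {l})" if "l < N" for l using that by auto
    moreover have "{..<Suc N} - {N} = {..<N}" by auto
    ultimately show ?thesis by simp
  qed
  also have "\<dots> = (\<Prod>l<N. y l - y N) * ((-1) ^ (N * (N - 1) div 2) * (vandermonde N y * vandermonde N y)) * (\<Prod>m<N. y N - y m)"
    by (simp only: prod.distrib Suc)
  also have "\<dots> = (-1) ^ (N + N * (N - 1) div 2) * (vandermonde (Suc N) y * vandermonde (Suc N) y)"
    by (simp only: prod_minus_swap vandermonde_Suc power_add mult_ac)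
  also have "N + N * (N - 1) div 2 = Suc N * (Suc N - 1) div 2"
    by (cases N) (auto simp: algebra_simps)
  finally show ?case .
qed (simp add: vandermonde_def)

text \<open>Multiplied by the matrix of powers of \<open>y\<close>, the coefficient matrix becomes
  diagonal with entries \<open>\<Prod>m\<noteq>l. y l - y m\<close>. Their product is, up to sign,
  the square of the Vandermonde product, of which one factor cancels. The sign of the
  order-reversing permutation comes from ascending against descending powers; it stays unevaluated,
  being the same for \<open>x\<close> and \<open>y\<close>.\<close>

private lemma detN_eq:
  assumes "vandermonde n y \<noteq> 0"
  shows "of_int (sign (\<lambda>j. if j < n then n - 1 - j else j)) * detN = vandermonde n y"
proof -
  let ?r = "\<lambda>j. if j < n then n - 1 - j else j"
  have r: "?r permutes {..<n}"
    by (rule bij_imp_permutes) (auto intro!: bij_betw_byWitness[of _ ?r])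
  have "ddet n (\<lambda>k l. \<Sum>j<n. y k ^ j * coeff (npoly l) (n - 1 - j)) = ddet n (\<lambda>k l. if k = l then (\<Prod>m\<in>{..<n} - {l}. y l - y m) else 0)"
  proof (rule ddet_cong)
    fix k l assume kl: "k < n" "l < n"
    have card: "card ({..<n} - {l}) = n - 1" using kl by simp
    have "(\<Sum>j<n. y k ^ j * coeff (npoly l) (n - 1 - j)) = (\<Sum>i<n. coeff (npoly l) i * y k ^ (n - 1 - i))"
      by (rule sum.reindex_bij_witness[of _ "\<lambda>k. n - 1 - k" "\<lambda>j. n - 1 - j"]) (auto simp: mult_ac)
    also have "\<dots> = (\<Sum>i\<le>n - 1. coeff (npoly l) i * y k ^ (n - 1 - i))"
      using kl by (intro sum.cong) auto
    also have "\<dots> = (\<Prod>m\<in>{..<n} - {l}. y k - y m)"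
      using reversed_eval_prod[of "{..<n} - {l}" y "y k"] unfolding card npoly_def by simp
    also have "\<dots> = (if k = l then (\<Prod>m\<in>{..<n} - {l}. y l - y m) else 0)"
      using kl by (auto intro!: prod_zero)
    finally show "(\<Sum>j<n. y k ^ j * coeff (npoly l) (n - 1 - j)) = (if k = l then (\<Prod>m\<in>{..<n} - {l}. y l - y m) else 0)" .
  qed
  also have "\<dots> = (\<Prod>l<n. \<Prod>m\<in>{..<n} - {l}. y l - y m)"
    by (subst ddet_diag) auto
  finally have 1: "ddet n (\<lambda>k j. y k ^ j) * detN = (-1) ^ (n * (n - 1) div 2) * (vandermonde n y * vandermonde n y)"
    unfolding ddet_mult prod_prod_minus detN_def .
  have "ddet n (\<lambda>k j. y k ^ j) = ddet n (\<lambda>k j. y k ^ (n - 1 - ?r j))"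
    by (rule ddet_cong) auto
  also have "\<dots> = of_int (sign ?r) * ddet n (\<lambda>k j. y k ^ (n - 1 - j))"
    using ddet_permute_rows[OF r, of "\<lambda>j k. y k ^ (n - 1 - j)"]
      ddet_transpose[of n "\<lambda>k j. y k ^ (n - 1 - ?r j)"] ddet_transpose[of n "\<lambda>k j. y k ^ (n - 1 - j)"] by simp
  finally have 2: "ddet n (\<lambda>k j. y k ^ j) = of_int (sign ?r) * ((-1) ^ (n * (n - 1) div 2) * vandermonde n y)"
    unfolding vandermonde_ddet .
  have "((-1) ^ (n * (n - 1) div 2) * vandermonde n y) * (of_int (sign ?r) * detN) =
      ((-1) ^ (n * (n - 1) div 2) * vandermonde n y) * vandermonde n y"
    using 1 unfolding 2 by (simp only: mult_ac)
  then show ?thesis using assms by simp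
qed

lemma ddet_kernel_eq:
  fixes x :: "nat \<Rightarrow> 'a" and u :: 'a and v :: "nat \<Rightarrow> nat \<Rightarrow> 'a"
  assumes v: "\<And>i k. i < n \<Longrightarrow> k < n \<Longrightarrow> v i k * (1 - x i * y k) = 1" and y: "vandermonde n y \<noteq> 0"
  shows "(\<Prod>i<n. \<Prod>k<n. v i k) *
      (ddet n (\<lambda>i j. x i ^ (n - 1 - j) * (of_nat (n - 1 - j) + u + (\<Sum>k<n. x i * y k * v i k))) * vandermonde n y) =
    of_int (sign (\<lambda>j. if j < n then n - 1 - j else j)) * ddet n (\<lambda>i l. v i l * (u + x i * y l * v i l))"
proof -
  have *: "(\<Prod>i<n. \<Prod>k<n. v i k) *
      ddet n (\<lambda>i j. x i ^ (n - 1 - j) * (of_nat (n - 1 - j) + u + (\<Sum>k<n. x i * y k * v i k))) * detN =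
    ddet n (\<lambda>i l. v i l * (u + x i * y l * v i l))"
    by (rule det_step) (rule v)
  show ?thesis
    unfolding detN_eq[OF y, symmetric] *[symmetric] by (simp only: mult_ac)
qed

end

text \<open>After multiplication by all \<open>v i k\<close>, both sides are the same sign times the
  determinant of \<open>v i l * (u + x i * y l * v i l)\<close>, and exchanging \<open>x\<close> and
  \<open>y\<close> transposes this matrix. Inverses enter as given elements \<open>v\<close> because
  the identity is applied to power series, which do not form a field.\<close>

theorem ddet_kernel_symmetric:
  fixes x y :: "nat \<Rightarrow> 'a::idom" and u :: 'a and v :: "nat \<Rightarrow> nat \<Rightarrow> 'a"
  assumes v: "\<And>i k. i < n \<Longrightarrow> k < n \<Longrightarrow> v i k * (1 - x i * y k) = 1"
    and x: "vandermonde n x \<noteq> 0" and y: "vandermonde n y \<noteq> 0"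
  shows "ddet n (\<lambda>i j. x i ^ (n - 1 - j) * (of_nat (n - 1 - j) + u + (\<Sum>k<n. x i * y k * v i k))) * vandermonde n y =
    ddet n (\<lambda>i j. y i ^ (n - 1 - j) * (of_nat (n - 1 - j) + u + (\<Sum>k<n. y i * x k * v k i))) * vandermonde n x"
    (is "?L = ?R")
proof -
  have nz: "(\<Prod>i<n. \<Prod>k<n. v i k) \<noteq> 0"
    using v by (fastforce simp: prod_zero_iff)
  have "(\<Prod>i<n. \<Prod>k<n. v i k) * ?L = of_int (sign (\<lambda>j. if j < n then n - 1 - j else j)) * ddet n (\<lambda>i l. v i l * (u + x i * y l * v i l))"
    by (rule ddet_kernel_eq[OF v y])
  also have "ddet n (\<lambda>i l. v i l * (u + x i * y l * v i l)) = ddet n (\<lambda>i l. v l i * (u + y i * x l * v l i))"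
    by (subst ddet_transpose[symmetric]) (simp only: mult_ac)
  also have "of_int (sign (\<lambda>j. if j < n then n - 1 - j else j)) * \<dots> = (\<Prod>i<n. \<Prod>k<n. v k i) * ?R"
    by (rule ddet_kernel_eq[symmetric, OF _ x]) (use v in \<open>simp add: mult.commute\<close>)
  also have "(\<Prod>i<n. \<Prod>k<n. v k i) = (\<Prod>i<n. \<Prod>k<n. v i k)"
    by (rule prod.swap)
  finally show ?thesis using nz by simp
qed

section \<open>Products of binomial series\<close>

text \<open>The series of \<open>(1 - c X) powr (- a)\<close>.\<close>

definition bser :: "complex \<Rightarrow> complex \<Rightarrow> complex fps" where
  "bser a c = Abs_fps (\<lambda>k. pochhammer a k / fact k * c ^ k)"

definition geo :: "complex \<Rightarrow> complex fps" where
  "geo c = Abs_fps (\<lambda>k. c ^ k)"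

definition theta :: "complex fps \<Rightarrow> complex fps" where
  "theta f = fps_X * fps_deriv f"

definition dil :: "complex \<Rightarrow> complex fps \<Rightarrow> complex fps" where
  "dil c f = Abs_fps (\<lambda>k. fps_nth f k * c ^ k)"

lemma theta_nth [simp]: "fps_nth (theta f) k = of_nat k * fps_nth f k"
  by (cases k) (auto simp: theta_def fps_X_mult_nth)

lemma dil_nth [simp]: "fps_nth (dil c f) k = fps_nth f k * c ^ k"
  by (simp add: dil_def)

lemma dil_mult: "dil c (f * g) = dil c f * dil c g"
proof (rule fps_ext)
  fix k
  have eq: "fps_nth f i * c ^ i * (fps_nth g (k - i) * c ^ (k - i)) = fps_nth f i * fps_nth g (k - i) * c ^ k" if "i \<in> {0..k}" for i
  proof -
    have "c ^ i * c ^ (k - i) = c ^ k" using that by (simp flip: power_add)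
    then show ?thesis by (metis (no_types, lifting) mult.assoc mult.commute)
  qed
  show "fps_nth (dil c (f * g)) k = fps_nth (dil c f * dil c g) k"
    unfolding dil_nth fps_mult_nth sum_distrib_right by (rule sum.cong[OF refl], rule eq[symmetric])
qed

lemma dil_one: "dil c 1 = 1"
  by (rule fps_ext) (simp add: fps_one_nth)

lemma dil_prod: "dil c (prod f A) = (\<Prod>a\<in>A. dil c (f a))"
  by (induction A rule: infinite_finite_induct) (auto simp: dil_mult dil_one)

lemma dil_bser: "dil x (bser a c) = bser a (x * c)"
  by (rule fps_ext) (simp add: bser_def power_mult_distrib mult_ac)

lemma theta_mult: "theta (f * g) = theta f * g + f * theta g"
  by (simp add: theta_def algebra_simps)

lemma theta_one [simp]: "theta 1 = 0"
  by (simp add: theta_def)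

lemma geo_inverse: "geo c * (1 - fps_const c * fps_X) = 1"
proof (rule fps_ext)
  fix k
  have "geo c * (1 - fps_const c * fps_X) = geo c - fps_const c * (fps_X * geo c)"
    by (simp add: algebra_simps)
  then show "fps_nth (geo c * (1 - fps_const c * fps_X)) k = fps_nth 1 k"
    by (cases k) (auto simp: geo_def)
qed

lemma theta_bser: "theta (bser a c) = fps_const (a * c) * fps_X * geo c * bser a c"
proof -
  have "(1 - fps_const c * fps_X) * theta (bser a c) = fps_const (a * c) * fps_X * bser a c"
  proof (rule fps_ext)
    fix k
    show "fps_nth ((1 - fps_const c * fps_X) * theta (bser a c)) k = fps_nth (fps_const (a * c) * fps_X * bser a c) k"
    proof (cases k)
      case (Suc m)
      have "fps_nth ((1 - fps_const c * fps_X) * theta (bser a c)) (Suc m) =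
          of_nat (Suc m) * fps_nth (bser a c) (Suc m) - c * (of_nat m * fps_nth (bser a c) m)"
        by (simp add: left_diff_distrib mult.assoc fps_X_mult_nth)
      also have "of_nat (Suc m) * fps_nth (bser a c) (Suc m) = (a + of_nat m) * c * fps_nth (bser a c) m"
        by (simp add: bser_def pochhammer_Suc field_simps del: of_nat_Suc)
      finally show ?thesis
        using Suc by (simp add: mult.assoc fps_X_mult_nth) (simp add: algebra_simps)
    qed (simp add: mult.assoc left_diff_distrib fps_X_mult_nth)
  qed
  then have "geo c * (1 - fps_const c * fps_X) * theta (bser a c) = fps_const (a * c) * fps_X * geo c * bser a c"
    by (simp only: mult_ac)
  then show ?thesis by (simp only: geo_inverse mult_1)
qed

lemma geo_bser: "geo c * bser a c = bser (a + 1) c"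
proof -
  have "(1 - fps_const c * fps_X) * bser (a + 1) c = bser a c"
  proof (rule fps_ext)
    fix k
    show "fps_nth ((1 - fps_const c * fps_X) * bser (a + 1) c) k = fps_nth (bser a c) k"
    proof (cases k)
      case (Suc m)
      have "fps_nth ((1 - fps_const c * fps_X) * bser (a + 1) c) (Suc m) = fps_nth (bser (a + 1) c) (Suc m) - c * fps_nth (bser (a + 1) c) m"
        by (simp add: left_diff_distrib mult.assoc fps_X_mult_nth)
      also have "fps_nth (bser (a + 1) c) (Suc m) = (a + 1 + of_nat m) / of_nat (Suc m) * (pochhammer (a + 1) m / fact m * c ^ Suc m)"
        by (simp add: bser_def pochhammer_Suc field_simps del: of_nat_Suc)
      also have "c * fps_nth (bser (a + 1) c) m = of_nat (Suc m) / of_nat (Suc m) * (pochhammer (a + 1) m / fact m * c ^ Suc m)"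
        by (simp add: bser_def del: of_nat_Suc)
      also have "(a + 1 + of_nat m) / of_nat (Suc m) * (pochhammer (a + 1) m / fact m * c ^ Suc m) - \<dots> =
          a / of_nat (Suc m) * (pochhammer (a + 1) m / fact m * c ^ Suc m)"
        unfolding left_diff_distrib[symmetric] diff_divide_distrib[symmetric] by simp
      also have "\<dots> = fps_nth (bser a c) (Suc m)"
        by (simp add: bser_def pochhammer_rec field_simps del: of_nat_Suc)
      finally show ?thesis using Suc by simp
    qed (simp add: bser_def mult.assoc left_diff_distrib fps_X_mult_nth)
  qed
  then have "geo c * (1 - fps_const c * fps_X) * bser (a + 1) c = geo c * bser a c"
    by (simp only: mult.assoc)
  then show ?thesis by (simp only: geo_inverse mult_1)
qed

lemma bser_mult: "bser a c * bser b c = bser (a + b) c"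
proof (rule fps_ext)
  fix k
  have "fps_nth (bser a c * bser b c) k = (\<Sum>i\<le>k. of_nat (k choose i) * pochhammer a i * pochhammer b (k - i)) / fact k * c ^ k"
    unfolding sum_divide_distrib sum_distrib_right fps_mult_nth atLeast0AtMost
  proof (rule sum.cong[OF refl])
    fix i assume "i \<in> {..k}"
    then have i: "i \<le> k" by simp
    have "of_nat (k choose i) / fact k = (1 / (fact i * fact (k - i)) :: complex)"
      using i by (simp add: binomial_fact)
    moreover have "c ^ i * c ^ (k - i) = c ^ k" using i by (simp flip: power_add)
    ultimately show "fps_nth (bser a c) i * fps_nth (bser b c) (k - i) = of_nat (k choose i) * pochhammer a i * pochhammer b (k - i) / fact k * c ^ k"
      by (simp add: bser_def field_simps)
  qed
  then show "fps_nth (bser a c * bser b c) k = fps_nth (bser (a + b) c) k"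
    by (simp add: bser_def pochhammer_binomial_sum)
qed

lemma bser_zero [simp]: "bser a 0 = 1" and bser_0 [simp]: "bser 0 c = 1"
  by (auto intro!: fps_ext simp: bser_def fps_one_nth power_0_left pochhammer_0_left)

lemma bser_power: "bser a c ^ m = bser (of_nat m * a) c"
  by (induction m) (auto simp: bser_mult algebra_simps)

lemma theta_prod_bser:
  "theta (\<Prod>j\<in>A. bser a (c j)) = (\<Sum>j\<in>A. fps_const (a * c j) * fps_X * geo (c j)) * (\<Prod>j\<in>A. bser a (c j))"
  by (induction A rule: infinite_finite_induct) (auto simp: theta_mult theta_bser algebra_simps)

lemma fps_const_prod: "fps_const (prod f A :: complex) = (\<Prod>a\<in>A. fps_const (f a))"
  by (induction A rule: infinite_finite_induct) (auto simp: fps_const_mult[symmetric] simp del: fps_const_mult)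

lemma fps_const_sum': "fps_const (sum f A :: complex) = (\<Sum>a\<in>A. fps_const (f a))"
  by (induction A rule: infinite_finite_induct) (auto simp: fps_const_add[symmetric] simp del: fps_const_add)

section \<open>Products of series in the separate variables\<close>

lemma natpermute_iff: "l \<in> natpermute d n \<longleftrightarrow> length l = n \<and> sum_list l = d"
  by (auto simp: natpermute_def)

lemma fps_prod_nth_lessThan:
  fixes f :: "nat \<Rightarrow> complex fps"
  shows "fps_nth (\<Prod>i<n. f i) d = (\<Sum>l\<in>natpermute d n. \<Prod>i<n. fps_nth (f i) (l ! i))"
proof (cases n)
  case 0
  have "natpermute d 0 = (if d = 0 then {[]} else {})" by (auto simp: natpermute_iff)
  then show ?thesis using 0 by (simp add: fps_one_nth)
next
  case (Suc m)
  have "{..<Suc m} = {0..m}" by auto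
  then show ?thesis using fps_prod_nth[of f m d] Suc by simp
qed

text \<open>The part of degree \<open>d\<close> of
  \<open>\<Prod>i. \<Sum>k. \<psi> k * x i ^ k\<close>; in \<open>eval_prodpoly\<close> the series
  variable merely records the degree. Cauchy kernels and products of binomial series both have this
  form.\<close>

definition prodpoly :: "nat \<Rightarrow> nat \<Rightarrow> (nat \<Rightarrow> complex) \<Rightarrow> mpoly" where
  "prodpoly n d \<psi> = (\<Sum>l\<in>natpermute d n. single (expvec n ((!) l)) (\<Prod>i<n. \<psi> (l ! i)))"

lemma eval_prodpoly:
  "eval_mpoly x (prodpoly n d \<psi>) = fps_nth (\<Prod>i<n. Abs_fps (\<lambda>k. \<psi> k * x i ^ k)) d"
  by (simp add: prodpoly_def eval_mpoly_sum eval_mpoly_single meval_expvec fps_prod_nth_lessThan prod.distrib)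

lemma in_vars_prodpoly [simp]: "in_vars n (prodpoly n d \<psi>)"
  unfolding prodpoly_def by (intro in_vars_sum) simp

lemma lookup_prodpoly:
  "lookup (prodpoly n d \<psi>) (expvec n a) = (if (\<Sum>i<n. a i) = d then \<Prod>i<n. \<psi> (a i) else 0)"
proof -
  have "lookup (prodpoly n d \<psi>) (expvec n a) = (\<Sum>l\<in>natpermute d n. if l = map a [0..<n] then \<Prod>i<n. \<psi> (a i) else 0)"
    unfolding prodpoly_def lookup_sum lookup_single when_def
  proof (rule sum.cong[OF refl])
    fix l assume "l \<in> natpermute d n"
    then have "length l = n" by (simp add: natpermute_iff)
    then have "expvec n ((!) l) = expvec n a \<longleftrightarrow> l = map a [0..<n]" by (rule nth_expvec_eq_iff)
    moreover have "(\<Prod>i<n. \<psi> (map a [0..<n] ! i)) = (\<Prod>i<n. \<psi> (a i))" by (rule prod.cong) auto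
    ultimately show "(if expvec n ((!) l) = expvec n a then \<Prod>i<n. \<psi> (l ! i) else 0) = (if l = map a [0..<n] then \<Prod>i<n. \<psi> (a i) else 0)"
      by auto
  qed
  also have "\<dots> = (if map a [0..<n] \<in> natpermute d n then \<Prod>i<n. \<psi> (a i) else 0)"
    using natpermute_finite[of d n] by (simp add: sum.delta')
  also have "map a [0..<n] \<in> natpermute d n \<longleftrightarrow> (\<Sum>i<n. a i) = d"
    by (simp add: natpermute_iff sum_list_nth_lessThan[of _ n] interv_sum_list_conv_sum_set_nat lessThan_atLeast0)
  finally show ?thesis .
qed

lemma prodpoly_sym [simp]: "prodpoly n d \<psi> \<in> sym_polys n"
  unfolding sym_polys_iff
proof (intro conjI allI impI)
  fix \<sigma> and a :: "nat \<Rightarrow> nat" assume \<sigma>: "\<sigma> permutes {..<n}"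
  show "lookup (prodpoly n d \<psi>) (expvec n (\<lambda>i. a (\<sigma> i))) = lookup (prodpoly n d \<psi>) (expvec n a)"
    unfolding lookup_prodpoly using sum.permute[OF \<sigma>, of a] prod.permute[OF \<sigma>, of "\<lambda>i. \<psi> (a i)"]
    by (simp add: o_def)
qed simp

text \<open>Each term of the determinant acts on the variables separately, hence factor by factor on
  a product of one-variable series; so the determinant of operators becomes a determinant of
  series.\<close>

lemma eval_D_det_prodpoly:
  "eval_mpoly x (D_det n g u (prodpoly n d \<psi>)) =
    fps_nth (ddet n (\<lambda>i j. fps_const (x i ^ (n - 1 - j)) *
      Abs_fps (\<lambda>k. (of_nat k + of_real (real (n - 1 - j) * g) + u) * (\<psi> k * x i ^ k)))) d"
proof -
  have of_int_nth: "fps_nth (of_int c * f) d = of_int c * fps_nth f d" for c and f :: "complex fps"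
    by (metis fps_mult_left_const_nth fps_of_int)
  have "eval_mpoly x (D_det n g u (prodpoly n d \<psi>)) = (\<Sum>l\<in>natpermute d n. \<Sum>\<sigma> | \<sigma> permutes {..<n}.
    of_int (sign \<sigma>) * (\<Prod>i<n. x i ^ (n - 1 - \<sigma> i) * ((of_nat (l ! i) + of_real (real (n - 1 - \<sigma> i) * g) + u) * (\<psi> (l ! i) * x i ^ (l ! i)))))"
    unfolding prodpoly_def D_det_sum D_det_single eval_mpoly_sum eval_mpoly_single meval_expvec D_coef_def
    by (intro sum.cong refl) (simp add: prod.distrib power_add mult_ac)
  also have "\<dots> = (\<Sum>\<sigma> | \<sigma> permutes {..<n}. of_int (sign \<sigma>) * (\<Sum>l\<in>natpermute d n.
    \<Prod>i<n. x i ^ (n - 1 - \<sigma> i) * ((of_nat (l ! i) + of_real (real (n - 1 - \<sigma> i) * g) + u) * (\<psi> (l ! i) * x i ^ (l ! i)))))"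
    by (subst sum.swap) (simp only: sum_distrib_left)
  finally show ?thesis
    unfolding ddet_def fps_sum_nth of_int_nth fps_prod_nth_lessThan by simp
qed

text \<open>The component of degree \<open>d\<close> of the Cauchy kernel \<open>\<Prod>i<n. \<Prod>j<m. (1 - x i * y j) powr (- g)\<close>.\<close>

definition kerp :: "nat \<Rightarrow> nat \<Rightarrow> real \<Rightarrow> nat \<Rightarrow> (nat \<Rightarrow> complex) \<Rightarrow> mpoly" where
  "kerp n m g d y = prodpoly n d (fps_nth (\<Prod>j<m. bser (of_real g) (y j)))"

lemma kerp_sym [simp]: "kerp n m g d y \<in> sym_polys n"
  by (simp add: kerp_def)

lemma kernel_series:
  "Abs_fps (\<lambda>k. fps_nth (\<Prod>j<m. bser a (y j)) k * x ^ k) = (\<Prod>j<m. bser a (x * y j))"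
proof -
  have "Abs_fps (\<lambda>k. fps_nth (\<Prod>j<m. bser a (y j)) k * x ^ k) = dil x (\<Prod>j<m. bser a (y j))"
    by (simp add: dil_def)
  then show ?thesis by (simp add: dil_prod dil_bser)
qed

lemma eval_kerp:
  "eval_mpoly x (kerp n m g d y) = fps_nth (\<Prod>i<n. \<Prod>j<m. bser (of_real g) (x i * y j)) d"
  by (simp add: kerp_def eval_prodpoly kernel_series)

text \<open>The factor of the kernel that contains \<open>x i\<close> has as logarithmic derivative
  \<open>g\<close> times a sum of geometric series. Taking \<open>g\<close> out of each row rescales
  \<open>u\<close> to \<open>u / g\<close> and leaves exactly the determinant of
  \<open>ddet_kernel_symmetric\<close>.\<close>

lemma eval_D_det_kerp:
  fixes g :: real
  assumes "g \<noteq> 0"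
  shows "eval_mpoly x (D_det n g u (kerp n n g d y)) =
    fps_nth (fps_const (of_real g ^ n) * (\<Prod>i<n. \<Prod>j<n. bser (of_real g) (x i * y j)) *
      ddet n (\<lambda>i j. fps_const (x i) ^ (n - 1 - j) * (of_nat (n - 1 - j) + fps_const (u / of_real g) +
        (\<Sum>k<n. fps_const (x i) * (fps_const (y k) * fps_X) * geo (x i * y k))))) d"
proof -
  let ?P = "\<lambda>i. \<Prod>j<n. bser (of_real g) (x i * y j)"
  have entry: "fps_const (x i ^ (n - 1 - j)) *
      Abs_fps (\<lambda>k. (of_nat k + of_real (real (n - 1 - j) * g) + u) * (fps_nth (\<Prod>j<n. bser (of_real g) (y j)) k * x i ^ k)) =
     (fps_const (of_real g) * ?P i) * (fps_const (x i) ^ (n - 1 - j) * (of_nat (n - 1 - j) + fps_const (u / of_real g) +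
        (\<Sum>k<n. fps_const (x i) * (fps_const (y k) * fps_X) * geo (x i * y k))))" for i j
  proof -
    have "Abs_fps (\<lambda>k. (of_nat k + of_real (real (n - 1 - j) * g) + u) * (fps_nth (\<Prod>j<n. bser (of_real g) (y j)) k * x i ^ k)) =
      theta (?P i) + fps_const (of_real (real (n - 1 - j) * g) + u) * ?P i"
      unfolding kernel_series[symmetric] by (rule fps_ext) (simp add: algebra_simps)
    also have "\<dots> = (fps_const (of_real g) * ?P i) * (of_nat (n - 1 - j) + fps_const (u / of_real g) +
        (\<Sum>k<n. fps_const (x i) * (fps_const (y k) * fps_X) * geo (x i * y k)))"
    proof -
      have c: "fps_const (of_real (real (n - 1 - j) * g) + u) = fps_const (of_real g) * (of_nat (n - 1 - j) + fps_const (u / of_real g))"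
        using assms by (simp add: fps_of_nat[symmetric] distrib_left mult.commute del: fps_of_nat)
      have s: "(\<Sum>k<n. fps_const (of_real g * (x i * y k)) * fps_X * geo (x i * y k)) =
         fps_const (of_real g) * (\<Sum>k<n. fps_const (x i) * (fps_const (y k) * fps_X) * geo (x i * y k))"
        unfolding sum_distrib_left by (intro sum.cong refl) (simp add: mult.assoc[symmetric])
      show ?thesis unfolding theta_prod_bser c s by (simp only: algebra_simps)
    qed
    finally show ?thesis by (simp add: mult_ac)
  qed
  show ?thesis
    unfolding kerp_def eval_D_det_prodpoly entry ddet_scale_rows
    by (simp add: prod.distrib)
qed

text \<open>The series variable is attached to \<open>y\<close>, so
  \<open>ddet_kernel_symmetric\<close> is applied with \<open>Y i * fps_X\<close> in place of
  \<open>y\<close>. The surplus powers of \<open>fps_X\<close>, from the Vandermonde product on one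
  side and from the columns on the other, form the same product \<open>?N\<close> and
  cancel.\<close>

theorem D_det_kerp_symmetric:
  fixes g :: real and x y :: "nat \<Rightarrow> complex"
  assumes g: "g \<noteq> 0" and x: "vandermonde n x \<noteq> 0" and y: "vandermonde n y \<noteq> 0"
  shows "vandermonde n y * eval_mpoly x (D_det n g u (kerp n n g d y)) =
    vandermonde n x * eval_mpoly y (D_det n g u (kerp n n g d x))"
proof -
  define X where "X i = fps_const (x i)" for i
  define Y where "Y i = fps_const (y i)" for i
  let ?N = "\<Prod>j<n. fps_X ^ j :: complex fps"
  define U where "U = fps_const (u / of_real g)"
  define KX where "KX = ddet n (\<lambda>i j. X i ^ (n - 1 - j) * (of_nat (n - 1 - j) + U + (\<Sum>k<n. X i * (Y k * fps_X) * geo (x i * y k))))"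
  define KY where "KY = ddet n (\<lambda>i j. Y i ^ (n - 1 - j) * (of_nat (n - 1 - j) + U + (\<Sum>k<n. Y i * (X k * fps_X) * geo (y i * x k))))"
  have N: "?N \<noteq> 0" by (simp add: prod_zero_iff)
  have vc: "vandermonde n (\<lambda>i. fps_const (z i)) = fps_const (vandermonde n z)" for z :: "nat \<Rightarrow> complex"
    by (simp add: vandermonde_def fps_const_prod)
  have vX: "vandermonde n (\<lambda>i. Y i * fps_X) = ?N * fps_const (vandermonde n y)"
  proof -
    have "vandermonde n (\<lambda>i. Y i * fps_X) = (\<Prod>j<n. \<Prod>i<j. fps_X * (Y j - Y i))"
      by (simp add: vandermonde_def algebra_simps)
    also have "\<dots> = ?N * vandermonde n Y" by (simp add: prod.distrib vandermonde_def)
    finally show ?thesis using vc[of y] by (simp add: Y_def[abs_def])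
  qed
  have "KX * vandermonde n (\<lambda>i. Y i * fps_X) =
    ddet n (\<lambda>i j. (Y i * fps_X) ^ (n - 1 - j) * (of_nat (n - 1 - j) + U + (\<Sum>k<n. (Y i * fps_X) * X k * geo (x k * y i)))) * vandermonde n X"
    unfolding KX_def
  proof (rule ddet_kernel_symmetric)
    show "geo (x i * y k) * (1 - X i * (Y k * fps_X)) = 1" for i k
      using geo_inverse[of "x i * y k"] by (simp add: X_def Y_def mult.assoc[symmetric])
    show "vandermonde n X \<noteq> 0" using x vc[of x] by (simp add: X_def[abs_def])
    show "vandermonde n (\<lambda>i. Y i * fps_X) \<noteq> 0" using y N unfolding vX by simp
  qed
  also have "ddet n (\<lambda>i j. (Y i * fps_X) ^ (n - 1 - j) * (of_nat (n - 1 - j) + U + (\<Sum>k<n. (Y i * fps_X) * X k * geo (x k * y i)))) =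
     ddet n (\<lambda>i j. fps_X ^ (n - 1 - j) * (Y i ^ (n - 1 - j) * (of_nat (n - 1 - j) + U + (\<Sum>k<n. Y i * (X k * fps_X) * geo (y i * x k)))))"
    by (simp add: power_mult_distrib mult_ac)
  also have "\<dots> = (\<Prod>j<n. fps_X ^ (n - 1 - j)) * KY"
    unfolding KY_def by (rule ddet_scale_cols)
  also have "(\<Prod>j<n. fps_X ^ (n - 1 - j) :: complex fps) = ?N"
    by (rule prod.reindex_bij_witness[of _ "\<lambda>k. n - 1 - k" "\<lambda>j. n - 1 - j"]) auto
  finally have "?N * (KX * fps_const (vandermonde n y)) = ?N * (KY * fps_const (vandermonde n x))"
    unfolding vX using vc[of x] by (simp add: X_def[abs_def] mult_ac)
  then have eq: "KX * fps_const (vandermonde n y) = KY * fps_const (vandermonde n x)"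
    using N by simp
  have P: "(\<Prod>i<n. \<Prod>j<n. bser (of_real g) (y i * x j)) = (\<Prod>i<n. \<Prod>j<n. bser (of_real g) (x i * y j))"
    by (subst prod.swap) (simp add: mult.commute)
  let ?C = "fps_const (of_real g ^ n) * (\<Prod>i<n. \<Prod>j<n. bser (of_real g) (x i * y j))"
  have "vandermonde n y * eval_mpoly x (D_det n g u (kerp n n g d y)) = fps_nth (?C * (KX * fps_const (vandermonde n y))) d"
    unfolding eval_D_det_kerp[OF g] KX_def X_def Y_def U_def
    by (subst mult.assoc[symmetric], subst fps_mult_right_const_nth) (simp add: mult.commute)
  also have "\<dots> = vandermonde n x * eval_mpoly y (D_det n g u (kerp n n g d x))"
    unfolding eq eval_D_det_kerp[OF g] P KY_def X_def Y_def U_def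
    by (subst mult.assoc[symmetric], subst fps_mult_right_const_nth) (simp add: mult.commute)
  finally show ?thesis .
qed

definition psum :: "nat \<Rightarrow> nat \<Rightarrow> (nat \<Rightarrow> complex) \<Rightarrow> complex" where
  "psum n k x = (\<Sum>i<n. x i ^ k)"

text \<open>The logarithmic derivative of the kernel is \<open>a\<close> times the generating series
  of the products of a power sum of \<open>x\<close> with the same power sum of
  \<open>y\<close>.\<close>

lemma kernel_recursion:
  "of_nat d * fps_nth (\<Prod>i<n. \<Prod>j<m. bser a (x i * y j)) d =
    (\<Sum>k=1..d. a * psum n k x * psum m k y * fps_nth (\<Prod>i<n. \<Prod>j<m. bser a (x i * y j)) (d - k))"
proof -
  define P where "P = (\<Prod>i<n. \<Prod>j<m. bser a (x i * y j))"
  define S where "S = (\<Sum>p\<in>{..<n} \<times> {..<m}. fps_const (a * (x (fst p) * y (snd p))) * fps_X * geo (x (fst p) * y (snd p)))"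
  have P: "P = (\<Prod>p\<in>{..<n} \<times> {..<m}. bser a (x (fst p) * y (snd p)))"
    by (simp add: P_def prod.cartesian_product case_prod_beta)
  have S: "fps_nth S k = (if k = 0 then 0 else a * psum n k x * psum m k y)" for k
  proof -
    have "fps_nth S k = (\<Sum>p\<in>{..<n} \<times> {..<m}. if k = 0 then 0 else a * (x (fst p) * y (snd p)) ^ k)"
      unfolding S_def fps_sum_nth
      by (intro sum.cong refl) (cases k, auto simp: mult.assoc fps_X_mult_nth geo_def)
    also have "\<dots> = (if k = 0 then 0 else a * (\<Sum>p\<in>{..<n} \<times> {..<m}. x (fst p) ^ k * y (snd p) ^ k))"
      by (simp add: sum_distrib_left power_mult_distrib)
    also have "(\<Sum>p\<in>{..<n} \<times> {..<m}. x (fst p) ^ k * y (snd p) ^ k) = psum n k x * psum m k y"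
      by (simp add: psum_def sum_product sum.cartesian_product case_prod_beta)
    finally show ?thesis by (simp add: mult.assoc)
  qed
  have "of_nat d * fps_nth P d = fps_nth (theta P) d" by simp
  also have "theta P = S * P" unfolding P S_def by (rule theta_prod_bser)
  also have "fps_nth (S * P) d = (\<Sum>k=0..d. fps_nth S k * fps_nth P (d - k))"
    by (rule fps_mult_nth)
  also have "\<dots> = (\<Sum>k=1..d. fps_nth S k * fps_nth P (d - k))"
    by (rule sum.mono_neutral_right) (auto simp: S not_le)
  also have "\<dots> = (\<Sum>k=1..d. a * psum n k x * psum m k y * fps_nth P (d - k))"
    by (intro sum.cong) (auto simp: S)
  finally show ?thesis unfolding P_def .
qed

section \<open>The action of \<open>D\<close> on products of one binomial series\<close>

text \<open>The component of degree \<open>d\<close> of \<open>\<Prod>i<n. (1 - x i) powr (- a)\<close>.\<close>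

definition binp :: "nat \<Rightarrow> nat \<Rightarrow> real \<Rightarrow> mpoly" where
  "binp n d a = prodpoly n d (fps_nth (bser (of_real a) 1))"

lemma eval_binp: "eval_mpoly x (binp n d a) = fps_nth (\<Prod>i<n. bser (of_real a) (x i)) d"
proof -
  have "Abs_fps (\<lambda>k. fps_nth (bser (of_real a) 1) k * x i ^ k) = bser (of_real a) (x i)" for i
    by (rule fps_ext) (simp add: bser_def)
  then show ?thesis by (simp add: binp_def eval_prodpoly)
qed

text \<open>The value of \<open>u\<close> makes the constant of column \<open>j\<close> equal to
  \<open>a - j * g\<close>. In the entry, \<open>a * x X + (a - j * g) * (1 - x X)\<close> collapses
  to \<open>(a - j * g) + j * g * x X\<close>, where the extra \<open>x\<close> points to the
  preceding column. In column 0 the second summand vanishes, so no power leaves the range, and the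
  determinant is that of the powers times an upper triangular one with diagonal
  \<open>a - j * g\<close>.\<close>

theorem D_op_binp:
  fixes a g :: real
  shows "D_op n g (of_real (a - real (n - 1) * g)) (binp n d a) =
    const (\<Prod>j<n. of_real (a - real j * g)) * binp n d (a + 1)"
proof (rule D_op_unique)
  let ?u = "of_real (a - real (n - 1) * g) :: complex"
  show "binp n d a \<in> sym_polys n" by (simp add: binp_def)
  have key: "eval_mpoly x (D_det n g ?u (binp n d a)) =
     (\<Prod>j<n. of_real (a - real j * g)) * ((-1) ^ (n * (n - 1) div 2) * vandermonde n x) * eval_mpoly x (binp n d (a + 1))"
    for x :: "nat \<Rightarrow> complex"
  proof -
    let ?c = "\<lambda>j. of_real (a - real j * g) :: complex"
    have entry: "fps_const (x i ^ (n - 1 - j)) *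
      Abs_fps (\<lambda>k. (of_nat k + of_real (real (n - 1 - j) * g) + ?u) * (fps_nth (bser (of_real a) 1) k * x i ^ k)) =
      bser (of_real (a + 1)) (x i) * (\<Sum>k<n. fps_const (x i ^ (n - 1 - k)) *
        (if k = j then fps_const (?c j) else if Suc k = j then fps_const (of_real (real j * g)) * fps_X else 0))"
      if j: "j < n" for i j
    proof -
      have dil: "Abs_fps (\<lambda>k. fps_nth (bser (of_real a) 1) k * x i ^ k) = bser (of_real a) (x i)"
        by (rule fps_ext) (simp add: bser_def)
      have cj: "of_real (real (n - 1 - j) * g) + ?u = ?c j"
      proof -
        have "real (n - 1 - j) = real (n - 1) - real j" using j by linarith
        then have "real (n - 1 - j) * g + (a - real (n - 1) * g) = a - real j * g"
          by (simp only: left_diff_distrib)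
        then show ?thesis by (metis of_real_add)
      qed
      have "Abs_fps (\<lambda>k. (of_nat k + of_real (real (n - 1 - j) * g) + ?u) * (fps_nth (bser (of_real a) 1) k * x i ^ k)) =
        theta (bser (of_real a) (x i)) + fps_const (?c j) * bser (of_real a) (x i)"
        unfolding dil[symmetric] cj[symmetric] by (rule fps_ext) (simp add: algebra_simps)
      also have "\<dots> = fps_const (of_real a * x i) * fps_X * (geo (x i) * bser (of_real a) (x i)) +
         fps_const (?c j) * ((geo (x i) * (1 - fps_const (x i) * fps_X)) * bser (of_real a) (x i))"
        unfolding theta_bser geo_inverse by (simp add: mult_ac)
      also have "\<dots> = (geo (x i) * bser (of_real a) (x i)) * (fps_const (?c j) + (fps_const (of_real a * x i) - fps_const (?c j * x i)) * fps_X)"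
      proof -
        have "A * Z * X * (G * H) + C * ((G * (1 - Z * X)) * H) = (G * H) * (C + (A * Z - C * Z) * X)"
          for A Z X G H C :: "complex fps"
          by (simp add: algebra_simps)
        then show ?thesis unfolding fps_const_mult[symmetric] .
      qed
      also have "geo (x i) * bser (of_real a) (x i) = bser (of_real (a + 1)) (x i)"
        by (simp add: geo_bser)
      also have "fps_const (of_real a * x i) - fps_const (?c j * x i) = fps_const (of_real (real j * g)) * fps_const (x i)"
        by (simp add: algebra_simps)
      finally have e: "Abs_fps (\<lambda>k. (of_nat k + of_real (real (n - 1 - j) * g) + ?u) * (fps_nth (bser (of_real a) 1) k * x i ^ k)) =
        bser (of_real (a + 1)) (x i) * (fps_const (?c j) + fps_const (of_real (real j * g)) * fps_const (x i) * fps_X)" .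
      have "(\<Sum>k<n. fps_const (x i ^ (n - 1 - k)) *
        (if k = j then fps_const (?c j) else if Suc k = j then fps_const (of_real (real j * g)) * fps_X else 0)) =
        (\<Sum>k<n. (if k = j then fps_const (x i ^ (n - 1 - j)) * fps_const (?c j) else 0) +
           (if Suc k = j then fps_const (x i ^ (n - 1 - k)) * (fps_const (of_real (real j * g)) * fps_X) else 0))"
        by (intro sum.cong) auto
      also have "\<dots> = fps_const (x i ^ (n - 1 - j)) * fps_const (?c j) +
          (\<Sum>k<n. if Suc k = j then fps_const (x i ^ (n - 1 - k)) * (fps_const (of_real (real j * g)) * fps_X) else 0)"
        using j by (simp add: sum.distrib)
      also have "(\<Sum>k<n. if Suc k = j then fps_const (x i ^ (n - 1 - k)) * (fps_const (of_real (real j * g)) * fps_X) else 0) =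
          fps_const (x i ^ (n - 1 - j)) * (fps_const (of_real (real j * g)) * fps_const (x i) * fps_X)"
      proof (cases j)
        case (Suc j')
        have "x i ^ (n - 1 - j') = x i ^ (n - 1 - j) * x i"
          using Suc j by (metis Suc_diff_Suc diff_Suc_eq_diff_pred power_Suc2)
        then show ?thesis using Suc j
          by (simp add: mult_ac fps_const_mult[symmetric] del: fps_const_mult)
      qed simp
      finally show ?thesis unfolding e by (simp add: algebra_simps)
    qed
    have "ddet n (\<lambda>i j. fps_const (x i ^ (n - 1 - j)) *
      Abs_fps (\<lambda>k. (of_nat k + of_real (real (n - 1 - j) * g) + ?u) * (fps_nth (bser (of_real a) 1) k * x i ^ k))) =
      ddet n (\<lambda>i j. bser (of_real (a + 1)) (x i) * (\<Sum>k<n. fps_const (x i ^ (n - 1 - k)) *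
        (if k = j then fps_const (?c j) else if Suc k = j then fps_const (of_real (real j * g)) * fps_X else 0)))"
      by (rule ddet_cong) (simp only: entry)
    also have "\<dots> = (\<Prod>i<n. bser (of_real (a + 1)) (x i)) * (ddet n (\<lambda>i j. fps_const (x i ^ (n - 1 - j))) *
       ddet n (\<lambda>k j. if k = j then fps_const (?c j) else if Suc k = j then fps_const (of_real (real j * g)) * fps_X else 0))"
      unfolding ddet_scale_rows ddet_mult ..
    also have "ddet n (\<lambda>k j. if k = j then fps_const (?c j) else if Suc k = j then fps_const (of_real (real j * g)) * fps_X else 0) = fps_const (\<Prod>j<n. ?c j)"
      by (subst ddet_upper) (auto simp: fps_const_prod)
    also have "ddet n (\<lambda>i j. fps_const (x i ^ (n - 1 - j))) = fps_const ((-1) ^ (n * (n - 1) div 2) * vandermonde n x)"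
      unfolding vandermonde_ddet[symmetric] ddet_def
      by (simp add: fps_const_prod[symmetric] fps_of_int[symmetric] fps_const_sum')
    finally show ?thesis
      unfolding binp_def[of n d a] eval_D_det_prodpoly by (simp add: eval_binp mult_ac)
  qed
  show "vandermonde n var * (const (\<Prod>j<n. of_real (a - real j * g)) * binp n d (a + 1)) =
    (-1) ^ (n * (n - 1) div 2) * D_det n g ?u (binp n d a)"
  proof (rule mpoly_eqI_eval[of n])
    fix x :: "nat \<Rightarrow> real"
    show "eval_mpoly (\<lambda>i. of_real (x i)) (vandermonde n var * (const (\<Prod>j<n. of_real (a - real j * g)) * binp n d (a + 1))) =
      eval_mpoly (\<lambda>i. of_real (x i)) ((-1) ^ (n * (n - 1) div 2) * D_det n g ?u (binp n d a))"
    proof -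
      have gen: "V * (c * E) = s * (c * (s * V) * E)" if "s * s = 1" for V c E s :: complex
      proof -
        have "s * (c * (s * V) * E) = (s * s) * (V * (c * E))" by (simp only: mult_ac)
        then show ?thesis using that by simp
      qed
      have "(-1) ^ (n * (n - 1) div 2) * (-1) ^ (n * (n - 1) div 2) = (1 :: complex)"
        by (simp flip: power_add mult_2)
      then show ?thesis
        unfolding eval_mpoly_mult eval_vandermonde key eval_mpoly_power eval_mpoly_uminus eval_mpoly_one eval_mpoly_const
        by (rule gen)
    qed
  qed (auto intro!: in_vars_mult in_vars_D_det simp: binp_def)
qed

section \<open>Power sums\<close>

definition compos :: "nat \<Rightarrow> nat list set" where
  "compos d = {\<alpha>. (\<forall>k\<in>set \<alpha>. 0 < k) \<and> sum_list \<alpha> = d}"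

definition psl :: "nat \<Rightarrow> nat list \<Rightarrow> (nat \<Rightarrow> complex) \<Rightarrow> complex" where
  "psl n \<alpha> x = (\<Prod>k\<leftarrow>\<alpha>. psum n k x)"

lemma compos_Cons: "k # \<alpha> \<in> compos d \<longleftrightarrow> 0 < k \<and> k \<le> d \<and> \<alpha> \<in> compos (d - k)"
  by (auto simp: compos_def)

lemma compos_0: "compos 0 = {[]}"
proof -
  have "\<alpha> = []" if "\<alpha> \<in> compos 0" for \<alpha>
    using that by (cases \<alpha>) (auto simp: compos_def)
  then show ?thesis by (auto simp: compos_def)
qed

lemma compos_decomp: "0 < d \<Longrightarrow> compos d = (\<lambda>(k, \<alpha>). k # \<alpha>) ` (SIGMA k:{1..d}. compos (d - k))"
proof (intro equalityI subsetI)
  fix \<alpha> assume "0 < d" "\<alpha> \<in> compos d"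
  moreover from this obtain k \<beta> where "\<alpha> = k # \<beta>" by (cases \<alpha>) (auto simp: compos_def)
  ultimately show "\<alpha> \<in> (\<lambda>(k, \<alpha>). k # \<alpha>) ` (SIGMA k:{1..d}. compos (d - k))"
    by (auto simp: compos_Cons image_iff)
qed (auto simp: compos_Cons)

lemma finite_compos: "finite (compos d)"
proof (induction d rule: less_induct)
  case (less d)
  show ?case
  proof (cases "d = 0")
    case False
    then show ?thesis using less by (subst compos_decomp) (auto intro!: finite_imageI finite_SigmaI simp del: One_nat_def)
  qed (simp add: compos_0)
qed

lemma sum_compos:
  assumes "0 < d"
  shows "(\<Sum>\<alpha>\<in>compos d. f \<alpha>) = (\<Sum>k=1..d. \<Sum>\<alpha>\<in>compos (d - k). f (k # \<alpha>))"
proof -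
  have "(\<Sum>\<alpha>\<in>compos d. f \<alpha>) = (\<Sum>p\<in>(SIGMA k:{1..d}. compos (d - k)). f (fst p # snd p))"
    unfolding compos_decomp[OF assms] by (subst sum.reindex) (auto simp: inj_on_def case_prod_beta o_def)
  then show ?thesis
    by (subst sum.Sigma) (auto simp: finite_compos case_prod_beta)
qed

text \<open>The coefficients of the Cauchy kernel in products of power sums, spread over compositions so that
  they obey a recursion.\<close>

fun pcoef :: "real \<Rightarrow> nat list \<Rightarrow> real" where
  "pcoef g [] = 1"
| "pcoef g (k # \<alpha>) = g / real (sum_list (k # \<alpha>)) * pcoef g \<alpha>"

lemma pcoef_pos: "g > 0 \<Longrightarrow> \<alpha> \<in> compos d \<Longrightarrow> pcoef g \<alpha> > 0"
  by (induction \<alpha> arbitrary: d) (auto simp: compos_Cons intro!: divide_pos_pos mult_pos_pos add_pos_nonneg)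

lemma fps_prod_nth_0: "fps_nth (prod f A) 0 = (\<Prod>a\<in>A. fps_nth (f a :: complex fps) 0)"
  by (induction A rule: infinite_finite_induct) auto

theorem kernel_power_sums:
  "fps_nth (\<Prod>i<n. \<Prod>j<m. bser (of_real g) (x i * y j)) d =
    (\<Sum>\<alpha>\<in>compos d. of_real (pcoef g \<alpha>) * psl n \<alpha> x * psl m \<alpha> y)"
proof (induction d rule: less_induct)
  case (less d)
  let ?P = "\<Prod>i<n. \<Prod>j<m. bser (of_real g) (x i * y j)"
  show ?case
  proof (cases "d = 0")
    case True
    have "fps_nth (bser a c) 0 = 1" for a c by (simp add: bser_def)
    then have "fps_nth ?P 0 = 1" by (simp add: fps_prod_nth_0)
    then show ?thesis using True by (simp add: compos_0 psl_def)
  next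
    case False
    then have d: "0 < d" by simp
    have "of_nat d * fps_nth ?P d = (\<Sum>k=1..d. of_real g * psum n k x * psum m k y * fps_nth ?P (d - k))"
      by (rule kernel_recursion)
    also have "\<dots> = (\<Sum>k=1..d. \<Sum>\<alpha>\<in>compos (d - k). of_nat d * (of_real (pcoef g (k # \<alpha>)) * psl n (k # \<alpha>) x * psl m (k # \<alpha>) y))"
    proof (rule sum.cong[OF refl])
      fix k assume k: "k \<in> {1..d}"
      have "of_real g * psum n k x * psum m k y * fps_nth ?P (d - k) =
        (\<Sum>\<alpha>\<in>compos (d - k). of_real g * psum n k x * psum m k y * (of_real (pcoef g \<alpha>) * psl n \<alpha> x * psl m \<alpha> y))"
        using less[of "d - k"] k by (simp add: sum_distrib_left)
      also have "\<dots> = (\<Sum>\<alpha>\<in>compos (d - k). of_nat d * (of_real (pcoef g (k # \<alpha>)) * psl n (k # \<alpha>) x * psl m (k # \<alpha>) y))"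
      proof (rule sum.cong[OF refl])
        fix \<alpha> assume "\<alpha> \<in> compos (d - k)"
        then have "sum_list (k # \<alpha>) = d" using k by (simp add: compos_def)
        then have "of_nat d * complex_of_real (pcoef g (k # \<alpha>)) = of_real g * of_real (pcoef g \<alpha>)"
          using d by simp
        then show "of_real g * psum n k x * psum m k y * (of_real (pcoef g \<alpha>) * psl n \<alpha> x * psl m \<alpha> y) =
          of_nat d * (of_real (pcoef g (k # \<alpha>)) * psl n (k # \<alpha>) x * psl m (k # \<alpha>) y)"
          by (simp only: mult.assoc[symmetric]) (simp add: psl_def mult_ac)
      qed
      finally show "of_real g * psum n k x * psum m k y * fps_nth ?P (d - k) = \<dots>" .
    qed
    also have "\<dots> = of_nat d * (\<Sum>\<alpha>\<in>compos d. of_real (pcoef g \<alpha>) * psl n \<alpha> x * psl m \<alpha> y)"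
      unfolding sum_compos[OF d] sum_distrib_left ..
    finally show ?thesis using d by simp
  qed
qed

definition pspoly :: "nat \<Rightarrow> nat list \<Rightarrow> mpoly" where
  "pspoly n \<alpha> = (\<Prod>k\<leftarrow>\<alpha>. \<Sum>i<n. var i ^ k)"

lemma eval_pspoly [simp]: "eval_mpoly x (pspoly n \<alpha>) = psl n \<alpha> x"
  by (induction \<alpha>) (auto simp: pspoly_def psl_def psum_def eval_mpoly_mult eval_mpoly_sum eval_mpoly_power)

lemma psum_permute:
  assumes "\<sigma> permutes {..<n}"
  shows "psum n k (\<lambda>i. x (\<sigma> i)) = psum n k x"
  unfolding psum_def using sum.permute[OF assms, of "\<lambda>i. x i ^ k"] by (simp add: o_def)

lemma in_vars_pspoly: "in_vars n (pspoly n \<alpha>)"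
  by (induction \<alpha>) (auto simp: pspoly_def intro!: in_vars_mult in_vars_sum in_vars_power)

lemma pspoly_sym [simp]: "pspoly n \<alpha> \<in> sym_polys n"
  unfolding sym_polys_eval_iff by (simp add: in_vars_pspoly psl_def psum_permute)

text \<open>The augmented monomial sum, over injective index tuples: repeated exponents carry no
  symmetry factor, so multiplication by a power sum has all coefficients 1.\<close>

definition mono_sum :: "nat \<Rightarrow> nat list \<Rightarrow> (nat \<Rightarrow> complex) \<Rightarrow> complex" where
  "mono_sum n as x = (\<Sum>is | length is = length as \<and> distinct is \<and> set is \<subseteq> {..<n}. \<Prod>j<length as. x (is ! j) ^ (as ! j))"

lemma finite_index_lists: "finite {is. length is = l \<and> distinct is \<and> set is \<subseteq> {..<n::nat}}"
  by (rule finite_subset[OF _ finite_lists_length_eq[of "{..<n}" l]]) auto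

lemma prod_nth_Cons: "(\<Prod>j<length (a # as). x ((i # is) ! j) ^ ((a # as) ! j)) = x i ^ a * (\<Prod>j<length as. x (is ! j) ^ (as ! j))"
  for x :: "nat \<Rightarrow> complex"
  by (simp add: prod.lessThan_Suc_shift del: prod.lessThan_Suc)

lemma prod_list_update:
  fixes x :: "nat \<Rightarrow> complex"
  assumes "j < length as"
  shows "(\<Prod>j'<length as. x (is ! j') ^ (as[j := as ! j + k] ! j')) = x (is ! j) ^ k * (\<Prod>j'<length as. x (is ! j') ^ (as ! j'))"
proof -
  have "(\<Prod>j'<length as. x (is ! j') ^ (as[j := as ! j + k] ! j')) = (\<Prod>j'<length as. (if j' = j then x (is ! j) ^ k else 1) * x (is ! j') ^ (as ! j'))"
    using assms by (intro prod.cong) (auto simp: nth_list_update power_add mult_ac)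
  then show ?thesis using assms by (simp add: prod.distrib)
qed

text \<open>The index of the extra factor is either new, which lengthens the tuple, or equals the
  index in some place \<open>j\<close>, which adds \<open>k\<close> to that exponent.\<close>

lemma psum_times_mono_sum:
  "psum n k x * mono_sum n as x = mono_sum n (k # as) x + (\<Sum>j<length as. mono_sum n (as[j := as ! j + k]) x)"
proof -
  let ?I = "{is. length is = length as \<and> distinct is \<and> set is \<subseteq> {..<n}}"
  let ?m = "\<lambda>is. \<Prod>j<length as. x (is ! j) ^ (as ! j)"
  have "psum n k x * mono_sum n as x = (\<Sum>is\<in>?I. \<Sum>i<n. x i ^ k * ?m is)"
    unfolding psum_def mono_sum_def sum_product by (rule sum.swap)
  also have "\<dots> = (\<Sum>is\<in>?I. (\<Sum>i\<in>{..<n} - set is. x i ^ k * ?m is) + (\<Sum>i\<in>set is. x i ^ k * ?m is))"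
    by (intro sum.cong refl sum.subset_diff) auto
  also have "\<dots> = (\<Sum>is\<in>?I. \<Sum>i\<in>{..<n} - set is. x i ^ k * ?m is) + (\<Sum>is\<in>?I. \<Sum>i\<in>set is. x i ^ k * ?m is)"
    by (rule sum.distrib)
  also have "(\<Sum>is\<in>?I. \<Sum>i\<in>{..<n} - set is. x i ^ k * ?m is) = mono_sum n (k # as) x"
  proof -
    have "(\<Sum>is\<in>?I. \<Sum>i\<in>{..<n} - set is. x i ^ k * ?m is) = (\<Sum>p\<in>(SIGMA is:?I. {..<n} - set is). x (snd p) ^ k * ?m (fst p))"
      by (subst sum.Sigma) (auto simp: finite_index_lists case_prod_beta)
    also have "\<dots> = (\<Sum>is | length is = length (k # as) \<and> distinct is \<and> set is \<subseteq> {..<n}. \<Prod>j<length (k # as). x (is ! j) ^ ((k # as) ! j))"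
    proof (rule sum.reindex_bij_witness[of _ "\<lambda>is. (tl is, hd is)" "\<lambda>p. snd p # fst p"])
      fix p assume "p \<in> (SIGMA is:?I. {..<n} - set is)"
      show "(\<Prod>j<length (k # as). x ((snd p # fst p) ! j) ^ ((k # as) ! j)) = x (snd p) ^ k * ?m (fst p)"
        by (rule prod_nth_Cons)
    next
      fix "is" assume "is \<in> {is. length is = length (k # as) \<and> distinct is \<and> set is \<subseteq> {..<n}}"
      then show "(tl is, hd is) \<in> (SIGMA is:?I. {..<n} - set is)" "snd (tl is, hd is) # fst (tl is, hd is) = is"
        by (cases "is"; auto)+
    qed auto
    finally show ?thesis by (simp add: mono_sum_def)
  qed
  also have "(\<Sum>is\<in>?I. \<Sum>i\<in>set is. x i ^ k * ?m is) = (\<Sum>j<length as. mono_sum n (as[j := as ! j + k]) x)"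
  proof -
    have "(\<Sum>is\<in>?I. \<Sum>i\<in>set is. x i ^ k * ?m is) = (\<Sum>is\<in>?I. \<Sum>j<length as. x (is ! j) ^ k * ?m is)"
    proof (rule sum.cong[OF refl])
      fix "is" assume "is \<in> ?I"
      then have "bij_betw ((!) is) {..<length as} (set is)" using bij_betw_nth[of "is" "{..<length as}" "set is"] by auto
      from sum.reindex_bij_betw[OF this, of "\<lambda>i. x i ^ k * ?m is"]
      show "(\<Sum>i\<in>set is. x i ^ k * ?m is) = (\<Sum>j<length as. x (is ! j) ^ k * ?m is)" by simp
    qed
    also have "\<dots> = (\<Sum>j<length as. \<Sum>is\<in>?I. x (is ! j) ^ k * ?m is)" by (rule sum.swap)
    also have "\<dots> = (\<Sum>j<length as. mono_sum n (as[j := as ! j + k]) x)"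
      unfolding mono_sum_def length_list_update by (intro sum.cong refl) (simp add: prod_list_update)
    finally show ?thesis .
  qed
  finally show ?thesis .
qed

definition psum_span :: "nat \<Rightarrow> nat \<Rightarrow> ((nat \<Rightarrow> complex) \<Rightarrow> complex) \<Rightarrow> bool" where
  "psum_span n d f \<longleftrightarrow> (\<exists>t. \<forall>x. f x = (\<Sum>\<alpha>\<in>compos d. t \<alpha> * psl n \<alpha> x))"

lemma psum_span_add: "psum_span n d f \<Longrightarrow> psum_span n d h \<Longrightarrow> psum_span n d (\<lambda>x. f x + h x)"
  unfolding psum_span_def
proof (elim exE)
  fix s t assume "\<forall>x. f x = (\<Sum>\<alpha>\<in>compos d. s \<alpha> * psl n \<alpha> x)" "\<forall>x. h x = (\<Sum>\<alpha>\<in>compos d. t \<alpha> * psl n \<alpha> x)"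
  then show "\<exists>t. \<forall>x. f x + h x = (\<Sum>\<alpha>\<in>compos d. t \<alpha> * psl n \<alpha> x)"
    by (intro exI[of _ "\<lambda>\<alpha>. s \<alpha> + t \<alpha>"]) (simp add: distrib_right sum.distrib)
qed

lemma psum_span_scale: "psum_span n d f \<Longrightarrow> psum_span n d (\<lambda>x. c * f x)"
  unfolding psum_span_def
proof (elim exE)
  fix s assume "\<forall>x. f x = (\<Sum>\<alpha>\<in>compos d. s \<alpha> * psl n \<alpha> x)"
  then show "\<exists>t. \<forall>x. c * f x = (\<Sum>\<alpha>\<in>compos d. t \<alpha> * psl n \<alpha> x)"
    by (intro exI[of _ "\<lambda>\<alpha>. c * s \<alpha>"]) (simp add: sum_distrib_left mult_ac)
qed

lemma psum_span_zero: "psum_span n d (\<lambda>x. 0)"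
  unfolding psum_span_def by (intro exI[of _ "\<lambda>_. 0"]) simp

lemma psum_span_sum: "(\<And>a. a \<in> A \<Longrightarrow> psum_span n d (f a)) \<Longrightarrow> psum_span n d (\<lambda>x. \<Sum>a\<in>A. f a x)"
  by (induction A rule: infinite_finite_induct) (auto simp: psum_span_zero psum_span_add)

lemma psum_span_psum_times:
  assumes "psum_span n d f"
  shows "psum_span n (k + d) (\<lambda>x. psum n k x * f x)"
proof (cases "k = 0")
  \<comment> \<open>\<open>psum n 0\<close> is the constant \<open>n\<close>; compositions have no
    zero entries, so this factor goes into the coefficients.\<close>
  case True
  then show ?thesis using psum_span_scale[OF assms, of "of_nat n"] by (simp add: psum_def)
next
  case False
  obtain t where t: "\<And>x. f x = (\<Sum>\<alpha>\<in>compos d. t \<alpha> * psl n \<alpha> x)" using assms by (auto simp: psum_span_def)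
  \<comment> \<open>Compositions are ordered, so the coefficients can be placed on those that begin
    with \<open>k\<close>.\<close>
  define s where "s \<beta> = (if hd \<beta> = k then t (tl \<beta>) else 0)" for \<beta>
  have "psum n k x * f x = (\<Sum>\<beta>\<in>compos (k + d). s \<beta> * psl n \<beta> x)" for x
  proof -
    have "(\<Sum>\<beta>\<in>compos (k + d). s \<beta> * psl n \<beta> x) = (\<Sum>k'=1..k+d. \<Sum>\<alpha>\<in>compos (k + d - k'). s (k' # \<alpha>) * psl n (k' # \<alpha>) x)"
      using False by (intro sum_compos) simp
    also have "\<dots> = (\<Sum>k'=1..k+d. if k' = k then \<Sum>\<alpha>\<in>compos d. t \<alpha> * psl n (k # \<alpha>) x else 0)"
      by (intro sum.cong refl) (auto simp: s_def)
    also have "\<dots> = (\<Sum>\<alpha>\<in>compos d. t \<alpha> * psl n (k # \<alpha>) x)" using False by simp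
    also have "\<dots> = psum n k x * f x" by (simp add: t psl_def sum_distrib_left mult_ac)
    finally show ?thesis ..
  qed
  then show ?thesis unfolding psum_span_def by blast
qed

text \<open>Solved for the longest tuple, \<open>psum_times_mono_sum\<close> expresses it by shorter
  ones. The induction is on the length, because the exponents grow.\<close>

lemma psum_span_mono_sum: "psum_span n (sum_list as) (mono_sum n as)"
proof (induction "length as" arbitrary: as)
  case 0
  then have "as = []" by simp
  moreover have "{is. length is = 0 \<and> distinct is \<and> set is \<subseteq> {..<n}} = {[]}" by auto
  ultimately have "mono_sum n as = (\<lambda>x. 1)" by (simp add: mono_sum_def fun_eq_iff)
  moreover have "psum_span n 0 (\<lambda>x. 1)" unfolding psum_span_def by (intro exI[of _ "\<lambda>_. 1"]) (simp add: compos_0 psl_def)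
  ultimately show ?case using 0 by simp
next
  case (Suc l)
  then obtain k bs where as: "as = k # bs" "length bs = l" by (cases as) auto
  have sl: "sum_list (bs[j := bs ! j + k]) = k + sum_list bs" if "j < l" for j
    using that as(2) by (simp add: sum_list_update)
  have 1: "psum_span n (k + sum_list bs) (\<lambda>x. psum n k x * mono_sum n bs x)"
    using Suc(1)[of bs] as by (intro psum_span_psum_times) simp
  have 2: "psum_span n (k + sum_list bs) (mono_sum n (bs[j := bs ! j + k]))" if "j < l" for j
    using Suc(1)[of "bs[j := bs ! j + k]"] as sl[OF that] by simp
  have eq: "mono_sum n as = (\<lambda>x. psum n k x * mono_sum n bs x + (-1) * (\<Sum>j<l. mono_sum n (bs[j := bs ! j + k]) x))"
    using psum_times_mono_sum[of n k _ bs] as by (auto simp: fun_eq_iff)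
  show ?case
    unfolding eq using as by (simp only: sum_list.Cons) (intro psum_span_add psum_span_scale psum_span_sum 1 2, simp)
qed

lemma sum_permutations_mono_sum:
  "(\<Sum>\<sigma> | \<sigma> permutes {..<n}. \<Prod>i<n. x (\<sigma> i) ^ a i) = mono_sum n (map a [0..<n]) x"
proof -
  let ?I = "{is. length is = n \<and> distinct is \<and> set is \<subseteq> {..<n}}"
  have "(\<Sum>\<sigma> | \<sigma> permutes {..<n}. \<Prod>i<n. x (\<sigma> i) ^ a i) = (\<Sum>is\<in>?I. \<Prod>j<n. x (is ! j) ^ a j)"
  proof (rule sum.reindex_bij_witness[of _ "\<lambda>is i. if i < n then is ! i else i" "\<lambda>\<sigma>. map \<sigma> [0..<n]"])
    fix \<sigma> assume "\<sigma> \<in> {\<sigma>. \<sigma> permutes {..<n}}"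
    then have \<sigma>: "\<sigma> permutes {..<n}" by simp
    show "(\<lambda>i. if i < n then map \<sigma> [0..<n] ! i else i) = \<sigma>"
      using \<sigma> by (auto simp: fun_eq_iff permutes_def)
    show "map \<sigma> [0..<n] \<in> ?I"
      using permutes_inj_on[OF \<sigma>] permutes_image[OF \<sigma>] by (auto simp: distinct_map lessThan_atLeast0)
    show "(\<Prod>j<n. x (map \<sigma> [0..<n] ! j) ^ a j) = (\<Prod>i<n. x (\<sigma> i) ^ a i)"
      by (rule prod.cong) auto
  next
    fix "is" assume "is \<in> ?I"
    then have i: "length is = n" "distinct is" "set is \<subseteq> {..<n}" by auto
    show "map (\<lambda>i. if i < n then is ! i else i) [0..<n] = is"
      using i(1) by (auto intro!: nth_equalityI)
    have "card (set is) = n" using i by (simp add: distinct_card)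
    then have s: "set is = {..<n}" using i(3) by (intro card_subset_eq) auto
    have "bij_betw ((!) is) {..<n} {..<n}" by (rule bij_betw_nth) (simp_all only: i s)
    then have "bij_betw (\<lambda>i. if i < n then is ! i else i) {..<n} {..<n}"
      by (subst bij_betw_cong[of _ _ "(!) is"]) auto
    then show "(\<lambda>i. if i < n then is ! i else i) \<in> {\<sigma>. \<sigma> permutes {..<n}}"
      unfolding mem_Collect_eq by (rule bij_imp_permutes) simp
  qed
  also have "\<dots> = mono_sum n (map a [0..<n]) x"
    unfolding mono_sum_def by (intro sum.cong prod.cong) auto
  finally show ?thesis .
qed

text \<open>Summing over all permutations of the variables turns each monomial, padded with zero
  exponents, into a sum over the injective tuples of length \<open>n\<close>.\<close>

lemma sym_eval_mono_sum:
  assumes "p \<in> sym_polys n"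
  shows "fact n * eval_mpoly x p = (\<Sum>m\<in>keys p. lookup p m * mono_sum n (map (lookup m) [0..<n]) x)"
proof -
  have "fact n * eval_mpoly x p = (\<Sum>\<sigma> | \<sigma> permutes {..<n}. eval_mpoly (\<lambda>i. x (\<sigma> i)) p)"
    using eval_sym_permute[OF assms] card_permutations[of "{..<n}" n] by simp
  also have "\<dots> = (\<Sum>\<sigma> | \<sigma> permutes {..<n}. \<Sum>m\<in>keys p. lookup p m * (\<Prod>i<n. x (\<sigma> i) ^ lookup m i))"
    unfolding eval_mpoly_superset[OF finite_keys order_refl]
  proof (intro sum.cong refl)
    fix \<sigma> m assume "m \<in> keys p"
    then have "keys m \<subseteq> {..<n}" using sym_polys_in_vars[OF assms] by (auto simp: in_vars_def)
    then have "meval (\<lambda>i. x (\<sigma> i)) m = (\<Prod>i<n. x (\<sigma> i) ^ lookup m i)"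
      by (intro meval_superset) auto
    then show "lookup p m * meval (\<lambda>i. x (\<sigma> i)) m = lookup p m * (\<Prod>i<n. x (\<sigma> i) ^ lookup m i)"
      by simp
  qed
  also have "\<dots> = (\<Sum>m\<in>keys p. lookup p m * (\<Sum>\<sigma> | \<sigma> permutes {..<n}. \<Prod>i<n. x (\<sigma> i) ^ lookup m i))"
    by (subst sum.swap) (simp only: sum_distrib_left)
  finally show ?thesis by (simp only: sum_permutations_mono_sum)
qed

theorem sym_homogeneous_psum_span:
  assumes "p \<in> sym_polys n"
    and "\<And>m. m \<in> keys p \<Longrightarrow> (\<Sum>i<n. lookup m i) = d"
  shows "psum_span n d (\<lambda>x. eval_mpoly x p)"
proof -
  have "psum_span n d (mono_sum n (map (lookup m) [0..<n]))" if "m \<in> keys p" for m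
    using psum_span_mono_sum[of n "map (lookup m) [0..<n]"] assms(2)[OF that]
    by (simp add: interv_sum_list_conv_sum_set_nat lessThan_atLeast0)
  then have "psum_span n d (\<lambda>x. (1 / fact n) * (\<Sum>m\<in>keys p. lookup p m * mono_sum n (map (lookup m) [0..<n]) x))"
    by (intro psum_span_scale psum_span_sum)
  then show ?thesis unfolding sym_eval_mono_sum[OF assms(1), symmetric] by simp
qed

section \<open>Existence of the Jack polynomials\<close>

definition unitri :: "nat \<Rightarrow> nat list \<Rightarrow> mpoly \<Rightarrow> bool" where
  "unitri n lam P \<longleftrightarrow> P \<in> sym_polys n \<and> coefp n P lam = 1 \<and>
     (\<forall>mu. is_partition n mu \<longrightarrow> coefp n P mu \<noteq> 0 \<longrightarrow> dominated n mu lam)"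

lemma unitri_iff:
  assumes "is_partition n lam"
  shows "unitri n lam P \<longleftrightarrow> P \<in> sym_polys n \<and> (\<exists>v. P = monomial_sym n lam +
        (\<Sum>mu | is_partition n mu \<and> dominated n mu lam \<and> mu \<noteq> lam. const (v mu) * monomial_sym n mu))"
proof -
  let ?S = "{mu. is_partition n mu \<and> dominated n mu lam \<and> mu \<noteq> lam}"
  have S: "lower n lam = insert lam ?S" "lam \<notin> ?S"
    using assms by (auto simp: lower_def dominated_refl)
  have fin: "finite ?S" using finite_lower[of n lam] unfolding S(1) by simp
  have c: "coefp n (monomial_sym n lam + (\<Sum>mu\<in>?S. const (v mu) * monomial_sym n mu)) nu =
      (if nu = lam then 1 else if nu \<in> ?S then v nu else 0)" if "is_partition n nu" for v nu
  proof -
    have "coefp n (\<Sum>mu\<in>?S. const (v mu) * monomial_sym n mu) nu = (\<Sum>mu\<in>?S. if mu = nu then v mu else 0)"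
      unfolding lookup_sum by (intro sum.cong refl) (use that in \<open>auto simp: coefp_monomial_sym\<close>)
    also have "\<dots> = (if nu \<in> ?S then v nu else 0)"
      using fin by (simp add: sum.delta)
    finally show ?thesis
      using that assms by (simp add: lookup_add coefp_monomial_sym)
  qed
  show ?thesis
  proof (intro iffI conjI; (elim conjE exE)?)
    assume P: "unitri n lam P"
    then show Ps: "P \<in> sym_polys n" by (simp add: unitri_def)
    have "P = (\<Sum>mu\<in>lower n lam. const (coefp n P mu) * monomial_sym n mu)"
      using P by (intro sym_expand finite_lower) (auto simp: unitri_def lower_def)
    also have "\<dots> = monomial_sym n lam + (\<Sum>mu\<in>?S. const (coefp n P mu) * monomial_sym n mu)"
      unfolding S(1) using S(2) fin P by (simp add: unitri_def)
    finally show "\<exists>v. P = monomial_sym n lam + (\<Sum>mu\<in>?S. const (v mu) * monomial_sym n mu)"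
      by (intro exI[of _ "\<lambda>mu. coefp n P mu"])
  next
    fix v assume Ps: "P \<in> sym_polys n" and eq: "P = monomial_sym n lam + (\<Sum>mu\<in>?S. const (v mu) * monomial_sym n mu)"
    have cP: "coefp n P nu = (if nu = lam then 1 else if nu \<in> ?S then v nu else 0)" if "is_partition n nu" for nu
      unfolding eq by (rule c[OF that])
    show "unitri n lam P"
      unfolding unitri_def
    proof (intro conjI allI impI Ps)
      show "coefp n P lam = 1" using cP[OF assms] by simp
      fix mu assume "is_partition n mu" "coefp n P mu \<noteq> 0"
      then show "dominated n mu lam" using cP[of mu] by (auto simp: dominated_refl split: if_splits)
    qed
  qed
qed

text \<open>Summation by parts. As dominance compares partial sums, this form makes the weight
  strictly monotone.\<close>

lemma weight_partial_sums: "weight n a = (\<Sum>k<n. \<Sum>i<k. a i)"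
proof -
  have "(\<Sum>k<n. \<Sum>i<k. a i) = (\<Sum>k<n. \<Sum>i<n. if i < k then a i else 0)"
    by (intro sum.cong refl sum.mono_neutral_cong_left) auto
  also have "\<dots> = (\<Sum>i<n. \<Sum>k<n. if i < k then a i else 0)" by (rule sum.swap)
  also have "\<dots> = (\<Sum>i<n. card {k \<in> {..<n}. i < k} * a i)"
    by (intro sum.cong refl) (simp add: sum.If_cases Int_def)
  also have "\<dots> = weight n a"
    unfolding weight_def
  proof (intro sum.cong refl arg_cong2[of _ _ _ _ "(*)"])
    fix i assume "i \<in> {..<n}"
    then have "{k \<in> {..<n}. i < k} = {Suc i..<n}" by auto
    then show "card {k \<in> {..<n}. i < k} = n - 1 - i" by simp
  qed
  finally show ?thesis ..
qed

abbreviation lw :: "nat \<Rightarrow> nat list \<Rightarrow> nat" where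
  "lw n mu \<equiv> weight n ((!) mu)"

lemma dominated_weight_less:
  assumes "is_partition n mu" "is_partition n lam" "dominated n mu lam" "mu \<noteq> lam"
  shows "lw n mu < lw n lam"
proof -
  have len: "length mu = n" "length lam = n" using assms by (auto simp: is_partition_def)
  have le: "(\<Sum>i<k. mu ! i) \<le> (\<Sum>i<k. lam ! i)" if "k \<le> n" for k
    using dominated_iff_exp_dom[OF assms(1) len(2)] exp_dom_decr_iff[OF is_partition_decr[OF assms(1)]] assms(3) that by blast
  have "\<exists>k<n. (\<Sum>i<k. mu ! i) \<noteq> (\<Sum>i<k. lam ! i)"
  proof (rule ccontr)
    assume "\<not> (\<exists>k<n. (\<Sum>i<k. mu ! i) \<noteq> (\<Sum>i<k. lam ! i))"
    moreover have "(\<Sum>i<n. mu ! i) = (\<Sum>i<n. lam ! i)"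
      using assms(3) len by (simp add: dominated_def sum_list_nth_lessThan)
    ultimately have "(\<Sum>i<k. mu ! i) = (\<Sum>i<k. lam ! i)" if "k \<le> n" for k
      using that by (cases "k = n") auto
    from this[of "Suc _"] this have "mu ! i = lam ! i" if "i < n" for i
      using that by (metis Suc_leI add_left_cancel less_imp_le sum.lessThan_Suc)
    then show False using assms(4) len by (auto intro: nth_equalityI)
  qed
  then obtain k where k: "k < n" "(\<Sum>i<k. mu ! i) \<noteq> (\<Sum>i<k. lam ! i)" by blast
  show ?thesis
    unfolding weight_partial_sums
    by (rule sum_strict_mono_ex1) (use le k in \<open>auto intro!: bexI[of _ k] simp: le_less\<close>)
qed

section \<open>Bases that are unitriangular for dominance\<close>

definition down_closed :: "nat \<Rightarrow> nat list set \<Rightarrow> bool" where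
  "down_closed n S \<longleftrightarrow> (\<forall>mu\<in>S. is_partition n mu) \<and>
    (\<forall>mu\<in>S. \<forall>nu. is_partition n nu \<longrightarrow> dominated n nu mu \<longrightarrow> nu \<in> S)"

lemma down_closed_Par: "down_closed n (Par n d)"
  by (auto simp: down_closed_def Par_def dominated_def)

lemma down_closed_lower: "down_closed n (lower n lam)"
  by (auto simp: down_closed_def lower_def intro: dominated_trans)

lemma down_closed_strict_lower: "is_partition n lam \<Longrightarrow> down_closed n (lower n lam - {lam})"
  by (auto simp: down_closed_def lower_def intro: dominated_trans dest: dominated_antisym)

text \<open>Partitions are inserted in the order of their weights, so the new \<open>lam\<close>
  lies below none of the earlier ones and the rest stays closed downwards. Subtracting the right
  multiple of \<open>P lam\<close> removes \<open>lam\<close> and brings in only partitions below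
  it.\<close>

lemma unitri_expand:
  assumes "finite S" "down_closed n S"
    and P: "\<And>mu. mu \<in> S \<Longrightarrow> unitri n mu (P mu)"
    and "p \<in> sym_polys n" "\<And>mu. is_partition n mu \<Longrightarrow> coefp n p mu \<noteq> 0 \<Longrightarrow> mu \<in> S"
  shows "\<exists>c. p = (\<Sum>mu\<in>S. const (c mu) * P mu)"
  using assms
proof (induction S arbitrary: p rule: finite_ranking_induct[where f = "lw n"])
  case empty
  then have "p = 0" by (intro sym_polys_eqI[of _ n]) auto
  then show ?case by simp
next
  case (insert lam S)
  have lam: "is_partition n lam" using insert.prems by (auto simp: down_closed_def)
  show ?case
  proof (cases "lam \<in> S")
    case True
    then show ?thesis using insert.IH insert.prems by (simp add: insert_absorb)
  next
    case False
    have dS: "down_closed n S"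
      unfolding down_closed_def
    proof (intro conjI ballI allI impI)
      fix mu nu assume *: "mu \<in> S" "is_partition n nu" "dominated n nu mu"
      then have "nu \<in> insert lam S" "is_partition n mu" using insert.prems(1) by (auto simp: down_closed_def)
      moreover have "nu \<noteq> lam"
        using dominated_weight_less[of n lam mu] lam insert.hyps(2)[of mu] * False \<open>is_partition n mu\<close> by fastforce
      ultimately show "nu \<in> S" by simp
    qed (use insert.prems in \<open>auto simp: down_closed_def\<close>)
    have Pl: "unitri n lam (P lam)" using insert.prems by simp
    define q where "q = p - const (coefp n p lam) * P lam"
    have q: "q \<in> sym_polys n"
      using Pl insert.prems(3) by (auto simp: q_def unitri_def intro!: sym_polys_minus sym_polys_mult)
    have "mu \<in> S" if mu: "is_partition n mu" "coefp n q mu \<noteq> 0" for mu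
    proof -
      have "mu \<noteq> lam" using mu Pl by (auto simp: q_def lookup_minus unitri_def)
      moreover have "coefp n p mu \<noteq> 0 \<or> coefp n (P lam) mu \<noteq> 0"
        using mu by (auto simp: q_def lookup_minus)
      then have "mu \<in> insert lam S"
      proof
        assume "coefp n (P lam) mu \<noteq> 0"
        then have "dominated n mu lam" using Pl mu by (auto simp: unitri_def)
        then show ?thesis using insert.prems(1) mu by (auto simp: down_closed_def)
      qed (use insert.prems mu in blast)
      ultimately show ?thesis by simp
    qed
    then obtain c where c: "q = (\<Sum>mu\<in>S. const (c mu) * P mu)"
      using insert.IH[OF dS _ q] insert.prems(2) by auto
    have "p = (\<Sum>mu\<in>insert lam S. const ((c(lam := coefp n p lam)) mu) * P mu)"
    proof -
      have "(\<Sum>mu\<in>S. const ((c(lam := coefp n p lam)) mu) * P mu) = q"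
        unfolding c using False by (intro sum.cong) auto
      then show ?thesis using False insert.hyps(1) by (simp add: q_def)
    qed
    then show ?thesis by blast
  qed
qed

text \<open>Among the partitions with nonzero coefficient take one of maximal weight: no other
  polynomial of the relation contains its monomial.\<close>

lemma unitri_independent:
  assumes "finite S" "\<And>mu. mu \<in> S \<Longrightarrow> is_partition n mu" "\<And>mu. mu \<in> S \<Longrightarrow> unitri n mu (P mu)"
    and "(\<Sum>mu\<in>S. const (c mu) * P mu) = 0" "mu \<in> S"
  shows "c mu = 0"
proof (rule ccontr)
  assume "c mu \<noteq> 0"
  let ?T = "{mu \<in> S. c mu \<noteq> 0}"
  have T: "finite ?T" "?T \<noteq> {}" using assms \<open>c mu \<noteq> 0\<close> by auto
  define M where "M = Max (lw n ` ?T)"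
  have "M \<in> lw n ` ?T" unfolding M_def using T by (intro Max_in) auto
  then obtain lam where lam: "lam \<in> S" "c lam \<noteq> 0" "lw n lam = M" by auto
  have max: "lw n nu \<le> lw n lam" if "nu \<in> S" "c nu \<noteq> 0" for nu
    unfolding lam(3) M_def using that T by (intro Max_ge) auto
  have "0 = coefp n (\<Sum>mu\<in>S. const (c mu) * P mu) lam" using assms(4) by simp
  also have "\<dots> = (\<Sum>mu\<in>S. if mu = lam then c lam else 0)"
    unfolding lookup_sum
  proof (rule sum.cong[OF refl])
    fix nu assume nu: "nu \<in> S"
    show "coefp n (const (c nu) * P nu) lam = (if nu = lam then c lam else 0)"
    proof (cases "nu = lam")
      case True
      then show ?thesis using assms(3)[OF lam(1)] by (simp add: unitri_def)
    next
      case False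
      have "c nu = 0 \<or> coefp n (P nu) lam = 0"
      proof (rule ccontr)
        assume "\<not> ?thesis"
        then have "dominated n lam nu" "c nu \<noteq> 0"
          using assms(2)[OF lam(1)] assms(3)[OF nu] by (auto simp: unitri_def)
        then show False
          using dominated_weight_less[of n lam nu] assms(2) lam nu False max[of nu] by fastforce
      qed
      then show ?thesis using False by auto
    qed
  qed
  also have "\<dots> = c lam" using assms(1) lam by simp
  finally show False using lam by simp
qed

lemma unitri_independent_eval:
  assumes "finite S" "\<And>mu. mu \<in> S \<Longrightarrow> is_partition n mu" "\<And>mu. mu \<in> S \<Longrightarrow> unitri n mu (P mu)"
    and eq: "\<And>x::nat \<Rightarrow> real. strict_mono_on {..<n} x \<Longrightarrow>
      (\<Sum>mu\<in>S. c mu * eval_mpoly (\<lambda>i. of_real (x i)) (P mu)) = (\<Sum>mu\<in>S. c' mu * eval_mpoly (\<lambda>i. of_real (x i)) (P mu))"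
    and "mu \<in> S"
  shows "c mu = c' mu"
proof -
  have "(\<Sum>mu\<in>S. const (c mu - c' mu) * P mu) = 0"
  proof (rule mpoly_zeroI[of n])
    show "in_vars n (\<Sum>mu\<in>S. const (c mu - c' mu) * P mu)"
      using assms(3) by (intro in_vars_sum in_vars_mult in_vars_const) (auto simp: unitri_def intro: sym_polys_in_vars)
    fix x :: "nat \<Rightarrow> real" assume "strict_mono_on {..<n} x"
    from eq[OF this] show "eval_mpoly (\<lambda>i. of_real (x i)) (\<Sum>mu\<in>S. const (c mu - c' mu) * P mu) = 0"
      by (simp add: eval_mpoly_sum eval_mpoly_mult left_diff_distrib sum_subtractf)
  qed
  then have "c mu - c' mu = 0"
    using unitri_independent[OF assms(1-3), of "\<lambda>mu. c mu - c' mu"] assms(5) by blast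
  then show ?thesis by simp
qed

text \<open>Reality is tracked because the diagonal of the kernel matrix is a sum of squares with
  positive factors, and it is seen to be nonzero only for real expansion coefficients.\<close>

definition real_valued :: "mpoly \<Rightarrow> bool" where
  "real_valued p \<longleftrightarrow> (\<forall>x::nat \<Rightarrow> real. eval_mpoly (\<lambda>i. of_real (x i)) p \<in> \<real>)"

definition eigenp :: "nat \<Rightarrow> real \<Rightarrow> real \<Rightarrow> nat list \<Rightarrow> mpoly \<Rightarrow> bool" where
  "eigenp n g u lam P \<longleftrightarrow> unitri n lam P \<and> real_valued P \<and>
     D_op n g (of_real u) P = const (D_eval n g lam (of_real u)) * P"

lemma real_valued_add: "real_valued p \<Longrightarrow> real_valued q \<Longrightarrow> real_valued (p + q)"
  by (simp add: real_valued_def eval_mpoly_add)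

lemma real_valued_minus: "real_valued p \<Longrightarrow> real_valued q \<Longrightarrow> real_valued (p - q)"
  by (simp add: real_valued_def eval_mpoly_minus)

lemma real_valued_mult: "real_valued p \<Longrightarrow> real_valued q \<Longrightarrow> real_valued (p * q)"
  by (simp add: real_valued_def eval_mpoly_mult)

lemma real_valued_const: "c \<in> \<real> \<Longrightarrow> real_valued (const c)"
  by (simp add: real_valued_def)

lemma real_valued_sum: "(\<And>a. a \<in> A \<Longrightarrow> real_valued (f a)) \<Longrightarrow> real_valued (sum f A)"
  by (simp add: real_valued_def eval_mpoly_sum sum_in_Reals)

lemma real_valued_monomial_sym: "real_valued (monomial_sym n lam)"
  by (auto simp: real_valued_def monomial_sym_def eval_mpoly_sum eval_mpoly_prod eval_mpoly_power
      intro!: sum_in_Reals prod_in_Reals Reals_power)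

lemma D_eval_real: "D_eval n g lam (of_real u) \<in> \<real>"
  by (auto simp: D_eval_def intro!: prod_in_Reals Reals_add Reals_mult)

definition cnj_mpoly :: "mpoly \<Rightarrow> mpoly" where
  "cnj_mpoly p = (\<Sum>m\<in>keys p. single m (cnj (lookup p m)))"

lemma lookup_cnj_mpoly: "lookup (cnj_mpoly p) m = cnj (lookup p m)"
  by (auto simp: cnj_mpoly_def lookup_sum lookup_single when_def in_keys_iff)

lemma eval_cnj_mpoly:
  fixes x :: "nat \<Rightarrow> real"
  shows "eval_mpoly (\<lambda>i. of_real (x i)) (cnj_mpoly p) = cnj (eval_mpoly (\<lambda>i. of_real (x i)) p)"
  by (simp add: cnj_mpoly_def eval_mpoly_sum eval_mpoly_single eval_mpoly_superset[OF finite_keys order_refl, of _ p] meval_def)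

lemma cnj_mpoly_eq_iff: "cnj_mpoly p = p \<longleftrightarrow> (\<forall>m. lookup p m \<in> \<real>)"
  by (simp add: poly_mapping_eq_iff fun_eq_iff lookup_cnj_mpoly Reals_cnj_iff)

lemma in_vars_cnj: "in_vars n p \<Longrightarrow> in_vars n (cnj_mpoly p)"
  by (simp add: in_vars_def in_keys_iff lookup_cnj_mpoly)

lemma real_valued_coeffs:
  assumes "in_vars n p" "\<And>x::nat \<Rightarrow> real. strict_mono_on {..<n} x \<Longrightarrow> eval_mpoly (\<lambda>i. of_real (x i)) p \<in> \<real>"
  shows "lookup p m \<in> \<real>"
proof -
  have "cnj_mpoly p = p"
    using assms by (intro mpoly_eqI_eval[of n]) (auto simp: in_vars_cnj eval_cnj_mpoly Reals_cnj_iff)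
  then show ?thesis by (simp add: cnj_mpoly_eq_iff)
qed

lemma real_valued_iff_coeffs:
  assumes "in_vars n p"
  shows "real_valued p \<longleftrightarrow> (\<forall>m. lookup p m \<in> \<real>)"
proof
  assume "\<forall>m. lookup p m \<in> \<real>"
  then have "cnj_mpoly p = p" by (simp add: cnj_mpoly_eq_iff)
  then show "real_valued p" unfolding real_valued_def by (metis Reals_cnj_iff eval_cnj_mpoly)
qed (use real_valued_coeffs[OF assms] in \<open>auto simp: real_valued_def\<close>)

lemma real_valued_D_op:
  assumes p: "p \<in> sym_polys n" "real_valued p"
  shows "real_valued (D_op n g (of_real u) p)"
proof -
  have pr: "lookup p m \<in> \<real>" for m
    using p real_valued_iff_coeffs[OF sym_polys_in_vars[OF p(1)]] by blast
  have D: "eval_mpoly (\<lambda>i. of_real (x i)) (D_det n g (of_real u) p) \<in> \<real>" for x :: "nat \<Rightarrow> real"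
    unfolding D_det_eq[OF sym_polys_in_vars[OF p(1)]] eval_mpoly_sum eval_mpoly_single meval_expvec D_coef_def
    by (intro sum_in_Reals Reals_mult prod_in_Reals Reals_add Reals_of_nat Reals_of_real Reals_power Reals_of_int pr)
  have "eval_mpoly (\<lambda>i. of_real (x i)) (D_op n g (of_real u) p) \<in> \<real>"
    if x: "strict_mono_on {..<n} x" for x :: "nat \<Rightarrow> real"
  proof -
    let ?x = "\<lambda>i. complex_of_real (x i)"
    have "vandermonde n ?x * eval_mpoly ?x (D_op n g (of_real u) p) = (-1) ^ (n * (n - 1) div 2) * eval_mpoly ?x (D_det n g (of_real u) p)"
      using arg_cong[OF D_op_eq[OF p(1), of g "of_real u"], of "eval_mpoly ?x"]
      by (simp add: eval_mpoly_mult eval_vandermonde eval_mpoly_power eval_mpoly_uminus)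
    then have "eval_mpoly ?x (D_op n g (of_real u) p) = (-1) ^ (n * (n - 1) div 2) * eval_mpoly ?x (D_det n g (of_real u) p) / vandermonde n ?x"
      using vandermonde_increasing_nonzero[OF x] by (simp add: field_simps)
    moreover have "vandermonde n ?x \<in> \<real>"
      unfolding vandermonde_def by (intro prod_in_Reals Reals_diff Reals_of_real)
    ultimately show ?thesis
      using D by (auto intro!: Reals_divide Reals_mult Reals_power)
  qed
  then show ?thesis
    using real_valued_coeffs[OF in_vars_D_op[OF p(1)]] real_valued_iff_coeffs[OF in_vars_D_op[OF p(1)]] by blast
qed

text \<open>Conjugating the values at real points fixes \<open>p\<close> and all
  \<open>P mu\<close>, so the conjugated coefficients belong to the same expansion.\<close>

lemma unitri_expand_real:
  assumes "finite S" "\<And>mu. mu \<in> S \<Longrightarrow> is_partition n mu"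
    and "\<And>mu. mu \<in> S \<Longrightarrow> unitri n mu (P mu)" "\<And>mu. mu \<in> S \<Longrightarrow> real_valued (P mu)"
    and p: "p = (\<Sum>mu\<in>S. const (c mu) * P mu)" "real_valued p" and "mu \<in> S"
  shows "c mu \<in> \<real>"
proof -
  have "cnj (c mu) = c mu"
  proof (rule unitri_independent_eval[OF assms(1-3)])
    fix x :: "nat \<Rightarrow> real"
    let ?e = "eval_mpoly (\<lambda>i. of_real (x i))"
    have "cnj (?e (P mu)) = ?e (P mu)" if "mu \<in> S" for mu
      using assms(4)[OF that] by (simp add: real_valued_def Reals_cnj_iff)
    then have "(\<Sum>mu\<in>S. cnj (c mu) * ?e (P mu)) = cnj (?e p)"
      by (simp add: p(1) eval_mpoly_sum eval_mpoly_mult)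
    also have "\<dots> = ?e p" using p(2) by (simp add: real_valued_def Reals_cnj_iff)
    finally show "(\<Sum>mu\<in>S. cnj (c mu) * ?e (P mu)) = (\<Sum>mu\<in>S. c mu * ?e (P mu))"
      by (simp add: p(1) eval_mpoly_sum eval_mpoly_mult)
  qed (use assms(7) in auto)
  then show ?thesis by (simp add: Reals_cnj_iff)
qed

lemma unitri_monomial_sym:
  assumes "is_partition n lam"
  shows "unitri n lam (monomial_sym n lam)"
  using assms by (auto simp: unitri_def coefp_monomial_sym monomial_sym_sym is_partition_def dominated_refl
      split: if_splits)

lemma unitri_supp_exp_dom:
  assumes "is_partition n lam" "unitri n lam P"
  shows "supp_exp_dom n ((!) lam) P"
  using assms supp_exp_dom_iff_lower[of P n lam] by (auto simp: unitri_def lower_def is_partition_def)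

lemma D_op_unitri_lower:
  assumes lam: "is_partition n lam" and P: "unitri n lam P"
    and mu: "is_partition n mu" "coefp n (D_op n g u P - const (D_eval n g lam u) * P) mu \<noteq> 0"
  shows "mu \<in> lower n lam - {lam}"
proof -
  have Ps: "P \<in> sym_polys n" using P by (simp add: unitri_def)
  have len: "length lam = n" using lam by (simp add: is_partition_def)
  have "supp_exp_dom n ((!) lam) (D_op n g u P)"
    by (rule supp_exp_dom_D_op[OF Ps unitri_supp_exp_dom[OF lam P]])
  then have low: "nu \<in> lower n lam" if "is_partition n nu" "coefp n (D_op n g u P) nu \<noteq> 0" for nu
    using supp_exp_dom_iff_lower[OF D_op_sym[OF Ps] len] that by blast
  have "coefp n (D_op n g u P) lam = D_eval n g lam u"
    using lookup_D_op_leading[OF Ps unitri_supp_exp_dom[OF lam P] is_partition_decr[OF lam]] P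
    by (simp add: D_coef_id unitri_def)
  then have "mu \<noteq> lam" using mu P by (auto simp: lookup_minus unitri_def)
  moreover have "mu \<in> lower n lam"
  proof (cases "coefp n P mu = 0")
    case True
    then show ?thesis using low mu by (simp add: lookup_minus)
  next
    case False
    then show ?thesis using P mu by (simp add: unitri_def lower_def)
  qed
  ultimately show ?thesis by simp
qed

text \<open>Subtracting the eigenvalue of \<open>lam\<close> from \<open>D\<close> maps
  \<open>monomial_sym n lam\<close> into the span of the eigenvectors strictly below
  \<open>lam\<close>. Each component of this defect is corrected after division by the difference of
  the two eigenvalues, which is nonzero by \<open>inj\<close>.\<close>

lemma eigenp_exists:
  assumes inj: "inj_on (\<lambda>mu. D_eval n g mu (of_real u)) (Par n d)" and "lam \<in> Par n d"
  shows "\<exists>P. eigenp n g u lam P"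
  using assms(2)
proof (induction "lw n lam" arbitrary: lam rule: less_induct)
  case less
  let ?u = "complex_of_real u" and ?S = "lower n lam - {lam}"
  have lam: "is_partition n lam" using less.prems by (simp add: Par_def)
  have SP: "mu \<in> Par n d" "is_partition n mu" "lw n mu < lw n lam" if "mu \<in> ?S" for mu
    using that less.prems dominated_weight_less[OF _ lam] by (auto simp: lower_def Par_def dominated_def)
  have "\<forall>mu\<in>?S. \<exists>P. eigenp n g u mu P" using less.hyps SP by blast
  then obtain P where P: "\<And>mu. mu \<in> ?S \<Longrightarrow> eigenp n g u mu (P mu)" by metis
  let ?m = "monomial_sym n lam" and ?d = "\<lambda>mu. D_eval n g mu ?u"
  have m: "unitri n lam ?m" by (rule unitri_monomial_sym[OF lam])
  then have ms: "?m \<in> sym_polys n" by (simp add: unitri_def)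
  have "\<exists>c. D_op n g ?u ?m - const (?d lam) * ?m = (\<Sum>mu\<in>?S. const (c mu) * P mu)"
  proof (rule unitri_expand)
    show "D_op n g ?u ?m - const (?d lam) * ?m \<in> sym_polys n"
      using ms by (intro sym_polys_minus sym_polys_mult D_op_sym) auto
  qed (use P down_closed_strict_lower[OF lam] D_op_unitri_lower[OF lam m] in \<open>auto simp: eigenp_def\<close>)
  then obtain c where c: "D_op n g ?u ?m - const (?d lam) * ?m = (\<Sum>mu\<in>?S. const (c mu) * P mu)" ..
  have cr: "c mu \<in> \<real>" if "mu \<in> ?S" for mu
  proof (rule unitri_expand_real[OF _ _ _ _ c])
    show "real_valued (D_op n g ?u ?m - const (?d lam) * ?m)"
      using ms by (intro real_valued_minus real_valued_mult real_valued_D_op real_valued_const real_valued_monomial_sym D_eval_real)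
  qed (use P SP that in \<open>auto simp: eigenp_def\<close>)
  have dne: "?d lam - ?d mu \<noteq> 0" if "mu \<in> ?S" for mu
    using inj SP(1)[OF that] less.prems that by (auto simp: inj_on_def)
  define R where "R = ?m + (\<Sum>mu\<in>?S. const (c mu / (?d lam - ?d mu)) * P mu)"
  have Ps: "P mu \<in> sym_polys n" if "mu \<in> ?S" for mu using P[OF that] by (simp add: eigenp_def unitri_def)
  have Rs: "R \<in> sym_polys n"
    unfolding R_def using ms Ps by (intro sym_polys_add sym_polys_sum sym_polys_mult) auto
  have coef: "coefp n R nu = coefp n ?m nu + (\<Sum>mu\<in>?S. c mu / (?d lam - ?d mu) * coefp n (P mu) nu)" for nu
    by (simp add: R_def lookup_add lookup_sum)
  have "unitri n lam R"
    unfolding unitri_def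
  proof (intro conjI allI impI Rs)
    have "coefp n (P mu) lam = 0" if "mu \<in> ?S" for mu
    proof (rule ccontr)
      assume "coefp n (P mu) lam \<noteq> 0"
      then have "dominated n lam mu" using P[OF that] lam by (auto simp: eigenp_def unitri_def)
      then show False using dominated_weight_less[OF lam, of mu] SP[OF that] by fastforce
    qed
    then show "coefp n R lam = 1" unfolding coef using m by (simp add: unitri_def)
  next
    fix nu assume nu: "is_partition n nu" "coefp n R nu \<noteq> 0"
    show "dominated n nu lam"
    proof (rule ccontr)
      assume nd: "\<not> dominated n nu lam"
      have "coefp n (P mu) nu = 0" if "mu \<in> ?S" for mu
      proof (rule ccontr)
        assume "coefp n (P mu) nu \<noteq> 0"
        then have "dominated n nu mu" using P[OF that] nu by (auto simp: eigenp_def unitri_def)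
        then show False using nd that by (auto simp: lower_def dest: dominated_trans)
      qed
      moreover have "coefp n ?m nu = 0" using m nd nu by (auto simp: unitri_def)
      ultimately show False using nu unfolding coef by simp
    qed
  qed
  moreover have "real_valued R"
    unfolding R_def using P cr
    by (intro real_valued_add real_valued_sum real_valued_mult real_valued_const real_valued_monomial_sym Reals_divide Reals_diff D_eval_real)
      (auto simp: eigenp_def)
  moreover have "D_op n g ?u R = const (?d lam) * R"
  proof -
    have "D_op n g ?u R = D_op n g ?u ?m + (\<Sum>mu\<in>?S. D_op n g ?u (const (c mu / (?d lam - ?d mu)) * P mu))"
      unfolding R_def using ms Ps by (subst D_op_add; (subst D_op_sum)?) (auto intro!: sym_polys_sum sym_polys_mult)
    also have "(\<Sum>mu\<in>?S. D_op n g ?u (const (c mu / (?d lam - ?d mu)) * P mu)) =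
        (\<Sum>mu\<in>?S. const (c mu / (?d lam - ?d mu) * ?d mu) * P mu)"
    proof (rule sum.cong[OF refl])
      fix mu assume "mu \<in> ?S"
      then show "D_op n g ?u (const (c mu / (?d lam - ?d mu)) * P mu) = const (c mu / (?d lam - ?d mu) * ?d mu) * P mu"
        unfolding const_mult mult.assoc using P Ps by (simp only: D_op_const_mult eigenp_def)
    qed
    also have "D_op n g ?u ?m = const (?d lam) * ?m + (\<Sum>mu\<in>?S. const (c mu) * P mu)"
      using c by (simp add: algebra_simps)
    also have "const (?d lam) * ?m + (\<Sum>mu\<in>?S. const (c mu) * P mu) + (\<Sum>mu\<in>?S. const (c mu / (?d lam - ?d mu) * ?d mu) * P mu) =
      const (?d lam) * ?m + (\<Sum>mu\<in>?S. const (c mu + c mu / (?d lam - ?d mu) * ?d mu) * P mu)"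
      by (simp add: sum.distrib const_add distrib_right add.assoc)
    also have "(\<Sum>mu\<in>?S. const (c mu + c mu / (?d lam - ?d mu) * ?d mu) * P mu) =
       (\<Sum>mu\<in>?S. const (?d lam) * (const (c mu / (?d lam - ?d mu)) * P mu))"
    proof (rule sum.cong[OF refl])
      fix mu assume "mu \<in> ?S"
      then have "c mu + c mu / (?d lam - ?d mu) * ?d mu = ?d lam * (c mu / (?d lam - ?d mu))"
        using dne by (simp add: field_simps)
      then show "const (c mu + c mu / (?d lam - ?d mu) * ?d mu) * P mu = const (?d lam) * (const (c mu / (?d lam - ?d mu)) * P mu)"
        by (simp only: const_mult mult.assoc)
    qed
    also have "const (?d lam) * ?m + \<dots> = const (?d lam) * R"
      by (simp add: R_def sum_distrib_left distrib_left)
    finally show ?thesis .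
  qed
  ultimately show ?case unfolding eigenp_def by blast
qed

lemma coefp_pspoly_degree:
  assumes "\<alpha> \<in> compos d" "is_partition n mu" "coefp n (pspoly n \<alpha>) mu \<noteq> 0"
  shows "mu \<in> Par n d"
proof -
  have "(\<Sum>i<n. lookup m i) = sum_list \<alpha>" if "m \<in> keys (pspoly n \<alpha>)" for m \<alpha>
    using that
  proof (induction \<alpha> arbitrary: m)
    case Nil
    then show ?case by (simp add: pspoly_def)
  next
    case (Cons k \<alpha>)
    have "pspoly n (k # \<alpha>) = (\<Sum>i<n. var i ^ k) * pspoly n \<alpha>" by (simp add: pspoly_def)
    then obtain a b where ab: "a \<in> keys (\<Sum>i<n. var i ^ k)" "b \<in> keys (pspoly n \<alpha>)" "m = a + b"
      using Cons.prems Poly_Mapping.keys_mult[of "\<Sum>i<n. var i ^ k" "pspoly n \<alpha>"] by auto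
    have "a \<in> (\<Union>i<n. keys (var i ^ k))" using ab(1)
      by (metis (no_types, lifting) Poly_Mapping.in_keys_iff UN_iff lookup_sum sum.neutral)
    then obtain i where i: "i < n" "a = single i k" by (auto simp: var_power)
    have "(\<Sum>j<n. lookup a j) = k"
      using i by (simp add: lookup_single when_def)
    then show ?case using Cons.IH[OF ab(2)] ab(3) by (simp add: lookup_add sum.distrib)
  qed
  from this[of "expvec n ((!) mu)" \<alpha>] have "(\<Sum>i<n. mu ! i) = sum_list \<alpha>"
    using assms(3) by (simp add: in_keys_iff lookup_expvec)
  then show ?thesis using assms by (simp add: Par_def compos_def is_partition_def sum_list_nth_lessThan)
qed

lemma real_valued_pspoly: "real_valued (pspoly n \<alpha>)"
proof -
  have "psl n \<alpha> (\<lambda>i. of_real (x i)) \<in> \<real>" for x :: "nat \<Rightarrow> real"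
    unfolding psl_def psum_def by (induction \<alpha>) (auto intro!: Reals_mult sum_in_Reals Reals_power)
  then show ?thesis by (simp add: real_valued_def)
qed

lemma D_op_kerp_symmetric:
  fixes x y :: "nat \<Rightarrow> real"
  assumes "g \<noteq> 0" and x: "strict_mono_on {..<n} x" and y: "strict_mono_on {..<n} y"
  shows "eval_mpoly (\<lambda>i. of_real (x i)) (D_op n g u (kerp n n g d (\<lambda>i. of_real (y i)))) =
    eval_mpoly (\<lambda>i. of_real (y i)) (D_op n g u (kerp n n g d (\<lambda>i. of_real (x i))))"
proof -
  let ?x = "\<lambda>i. complex_of_real (x i)" and ?y = "\<lambda>i. complex_of_real (y i)"
  have vx: "vandermonde n ?x \<noteq> 0" and vy: "vandermonde n ?y \<noteq> 0"
    using vandermonde_increasing_nonzero x y by blast+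
  have eq: "eval_mpoly z (D_det n g u p) = (-1) ^ (n * (n - 1) div 2) * (vandermonde n z * eval_mpoly z (D_op n g u p))"
    if "p \<in> sym_polys n" for z p
    using arg_cong[OF D_op_eq'[OF that, of g u, symmetric], of "eval_mpoly z"]
    by (simp add: eval_mpoly_mult eval_vandermonde eval_mpoly_power eval_mpoly_uminus)
  have "(-1) ^ (n * (n - 1) div 2) * (vandermonde n ?x * vandermonde n ?y * eval_mpoly ?x (D_op n g u (kerp n n g d ?y))) =
    (-1) ^ (n * (n - 1) div 2) * (vandermonde n ?x * vandermonde n ?y * eval_mpoly ?y (D_op n g u (kerp n n g d ?x)))"
    using D_det_kerp_symmetric[OF assms(1) vx vy, of u d] by (simp add: eq mult_ac)
  then show ?thesis using vx vy by simp
qed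

lemma kerp_eq_power_sums:
  "kerp n m g d y = (\<Sum>\<alpha>\<in>compos d. const (of_real (pcoef g \<alpha>) * psl m \<alpha> y) * pspoly n \<alpha>)"
proof (rule mpoly_eqI_eval[of n])
  fix x :: "nat \<Rightarrow> real"
  show "eval_mpoly (\<lambda>i. of_real (x i)) (kerp n m g d y) =
    eval_mpoly (\<lambda>i. of_real (x i)) (\<Sum>\<alpha>\<in>compos d. const (of_real (pcoef g \<alpha>) * psl m \<alpha> y) * pspoly n \<alpha>)"
    unfolding eval_kerp kernel_power_sums eval_mpoly_sum eval_mpoly_mult eval_mpoly_const eval_pspoly
    by (simp only: mult_ac)
qed (auto simp: sym_polys_in_vars intro!: in_vars_sum in_vars_mult)

section \<open>The matrix of the Cauchy kernel in a unitriangular basis\<close>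

context
  fixes n d :: nat and g :: real and P :: "nat list \<Rightarrow> mpoly"
  assumes g: "g > 0"
    and P: "\<And>mu. mu \<in> Par n d \<Longrightarrow> unitri n mu (P mu)" "\<And>mu. mu \<in> Par n d \<Longrightarrow> real_valued (P mu)"
begin

private abbreviation (input) "ev x \<equiv> eval_mpoly (\<lambda>i. complex_of_real (x i))"

private lemma Ps: "mu \<in> Par n d \<Longrightarrow> P mu \<in> sym_polys n"
  using P(1) by (simp add: unitri_def)

private lemma Pp: "mu \<in> Par n d \<Longrightarrow> is_partition n mu"
  by (simp add: Par_def)

private lemma pspoly_expand: "\<alpha> \<in> compos d \<Longrightarrow> \<exists>c. pspoly n \<alpha> = (\<Sum>mu\<in>Par n d. const (c mu) * P mu)"
  by (rule unitri_expand[where n = n]) (auto simp: down_closed_Par P coefp_pspoly_degree)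

private definition "tc \<alpha> = (SOME c. pspoly n \<alpha> = (\<Sum>mu\<in>Par n d. const (c mu) * P mu))"

private lemma tc: "\<alpha> \<in> compos d \<Longrightarrow> pspoly n \<alpha> = (\<Sum>mu\<in>Par n d. const (tc \<alpha> mu) * P mu)"
  using someI_ex[OF pspoly_expand[of \<alpha>]] unfolding tc_def by blast

private lemma tc_real: "\<alpha> \<in> compos d \<Longrightarrow> mu \<in> Par n d \<Longrightarrow> tc \<alpha> mu \<in> \<real>"
  by (rule unitri_expand_real[OF finite_Par Pp P tc real_valued_pspoly])

text \<open>The coefficient of \<open>P lam\<close> in \<open>y\<close> times \<open>P mu\<close> in
  \<open>x\<close> in the Cauchy kernel, obtained by expanding power sums in the basis
  \<open>P\<close>. The matrix is symmetric and, as \<open>pcoef\<close> is positive and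
  \<open>tc\<close> real, positive semidefinite.\<close>

definition Bmat :: "nat list \<Rightarrow> nat list \<Rightarrow> complex" where
  "Bmat lam mu = (\<Sum>\<alpha>\<in>compos d. of_real (pcoef g \<alpha>) * tc \<alpha> lam * tc \<alpha> mu)"

private lemma Bmat_commute: "Bmat lam mu = Bmat mu lam"
  by (simp add: Bmat_def mult_ac)

private lemma psl_eq: "\<alpha> \<in> compos d \<Longrightarrow> psl n \<alpha> x = (\<Sum>mu\<in>Par n d. tc \<alpha> mu * eval_mpoly x (P mu))"
  using arg_cong[OF tc, of \<alpha> "eval_mpoly x"] by (simp add: eval_mpoly_sum eval_mpoly_mult)

private lemma kerp_eq: "kerp n n g d y = (\<Sum>mu\<in>Par n d. const (\<Sum>lam\<in>Par n d. Bmat lam mu * eval_mpoly y (P lam)) * P mu)"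
proof -
  have "kerp n n g d y = (\<Sum>\<alpha>\<in>compos d. \<Sum>mu\<in>Par n d. const (of_real (pcoef g \<alpha>) * psl n \<alpha> y * tc \<alpha> mu) * P mu)"
    unfolding kerp_eq_power_sums
  proof (rule sum.cong[OF refl])
    fix \<alpha> assume "\<alpha> \<in> compos d"
    then show "const (of_real (pcoef g \<alpha>) * psl n \<alpha> y) * pspoly n \<alpha> = (\<Sum>mu\<in>Par n d. const (of_real (pcoef g \<alpha>) * psl n \<alpha> y * tc \<alpha> mu) * P mu)"
      by (simp only: tc sum_distrib_left const_mult mult.assoc)
  qed
  also have "\<dots> = (\<Sum>mu\<in>Par n d. const (\<Sum>\<alpha>\<in>compos d. of_real (pcoef g \<alpha>) * psl n \<alpha> y * tc \<alpha> mu) * P mu)"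
    by (subst sum.swap) (simp add: const_sum sum_distrib_right)
  also have "\<dots> = (\<Sum>mu\<in>Par n d. const (\<Sum>lam\<in>Par n d. Bmat lam mu * eval_mpoly y (P lam)) * P mu)"
  proof (rule sum.cong[OF refl])
    fix mu
    have "(\<Sum>\<alpha>\<in>compos d. of_real (pcoef g \<alpha>) * psl n \<alpha> y * tc \<alpha> mu) =
      (\<Sum>\<alpha>\<in>compos d. \<Sum>lam\<in>Par n d. of_real (pcoef g \<alpha>) * tc \<alpha> lam * tc \<alpha> mu * eval_mpoly y (P lam))"
      by (intro sum.cong refl) (simp add: psl_eq sum_distrib_left sum_distrib_right mult_ac)
    also have "\<dots> = (\<Sum>lam\<in>Par n d. Bmat lam mu * eval_mpoly y (P lam))"
      by (subst sum.swap) (simp add: Bmat_def sum_distrib_right)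
    finally show "const (\<Sum>\<alpha>\<in>compos d. of_real (pcoef g \<alpha>) * psl n \<alpha> y * tc \<alpha> mu) * P mu =
      const (\<Sum>lam\<in>Par n d. Bmat lam mu * eval_mpoly y (P lam)) * P mu" by (simp only:)
  qed
  finally show ?thesis .
qed

text \<open>\<open>D u\<close> may be applied to the kernel in \<open>x\<close> or in
  \<open>y\<close> with the same result; comparing coefficients in both sets of variables shows that
  the product of \<open>Bmat\<close> with the matrix \<open>e\<close> of \<open>D u\<close> is
  symmetric.\<close>

private lemma Bmat_e_commute:
  assumes e: "\<And>mu. mu \<in> Par n d \<Longrightarrow> D_op n g u (P mu) = (\<Sum>nu\<in>Par n d. const (e mu nu) * P nu)"
    and "lam \<in> Par n d" "nu \<in> Par n d"
  shows "(\<Sum>mu\<in>Par n d. Bmat lam mu * e mu nu) = (\<Sum>mu\<in>Par n d. Bmat nu mu * e mu lam)"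
proof -
  define C where "C lam nu = (\<Sum>mu\<in>Par n d. Bmat lam mu * e mu nu)" for lam nu
  have D: "ev x (D_op n g u (kerp n n g d (\<lambda>i. of_real (y i)))) = (\<Sum>lam\<in>Par n d. (\<Sum>nu\<in>Par n d. C lam nu * ev x (P nu)) * ev y (P lam))"
    for x y :: "nat \<Rightarrow> real"
  proof -
    have "ev x (D_op n g u (kerp n n g d (\<lambda>i. of_real (y i)))) =
      (\<Sum>mu\<in>Par n d. (\<Sum>lam\<in>Par n d. Bmat lam mu * ev y (P lam)) * (\<Sum>nu\<in>Par n d. e mu nu * ev x (P nu)))"
      unfolding kerp_eq
      by (subst D_op_sum) (auto simp: Ps sym_polys_mult D_op_const_mult e eval_mpoly_sum eval_mpoly_mult)
    also have "\<dots> = (\<Sum>mu\<in>Par n d. \<Sum>lam\<in>Par n d. \<Sum>nu\<in>Par n d. Bmat lam mu * e mu nu * ev x (P nu) * ev y (P lam))"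
      unfolding sum_product by (simp only: mult_ac)
    also have "\<dots> = (\<Sum>lam\<in>Par n d. \<Sum>nu\<in>Par n d. \<Sum>mu\<in>Par n d. Bmat lam mu * e mu nu * ev x (P nu) * ev y (P lam))"
      by (subst sum.swap) (rule sum.cong[OF refl], rule sum.swap)
    finally show ?thesis by (simp add: C_def sum_distrib_right)
  qed
  have ind: "c mu = c' mu" if "\<And>x::nat \<Rightarrow> real. strict_mono_on {..<n} x \<Longrightarrow>
      (\<Sum>mu\<in>Par n d. c mu * ev x (P mu)) = (\<Sum>mu\<in>Par n d. c' mu * ev x (P mu))" "mu \<in> Par n d" for c c' mu
    using unitri_independent_eval[OF finite_Par Pp P(1) that] by blast
  have 1: "(\<Sum>nu\<in>Par n d. C lam nu * ev x (P nu)) = (\<Sum>nu\<in>Par n d. C nu lam * ev x (P nu))"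
    if x: "strict_mono_on {..<n} x" "lam \<in> Par n d" for lam and x :: "nat \<Rightarrow> real"
  proof (rule ind[OF _ that(2)])
    fix y :: "nat \<Rightarrow> real" assume y: "strict_mono_on {..<n} y"
    have "(\<Sum>lam\<in>Par n d. (\<Sum>nu\<in>Par n d. C lam nu * ev x (P nu)) * ev y (P lam)) =
      (\<Sum>nu\<in>Par n d. (\<Sum>lam\<in>Par n d. C nu lam * ev y (P lam)) * ev x (P nu))"
      using D_op_kerp_symmetric[OF _ x(1) y, of g u d] g unfolding D by simp
    also have "\<dots> = (\<Sum>lam\<in>Par n d. (\<Sum>nu\<in>Par n d. C nu lam * ev x (P nu)) * ev y (P lam))"
      unfolding sum_distrib_right by (subst sum.swap) (simp add: mult_ac)
    finally show "(\<Sum>lam\<in>Par n d. (\<Sum>nu\<in>Par n d. C lam nu * ev x (P nu)) * ev y (P lam)) = \<dots>" .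
  qed
  have "C lam nu = C nu lam"
    by (rule ind[OF _ assms(3), of "C lam" "\<lambda>nu. C nu lam"]) (use 1 assms(2) in blast)
  then show ?thesis by (simp add: C_def)
qed

text \<open>If the diagonal entry vanished, so would every term of the sum of squares, and
  \<open>P lam\<close> would occur in no product of power sums of degree \<open>d\<close>; but
  \<open>P lam\<close> is itself a combination of such products.\<close>

private lemma Bmat_diag_pos:
  assumes "lam \<in> Par n d"
  shows "Bmat lam lam \<noteq> 0"
proof
  assume 0: "Bmat lam lam = 0"
  define t where "t \<alpha> = Re (tc \<alpha> lam)" for \<alpha>
  have t: "tc \<alpha> lam = of_real (t \<alpha>)" if "\<alpha> \<in> compos d" for \<alpha>
    using tc_real[OF that assms] by (simp add: t_def complex_is_Real_iff complex_eq_iff)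
  have "complex_of_real (\<Sum>\<alpha>\<in>compos d. pcoef g \<alpha> * t \<alpha> ^ 2) = Bmat lam lam"
    by (simp add: Bmat_def t power2_eq_square mult.assoc)
  then have "(\<Sum>\<alpha>\<in>compos d. pcoef g \<alpha> * t \<alpha> ^ 2) = 0" using 0 by (metis of_real_eq_0_iff)
  then have "\<forall>\<alpha>\<in>compos d. pcoef g \<alpha> * t \<alpha> ^ 2 = 0"
    using pcoef_pos[OF g] by (subst (asm) sum_nonneg_eq_0_iff) (auto simp: finite_compos less_imp_le)
  then have t0: "tc \<alpha> lam = 0" if "\<alpha> \<in> compos d" for \<alpha>
    using pcoef_pos[OF g that] t[OF that] that by fastforce
  have "(\<Sum>i<n. lookup m i) = d" if m: "m \<in> keys (P lam)" for m
  proof -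
    have iv: "in_vars n (P lam)" using Ps[OF assms] by (rule sym_polys_in_vars)
    have "lookup (P lam) (expvec n (lookup m)) \<noteq> 0"
      using m iv by (simp add: in_vars_def expvec_lookup in_keys_iff)
    then have "exp_dom n (lookup m) ((!) lam)"
      using unitri_supp_exp_dom[OF Pp[OF assms] P(1)[OF assms]] by (auto simp: supp_exp_dom_def)
    then show ?thesis using assms sum_list_nth_lessThan[of lam n] by (simp add: exp_dom_def Par_def is_partition_def)
  qed
  then have "psum_span n d (\<lambda>x. eval_mpoly x (P lam))"
    by (intro sym_homogeneous_psum_span Ps assms)
  then obtain s where s: "\<And>x. eval_mpoly x (P lam) = (\<Sum>\<alpha>\<in>compos d. s \<alpha> * psl n \<alpha> x)"
    by (auto simp: psum_span_def)
  have "(if lam = lam then 1 else 0) = (\<Sum>\<alpha>\<in>compos d. s \<alpha> * tc \<alpha> lam)"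
  proof (rule unitri_independent_eval[OF finite_Par Pp P(1) _ assms, of "\<lambda>mu. if mu = lam then 1 else 0" "\<lambda>mu. \<Sum>\<alpha>\<in>compos d. s \<alpha> * tc \<alpha> mu"])
    fix x :: "nat \<Rightarrow> real"
    have "(\<Sum>mu\<in>Par n d. (if mu = lam then 1 else 0) * ev x (P mu)) = ev x (P lam)"
      using assms by (simp add: if_distrib[of "\<lambda>z. z * _"] cong: if_cong)
    also have "\<dots> = (\<Sum>\<alpha>\<in>compos d. \<Sum>mu\<in>Par n d. s \<alpha> * tc \<alpha> mu * ev x (P mu))"
      unfolding s by (intro sum.cong refl) (simp add: psl_eq sum_distrib_left mult_ac)
    also have "\<dots> = (\<Sum>mu\<in>Par n d. (\<Sum>\<alpha>\<in>compos d. s \<alpha> * tc \<alpha> mu) * ev x (P mu))"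
      by (subst sum.swap) (simp add: sum_distrib_right)
    finally show "(\<Sum>mu\<in>Par n d. (if mu = lam then 1 else 0) * ev x (P mu)) = \<dots>" .
  qed
  then show False using t0 by simp
qed

text \<open>For \<open>u0\<close> the matrix \<open>e\<close> is diagonal with distinct entries, and
  symmetry of its product with \<open>Bmat\<close> forces \<open>Bmat\<close> to be diagonal. For
  arbitrary \<open>u\<close>, then, \<open>e lam nu\<close> and \<open>e nu lam\<close> are nonzero
  together, whereas triangularity would make \<open>lam\<close> and \<open>nu\<close> dominate each
  other. So \<open>e\<close> is diagonal as well.\<close>

lemma kernel_diagonal:
  assumes eig: "\<And>mu. mu \<in> Par n d \<Longrightarrow> D_op n g (of_real u0) (P mu) = const (D_eval n g mu (of_real u0)) * P mu"
    and inj: "inj_on (\<lambda>mu. D_eval n g mu (of_real u0)) (Par n d)"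
  shows "lam \<in> Par n d \<Longrightarrow> D_op n g u (P lam) = const (D_eval n g lam u) * P lam"
    and "\<exists>b. (\<forall>mu\<in>Par n d. b mu \<noteq> 0) \<and>
      (\<forall>y. kerp n n g d y = (\<Sum>mu\<in>Par n d. const (b mu * eval_mpoly y (P mu)) * P mu))"
proof -
  let ?d = "\<lambda>mu. D_eval n g mu (of_real u0)"
  have off: "Bmat lam nu = 0" if "lam \<in> Par n d" "nu \<in> Par n d" "lam \<noteq> nu" for lam nu
  proof -
    define e where "e mu nu = (if mu = nu then ?d mu else 0)" for mu nu
    have "(\<Sum>mu\<in>Par n d. Bmat lam mu * e mu nu) = (\<Sum>mu\<in>Par n d. Bmat nu mu * e mu lam)"
    proof (rule Bmat_e_commute[OF _ that(1,2)])
      fix mu assume "mu \<in> Par n d"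
      then show "D_op n g (of_real u0) (P mu) = (\<Sum>nu\<in>Par n d. const (e mu nu) * P nu)"
        by (simp add: eig e_def if_distrib[of const] if_distrib[of "\<lambda>z. z * _"] cong: if_cong)
    qed
    then have "Bmat lam nu * ?d nu = Bmat nu lam * ?d lam"
      using that by (simp add: e_def if_distrib[of "\<lambda>z. _ * z"] cong: if_cong)
    then have "Bmat lam nu * (?d nu - ?d lam) = 0"
      by (simp add: Bmat_commute[of nu lam] algebra_simps)
    moreover have "?d nu - ?d lam \<noteq> 0" using inj that by (auto simp: inj_on_def)
    ultimately show ?thesis by simp
  qed
  have Bsum: "(\<Sum>mu\<in>Par n d. Bmat lam mu * f mu) = Bmat lam lam * f lam" if "lam \<in> Par n d" for lam f
  proof -
    have "(\<Sum>mu\<in>Par n d - {lam}. Bmat lam mu * f mu) = 0"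
      by (rule sum.neutral) (use off[OF that] in force)
    then show ?thesis using that by (simp add: sum.remove)
  qed
  have "\<exists>c. D_op n g u (P mu) = (\<Sum>nu\<in>Par n d. const (c nu) * P nu) \<and>
      (\<forall>nu\<in>Par n d. c nu \<noteq> 0 \<longrightarrow> dominated n nu mu)" if mu: "mu \<in> Par n d" for mu
  proof -
    have "coefp n (D_op n g u (P mu)) nu \<noteq> 0 \<Longrightarrow> nu \<in> lower n mu" if "is_partition n nu" for nu
      using supp_exp_dom_iff_lower[OF D_op_sym[OF Ps[OF mu]], of mu]
        supp_exp_dom_D_op[OF Ps[OF mu] unitri_supp_exp_dom[OF Pp[OF mu] P(1)[OF mu]], of g u] Pp[OF mu] that
      by (auto simp: is_partition_def)
    moreover have "lower n mu \<subseteq> Par n d" using lower_subset[of n mu] mu by (simp add: Par_def)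
    ultimately obtain c where c: "D_op n g u (P mu) = (\<Sum>nu\<in>lower n mu. const (c nu) * P nu)"
      using unitri_expand[OF finite_lower down_closed_lower, of n mu P "D_op n g u (P mu)"] P(1) D_op_sym[OF Ps[OF mu]] by blast
    have "D_op n g u (P mu) = (\<Sum>nu\<in>Par n d. const (if nu \<in> lower n mu then c nu else 0) * P nu)"
      unfolding c using \<open>lower n mu \<subseteq> Par n d\<close> by (intro sum.mono_neutral_cong_left) auto
    then show ?thesis by (intro exI[of _ "\<lambda>nu. if nu \<in> lower n mu then c nu else 0"]) (auto simp: lower_def)
  qed
  then obtain e where e: "\<And>mu. mu \<in> Par n d \<Longrightarrow> D_op n g u (P mu) = (\<Sum>nu\<in>Par n d. const (e mu nu) * P nu)"
    and ed: "\<And>mu nu. mu \<in> Par n d \<Longrightarrow> nu \<in> Par n d \<Longrightarrow> e mu nu \<noteq> 0 \<Longrightarrow> dominated n nu mu"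
    by metis
  have e0: "e lam nu = 0" if "lam \<in> Par n d" "nu \<in> Par n d" "lam \<noteq> nu" for lam nu
  proof (rule ccontr)
    assume ne: "e lam nu \<noteq> 0"
    have "Bmat lam lam * e lam nu = Bmat nu nu * e nu lam"
      using Bmat_e_commute[OF e that(1,2)] Bsum that by simp
    then have "e nu lam \<noteq> 0" using ne Bmat_diag_pos[OF that(1)] by auto
    then show False using ed that ne dominated_antisym Pp by blast
  qed
  show "D_op n g u (P lam) = const (D_eval n g lam u) * P lam" if lam: "lam \<in> Par n d"
  proof -
    have "(\<Sum>nu\<in>Par n d - {lam}. const (e lam nu) * P nu) = 0"
      by (rule sum.neutral) (use e0[OF lam] in force)
    then have eq: "D_op n g u (P lam) = const (e lam lam) * P lam"
      unfolding e[OF lam] using lam by (simp add: sum.remove)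
    have "coefp n (D_op n g u (P lam)) lam = D_eval n g lam u"
      using lookup_D_op_leading[OF Ps[OF lam] unitri_supp_exp_dom[OF Pp[OF lam] P(1)[OF lam]] is_partition_decr[OF Pp[OF lam]]]
        P(1)[OF lam] by (simp add: D_coef_id unitri_def)
    then show ?thesis using P(1)[OF lam] unfolding eq by (simp add: unitri_def)
  qed
  have "kerp n n g d y = (\<Sum>mu\<in>Par n d. const (Bmat mu mu * eval_mpoly y (P mu)) * P mu)" for y
    unfolding kerp_eq using Bsum by (intro sum.cong refl) (simp add: Bmat_commute[of _ "_ :: nat list"])
  then show "\<exists>b. (\<forall>mu\<in>Par n d. b mu \<noteq> 0) \<and>
      (\<forall>y. kerp n n g d y = (\<Sum>mu\<in>Par n d. const (b mu * eval_mpoly y (P mu)) * P mu))"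
    using Bmat_diag_pos by (intro exI[of _ "\<lambda>mu. Bmat mu mu"]) blast
qed

end

section \<open>Uniqueness and characterization of the Jack polynomials\<close>

lemma unitri_eigen_unique:
  assumes g: "g > 0" and lam: "is_partition n lam" and U: "infinite U"
    and P: "unitri n lam P" "\<And>u. u \<in> U \<Longrightarrow> D_op n g u P = const (D_eval n g lam u) * P"
    and Q: "unitri n lam Q" "\<And>u. u \<in> U \<Longrightarrow> D_op n g u Q = const (D_eval n g lam u) * Q"
  shows "P = Q"
proof (rule ccontr)
  assume "P \<noteq> Q"
  have s: "P \<in> sym_polys n" "Q \<in> sym_polys n" using P Q by (auto simp: unitri_def)
  have R: "P - Q \<in> sym_polys n" "P - Q \<noteq> 0" using s \<open>P \<noteq> Q\<close> by (auto intro: sym_polys_minus)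
  have neg: "D_op n g u (- Q) = - D_op n g u Q" for u
    using D_op_const_mult[OF s(2), of g u "-1"] by (simp add: const_uminus)
  have nQ: "- Q \<in> sym_polys n" using sym_polys_minus[OF sym_polys_zero s(2)] by simp
  have eig: "D_op n g u (P - Q) = const (D_eval n g lam u) * (P - Q)" if "u \<in> U" for u
    using D_op_add[OF s(1) nQ, of g u] P(2)[OF that] Q(2)[OF that] by (simp add: neg algebra_simps)
  \<comment> \<open>The leading exponent of the difference shows the eigenvalues of
    \<open>lam\<close> for all \<open>u\<close> in \<open>U\<close>, hence is \<open>lam\<close>;
    but there the two leading coefficients 1 cancel.\<close>
  obtain a where a: "decr n a" "lookup (P - Q) (expvec n a) \<noteq> 0"
    "\<And>u d. D_op n g u (P - Q) = const d * (P - Q) \<Longrightarrow> d = D_coef n g u a id"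
    by (rule eigenvector_leading[OF R]) blast
  define mu where "mu = map a [0..<n]"
  have mu: "is_partition n mu" unfolding mu_def by (rule is_partitionI[OF a(1)])
  have "expvec n ((!) mu) = expvec n a" by (auto simp: mu_def expvec_eq_iff)
  then have c: "coefp n (P - Q) mu \<noteq> 0" using a(2) by simp
  have "D_eval n g lam u = D_eval n g mu u" if "u \<in> U" for u
  proof -
    have "D_eval n g lam u = D_coef n g u a id" using a(3)[OF eig[OF that]] .
    also have "\<dots> = D_eval n g mu u" by (simp add: D_coef_def D_eval_def mu_def)
    finally show ?thesis .
  qed
  then have "lam = mu" by (rule D_eval_inj[OF g lam mu U])
  then show False using c P(1) Q(1) by (simp add: lookup_minus unitri_def)
qed

theorem jack_exists:
  assumes g: "g > 0"
  shows "\<exists>P b. (\<forall>mu\<in>Par n d. unitri n mu (P mu) \<and> (\<forall>u. D_op n g u (P mu) = const (D_eval n g mu u) * P mu) \<and> b mu \<noteq> 0) \<and>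
    (\<forall>y. kerp n n g d y = (\<Sum>mu\<in>Par n d. const (b mu * eval_mpoly y (P mu)) * P mu))"
proof -
  obtain u0 where inj: "inj_on (\<lambda>mu. D_eval n g mu (of_real u0)) (Par n d)"
    using D_eval_separating[OF g] .
  have "\<forall>mu\<in>Par n d. \<exists>P. eigenp n g u0 mu P" using eigenp_exists[OF inj] by blast
  then obtain P where P: "\<And>mu. mu \<in> Par n d \<Longrightarrow> eigenp n g u0 mu (P mu)" by metis
  have *: "\<And>mu. mu \<in> Par n d \<Longrightarrow> unitri n mu (P mu)" "\<And>mu. mu \<in> Par n d \<Longrightarrow> real_valued (P mu)"
    "\<And>mu. mu \<in> Par n d \<Longrightarrow> D_op n g (of_real u0) (P mu) = const (D_eval n g mu (of_real u0)) * P mu"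
    using P by (auto simp: eigenp_def)
  obtain b where "\<forall>mu\<in>Par n d. b mu \<noteq> 0" "\<forall>y. kerp n n g d y = (\<Sum>mu\<in>Par n d. const (b mu * eval_mpoly y (P mu)) * P mu)"
    using kernel_diagonal(2)[OF g * inj] by blast
  then show ?thesis
    using kernel_diagonal(1)[OF g * inj] *(1) by (intro exI[of _ P] exI[of _ b]) blast
qed

lemma jack_eqI:
  assumes "g > 0" "is_partition n lam" "unitri n lam P" "\<And>u. D_op n g u P = const (D_eval n g lam u) * P"
  shows "jack n g lam = P"
  unfolding jack_def
proof (rule the_equality)
  show "P \<in> sym_polys n \<and>
     (\<exists>v. P = monomial_sym n lam +
        (\<Sum>mu | is_partition n mu \<and> dominated n mu lam \<and> mu \<noteq> lam. const (v mu) * monomial_sym n mu)) \<and>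
     (\<forall>u. D_op n g u P = const (\<Prod>i<n. of_nat (lam ! i) + of_real (real (n - 1 - i) * g) + u) * P)"
    using unitri_iff[OF assms(2), of P] assms(3,4) unfolding D_eval_def by blast
next
  fix Q assume "Q \<in> sym_polys n \<and>
     (\<exists>v. Q = monomial_sym n lam +
        (\<Sum>mu | is_partition n mu \<and> dominated n mu lam \<and> mu \<noteq> lam. const (v mu) * monomial_sym n mu)) \<and>
     (\<forall>u. D_op n g u Q = const (\<Prod>i<n. of_nat (lam ! i) + of_real (real (n - 1 - i) * g) + u) * Q)"
  then have Q: "unitri n lam Q" "\<And>u. D_op n g u Q = const (D_eval n g lam u) * Q"
    using unitri_iff[OF assms(2), of Q] unfolding D_eval_def by blast+
  show "Q = P"
    by (rule unitri_eigen_unique[OF assms(1,2) infinite_UNIV_char_0 Q(1) _ assms(3)]) (simp_all add: Q(2) assms(4))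
qed

theorem jack_properties:
  assumes "g > 0" "is_partition n lam"
  shows "unitri n lam (jack n g lam)" "D_op n g u (jack n g lam) = const (D_eval n g lam u) * jack n g lam"
proof -
  have "lam \<in> Par n (sum_list lam)" using assms by (simp add: Par_def)
  then obtain P where P: "unitri n lam P" "\<And>u. D_op n g u P = const (D_eval n g lam u) * P"
    using jack_exists[OF assms(1), of n "sum_list lam"] by blast
  have "jack n g lam = P" by (rule jack_eqI[OF assms P])
  then show "unitri n lam (jack n g lam)" "D_op n g u (jack n g lam) = const (D_eval n g lam u) * jack n g lam"
    using P by simp_all
qed

theorem kerp_jack:
  assumes "g > 0"
  shows "\<exists>b. (\<forall>mu\<in>Par n d. b mu \<noteq> 0) \<and>
    (\<forall>y. kerp n n g d y = (\<Sum>mu\<in>Par n d. const (b mu * eval_mpoly y (jack n g mu)) * jack n g mu))"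
proof -
  obtain P b where Pb: "\<forall>mu\<in>Par n d. unitri n mu (P mu) \<and> (\<forall>u. D_op n g u (P mu) = const (D_eval n g mu u) * P mu) \<and> b mu \<noteq> 0"
    "\<And>y. kerp n n g d y = (\<Sum>mu\<in>Par n d. const (b mu * eval_mpoly y (P mu)) * P mu)"
    using jack_exists[OF assms, of n d] by blast
  have "jack n g mu = P mu" if "mu \<in> Par n d" for mu
    using Pb(1) that by (intro jack_eqI[OF assms]) (auto simp: Par_def)
  then have "kerp n n g d y = (\<Sum>mu\<in>Par n d. const (b mu * eval_mpoly y (jack n g mu)) * jack n g mu)" for y
    unfolding Pb(2) by (intro sum.cong) auto
  then show ?thesis using Pb(1) by (intro exI[of _ b]) blast
qed

section \<open>The value of the Jack polynomials at \<open>(1, \<dots>, 1)\<close>\<close>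

definition prodvar :: "nat \<Rightarrow> mpoly" where
  "prodvar n = single (expvec n (\<lambda>_. 1)) 1"

lemma prodvar_eq_prod: "prodvar n = (\<Prod>i<n. var i)"
  using prod_var_power[of "\<lambda>_. 1" n] by (simp add: prodvar_def)

lemma eval_prodvar: "eval_mpoly x (prodvar n) = (\<Prod>i<n. x i)"
  by (simp add: prodvar_eq_prod eval_mpoly_prod)

lemma in_vars_prodvar [simp]: "in_vars n (prodvar n)"
  by (simp add: prodvar_def)

lemma prodvar_sym: "prodvar n \<in> sym_polys n"
  unfolding sym_polys_eval_iff
proof (intro conjI allI impI)
  fix \<sigma> x assume \<sigma>: "\<sigma> permutes {..<n}"
  show "eval_mpoly (\<lambda>i. x (\<sigma> i)) (prodvar n) = eval_mpoly x (prodvar n)"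
    unfolding eval_prodvar using prod.permute[OF \<sigma>, of x] by (simp add: o_def)
qed simp

lemma prodvar_nonzero: "prodvar n \<noteq> 0"
  by (simp add: prodvar_def) (metis single_zero single_one lookup_single_eq zero_neq_one lookup_zero)

text \<open>In the factors of \<open>D_coef\<close>, raising every exponent by one is the same as
  raising \<open>u\<close> by one.\<close>

lemma D_det_prodvar:
  assumes "in_vars n p"
  shows "D_det n g u (prodvar n * p) = prodvar n * D_det n g (u + 1) p"
proof -
  have "D_det n g u (prodvar n * single (expvec n a) c) = prodvar n * D_det n g (u + 1) (single (expvec n a) c)" for a c
  proof -
    have "D_coef n g u (\<lambda>i. 1 + a i) \<sigma> = D_coef n g (u + 1) a \<sigma>" for \<sigma>
      by (simp add: D_coef_def algebra_simps)
    then show ?thesis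
      by (simp add: prodvar_def mult_single expvec_add D_det_single sum_distrib_left add.assoc)
  qed
  then show ?thesis
    by (subst (1 2) in_vars_eq_sum[OF assms]) (simp only: sum_distrib_left D_det_sum)
qed

lemma D_op_prodvar:
  assumes "p \<in> sym_polys n"
  shows "D_op n g u (prodvar n * p) = prodvar n * D_op n g (u + 1) p"
  using assms D_op_eq[OF assms, of g "u + 1"]
  by (intro D_op_unique) (auto simp: sym_polys_mult prodvar_sym D_det_prodvar sym_polys_in_vars mult.left_commute)

lemma is_partition_map_Suc: "is_partition n (map Suc mu) \<longleftrightarrow> is_partition n mu"
  by (auto simp: is_partition_def sorted_wrt_map)

lemma coefp_prodvar:
  assumes "length mu = n"
  shows "coefp n (prodvar n * p) (map Suc mu) = coefp n p mu"
proof -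
  have "expvec n ((!) (map Suc mu)) = expvec n (\<lambda>_. 1) + expvec n ((!) mu)"
    using assms by (auto simp: expvec_add expvec_eq_iff)
  then show ?thesis using lookup_single_mult[of "expvec n (\<lambda>_. 1)" 1 p "expvec n ((!) mu)"]
    by (simp add: prodvar_def)
qed

lemma coefp_prodvar_eq_0:
  assumes "i < n" "mu ! i = 0"
  shows "coefp n (prodvar n * p) mu = 0"
  unfolding prodvar_def
proof (rule lookup_single_mult_eq_0)
  fix m
  show "expvec n ((!) mu) \<noteq> expvec n (\<lambda>_. 1) + m"
  proof
    assume eq: "expvec n ((!) mu) = expvec n (\<lambda>_. 1) + m"
    have "lookup (expvec n ((!) mu)) i = lookup (expvec n (\<lambda>_. 1) + m) i"
      by (simp only: eq)
    then show False using assms by (simp add: lookup_expvec lookup_add)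
  qed
qed

lemma sum_list_map_Suc: "sum_list (map Suc xs) = length xs + sum_list xs"
  by (induction xs) auto

lemma dominated_map_Suc:
  assumes "length mu = n" "length lam = n"
  shows "dominated n (map Suc mu) (map Suc lam) \<longleftrightarrow> dominated n mu lam"
  using assms by (auto simp: dominated_def take_map sum_list_map_Suc min_def)

lemma jack_map_Suc:
  assumes "g > 0" "is_partition n lam"
  shows "jack n g (map Suc lam) = prodvar n * jack n g lam"
proof (rule jack_eqI)
  let ?P = "jack n g lam"
  have len: "length lam = n" using assms by (simp add: is_partition_def)
  have P: "unitri n lam ?P" "\<And>u. D_op n g u ?P = const (D_eval n g lam u) * ?P"
    using jack_properties[OF assms] by blast+
  then have Ps: "?P \<in> sym_polys n" by (simp add: unitri_def)
  show "is_partition n (map Suc lam)" using assms by (simp add: is_partition_map_Suc)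
  show "unitri n (map Suc lam) (prodvar n * ?P)"
    unfolding unitri_def
  proof (intro conjI allI impI)
    show "prodvar n * ?P \<in> sym_polys n" by (intro sym_polys_mult prodvar_sym Ps)
    show "coefp n (prodvar n * ?P) (map Suc lam) = 1" using P len by (simp add: coefp_prodvar unitri_def)
    fix mu assume mu: "is_partition n mu" "coefp n (prodvar n * ?P) mu \<noteq> 0"
    then have l: "length mu = n" by (simp add: is_partition_def)
    have "mu ! i \<noteq> 0" if "i < n" for i using coefp_prodvar_eq_0[OF that] mu(2) by blast
    then have "mu = map Suc (map (\<lambda>k. k - 1) mu)" using l by (intro nth_equalityI) auto
    then obtain nu where nu: "mu = map Suc nu" by blast
    then have "is_partition n nu" "coefp n ?P nu \<noteq> 0" "length nu = n"
      using mu l coefp_prodvar[of nu n ?P] by (simp_all add: is_partition_map_Suc)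
    then show "dominated n mu (map Suc lam)" using P len unfolding nu by (simp add: dominated_map_Suc unitri_def)
  qed
  fix u
  have "D_eval n g (map Suc lam) u = D_eval n g lam (u + 1)"
    unfolding D_eval_def using len by (intro prod.cong) (auto simp: algebra_simps)
  then show "D_op n g u (prodvar n * ?P) = const (D_eval n g (map Suc lam) u) * (prodvar n * ?P)"
    by (simp add: D_op_prodvar[OF Ps] P(2) mult_ac)
qed (use assms in simp)

section \<open>Setting the last variable to zero\<close>

lemma eval_restrict_vars:
  "eval_mpoly x (restrict_vars k p) = eval_mpoly (\<lambda>i. if i < k then x i else 0) p"
proof -
  have "eval_mpoly (\<lambda>i. if i < k then x i else 0) p =
      (\<Sum>m\<in>keys p. if keys m \<subseteq> {..<k} then lookup p m * meval x m else 0)"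
    unfolding eval_mpoly_superset[OF finite_keys order_refl]
  proof (rule sum.cong[OF refl])
    fix m
    show "lookup p m * meval (\<lambda>i. if i < k then x i else 0) m =
      (if keys m \<subseteq> {..<k} then lookup p m * meval x m else 0)"
    proof (cases "keys m \<subseteq> {..<k}")
      case True
      then have "meval (\<lambda>i. if i < k then x i else 0) m = meval x m"
        unfolding meval_def by (intro prod.cong) auto
      then show ?thesis using True by simp
    next
      case False
      then obtain i where "i \<in> keys m" "\<not> i < k" by auto
      then have "meval (\<lambda>i. if i < k then x i else 0) m = 0"
        unfolding meval_def by (intro prod_zero) (auto intro!: bexI[of _ i] simp: in_keys_iff)
      then show ?thesis using False by simp
    qed
  qed
  also have "\<dots> = (\<Sum>m | m \<in> keys p \<and> keys m \<subseteq> {..<k}. lookup p m * meval x m)"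
    by (subst sum.inter_filter[symmetric]) auto
  also have "\<dots> = eval_mpoly x (restrict_vars k p)"
    by (simp add: restrict_vars_def eval_mpoly_sum eval_mpoly_single)
  finally show ?thesis ..
qed

lemma restrict_vars_var_self: "restrict_vars n (var n) = 0"
  by (simp add: var_def restrict_vars_single)

lemma restrict_vars_minus: "restrict_vars k (p - q) = restrict_vars k p - restrict_vars k q"
  by (rule poly_mapping_eqI) (simp add: lookup_restrict_vars lookup_minus)

lemma restrict_vars_prod: "restrict_vars k (prod f A) = (\<Prod>a\<in>A. restrict_vars k (f a))"
proof -
  have "restrict_vars k 1 = 1" by (rule restrict_vars_id) simp
  then show ?thesis
    by (induction A rule: infinite_finite_induct) (auto simp: restrict_vars_mult)
qed

lemma restrict_vandermonde:
  "restrict_vars n (vandermonde (Suc n) var) = (-1) ^ n * (prodvar n * vandermonde n var)"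
proof -
  have "restrict_vars n (\<Prod>i<n. var n - var i) = (\<Prod>i<n. 0 - var i)"
    unfolding restrict_vars_prod restrict_vars_minus restrict_vars_var_self
    by (intro prod.cong refl) (simp add: restrict_vars_id)
  also have "\<dots> = (-1) ^ n * prodvar n"
    using prod_minus_swap[of var 0 n] unfolding prodvar_eq_prod by (simp add: minus_power_mult_self flip: power_mult_distrib mult.assoc)
  finally show ?thesis
    unfolding vandermonde_Suc restrict_vars_mult by (simp add: restrict_vars_id mult_ac)
qed

lemma permutes_Suc_fix:
  "\<sigma> permutes {..<Suc n} \<and> \<sigma> n = n \<longleftrightarrow> \<sigma> permutes {..<n}"
proof
  assume *: "\<sigma> permutes {..<Suc n} \<and> \<sigma> n = n"
  show "\<sigma> permutes {..<n}"
    by (rule permutes_superset[OF conjunct1[OF *]]) (use * in \<open>auto simp: less_Suc_eq\<close>)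
next
  assume *: "\<sigma> permutes {..<n}"
  then have "\<sigma> permutes {..<Suc n}" by (rule permutes_subset) auto
  moreover have "\<sigma> n = n" using * by (auto simp: permutes_def)
  ultimately show "\<sigma> permutes {..<Suc n} \<and> \<sigma> n = n" ..
qed

text \<open>At \<open>x n = 0\<close> every term with \<open>\<sigma> n < n\<close> carries a
  positive power of \<open>x n\<close> and disappears. In the others, row \<open>n\<close>
  contributes the scalar \<open>u\<close>, and each remaining row has one more column to its right
  than in \<open>n\<close> variables: this yields an extra factor \<open>x i\<close>, collected in
  \<open>prodvar n\<close>, and raises \<open>u\<close> by \<open>g\<close>.\<close>

lemma restrict_D_det_single:
  "restrict_vars n (D_det (Suc n) g u (single (expvec (Suc n) a) c)) =
    const u * (prodvar n * D_det n g (u + of_real g) (restrict_vars n (single (expvec (Suc n) a) c)))"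
proof -
  have sub: "keys (expvec (Suc n) b) \<subseteq> {..<n} \<longleftrightarrow> b n = 0" for b
    by (auto simp: in_keys_iff lookup_expvec subset_iff less_Suc_eq split: if_splits)
  have red: "expvec (Suc n) b = expvec n b" if "b n = 0" for b
    using that by (intro poly_mapping_eqI) (auto simp: lookup_expvec less_Suc_eq)
  define T where "T \<sigma> = single (expvec (Suc n) (\<lambda>i. a i + (n - \<sigma> i))) (of_int (sign \<sigma>) * c * D_coef (Suc n) g u a \<sigma>)" for \<sigma>
  have "restrict_vars n (D_det (Suc n) g u (single (expvec (Suc n) a) c)) =
    (\<Sum>\<sigma> | \<sigma> permutes {..<Suc n}. restrict_vars n (T \<sigma>))"
    by (simp add: D_det_single restrict_vars_sum T_def)
  also have "\<dots> = (\<Sum>\<sigma> | \<sigma> permutes {..<Suc n}. if a n = 0 \<and> \<sigma> n = n then T \<sigma> else 0)"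
  proof (rule sum.cong[OF refl])
    fix \<sigma> assume "\<sigma> \<in> {\<sigma>. \<sigma> permutes {..<Suc n}}"
    then have "\<sigma> n \<le> n" using permutes_in_image[of \<sigma> "{..<Suc n}" n] by auto
    then have "a n + (n - \<sigma> n) = 0 \<longleftrightarrow> a n = 0 \<and> \<sigma> n = n" by auto
    then show "restrict_vars n (T \<sigma>) = (if a n = 0 \<and> \<sigma> n = n then T \<sigma> else 0)"
      unfolding T_def restrict_vars_single sub by simp
  qed
  also have "\<dots> = (if a n = 0 then \<Sum>\<sigma> | \<sigma> permutes {..<n}. T \<sigma> else 0)"
  proof (cases "a n = 0")
    case True
    have "(\<Sum>\<sigma> | \<sigma> permutes {..<Suc n}. if \<sigma> n = n then T \<sigma> else 0) = (\<Sum>\<sigma> | \<sigma> \<in> {\<sigma>. \<sigma> permutes {..<Suc n}} \<and> \<sigma> n = n. T \<sigma>)"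
      by (rule sum.inter_filter[symmetric]) (rule finite_permutations, simp)
    then show ?thesis using True by (simp add: permutes_Suc_fix)
  qed simp
  also have "\<dots> = const u * (prodvar n * D_det n g (u + of_real g) (restrict_vars n (single (expvec (Suc n) a) c)))"
  proof (cases "a n = 0")
    case True
    have "T \<sigma> = const u * (prodvar n * single (expvec n (\<lambda>i. a i + (n - 1 - \<sigma> i))) (of_int (sign \<sigma>) * c * D_coef n g (u + of_real g) a \<sigma>))"
      if \<sigma>: "\<sigma> permutes {..<n}" for \<sigma>
    proof -
      have \<sigma>n: "\<sigma> n = n" using \<sigma> by (auto simp: permutes_def)
      have lt: "\<sigma> i < n" if "i < n" for i using permutes_in_image[OF \<sigma>, of i] that by auto
      have "D_coef (Suc n) g u a \<sigma> = u * D_coef n g (u + of_real g) a \<sigma>"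
      proof -
        have "(\<Prod>i<n. of_nat (a i) + of_real (real (n - \<sigma> i) * g) + u) = (\<Prod>i<n. of_nat (a i) + of_real (real (n - 1 - \<sigma> i) * g) + (u + of_real g))"
        proof (rule prod.cong[OF refl])
          fix i assume "i \<in> {..<n}"
          then have "real (n - \<sigma> i) = real (n - 1 - \<sigma> i) + 1" using lt[of i] by simp
          then show "of_nat (a i) + of_real (real (n - \<sigma> i) * g) + u = of_nat (a i) + of_real (real (n - 1 - \<sigma> i) * g) + (u + of_real g)"
            by (simp only: distrib_right of_real_add mult_1 add_ac)
        qed
        then show ?thesis using True \<sigma>n by (simp add: D_coef_def)
      qed
      moreover have "expvec (Suc n) (\<lambda>i. a i + (n - \<sigma> i)) = expvec n (\<lambda>_. 1) + expvec n (\<lambda>i. a i + (n - 1 - \<sigma> i))"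
        using True \<sigma>n lt by (subst red) (auto simp: expvec_add expvec_eq_iff Suc_diff_Suc)
      ultimately show ?thesis
        by (simp add: T_def prodvar_def const_def mult_single mult_ac)
    qed
    moreover have "restrict_vars n (single (expvec (Suc n) a) c) = single (expvec n a) c"
      using True by (simp add: restrict_vars_single sub red keys_expvec)
    ultimately show ?thesis
      using True by (simp add: D_det_single sum_distrib_left)
  next
    case False
    then show ?thesis by (simp add: restrict_vars_single sub)
  qed
  finally show ?thesis .
qed

lemma restrict_D_det:
  assumes "in_vars (Suc n) p"
  shows "restrict_vars n (D_det (Suc n) g u p) = const u * (prodvar n * D_det n g (u + of_real g) (restrict_vars n p))"
  by (subst (1 2) in_vars_eq_sum[OF assms])
    (simp only: D_det_sum restrict_vars_sum restrict_D_det_single sum_distrib_left)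

lemma lookup_restrict_expvec:
  "lookup (restrict_vars n p) (expvec n a) = lookup p (expvec (Suc n) (\<lambda>i. if i < n then a i else 0))"
proof -
  have "expvec (Suc n) (\<lambda>i. if i < n then a i else 0) = expvec n a"
    by (rule poly_mapping_eqI) (auto simp: lookup_expvec)
  then show ?thesis by (simp add: lookup_restrict_vars keys_expvec)
qed

lemma sym_polys_lookup:
  "p \<in> sym_polys n \<Longrightarrow> \<sigma> permutes {..<n} \<Longrightarrow>
    lookup p (expvec n (\<lambda>i. a (\<sigma> i))) = lookup p (expvec n a)"
  by (simp add: sym_polys_iff)

lemma restrict_vars_sym:
  assumes "p \<in> sym_polys (Suc n)"
  shows "restrict_vars n p \<in> sym_polys n"
  unfolding sym_polys_iff
proof (intro conjI allI impI)
  fix \<sigma> and a :: "nat \<Rightarrow> nat" assume \<sigma>: "\<sigma> permutes {..<n}"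
  let ?b = "\<lambda>i. if i < n then a i else 0"
  have e: "(\<lambda>i. if i < n then a (\<sigma> i) else 0) = (\<lambda>i. ?b (\<sigma> i))"
    using permutes_in_image[OF \<sigma>] \<sigma> by (auto simp: fun_eq_iff permutes_def)
  have \<sigma>': "\<sigma> permutes {..<Suc n}" using \<sigma> permutes_Suc_fix by blast
  show "lookup (restrict_vars n p) (expvec n (\<lambda>i. a (\<sigma> i))) = lookup (restrict_vars n p) (expvec n a)"
    unfolding lookup_restrict_expvec e by (rule sym_polys_lookup[OF assms \<sigma>'])
qed simp

text \<open>The factor \<open>prodvar n\<close> comes from the Vandermonde product on one side and
  from the determinant on the other. It cancels together with the signs and with \<open>u\<close>,
  which has to be nonzero for this.\<close>

lemma D_op_restrict:
  assumes p: "p \<in> sym_polys (Suc n)" and u: "u \<noteq> 0" and eig: "D_op (Suc n) g u p = const (u * d) * p"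
  shows "D_op n g (u + of_real g) (restrict_vars n p) = const d * restrict_vars n p"
proof (rule D_op_unique[OF restrict_vars_sym[OF p]])
  let ?N = "Suc n * (Suc n - 1) div 2" and ?M = "n * (n - 1) div 2"
  have NM: "?N = ?M + n" by (cases n) (auto simp: algebra_simps)
  have "restrict_vars n (vandermonde (Suc n) var * (const (u * d) * p)) =
     restrict_vars n ((-1) ^ ?N * D_det (Suc n) g u p)"
    using D_op_eq[OF p, of g u] unfolding eig by simp
  then have "(-1) ^ n * (prodvar n * vandermonde n var) * (const (u * d) * restrict_vars n p) =
     (-1) ^ ?N * (const u * (prodvar n * D_det n g (u + of_real g) (restrict_vars n p)))"
    unfolding restrict_vars_mult restrict_vandermonde restrict_D_det[OF sym_polys_in_vars[OF p]]
    by (simp add: restrict_vars_id)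
  then have "((-1) ^ n * prodvar n * const u) * (vandermonde n var * (const d * restrict_vars n p)) =
    ((-1) ^ n * prodvar n * const u) * ((-1) ^ ?M * D_det n g (u + of_real g) (restrict_vars n p))"
    unfolding NM power_add const_mult by (simp only: mult_ac)
  moreover have "(-1) ^ n * prodvar n * const u \<noteq> 0"
    using u prodvar_nonzero by (simp add: const_def) (metis lookup_single_eq lookup_zero)
  ultimately show "vandermonde n var * (const d * restrict_vars n p) = (-1) ^ ?M * D_det n g (u + of_real g) (restrict_vars n p)"
    by (metis mult_left_cancel)
qed

lemma expvec_append_0: "length mu = n \<Longrightarrow> expvec (Suc n) ((!) (mu @ [0])) = expvec n ((!) mu)"
  by (intro poly_mapping_eqI) (auto simp: lookup_expvec nth_append)

lemma jack_restrict:
  assumes g: "g > 0" and lam: "is_partition n lam"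
  shows "restrict_vars n (jack (Suc n) g (lam @ [0])) = jack n g lam"
proof -
  let ?P = "jack (Suc n) g (lam @ [0])"
  have len: "length lam = n" using lam by (simp add: is_partition_def)
  have part0: "is_partition (Suc n) (mu @ [0])" if "is_partition n mu" for mu
    using that by (auto simp: is_partition_def sorted_wrt_append)
  have P: "unitri (Suc n) (lam @ [0]) ?P" "\<And>u. D_op (Suc n) g u ?P = const (D_eval (Suc n) g (lam @ [0]) u) * ?P"
    using jack_properties[OF g part0[OF lam]] by blast+
  then have Ps: "?P \<in> sym_polys (Suc n)" by (simp add: unitri_def)
  have coef: "coefp n (restrict_vars n ?P) mu = coefp (Suc n) ?P (mu @ [0])" if "length mu = n" for mu
    using that by (simp add: lookup_restrict_vars keys_expvec expvec_append_0)
  show ?thesis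
  proof (rule unitri_eigen_unique[OF g lam])
    \<comment> \<open>The value \<open>w = g\<close> belongs to \<open>u = 0\<close>, where
      \<open>D_op_restrict\<close> gives nothing; uniqueness over an infinite set of parameters
      tolerates the gap.\<close>
    show "infinite (UNIV - {of_real g :: complex})" by (simp add: infinite_UNIV_char_0)
    show "unitri n lam (restrict_vars n ?P)"
      unfolding unitri_def
    proof (intro conjI allI impI restrict_vars_sym Ps)
      show "coefp n (restrict_vars n ?P) lam = 1" using P(1) by (simp add: coef[OF len] unitri_def)
      fix mu assume mu: "is_partition n mu" "coefp n (restrict_vars n ?P) mu \<noteq> 0"
      then have l: "length mu = n" by (simp add: is_partition_def)
      have "dominated (Suc n) (mu @ [0]) (lam @ [0])"
        using P(1) mu part0[OF mu(1)] coef[OF l] by (simp add: unitri_def)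
      then show "dominated n mu lam" using l len by (auto simp: dominated_def)
    qed
    fix w assume w: "w \<in> UNIV - {complex_of_real g}"
    define u where "u = w - of_real g"
    have "D_eval (Suc n) g (lam @ [0]) u = u * D_eval n g lam (u + of_real g)"
    proof -
      have "(\<Prod>i<n. of_nat ((lam @ [0]) ! i) + of_real (real (n - i) * g) + u) = (\<Prod>i<n. of_nat (lam ! i) + of_real (real (n - 1 - i) * g) + (u + of_real g))"
      proof (rule prod.cong[OF refl])
        fix i assume i: "i \<in> {..<n}"
        then have "real (n - i) = real (n - 1 - i) + 1" by simp
        then have "complex_of_real (real (n - i) * g) = of_real (real (n - 1 - i) * g) + of_real g"
          by (simp only: distrib_right of_real_add mult_1)
        then show "of_nat ((lam @ [0]) ! i) + of_real (real (n - i) * g) + u = of_nat (lam ! i) + of_real (real (n - 1 - i) * g) + (u + of_real g)"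
          using i len by (simp add: nth_append)
      qed
      then show ?thesis using len by (simp add: D_eval_def nth_append)
    qed
    then have "D_op n g (u + of_real g) (restrict_vars n ?P) = const (D_eval n g lam (u + of_real g)) * restrict_vars n ?P"
      using w by (intro D_op_restrict[OF Ps]) (auto simp: u_def P(2))
    then show "D_op n g w (restrict_vars n ?P) = const (D_eval n g lam w) * restrict_vars n ?P"
      by (simp add: u_def)
  qed (use jack_properties[OF g lam] in auto)
qed

text \<open>The generalized Pochhammer symbol of the partition \<open>mu\<close> for the Jack
  parameter \<open>1 / g\<close>.\<close>

definition genpoch :: "nat \<Rightarrow> real \<Rightarrow> nat list \<Rightarrow> real \<Rightarrow> real" where
  "genpoch n g mu a = (\<Prod>i<n. pochhammer (a - real i * g) (mu ! i))"

text \<open>This is the recursion in \<open>a\<close> that \<open>D_op_binp\<close> imposes on the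
  coefficients of \<open>binp\<close> in the Jack basis; the last product is the eigenvalue of
  \<open>D\<close>.\<close>

lemma genpoch_step:
  "genpoch n g mu (a + 1) * (\<Prod>i<n. a - real i * g) = genpoch n g mu a * (\<Prod>i<n. a - real i * g + real (mu ! i))"
  unfolding genpoch_def prod.distrib[symmetric]
proof (rule prod.cong[OF refl])
  fix i
  let ?x = "a - real i * g"
  have "pochhammer (?x + 1) (mu ! i) * ?x = pochhammer ?x (Suc (mu ! i))" by (simp add: pochhammer_rec)
  also have "\<dots> = pochhammer ?x (mu ! i) * (?x + real (mu ! i))" by (simp add: pochhammer_Suc)
  finally show "pochhammer (a + 1 - real i * g) (mu ! i) * ?x = pochhammer ?x (mu ! i) * (?x + real (mu ! i))"
    by (simp add: algebra_simps)
qed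

definition poch_poly :: "'a::comm_ring_1 \<Rightarrow> nat \<Rightarrow> 'a poly" where
  "poch_poly c m = (\<Prod>k<m. [: c + of_nat k, 1 :])"

lemma poly_poch_poly: "poly (poch_poly c m) a = pochhammer (a + c) m"
  by (simp add: poch_poly_def poly_prod pochhammer_prod lessThan_atLeast0 add_ac)

text \<open>The ratio of both sides has period 1 in \<open>a\<close>, and both sides are polynomials in \<open>a\<close>.\<close>

lemma binp_expansion:
  assumes g: "g > 0" and mu: "mu \<in> Par n d"
  shows "\<exists>\<kappa>. \<forall>a c. binp n d a = (\<Sum>mu\<in>Par n d. const (c mu) * jack n g mu) \<longrightarrow> c mu = \<kappa> * of_real (genpoch n g mu a)"
proof -
  have J: "unitri n nu (jack n g nu)" if "nu \<in> Par n d" for nu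
    using jack_properties(1)[OF g] that by (simp add: Par_def)
  have Js: "jack n g nu \<in> sym_polys n" if "nu \<in> Par n d" for nu using J[OF that] by (simp add: unitri_def)
  have Pp: "is_partition n nu" if "nu \<in> Par n d" for nu using that by (simp add: Par_def)
  have "\<exists>c. monomial_sym n nu = (\<Sum>mu\<in>Par n d. const (c mu) * jack n g mu)" if "nu \<in> Par n d" for nu
  proof (rule unitri_expand[OF finite_Par down_closed_Par J])
    show "monomial_sym n nu \<in> sym_polys n"
      using that by (intro monomial_sym_sym) (simp add: Par_def is_partition_def)
    show "mu \<in> Par n d" if "is_partition n mu" "coefp n (monomial_sym n nu) mu \<noteq> 0" for mu
      using that \<open>nu \<in> Par n d\<close> Pp[OF \<open>nu \<in> Par n d\<close>] by (auto simp: coefp_monomial_sym split: if_splits)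
  qed
  then obtain t where t: "\<And>nu. nu \<in> Par n d \<Longrightarrow> monomial_sym n nu = (\<Sum>mu\<in>Par n d. const (t nu mu) * jack n g mu)"
    by metis
  \<comment> \<open>The coefficients of \<open>binp\<close> are products of Pochhammer symbols in
    \<open>a\<close>, and the passage \<open>t\<close> to the Jack basis does not involve
    \<open>a\<close>; so the Jack coefficient is the value of a polynomial \<open>F mu\<close> at
    \<open>a\<close>.\<close>
  define F where "F mu = (\<Sum>nu\<in>Par n d. Polynomial.smult (t nu mu) (\<Prod>i<n. Polynomial.smult (1 / fact (nu ! i)) (poch_poly 0 (nu ! i))))" for mu
  have coef: "coefp n (binp n d a) nu = (if sum_list nu = d then \<Prod>i<n. pochhammer (of_real a) (nu ! i) / fact (nu ! i) else 0)"
    if "is_partition n nu" for a nu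
    using that sum_list_nth_lessThan[of nu n] by (simp add: binp_def lookup_prodpoly bser_def is_partition_def)
  have bin: "binp n d a = (\<Sum>mu\<in>Par n d. const (poly (F mu) (of_real a)) * jack n g mu)" for a
  proof -
    have "binp n d a = (\<Sum>nu\<in>Par n d. const (coefp n (binp n d a) nu) * monomial_sym n nu)"
    proof (rule sym_expand[OF _ finite_Par Pp])
      show "binp n d a \<in> sym_polys n" by (simp add: binp_def)
      show "nu \<in> Par n d" if "is_partition n nu" "coefp n (binp n d a) nu \<noteq> 0" for nu
        using that coef[OF that(1), of a] by (auto simp: Par_def split: if_splits)
    qed
    also have "\<dots> = (\<Sum>nu\<in>Par n d. \<Sum>mu\<in>Par n d. const (coefp n (binp n d a) nu * t nu mu) * jack n g mu)"
      by (rule sum.cong[OF refl]) (simp only: t sum_distrib_left const_mult mult.assoc)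
    also have "\<dots> = (\<Sum>mu\<in>Par n d. const (\<Sum>nu\<in>Par n d. coefp n (binp n d a) nu * t nu mu) * jack n g mu)"
      by (subst sum.swap) (simp only: const_sum sum_distrib_right)
    also have "\<dots> = (\<Sum>mu\<in>Par n d. const (poly (F mu) (of_real a)) * jack n g mu)"
    proof (rule sum.cong[OF refl])
      fix mu
      have "(\<Sum>nu\<in>Par n d. coefp n (binp n d a) nu * t nu mu) = poly (F mu) (of_real a)"
        unfolding F_def poly_sum
        by (rule sum.cong[OF refl]) (auto simp: coef Par_def poly_prod poly_poch_poly)
      then show "const (\<Sum>nu\<in>Par n d. coefp n (binp n d a) nu * t nu mu) * jack n g mu = const (poly (F mu) (of_real a)) * jack n g mu"
        by simp
    qed
    finally show ?thesis .
  qed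
  have uniq: "c nu = c' nu" if "(\<Sum>mu\<in>Par n d. const (c mu) * jack n g mu) = (\<Sum>mu\<in>Par n d. const (c' mu) * jack n g mu)" "nu \<in> Par n d" for c c' nu
  proof -
    have "(\<Sum>mu\<in>Par n d. const (c mu - c' mu) * jack n g mu) = 0"
      using that(1) by (simp add: const_minus left_diff_distrib sum_subtractf)
    then show ?thesis using unitri_independent[OF finite_Par Pp J _ that(2), of "\<lambda>mu. c mu - c' mu"] by simp
  qed
  have rec: "poly (F mu) (of_real a) * of_real (\<Prod>i<n. a - real i * g + real (mu ! i)) = of_real (\<Prod>i<n. a - real i * g) * poly (F mu) (of_real (a + 1))" for a
  proof (rule uniq[OF _ mu, of "\<lambda>mu. poly (F mu) (of_real a) * of_real (\<Prod>i<n. a - real i * g + real (mu ! i))"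
        "\<lambda>mu. of_real (\<Prod>i<n. a - real i * g) * poly (F mu) (of_real (a + 1))"])
    let ?u = "complex_of_real (a - real (n - 1) * g)"
    have ev: "D_eval n g mu ?u = of_real (\<Prod>i<n. a - real i * g + real (mu ! i))" for mu
      unfolding D_eval_def of_real_prod
    proof (rule prod.cong[OF refl])
      fix i assume "i \<in> {..<n}"
      then have "real (n - 1 - i) = real (n - 1) - real i" by auto
      then have "real (mu ! i) + real (n - 1 - i) * g + (a - real (n - 1) * g) = a - real i * g + real (mu ! i)"
        by (simp only: left_diff_distrib)
      then show "of_nat (mu ! i) + of_real (real (n - 1 - i) * g) + ?u = of_real (a - real i * g + real (mu ! i))"
        by (metis of_real_add of_real_of_nat_eq)
    qed
    have "D_op n g ?u (binp n d a) = (\<Sum>mu\<in>Par n d. D_op n g ?u (const (poly (F mu) (of_real a)) * jack n g mu))"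
      unfolding bin by (rule D_op_sum) (auto intro!: sym_polys_mult Js)
    also have "\<dots> = (\<Sum>mu\<in>Par n d. const (poly (F mu) (of_real a) * of_real (\<Prod>i<n. a - real i * g + real (mu ! i))) * jack n g mu)"
    proof (rule sum.cong[OF refl])
      fix mu assume "mu \<in> Par n d"
      then show "D_op n g ?u (const (poly (F mu) (of_real a)) * jack n g mu) =
        const (poly (F mu) (of_real a) * of_real (\<Prod>i<n. a - real i * g + real (mu ! i))) * jack n g mu"
        using jack_properties(2)[OF g Pp, of mu ?u] Js[of mu]
        by (simp only: D_op_const_mult ev const_mult mult.assoc)
    qed
    finally show "(\<Sum>mu\<in>Par n d. const (poly (F mu) (of_real a) * of_real (\<Prod>i<n. a - real i * g + real (mu ! i))) * jack n g mu) =
      (\<Sum>mu\<in>Par n d. const (of_real (\<Prod>i<n. a - real i * g) * poly (F mu) (of_real (a + 1))) * jack n g mu)"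
      unfolding D_op_binp bin[of "a + 1"] by (simp add: sum_distrib_left const_mult mult.assoc)
  qed
  define G where "G = (\<Prod>i<n. poch_poly (- of_real (real i * g) :: complex) (mu ! i))"
  have G: "poly G (of_real a) = of_real (genpoch n g mu a)" for a
  proof -
    have "poly G (of_real a) = (\<Prod>i<n. pochhammer (of_real (a - real i * g)) (mu ! i))"
      by (simp add: G_def poly_prod poly_poch_poly)
    also have "\<dots> = of_real (genpoch n g mu a)"
      unfolding genpoch_def of_real_prod pochhammer_of_real ..
    finally show ?thesis .
  qed
  \<comment> \<open>From \<open>n * g + 1\<close> on all factors \<open>a - i * g\<close> are
    positive, so the recursion can be divided by them and carries the ratio along
    \<open>a0 + k\<close>. These infinitely many points suffice for an identity of
    polynomials.\<close>
  define a0 where "a0 = real n * g + 1"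
  have pos: "a0 + real k - real i * g > 0" if "i < n" for k i
  proof -
    have "real i * g \<le> real n * g" using that g by (intro mult_right_mono) auto
    then show ?thesis by (simp add: a0_def)
  qed
  have gp: "genpoch n g mu (a0 + real k) > 0" for k
    unfolding genpoch_def by (intro prod_pos pochhammer_pos) (use pos in auto)
  have pr: "(\<Prod>i<n. a0 + real k - real i * g) > 0" for k
    by (intro prod_pos) (use pos in auto)
  define \<kappa> where "\<kappa> = poly (F mu) (of_real a0) / of_real (genpoch n g mu a0)"
  have "poly (F mu) (of_real (a0 + real k)) = \<kappa> * of_real (genpoch n g mu (a0 + real k))" for k
  proof (induction k)
    case 0
    then show ?case using gp[of 0] by (simp add: \<kappa>_def)
  next
    case (Suc k)
    let ?a = "a0 + real k"
    have "of_real (\<Prod>i<n. ?a - real i * g) * poly (F mu) (of_real (?a + 1)) =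
      \<kappa> * of_real (genpoch n g mu ?a * (\<Prod>i<n. ?a - real i * g + real (mu ! i)))"
      using rec[of ?a] Suc by (simp only: of_real_mult mult.assoc)
    also have "\<dots> = of_real (\<Prod>i<n. ?a - real i * g) * (\<kappa> * of_real (genpoch n g mu (?a + 1)))"
      unfolding genpoch_step[symmetric] by (simp only: of_real_mult mult_ac)
    finally have "poly (F mu) (of_real (?a + 1)) = \<kappa> * of_real (genpoch n g mu (?a + 1))"
      using pr[of k] by (metis mult_left_cancel of_real_eq_0_iff less_irrefl)
    then show ?case by (simp add: add.commute add.left_commute)
  qed
  then have "poly (F mu - Polynomial.smult \<kappa> G) (of_real (a0 + real k)) = 0" for k
    by (simp only: poly_diff poly_smult G) simp
  then have sub: "(\<lambda>k. complex_of_real (a0 + real k)) ` UNIV \<subseteq> {z. poly (F mu - Polynomial.smult \<kappa> G) z = 0}"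
    by blast
  have "infinite ((\<lambda>k. complex_of_real (a0 + real k)) ` UNIV)"
    by (rule range_inj_infinite) (simp add: inj_def)
  then have "F mu - Polynomial.smult \<kappa> G = 0"
    using sub poly_roots_finite finite_subset by blast
  then have F: "poly (F mu) (of_real a) = \<kappa> * of_real (genpoch n g mu a)" for a
    by (simp add: G)
  show ?thesis
  proof (intro exI[of _ \<kappa>] allI impI)
    fix a c assume eq: "binp n d a = (\<Sum>mu\<in>Par n d. const (c mu) * jack n g mu)"
    have "c mu = poly (F mu) (of_real a)"
      by (rule uniq[OF _ mu]) (simp only: eq[symmetric] bin)
    then show "c mu = \<kappa> * of_real (genpoch n g mu a)" using F by simp
  qed
qed

section \<open>The recursion in the number of variables\<close>

lemma kerp_one: "kerp n n g d (\<lambda>_. 1) = binp n d (real n * g)"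
  by (rule mpoly_eqI_eval[of n]) (auto simp: eval_kerp eval_binp bser_power kerp_def binp_def)

lemma kerp_one_zero: "kerp (Suc n) (Suc n) g d (\<lambda>i. if i < n then 1 else 0) = binp (Suc n) d (real n * g)"
proof -
  have "(\<Prod>j<n. bser (of_real g) (x * (if j < n then 1 else 0))) = bser (of_real (real n * g)) x" for x
    by (simp add: bser_power)
  then show ?thesis
    by (intro mpoly_eqI_eval[of "Suc n"]) (auto simp: eval_kerp eval_binp kerp_def binp_def)
qed

text \<open>The numbers \<open>b\<close> and \<open>\<kappa>\<close> are unknown but common to both
  evaluations of the kernel, so they drop out on cross-multiplying. The part 0 in place
  \<open>n\<close> matters: its Pochhammer factor is 1 even for \<open>a = n * g\<close>, where a
  positive part would give 0.\<close>

lemma jack_one_append_0: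
  assumes g: "g > 0" and lam: "is_partition n lam"
  shows "eval_mpoly (\<lambda>_. 1) (jack (Suc n) g (lam @ [0])) * of_real (\<Prod>i<n. pochhammer (real (n - i) * g) (lam ! i)) =
    eval_mpoly (\<lambda>_. 1) (jack n g lam) * of_real (\<Prod>i<n. pochhammer (real (n - i + 1) * g) (lam ! i))"
proof -
  define d where "d = sum_list lam"
  let ?l = "lam @ [0]"
  have len: "length lam = n" using lam by (simp add: is_partition_def)
  have l: "?l \<in> Par (Suc n) d"
    using lam by (auto simp: Par_def is_partition_def sorted_wrt_append d_def)
  obtain b where b0: "\<forall>mu\<in>Par (Suc n) d. b mu \<noteq> 0"
    and b: "\<forall>y. kerp (Suc n) (Suc n) g d y = (\<Sum>mu\<in>Par (Suc n) d. const (b mu * eval_mpoly y (jack (Suc n) g mu)) * jack (Suc n) g mu)"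
    using kerp_jack[OF g, of "Suc n" d] by (elim exE conjE)
  obtain \<kappa> where \<kappa>': "\<forall>a c. binp (Suc n) d a = (\<Sum>mu\<in>Par (Suc n) d. const (c mu) * jack (Suc n) g mu) \<longrightarrow> c ?l = \<kappa> * of_real (genpoch (Suc n) g ?l a)"
    using binp_expansion[OF g l] by (elim exE)
  note \<kappa> = \<kappa>'[rule_format]
  have 1: "b ?l * eval_mpoly (\<lambda>_. 1) (jack (Suc n) g ?l) = \<kappa> * of_real (genpoch (Suc n) g ?l (real (Suc n) * g))"
    by (rule \<kappa>[of _ "\<lambda>mu. b mu * eval_mpoly (\<lambda>_. 1) (jack (Suc n) g mu)"]) (simp only: kerp_one[symmetric] b[rule_format])
  have 2: "b ?l * eval_mpoly (\<lambda>_. 1) (jack n g lam) = \<kappa> * of_real (genpoch (Suc n) g ?l (real n * g))"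
    unfolding jack_restrict[OF g lam, symmetric] eval_restrict_vars
    by (rule \<kappa>[of _ "\<lambda>mu. b mu * eval_mpoly (\<lambda>i. if i < n then 1 else 0) (jack (Suc n) g mu)"])
      (simp only: kerp_one_zero[symmetric] b[rule_format])
  have gp: "genpoch (Suc n) g ?l (real m * g) = (\<Prod>i<n. pochhammer (real (m - i) * g) (lam ! i))" if "n \<le> m" for m
  proof -
    have "genpoch (Suc n) g ?l (real m * g) = (\<Prod>i<n. pochhammer (real m * g - real i * g) (?l ! i))"
      using len by (simp add: genpoch_def nth_append)
    also have "\<dots> = (\<Prod>i<n. pochhammer (real (m - i) * g) (lam ! i))"
      using len that by (intro prod.cong refl) (auto simp: nth_append of_nat_diff left_diff_distrib)
    finally show ?thesis .
  qed
  have s: "(\<Prod>i<n. pochhammer (real (Suc n - i) * g) (lam ! i)) = (\<Prod>i<n. pochhammer (real (n - i + 1) * g) (lam ! i))"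
    by (intro prod.cong refl) (simp add: Suc_diff_le)
  have "b ?l * (eval_mpoly (\<lambda>_. 1) (jack (Suc n) g ?l) * of_real (genpoch (Suc n) g ?l (real n * g))) =
    b ?l * (eval_mpoly (\<lambda>_. 1) (jack n g lam) * of_real (genpoch (Suc n) g ?l (real (Suc n) * g)))"
    using 1 2 by (simp only: mult.assoc[symmetric]) (simp only: mult_ac)
  then show ?thesis
    using b0[rule_format, OF l] gp[of n] gp[of "Suc n"] s by simp
qed

definition jack_one :: "nat \<Rightarrow> real \<Rightarrow> nat list \<Rightarrow> complex" where
  "jack_one n g lam = (\<Prod>j<n. \<Prod>i<j. pochhammer (of_real (g * real (j - i + 1))) (lam ! i - lam ! j) /
                      pochhammer (of_real (g * real (j - i))) (lam ! i - lam ! j))"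

lemma jack_one_append_0_eq:
  assumes "g > 0" "length lam = n"
  shows "jack_one (Suc n) g (lam @ [0]) * of_real (\<Prod>i<n. pochhammer (real (n - i) * g) (lam ! i)) =
    jack_one n g lam * of_real (\<Prod>i<n. pochhammer (real (n - i + 1) * g) (lam ! i))"
proof -
  have "pochhammer (real (n - i) * g) (lam ! i) > 0" if "i < n" for i
    using assms that by (intro pochhammer_pos) simp
  then have nz: "complex_of_real (\<Prod>i<n. pochhammer (real (n - i) * g) (lam ! i)) \<noteq> 0"
    using prod_pos[of "{..<n}" "\<lambda>i. pochhammer (real (n - i) * g) (lam ! i)"] by (metis lessThan_iff less_irrefl of_real_eq_0_iff)
  have "jack_one (Suc n) g (lam @ [0]) = (\<Prod>j<n. \<Prod>i<j. pochhammer (of_real (g * real (j - i + 1))) ((lam @ [0]) ! i - (lam @ [0]) ! j) /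
                      pochhammer (of_real (g * real (j - i))) ((lam @ [0]) ! i - (lam @ [0]) ! j)) *
      (\<Prod>i<n. pochhammer (of_real (g * real (n - i + 1))) ((lam @ [0]) ! i - (lam @ [0]) ! n) /
                      pochhammer (of_real (g * real (n - i))) ((lam @ [0]) ! i - (lam @ [0]) ! n))"
    by (simp only: jack_one_def prod.lessThan_Suc)
  also have "(\<Prod>j<n. \<Prod>i<j. pochhammer (of_real (g * real (j - i + 1))) ((lam @ [0]) ! i - (lam @ [0]) ! j) /
                      pochhammer (of_real (g * real (j - i))) ((lam @ [0]) ! i - (lam @ [0]) ! j)) = jack_one n g lam"
    unfolding jack_one_def using assms by (intro prod.cong refl) (auto simp: nth_append)
  also have "(\<Prod>i<n. pochhammer (of_real (g * real (n - i + 1))) ((lam @ [0]) ! i - (lam @ [0]) ! n) /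
                      pochhammer (of_real (g * real (n - i))) ((lam @ [0]) ! i - (lam @ [0]) ! n)) =
    (\<Prod>i<n. complex_of_real (pochhammer (real (n - i + 1) * g) (lam ! i)) / of_real (pochhammer (real (n - i) * g) (lam ! i)))"
    unfolding pochhammer_of_real[symmetric] using assms
    by (intro prod.cong refl) (auto simp: nth_append mult.commute)
  also have "\<dots> = of_real (\<Prod>i<n. pochhammer (real (n - i + 1) * g) (lam ! i)) / of_real (\<Prod>i<n. pochhammer (real (n - i) * g) (lam ! i))"
    by (simp only: prod_dividef of_real_prod)
  finally show ?thesis using nz by simp
qed

text \<open>The inner induction is on the last part: full columns are stripped by
  \<open>jack_map_Suc\<close>, which changes neither the value at ones nor the differences of parts.
  A last part 0 leads to fewer variables by \<open>jack_one_append_0\<close>, in step with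
  \<open>jack_one_append_0_eq\<close> for the product.\<close>

theorem eval_jack_one:
  assumes "g > 0" "is_partition n lam"
  shows "eval_mpoly (\<lambda>_. 1) (jack n g lam) = jack_one n g lam"
  using assms(2)
proof (induction n arbitrary: lam)
  case 0
  then have "lam = []" by (simp add: is_partition_def)
  have "jack 0 g lam = 1"
  proof (rule jack_eqI[OF assms(1) 0])
    have e0: "expvec 0 a = 0" for a by (simp add: expvec_def)
    show "unitri 0 lam 1"
      using 0 by (auto simp: unitri_def e0 lookup_one is_partition_def dominated_def)
    fix u
    show "D_op 0 g u 1 = const (D_eval 0 g lam u) * 1"
      by (rule D_op_unique) (simp_all add: D_det_def vandermonde_def D_eval_def)
  qed
  then show ?case by (simp add: jack_one_def)
next
  case (Suc n)
  have "eval_mpoly (\<lambda>_. 1) (jack (Suc n) g lam) = jack_one (Suc n) g lam" if "is_partition (Suc n) lam" "lam ! n = k" for k lam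
    using that
  proof (induction k arbitrary: lam)
    case 0
    have len: "length lam = Suc n" using 0 by (simp add: is_partition_def)
    define mu where "mu = take n lam"
    have lam: "lam = mu @ [0]"
      using len 0(2) unfolding mu_def by (metis lessI order_refl take_Suc_conv_app_nth take_all)
    have mu: "is_partition n mu"
      using 0 len unfolding lam by (auto simp: is_partition_def sorted_wrt_append)
    have "pochhammer (real (n - i) * g) (mu ! i) > 0" if "i < n" for i
      using assms that by (intro pochhammer_pos) simp
    then have nz: "complex_of_real (\<Prod>i<n. pochhammer (real (n - i) * g) (mu ! i)) \<noteq> 0"
      using prod_pos[of "{..<n}" "\<lambda>i. pochhammer (real (n - i) * g) (mu ! i)"] by (metis lessThan_iff less_irrefl of_real_eq_0_iff)
    have "eval_mpoly (\<lambda>_. 1) (jack (Suc n) g lam) * of_real (\<Prod>i<n. pochhammer (real (n - i) * g) (mu ! i)) =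
      jack_one (Suc n) g lam * of_real (\<Prod>i<n. pochhammer (real (n - i) * g) (mu ! i))"
      unfolding lam jack_one_append_0[OF assms(1) mu] Suc.IH[OF mu]
      using mu by (subst jack_one_append_0_eq[OF assms(1)]) (simp_all add: is_partition_def)
    then show ?case using nz by simp
  next
    case (Suc k)
    have len: "length lam = Suc n" using Suc.prems by (simp add: is_partition_def)
    define mu where "mu = map (\<lambda>k. k - 1) lam"
    have "lam ! i > 0" if "i < Suc n" for i
    proof -
      have "lam ! n \<le> lam ! i" using is_partition_decr[OF Suc.prems(1)] that by (auto simp: decr_def)
      then show ?thesis using Suc.prems(2) by simp
    qed
    then have lam: "lam = map Suc mu" using len by (intro nth_equalityI) (auto simp: mu_def)
    have mu: "is_partition (Suc n) mu" using Suc.prems(1) unfolding lam by (simp add: is_partition_map_Suc)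
    have lm: "length mu = Suc n" using mu by (simp add: is_partition_def)
    have "mu ! n = k" using Suc.prems(2) lm unfolding lam by simp
    have "eval_mpoly (\<lambda>_. 1) (jack (Suc n) g lam) = eval_mpoly (\<lambda>_. 1) (jack (Suc n) g mu)"
      unfolding lam jack_map_Suc[OF assms(1) mu] by (simp add: eval_mpoly_mult eval_prodvar)
    also have "\<dots> = jack_one (Suc n) g mu" by (rule Suc.IH[OF mu \<open>mu ! n = k\<close>])
    also have "\<dots> = jack_one (Suc n) g lam"
      unfolding jack_one_def lam using lm by (intro prod.cong refl) auto
    finally show ?case .
  qed
  then show ?case using Suc.prems by blast
qed

section \<open>Lagrange interpolation\<close>

lemma degree_diff_monic_less:
  fixes p q :: "'a::field poly"
  assumes "degree p = n" "degree q = n" "coeff p n = coeff q n" "0 < n"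
  shows "degree (p - q) < n"
proof -
  have "degree (p - q) \<le> n" using assms by (intro degree_diff_le) auto
  moreover have "degree (p - q) \<noteq> n"
  proof
    assume "degree (p - q) = n"
    then have "coeff (p - q) n \<noteq> 0" using assms(4) by (metis degree_0 leading_coeff_0_iff less_numeral_extra(3))
    then show False using assms(3) by simp
  qed
  ultimately show ?thesis by simp
qed

lemma degree_prod_linear:
  fixes x :: "'b \<Rightarrow> 'a::field"
  assumes "finite I"
  shows "degree (\<Prod>j\<in>I. [:x j, -1:]) = card I" "coeff (\<Prod>j\<in>I. [:x j, -1:]) (card I) = (-1) ^ card I"
proof -
  show d: "degree (\<Prod>j\<in>I. [:x j, -1:]) = card I"
    using assms by (subst degree_prod_sum_eq) auto
  show "coeff (\<Prod>j\<in>I. [:x j, -1:]) (card I) = (-1) ^ card I"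
    using lead_coeff_prod[of "\<lambda>j. [:x j, -1:]" I] unfolding d by simp
qed

text \<open>The numerators in the partial fraction expansion of
  \<open>(\<Prod>j\<in>I. x j - T) / (\<Prod>j\<in>I. y j - T)\<close>, see
  \<open>lagrange_eval\<close>; for \<open>I = {..<n}\<close> over the reals they are the
  \<open>xi\<close>. The field is general because both the real integrals and the complex
  polynomials use them.\<close>

definition lagc :: "'b set \<Rightarrow> ('b \<Rightarrow> 'a::field) \<Rightarrow> ('b \<Rightarrow> 'a) \<Rightarrow> 'b \<Rightarrow> 'a" where
  "lagc I y x i = (\<Prod>j\<in>I. x j - y i) / (\<Prod>j\<in>I - {i}. y j - y i)"

text \<open>The two products have the same leading coefficient, so their difference has degree below
  \<open>card I\<close>, like the sum on the right, and both agree at the nodes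
  \<open>y i\<close>.\<close>

lemma lagrange_poly:
  fixes x y :: "'b \<Rightarrow> 'a::field"
  assumes I: "finite I" and inj: "inj_on y I"
  shows "(\<Prod>j\<in>I. [:x j, -1:]) = (\<Prod>j\<in>I. [:y j, -1:]) + (\<Sum>i\<in>I. Polynomial.smult (lagc I y x i) (\<Prod>j\<in>I - {i}. [:y j, -1:]))"
proof (cases "I = {}")
  case False
  let ?n = "card I"
  have n: "0 < ?n" using False I by (simp add: card_gt_0_iff)
  let ?p = "(\<Prod>j\<in>I. [:x j, -1:]) - (\<Prod>j\<in>I. [:y j, -1:])"
  let ?q = "\<Sum>i\<in>I. Polynomial.smult (lagc I y x i) (\<Prod>j\<in>I - {i}. [:y j, -1:])"
  have "?p = ?q"
  proof (rule poly_eqI_degree[of "y ` I"])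
    have card: "card (y ` I) = ?n" using inj by (rule card_image)
    show "degree ?p < card (y ` I)"
      unfolding card using degree_prod_linear[OF I, of x] degree_prod_linear[OF I, of y] n
      by (intro degree_diff_monic_less) auto
    have "degree ?q \<le> ?n - 1"
    proof (rule degree_sum_le[OF I])
      fix i assume "i \<in> I"
      then have "degree (\<Prod>j\<in>I - {i}. [:y j, -1:]) = ?n - 1" using I by (subst degree_prod_linear) auto
      then show "degree (Polynomial.smult (lagc I y x i) (\<Prod>j\<in>I - {i}. [:y j, -1:])) \<le> ?n - 1"
        using degree_smult_le[of "lagc I y x i" "\<Prod>j\<in>I - {i}. [:y j, -1:]"] by simp
    qed
    then show "degree ?q < card (y ` I)" unfolding card using n by linarith
    fix z assume "z \<in> y ` I"
    then obtain i where i: "i \<in> I" "z = y i" by blast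
    have nz: "(\<Prod>j\<in>I - {i}. y j - y i) \<noteq> 0"
      using I inj i by (auto simp: prod_zero_iff inj_on_def)
    have "poly ?q z = (\<Sum>k\<in>I. lagc I y x k * (\<Prod>j\<in>I - {k}. y j - y i))"
      by (simp add: poly_sum poly_prod i)
    also have "\<dots> = (\<Sum>k\<in>I. if k = i then \<Prod>j\<in>I. x j - y i else 0)"
    proof (rule sum.cong[OF refl])
      fix k assume "k \<in> I"
      show "lagc I y x k * (\<Prod>j\<in>I - {k}. y j - y i) = (if k = i then \<Prod>j\<in>I. x j - y i else 0)"
      proof (cases "k = i")
        case True
        then show ?thesis using nz by (simp add: lagc_def)
      next
        case False
        then have "(\<Prod>j\<in>I - {k}. y j - y i) = 0" using I i by (intro prod_zero) auto
        then show ?thesis using False by simp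
      qed
    qed
    also have "\<dots> = (\<Prod>j\<in>I. x j - y i)" using I i by simp
    also have "\<dots> = poly ?p z"
    proof -
      have "(\<Prod>j\<in>I. y j - y i) = 0" using I i by (intro prod_zero) auto
      then show ?thesis by (simp add: poly_prod i)
    qed
    finally show "poly ?p z = poly ?q z" ..
  qed
  then show ?thesis by (simp add: algebra_simps)
qed simp

lemma lagrange_eval:
  fixes x y :: "'b \<Rightarrow> 'a::field"
  assumes I: "finite I" and inj: "inj_on y I" and T: "T \<notin> y ` I"
  shows "(\<Prod>j\<in>I. x j - T) = (\<Prod>j\<in>I. y j - T) * (1 + (\<Sum>i\<in>I. lagc I y x i / (y i - T)))"
proof -
  have "(\<Prod>j\<in>I. x j - T) = (\<Prod>j\<in>I. y j - T) + (\<Sum>i\<in>I. lagc I y x i * (\<Prod>j\<in>I - {i}. y j - T))"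
    using arg_cong[OF lagrange_poly[OF I inj, of x], of "\<lambda>p. poly p T"] by (simp add: poly_prod poly_sum)
  also have "(\<Sum>i\<in>I. lagc I y x i * (\<Prod>j\<in>I - {i}. y j - T)) = (\<Sum>i\<in>I. (\<Prod>j\<in>I. y j - T) * (lagc I y x i / (y i - T)))"
  proof (rule sum.cong[OF refl])
    fix i assume i: "i \<in> I"
    then have "y i - T \<noteq> 0" using T by auto
    then show "lagc I y x i * (\<Prod>j\<in>I - {i}. y j - T) = (\<Prod>j\<in>I. y j - T) * (lagc I y x i / (y i - T))"
      using I i by (simp add: prod.remove)
  qed
  finally show ?thesis by (simp add: sum_distrib_left distrib_left)
qed

section \<open>Scaling and substitution in iterated integrals\<close>

abbreviation lebs :: "nat set \<Rightarrow> (nat \<Rightarrow> real) measure" where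
  "lebs I \<equiv> Pi\<^sub>M I (\<lambda>_. lborel)"

lemma product_sigma_finite_lborel: "product_sigma_finite (\<lambda>_::nat. lborel :: real measure)"
  by (simp add: product_sigma_finite_def sigma_finite_lborel)

lemma nn_integral_lebs_scale:
  fixes s :: "nat \<Rightarrow> real" and F :: "(nat \<Rightarrow> real) \<Rightarrow> ennreal"
  assumes "finite I" "\<And>i. i \<in> I \<Longrightarrow> 0 < s i" "F \<in> borel_measurable (lebs I)"
  shows "(\<integral>\<^sup>+x. F x \<partial>lebs I) = ennreal (\<Prod>i\<in>I. s i) * (\<integral>\<^sup>+x. F (\<lambda>i\<in>I. s i * x i) \<partial>lebs I)"
  using assms
proof (induction I arbitrary: F rule: finite_induct)
  case empty
  have "(\<lambda>_. undefined) = (\<lambda>i\<in>{}. s i * x i)" for x by (simp add: restrict_def)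
  then show ?case by (simp add: PiM_empty nn_integral_count_space_finite)
next
  case (insert i I)
  interpret product_sigma_finite "\<lambda>_::nat. lborel :: real measure" by (rule product_sigma_finite_lborel)
  note F[measurable] = insert.prems(2)
  have si: "0 < s i" using insert.prems by simp
  define G where "G x = (\<integral>\<^sup>+y. F (x(i := s i * y)) \<partial>lborel)" for x
  have upd[measurable]: "(\<lambda>p. (fst p)(i := s i * snd p)) \<in> measurable (lebs I \<Otimes>\<^sub>M lborel) (lebs (insert i I))"
    by (rule measurable_fun_upd[where J = I]) auto
  have "(\<lambda>p. F ((fst p)(i := s i * snd p))) \<in> borel_measurable (lebs I \<Otimes>\<^sub>M lborel)" by measurable
  then have G: "G \<in> borel_measurable (lebs I)"
    unfolding G_def by (intro sigma_finite_measure.borel_measurable_nn_integral[OF sigma_finite_lborel]) (simp add: case_prod_beta)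
  have "(\<integral>\<^sup>+x. F x \<partial>lebs (insert i I)) = (\<integral>\<^sup>+x. \<integral>\<^sup>+y. F (x(i := y)) \<partial>lborel \<partial>lebs I)"
    by (rule product_nn_integral_insert) (use insert in auto)
  also have "\<dots> = (\<integral>\<^sup>+x. ennreal (s i) * G x \<partial>lebs I)"
  proof (rule nn_integral_cong)
    fix x assume x: "x \<in> space (lebs I)"
    have "(\<lambda>y. x(i := y)) \<in> measurable lborel (lebs (insert i I))"
      using measurable_component_update[OF x insert.hyps(2)] .
    then have "(\<lambda>y. F (x(i := y))) \<in> borel_measurable lborel" by measurable
    then show "(\<integral>\<^sup>+y. F (x(i := y)) \<partial>lborel) = ennreal (s i) * G x"
      using nn_integral_real_affine[of "\<lambda>y. F (x(i := y))" "s i" 0] si by (simp add: G_def)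
  qed
  also have "\<dots> = ennreal (s i) * (\<integral>\<^sup>+x. G x \<partial>lebs I)"
    by (rule nn_integral_cmult[OF G])
  also have "(\<integral>\<^sup>+x. G x \<partial>lebs I) = ennreal (\<Prod>i\<in>I. s i) * (\<integral>\<^sup>+x. G (\<lambda>i\<in>I. s i * x i) \<partial>lebs I)"
    using insert by (intro insert.IH G) auto
  also have "(\<integral>\<^sup>+x. G (\<lambda>i\<in>I. s i * x i) \<partial>lebs I) = (\<integral>\<^sup>+x. \<integral>\<^sup>+y. F (\<lambda>j\<in>insert i I. s j * (x(i := y)) j) \<partial>lborel \<partial>lebs I)"
  proof -
    have "(\<lambda>j\<in>I. s j * x j)(i := s i * y) = (\<lambda>j\<in>insert i I. s j * (x(i := y)) j)" for x y
      using insert.hyps(2) by (auto simp: fun_eq_iff)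
    then show ?thesis by (simp add: G_def)
  qed
  also have "\<dots> = (\<integral>\<^sup>+x. F (\<lambda>j\<in>insert i I. s j * x j) \<partial>lebs (insert i I))"
    by (rule product_nn_integral_insert[symmetric]) (use insert in auto)
  finally have "(\<integral>\<^sup>+x. F x \<partial>lebs (insert i I)) = ennreal (s i) * (ennreal (\<Prod>i\<in>I. s i) * (\<integral>\<^sup>+x. F (\<lambda>j\<in>insert i I. s j * x j) \<partial>lebs (insert i I)))" .
  moreover have "ennreal (\<Prod>i\<in>insert i I. s i) = ennreal (s i) * ennreal (\<Prod>i\<in>I. s i)"
    using insert.hyps insert.prems(1) by (simp add: prod_nonneg less_imp_le ennreal_mult)
  ultimately show ?case by (simp only: mult.assoc)
qed

lemma nn_integral_substitution_Ioo:
  fixes f :: "real \<Rightarrow> ennreal" and \<phi> \<phi>' :: "real \<Rightarrow> real"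
  assumes f: "f \<in> borel_measurable borel" and "a < e"
    and d: "\<And>t. t \<in> {a..e} \<Longrightarrow> (\<phi> has_real_derivative \<phi>' t) (at t)"
    and c: "continuous_on {a..e} \<phi>'" and nn: "\<And>t. t \<in> {a..e} \<Longrightarrow> 0 \<le> \<phi>' t"
    and "\<phi> a = 0" "\<phi> e = M" and pos: "\<And>t. t \<in> {a<..<e} \<Longrightarrow> \<phi> t \<in> {0<..<M}"
  shows "(\<integral>\<^sup>+\<tau>. f \<tau> * indicator {0<..<M} \<tau> \<partial>lborel) = (\<integral>\<^sup>+t. f (\<phi> t) * ennreal (\<phi>' t) * indicator {a<..<e} t \<partial>lborel)"
proof -
  let ?f = "\<lambda>\<tau>. f \<tau> * indicator {0<..<M} \<tau>"
  have fm: "?f \<in> borel_measurable borel" using f by measurable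
  have "(\<integral>\<^sup>+\<tau>. ?f \<tau> \<partial>lborel) = (\<integral>\<^sup>+\<tau>. ?f \<tau> * indicator {\<phi> a..\<phi> e} \<tau> \<partial>lborel)"
    using assms by (intro nn_integral_cong) (auto simp: indicator_def)
  also have "\<dots> = (\<integral>\<^sup>+t. ?f (\<phi> t) * ennreal (\<phi>' t) * indicator {a..e} t \<partial>lborel)"
    by (rule nn_integral_substitution_aux[OF fm _ d c nn \<open>a < e\<close>]) auto
  also have "\<dots> = (\<integral>\<^sup>+t. f (\<phi> t) * ennreal (\<phi>' t) * indicator {a<..<e} t \<partial>lborel)"
  proof (rule nn_integral_cong)
    fix t
    consider "t \<in> {a<..<e}" | "t = a" | "t = e" | "t \<notin> {a..e}" by fastforce
    then show "?f (\<phi> t) * ennreal (\<phi>' t) * indicator {a..e} t = f (\<phi> t) * ennreal (\<phi>' t) * indicator {a<..<e} t"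
    proof cases
      case 1
      then show ?thesis using pos[OF 1] by (simp add: indicator_def)
    qed (use assms in \<open>auto simp: indicator_def\<close>)
  qed
  finally show ?thesis .
qed

section \<open>The change of variables from interlacing points to residues\<close>

text \<open>The indices run over \<open>{k..m}\<close> because the induction splits off \<open>x k\<close>. The last coordinate is
  determined by the product \<open>c\<close> of the \<open>x i\<close>, and the last weight by the sum \<open>\<zeta> - 1\<close> of the weights
  \<open>wgt k m y x i\<close> (that is, \<open>\<xi> i / y i\<close>), where \<open>\<zeta> = c / (\<Prod>i\<in>{k..m}. y i)\<close>.\<close>

definition interlaced :: "nat \<Rightarrow> nat \<Rightarrow> (nat \<Rightarrow> real) \<Rightarrow> (nat \<Rightarrow> real) \<Rightarrow> bool" where
  "interlaced k m y X \<longleftrightarrow> (\<forall>i\<in>{k..m}. y i < X i) \<and> (\<forall>i\<in>{k..<m}. X i < y (Suc i))"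

definition vdm :: "nat \<Rightarrow> nat \<Rightarrow> (nat \<Rightarrow> real) \<Rightarrow> real" where
  "vdm k m x = (\<Prod>j\<in>{k..m}. \<Prod>i\<in>{k..<j}. x j - x i)"

definition wgt :: "nat \<Rightarrow> nat \<Rightarrow> (nat \<Rightarrow> real) \<Rightarrow> (nat \<Rightarrow> real) \<Rightarrow> nat \<Rightarrow> real" where
  "wgt k m y X i = lagc {k..m} y X i / y i"

definition close_prod :: "nat \<Rightarrow> nat \<Rightarrow> real \<Rightarrow> (nat \<Rightarrow> real) \<Rightarrow> nat \<Rightarrow> real" where
  "close_prod k m c x = x(m := c / (\<Prod>i\<in>{k..<m}. x i))"

definition close_sum :: "nat \<Rightarrow> nat \<Rightarrow> real \<Rightarrow> (nat \<Rightarrow> real) \<Rightarrow> nat \<Rightarrow> real" where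
  "close_sum k m \<zeta> w = w(m := \<zeta> - 1 - (\<Sum>i\<in>{k..<m}. w i))"

text \<open>The Vandermonde factor from the integrand of \<open>Q\<close>, divided by the product of
  the \<open>x i\<close> with \<open>i < m\<close>: this divisor is the density left by the delta
  function once \<open>x m\<close> is eliminated. The function \<open>F\<close> of the weights is
  arbitrary and \<open>ennreal\<close>-valued, so the change of variables needs no integrability
  conditions.\<close>

definition lfun :: "nat \<Rightarrow> nat \<Rightarrow> (nat \<Rightarrow> real) \<Rightarrow> real \<Rightarrow> ((nat \<Rightarrow> real) \<Rightarrow> ennreal) \<Rightarrow> (nat \<Rightarrow> real) \<Rightarrow> ennreal" where
  "lfun k m y c F x = (if interlaced k m y (close_prod k m c x) then
     ennreal (vdm k m (close_prod k m c x) / (\<Prod>i\<in>{k..<m}. x i)) * F (\<lambda>i\<in>{k..m}. wgt k m y (close_prod k m c x) i) else 0)"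

definition sfun :: "nat \<Rightarrow> nat \<Rightarrow> real \<Rightarrow> ((nat \<Rightarrow> real) \<Rightarrow> ennreal) \<Rightarrow> (nat \<Rightarrow> real) \<Rightarrow> ennreal" where
  "sfun k m \<zeta> F w = (if \<forall>i\<in>{k..m}. 0 < close_sum k m \<zeta> w i then F (close_sum k m \<zeta> w) else 0)"

lemma vdm_Suc: "k \<le> m \<Longrightarrow> vdm k m x = vdm (Suc k) m x * (\<Prod>j\<in>{Suc k..m}. x j - x k)"
proof -
  assume "k \<le> m"
  have "vdm k m x = (\<Prod>i\<in>{k..<k}. x k - x i) * (\<Prod>j\<in>{Suc k..m}. \<Prod>i\<in>{k..<j}. x j - x i)"
    using \<open>k \<le> m\<close> unfolding vdm_def by (subst prod.atLeast_Suc_atMost) auto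
  also have "\<dots> = (\<Prod>j\<in>{Suc k..m}. (x j - x k) * (\<Prod>i\<in>{Suc k..<j}. x j - x i))"
    by (simp add: prod.atLeast_Suc_lessThan)
  finally show ?thesis by (simp add: prod.distrib vdm_def mult.commute)
qed

lemma interlaced_Suc:
  assumes "k < m"
  shows "interlaced k m y (X(k := t)) \<longleftrightarrow> y k < t \<and> t < y (Suc k) \<and> interlaced (Suc k) m y X"
proof -
  have "{k..m} = insert k {Suc k..m}" "{k..<m} = insert k {Suc k..<m}" using assms by auto
  then show ?thesis unfolding interlaced_def by auto
qed

lemma interlaced_vdm_pos:
  assumes "interlaced k m y X" and y: "strict_mono_on {k..m} y"
  shows "0 < vdm k m X"
  unfolding vdm_def
proof (intro prod_pos)
  fix i j assume j: "j \<in> {k..m}" and i: "i \<in> {k..<j}"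
  have "X i < y (Suc i)" using assms(1) i j by (auto simp: interlaced_def)
  also have "y (Suc i) \<le> y j" using y i j by (intro strict_mono_on_leD[OF y]) auto
  also have "y j < X j" using assms(1) j by (auto simp: interlaced_def)
  finally show "0 < X j - X i" by simp
qed

section \<open>Splitting off the first of the interlacing points\<close>

locale interlace =
  fixes k m :: nat and y :: "nat \<Rightarrow> real"
  assumes km: "k < m" and ypos: "\<And>i. i \<in> {k..m} \<Longrightarrow> 0 < y i" and ymono: "strict_mono_on {k..m} y"
begin

lemma ylt: "k \<le> i \<Longrightarrow> i < j \<Longrightarrow> j \<le> m \<Longrightarrow> y i < y j"
  using strict_mono_onD[OF ymono, of i j] by auto

lemma yle: "k \<le> i \<Longrightarrow> i \<le> j \<Longrightarrow> j \<le> m \<Longrightarrow> y i \<le> y j"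
  using ylt[of i j] by (cases "i = j") auto

lemma yinj: "inj_on y {Suc k..m}"
proof (rule linorder_inj_onI)
  fix i j assume "i < j" "i \<in> {Suc k..m}" "j \<in> {Suc k..m}"
  then show "y i \<noteq> y j" using ylt[of i j] by simp
qed auto

lemma yk_notin: "y k \<notin> y ` {Suc k..m}"
proof
  assume "y k \<in> y ` {Suc k..m}"
  then obtain i where "i \<in> {Suc k..m}" "y k = y i" by blast
  then show False using ylt[of k i] by simp
qed

text \<open>The integrand that remains after \<open>x k = t\<close> is split off, as a function of the weights \<open>v\<close> of the
  other nodes: Lagrange interpolation expresses the factors that contain \<open>t\<close> or \<open>y k\<close> by \<open>v\<close>.\<close>

definition peel :: "real \<Rightarrow> ((nat \<Rightarrow> real) \<Rightarrow> ennreal) \<Rightarrow> (nat \<Rightarrow> real) \<Rightarrow> ennreal" where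
  "peel t F v = ennreal ((\<Prod>i\<in>{Suc k..m}. y i - t) * (1 + (\<Sum>i\<in>{Suc k..m}. y i * v i / (y i - t)))) *
     F (\<lambda>i\<in>{k..m}. if i = k then (t - y k) / y k * (1 + (\<Sum>i\<in>{Suc k..m}. y i * v i / (y i - y k)))
         else v i * (y i - t) / (y i - y k))"

text \<open>The weight of node \<open>i\<close> changes by the quotient of the one new factor
  \<open>t - y i\<close> in the numerator and the one new factor \<open>y k - y i\<close> in the
  denominator.\<close>

lemma wgt_Suc:
  assumes "y k < t" "t < y (Suc k)" and i: "i \<in> {Suc k..m}"
  shows "wgt k m y (X(k := t)) i = wgt (Suc k) m y X i * (y i - t) / (y i - y k)"
proof -
  have e: "{k..m} = insert k {Suc k..m}" "{k..m} - {i} = insert k ({Suc k..m} - {i})" using km i by auto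
  have "(\<Prod>j\<in>{k..m}. (X(k := t)) j - y i) = (t - y i) * (\<Prod>j\<in>{Suc k..m}. X j - y i)"
    unfolding e(1) by (subst prod.insert) (auto intro!: prod.cong)
  moreover have "(\<Prod>j\<in>{k..m} - {i}. y j - y i) = (y k - y i) * (\<Prod>j\<in>{Suc k..m} - {i}. y j - y i)"
    unfolding e(2) by (subst prod.insert) auto
  moreover have "(t - y i) / (y k - y i) = (y i - t) / (y i - y k)"
    by (metis minus_diff_eq minus_divide_divide)
  ultimately have "wgt k m y (X(k := t)) i = (t - y i) * (\<Prod>j\<in>{Suc k..m}. X j - y i) / ((y k - y i) * (\<Prod>j\<in>{Suc k..m} - {i}. y j - y i)) / y i"
    and q: "(t - y i) / (y k - y i) = (y i - t) / (y i - y k)"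
    by (simp_all only: wgt_def lagc_def)
  from this(1) have "wgt k m y (X(k := t)) i = (t - y i) / (y k - y i) * ((\<Prod>j\<in>{Suc k..m}. X j - y i) / (\<Prod>j\<in>{Suc k..m} - {i}. y j - y i) / y i)"
    by simp
  then show ?thesis
    unfolding q wgt_def[of "Suc k"] lagc_def by (simp add: mult_ac)
qed

lemma lagc_eq:
  assumes "i \<in> {Suc k..m}"
  shows "lagc {Suc k..m} y X i = y i * wgt (Suc k) m y X i"
  using ypos[of i] assms by (simp add: wgt_def)

text \<open>\<open>lagrange_eval\<close> at \<open>T = y k\<close> expresses the product of the
  \<open>X j - y k\<close> by the weights of the other nodes.\<close>

lemma wgt_first:
  "wgt k m y (X(k := t)) k = (t - y k) / y k * (1 + (\<Sum>i\<in>{Suc k..m}. y i * wgt (Suc k) m y X i / (y i - y k)))"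
proof -
  have e: "{k..m} = insert k {Suc k..m}" "{k..m} - {k} = {Suc k..m}" using km by auto
  have "(\<Prod>j\<in>{k..m}. (X(k := t)) j - y k) = (t - y k) * (\<Prod>j\<in>{Suc k..m}. X j - y k)"
    unfolding e(1) by (subst prod.insert) (auto intro!: prod.cong)
  also have "(\<Prod>j\<in>{Suc k..m}. X j - y k) = (\<Prod>j\<in>{Suc k..m}. y j - y k) * (1 + (\<Sum>i\<in>{Suc k..m}. lagc {Suc k..m} y X i / (y i - y k)))"
    using yinj yk_notin by (intro lagrange_eval) auto
  also have "(\<Sum>i\<in>{Suc k..m}. lagc {Suc k..m} y X i / (y i - y k)) = (\<Sum>i\<in>{Suc k..m}. y i * wgt (Suc k) m y X i / (y i - y k))"
    by (intro sum.cong refl) (simp only: lagc_eq)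
  finally have num: "(\<Prod>j\<in>{k..m}. (X(k := t)) j - y k) =
     (t - y k) * ((\<Prod>j\<in>{Suc k..m}. y j - y k) * (1 + (\<Sum>i\<in>{Suc k..m}. y i * wgt (Suc k) m y X i / (y i - y k))))" .
  have nz: "(\<Prod>j\<in>{Suc k..m}. y j - y k) \<noteq> 0" using yk_notin by (auto simp: prod_zero_iff image_iff)
  show ?thesis
    unfolding wgt_def[of k] lagc_def[of "{k..m}"] num e(2) using nz by simp
qed

text \<open>Fixing \<open>x k = t\<close> leaves an integrand of the same kind on
  \<open>{Suc k..m}\<close> with the product \<open>c / t\<close>. The Vandermonde factors
  \<open>X j - t\<close> are expressed by the weights of the other nodes through
  \<open>lagrange_eval\<close> at \<open>T = t\<close>; this is possible because \<open>t\<close>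
  lies strictly below all of them.\<close>

lemma lfun_step:
  assumes t: "y k < t" "t < y (Suc k)"
  shows "lfun k m y c F (x(k := t)) = ennreal (1 / t) * lfun (Suc k) m y (c / t) (peel t F) x"
proof -
  let ?X = "close_prod (Suc k) m (c / t) x"
  have e: "{k..m} = insert k {Suc k..m}" "{k..<m} = insert k {Suc k..<m}" using km by auto
  have pr: "(\<Prod>i\<in>{k..<m}. (x(k := t)) i) = t * (\<Prod>i\<in>{Suc k..<m}. x i)"
    unfolding e(2) by (subst prod.insert) (auto intro!: prod.cong)
  have X: "close_prod k m c (x(k := t)) = ?X(k := t)"
    using km unfolding close_prod_def pr by (auto simp: fun_eq_iff)
  have tpos: "0 < t" using ypos[of k] km t by simp
  show ?thesis
  proof (cases "interlaced (Suc k) m y ?X")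
    case False
    then show ?thesis unfolding lfun_def X interlaced_Suc[OF km] by simp
  next
    case True
    have interlaced: "interlaced k m y (?X(k := t))" using interlaced_Suc[OF km] True t by simp
    have ymono': "strict_mono_on {Suc k..m} y" using ymono by (rule monotone_on_subset) auto
    have T: "t \<notin> y ` {Suc k..m}"
    proof
      assume "t \<in> y ` {Suc k..m}"
      then obtain i where "i \<in> {Suc k..m}" "t = y i" by blast
      then show False using t yle[of "Suc k" i] by simp
    qed
    have vdm: "vdm k m (?X(k := t)) = vdm (Suc k) m ?X * (\<Prod>j\<in>{Suc k..m}. ?X j - t)"
    proof -
      have "vdm (Suc k) m (?X(k := t)) = vdm (Suc k) m ?X" unfolding vdm_def by (intro prod.cong refl) auto
      moreover have "(\<Prod>j\<in>{Suc k..m}. (?X(k := t)) j - (?X(k := t)) k) = (\<Prod>j\<in>{Suc k..m}. ?X j - t)"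
        by (intro prod.cong refl) auto
      ultimately show ?thesis using km by (simp only: vdm_Suc[of k m "?X(k := t)"] less_imp_le)
    qed
    define A where "A = (\<Prod>j\<in>{Suc k..m}. ?X j - t)"
    have A: "A = (\<Prod>i\<in>{Suc k..m}. y i - t) * (1 + (\<Sum>i\<in>{Suc k..m}. y i * wgt (Suc k) m y ?X i / (y i - t)))"
      unfolding A_def lagrange_eval[OF finite_atLeastAtMost yinj T, of ?X]
      by (intro arg_cong2[of _ _ _ _ "(*)"] arg_cong2[of _ _ _ _ "(+)"] sum.cong refl) (simp only: lagc_eq)
    have Apos: "0 < A"
      unfolding A_def
    proof (intro prod_pos)
      fix j assume j: "j \<in> {Suc k..m}"
      have "t < y (Suc k)" by fact
      also have "y (Suc k) \<le> y j" using j by (intro yle) auto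
      also have "y j < ?X j" using True j by (auto simp: interlaced_def)
      finally show "0 < ?X j - t" by simp
    qed
    have args: "(\<lambda>i\<in>{k..m}. wgt k m y (?X(k := t)) i) = (\<lambda>i\<in>{k..m}. if i = k then (t - y k) / y k * (1 + (\<Sum>i\<in>{Suc k..m}. y i * (\<lambda>i\<in>{Suc k..m}. wgt (Suc k) m y ?X i) i / (y i - y k)))
         else (\<lambda>i\<in>{Suc k..m}. wgt (Suc k) m y ?X i) i * (y i - t) / (y i - y k))"
    proof (rule restrict_ext)
      fix i assume "i \<in> {k..m}"
      then consider "i = k" | "i \<noteq> k" "i \<in> {Suc k..m}" by fastforce
      then show "wgt k m y (?X(k := t)) i = (if i = k then (t - y k) / y k * (1 + (\<Sum>i\<in>{Suc k..m}. y i * (\<lambda>i\<in>{Suc k..m}. wgt (Suc k) m y ?X i) i / (y i - y k)))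
         else (\<lambda>i\<in>{Suc k..m}. wgt (Suc k) m y ?X i) i * (y i - t) / (y i - y k))"
      proof cases
        case 1
        have "(\<Sum>i\<in>{Suc k..m}. y i * (\<lambda>i\<in>{Suc k..m}. wgt (Suc k) m y ?X i) i / (y i - y k)) = (\<Sum>i\<in>{Suc k..m}. y i * wgt (Suc k) m y ?X i / (y i - y k))"
          by (intro sum.cong) auto
        then show ?thesis using 1 wgt_first[of ?X t] by simp
      qed (simp add: wgt_Suc[OF t])
    qed
    have FT: "peel t F (\<lambda>i\<in>{Suc k..m}. wgt (Suc k) m y ?X i) = ennreal A * F (\<lambda>i\<in>{k..m}. wgt k m y (?X(k := t)) i)"
    proof -
      have "(\<Sum>i\<in>{Suc k..m}. y i * (\<lambda>i\<in>{Suc k..m}. wgt (Suc k) m y ?X i) i / (y i - t)) = (\<Sum>i\<in>{Suc k..m}. y i * wgt (Suc k) m y ?X i / (y i - t))"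
        by (intro sum.cong) auto
      then show ?thesis unfolding peel_def args A by simp
    qed
    have xpos: "0 < (\<Prod>i\<in>{Suc k..<m}. x i)"
    proof (intro prod_pos)
      fix i assume i: "i \<in> {Suc k..<m}"
      have "?X i = x i" using i by (simp add: close_prod_def)
      moreover have "y i < ?X i" using True i unfolding interlaced_def by simp
      ultimately show "0 < x i" using ypos[of i] i by simp
    qed
    have Vpos: "0 < vdm (Suc k) m ?X" using interlaced_vdm_pos[OF True ymono'] .
    have "lfun k m y c F (x(k := t)) = ennreal (vdm (Suc k) m ?X * A / (t * (\<Prod>i\<in>{Suc k..<m}. x i))) * F (\<lambda>i\<in>{k..m}. wgt k m y (?X(k := t)) i)"
      unfolding lfun_def X pr vdm A_def[symmetric] using interlaced by simp
    also have "ennreal (vdm (Suc k) m ?X * A / (t * (\<Prod>i\<in>{Suc k..<m}. x i))) = ennreal (1 / t) * ennreal (vdm (Suc k) m ?X / (\<Prod>i\<in>{Suc k..<m}. x i)) * ennreal A"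
      using tpos Apos xpos Vpos by (simp add: ennreal_mult[symmetric] less_imp_le mult_ac)
    finally show ?thesis
      unfolding lfun_def[of "Suc k"] by (simp only: True if_True FT mult.assoc)
  qed
qed

end

section \<open>The weight of the first node as the new variable of integration\<close>

context interlace
begin

lemma ykpos: "0 < y k" using ypos[of k] km by simp

text \<open>For fixed weights \<open>w i\<close> with \<open>k < i < m\<close> the following are functions of \<open>t = x k\<close>: the weight of the
  last node after \<open>x k\<close> is split off, the weight of the last node before, and the derivative of
  \<open>slack \<zeta> w - wlast \<zeta> w t\<close>, which is the weight of node \<open>k\<close> and the new variable of integration.\<close>

definition vlast :: "real \<Rightarrow> (nat \<Rightarrow> real) \<Rightarrow> real \<Rightarrow> real" where
  "vlast \<zeta> w t = \<zeta> * y k / t - 1 - (\<Sum>i\<in>{Suc k..<m}. w i * (y i - y k) / (y i - t))"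

definition wlast :: "real \<Rightarrow> (nat \<Rightarrow> real) \<Rightarrow> real \<Rightarrow> real" where
  "wlast \<zeta> w t = (y m - t) * vlast \<zeta> w t / (y m - y k)"

definition dwfirst :: "real \<Rightarrow> (nat \<Rightarrow> real) \<Rightarrow> real \<Rightarrow> real" where
  "dwfirst \<zeta> w t = (vlast \<zeta> w t + (y m - t) * (\<zeta> * y k / t\<^sup>2 + (\<Sum>i\<in>{Suc k..<m}. w i * (y i - y k) / (y i - t)\<^sup>2))) / (y m - y k)"

definition slack :: "real \<Rightarrow> (nat \<Rightarrow> real) \<Rightarrow> real" where
  "slack \<zeta> w = \<zeta> - 1 - (\<Sum>i\<in>{Suc k..<m}. w i)"

lemma vlast_first: "vlast \<zeta> w (y k) = slack \<zeta> w"
proof -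
  have "(\<Sum>i\<in>{Suc k..<m}. w i * (y i - y k) / (y i - y k)) = (\<Sum>i\<in>{Suc k..<m}. w i)"
  proof (rule sum.cong[OF refl])
    fix i assume "i \<in> {Suc k..<m}"
    then have "y k < y i" using ylt[of k i] by simp
    then show "w i * (y i - y k) / (y i - y k) = w i" by simp
  qed
  then show ?thesis using ykpos by (simp add: vlast_def slack_def)
qed

lemma wlast_first: "wlast \<zeta> w (y k) = slack \<zeta> w"
  using ylt[of k m] km by (simp add: wlast_def vlast_first)

lemma vlast_less:
  assumes "0 < \<zeta>" "\<And>i. i \<in> {Suc k..<m} \<Longrightarrow> 0 < w i" "y k \<le> s" "s < t" "\<And>i. i \<in> {Suc k..<m} \<Longrightarrow> t < y i"
  shows "vlast \<zeta> w t < vlast \<zeta> w s"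
proof -
  have "\<zeta> * y k / t < \<zeta> * y k / s"
    using assms ykpos by (intro divide_strict_left_mono) auto
  moreover have "(\<Sum>i\<in>{Suc k..<m}. w i * (y i - y k) / (y i - s)) \<le> (\<Sum>i\<in>{Suc k..<m}. w i * (y i - y k) / (y i - t))"
  proof (rule sum_mono)
    fix i assume i: "i \<in> {Suc k..<m}"
    then have "y k < y i" "t < y i" "0 < w i" using assms ylt[of k i] by auto
    then show "w i * (y i - y k) / (y i - s) \<le> w i * (y i - y k) / (y i - t)"
      using assms(4) by (intro divide_left_mono) auto
  qed
  ultimately show ?thesis by (simp add: vlast_def)
qed

lemma vlast_deriv:
  assumes "0 < t" "\<And>i. i \<in> {Suc k..<m} \<Longrightarrow> t < y i"
  shows "(vlast \<zeta> w has_real_derivative - (\<zeta> * y k / t\<^sup>2 + (\<Sum>i\<in>{Suc k..<m}. w i * (y i - y k) / (y i - t)\<^sup>2))) (at t)"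
proof -
  have "((\<lambda>t. \<zeta> * y k / t) has_real_derivative - (\<zeta> * y k / t\<^sup>2)) (at t)"
    using assms(1) by (auto intro!: derivative_eq_intros simp: power2_eq_square)
  moreover have "((\<lambda>t. \<Sum>i\<in>{Suc k..<m}. w i * (y i - y k) / (y i - t)) has_real_derivative (\<Sum>i\<in>{Suc k..<m}. w i * (y i - y k) / (y i - t)\<^sup>2)) (at t)"
  proof (rule DERIV_sum)
    fix i assume "i \<in> {Suc k..<m}"
    then have "y i - t \<noteq> 0" using assms(2)[of i] by simp
    then show "((\<lambda>t. w i * (y i - y k) / (y i - t)) has_real_derivative w i * (y i - y k) / (y i - t)\<^sup>2) (at t)"
      by (auto intro!: derivative_eq_intros simp: power2_eq_square)
  qed
  ultimately have "((\<lambda>t. \<zeta> * y k / t - 1 - (\<Sum>i\<in>{Suc k..<m}. w i * (y i - y k) / (y i - t))) has_real_derivative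
      - (\<zeta> * y k / t\<^sup>2) - 0 - (\<Sum>i\<in>{Suc k..<m}. w i * (y i - y k) / (y i - t)\<^sup>2)) (at t)"
    by (intro DERIV_diff DERIV_const)
  moreover have "vlast \<zeta> w = (\<lambda>t. \<zeta> * y k / t - 1 - (\<Sum>i\<in>{Suc k..<m}. w i * (y i - y k) / (y i - t)))"
    by (rule ext) (rule vlast_def)
  ultimately show ?thesis by simp
qed

lemma wlast_deriv:
  assumes "0 < t" "\<And>i. i \<in> {Suc k..<m} \<Longrightarrow> t < y i"
  shows "((\<lambda>t. M - wlast \<zeta> w t) has_real_derivative dwfirst \<zeta> w t) (at t)"
proof -
  define S where "S = \<zeta> * y k / t\<^sup>2 + (\<Sum>i\<in>{Suc k..<m}. w i * (y i - y k) / (y i - t)\<^sup>2)"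
  have "(vlast \<zeta> w has_real_derivative - S) (at t)" unfolding S_def by (rule vlast_deriv[OF assms])
  then have "((\<lambda>t. M - (y m - t) * vlast \<zeta> w t / (y m - y k)) has_real_derivative
      0 - ((0 - 1) * vlast \<zeta> w t + - S * (y m - t)) / (y m - y k)) (at t)"
    by (intro DERIV_diff DERIV_const DERIV_cdivide DERIV_mult DERIV_ident)
  moreover have "0 - ((0 - 1) * vlast \<zeta> w t + - S * (y m - t)) / (y m - y k) = dwfirst \<zeta> w t"
    unfolding dwfirst_def S_def[symmetric] by (simp add: minus_divide_left mult.commute)
  ultimately show ?thesis by (simp only: wlast_def)
qed

text \<open>In general the end point is the zero of \<open>vlast\<close>; for \<open>m = Suc k\<close> it may also be \<open>y m\<close>.\<close>

definition is_endpoint :: "real \<Rightarrow> (nat \<Rightarrow> real) \<Rightarrow> real \<Rightarrow> bool" where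
  "is_endpoint \<zeta> w e \<longleftrightarrow> y k < e \<and> (\<forall>i\<in>{Suc k..<m}. e < y i) \<and> wlast \<zeta> w e = 0 \<and> 0 \<le> vlast \<zeta> w e \<and> e \<le> y m \<and>
    (\<forall>t. y k < t \<and> t < y (Suc k) \<and> 0 < vlast \<zeta> w t \<longleftrightarrow> y k < t \<and> t < e)"

lemma ex_endpoint:
  assumes z: "0 < \<zeta>" and w0: "\<forall>i\<in>{Suc k..<m}. 0 < w i" and M: "0 < slack \<zeta> w"
  shows "\<exists>e. is_endpoint \<zeta> w e"
proof (cases "Suc k = m")
  case True
  have v: "vlast \<zeta> w t = \<zeta> * y k / t - 1" for t using True by (simp add: vlast_def)
  have zk: "y k < \<zeta> * y k" using M True ykpos by (simp add: slack_def)
  define e where "e = min (y m) (\<zeta> * y k)"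
  have yk: "y k < y m" using ylt[of k m] km by simp
  have "y k < e" using zk yk by (simp add: e_def)
  moreover have "wlast \<zeta> w e = 0"
    using zk ykpos by (cases "y m \<le> \<zeta> * y k") (auto simp: e_def wlast_def v min_def)
  moreover have "0 \<le> vlast \<zeta> w e" using \<open>y k < e\<close> ykpos by (simp add: v e_def)
  moreover have "y k < t \<and> t < y (Suc k) \<and> 0 < vlast \<zeta> w t \<longleftrightarrow> y k < t \<and> t < e" for t
    using ykpos by (auto simp: e_def v True)
  moreover have "e \<le> y m" by (simp add: e_def)
  ultimately show ?thesis unfolding is_endpoint_def using True by auto
next
  case False
  note w = bspec[OF w0]
  from False have kJ: "Suc k \<in> {Suc k..<m}" using km by simp
  have ab: "y k < y (Suc k)" using ylt[of k "Suc k"] km by simp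
  have lt: "t < y i" if "t < y (Suc k)" "i \<in> {Suc k..<m}" for t i
    using yle[of "Suc k" i] that by auto
  \<comment> \<open>Chosen so that at \<open>y (Suc k) - \<delta>\<close> the summand of node
    \<open>Suc k\<close> alone equals \<open>\<zeta> + w (Suc k)\<close>, more than the term
    \<open>\<zeta> * y k / t\<close> can balance; so \<open>vlast\<close> is no longer positive
    there and has a zero before.\<close>
  define \<delta> where "\<delta> = w (Suc k) * (y (Suc k) - y k) / (\<zeta> + w (Suc k))"
  have wk: "0 < w (Suc k)" using w kJ by simp
  have d: "0 < \<delta>" "\<delta> < y (Suc k) - y k"
    using wk z ab by (auto simp: \<delta>_def field_simps)
  let ?t = "y (Suc k) - \<delta>"
  have t: "y k < ?t" "?t < y (Suc k)" using d by auto
  have "\<zeta> + w (Suc k) = w (Suc k) * (y (Suc k) - y k) / (y (Suc k) - ?t)"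
    using wk z ab by (simp add: \<delta>_def)
  also have "\<dots> \<le> (\<Sum>i\<in>{Suc k..<m}. w i * (y i - y k) / (y i - ?t))"
  proof (rule member_le_sum[OF kJ])
    fix i assume i: "i \<in> {Suc k..<m} - {Suc k}"
    then show "0 \<le> w i * (y i - y k) / (y i - ?t)"
      using w[of i] lt[OF t(2), of i] ylt[of k i] by (intro divide_nonneg_nonneg mult_nonneg_nonneg) auto
  qed simp
  finally have "\<zeta> + w (Suc k) \<le> (\<Sum>i\<in>{Suc k..<m}. w i * (y i - y k) / (y i - ?t))" .
  moreover have "\<zeta> * y k / ?t \<le> \<zeta>"
    using z t ykpos by (simp add: divide_le_eq)
  ultimately have neg: "vlast \<zeta> w ?t \<le> 0" using wk unfolding vlast_def by linarith
  have cont: "continuous_on {y k..?t} (vlast \<zeta> w)"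
  proof (intro continuous_at_imp_continuous_on ballI)
    fix s assume "s \<in> {y k..?t}"
    then have "0 < s" "s < y (Suc k)" using ykpos t by auto
    with lt[of s] show "isCont (vlast \<zeta> w) s" by (intro DERIV_isCont[OF vlast_deriv]) auto
  qed
  have "\<exists>e\<ge>y k. e \<le> ?t \<and> vlast \<zeta> w e = 0"
    using neg M t by (intro IVT2' cont) (auto simp: vlast_first)
  then obtain e where e: "y k \<le> e" "e \<le> ?t" "vlast \<zeta> w e = 0" by blast
  have eb: "e < y (Suc k)" using e t by simp
  have "e \<noteq> y k" using e(3) M by (auto simp: vlast_first)
  then have ek: "y k < e" using e by simp
  have "y k < t \<and> t < y (Suc k) \<and> 0 < vlast \<zeta> w t \<longleftrightarrow> y k < t \<and> t < e" for t
  proof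
    assume t: "y k < t \<and> t < y (Suc k) \<and> 0 < vlast \<zeta> w t"
    have "\<not> e < t" using vlast_less[OF z w, where s = e and t = t] t lt[of t] e by fastforce
    moreover have "t \<noteq> e" using t e by auto
    ultimately show "y k < t \<and> t < e" using t by simp
  next
    assume t: "y k < t \<and> t < e"
    then have "0 < vlast \<zeta> w t" using vlast_less[OF z w, where s = t and t = e] lt[OF eb] e by fastforce
    then show "y k < t \<and> t < y (Suc k) \<and> 0 < vlast \<zeta> w t" using t eb by simp
  qed
  moreover have "e \<le> y m" using eb yle[of "Suc k" m] km by simp
  moreover have "wlast \<zeta> w e = 0" by (simp add: wlast_def e)
  ultimately show ?thesis unfolding is_endpoint_def using ek lt[OF eb] e by (intro exI[of _ e]) simp
qed

text \<open>From \<open>y k\<close> to the end point,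
  \<open>slack \<zeta> w - wlast \<zeta> w t\<close> runs from 0 to \<open>slack \<zeta> w\<close>
  with nonnegative derivative \<open>dwfirst\<close>. If \<open>slack \<zeta> w\<close> is not
  positive, both domains are empty, since \<open>vlast\<close> starts at this value and
  decreases.\<close>

lemma nn_integral_first_weight:
  assumes z: "0 < \<zeta>" and w: "\<And>i. i \<in> {Suc k..<m} \<Longrightarrow> 0 < w i" and G: "G \<in> borel_measurable borel"
  shows "(\<integral>\<^sup>+\<tau>. G \<tau> * indicator {0<..<slack \<zeta> w} \<tau> \<partial>lborel) =
    (\<integral>\<^sup>+t. G (slack \<zeta> w - wlast \<zeta> w t) * ennreal (dwfirst \<zeta> w t) * indicator {t. y k < t \<and> t < y (Suc k) \<and> 0 < vlast \<zeta> w t} t \<partial>lborel)"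
proof (cases "0 < slack \<zeta> w")
  case False
  have "\<not> (y k < t \<and> t < y (Suc k) \<and> 0 < vlast \<zeta> w t)" for t
  proof
    assume t: "y k < t \<and> t < y (Suc k) \<and> 0 < vlast \<zeta> w t"
    have "t < y i" if "i \<in> {Suc k..<m}" for i using yle[of "Suc k" i] that t by auto
    then have "vlast \<zeta> w t < vlast \<zeta> w (y k)" using t by (intro vlast_less z w) auto
    then show False using t False by (simp add: vlast_first)
  qed
  then have "{t. y k < t \<and> t < y (Suc k) \<and> 0 < vlast \<zeta> w t} = {}" by blast
  then show ?thesis using False by simp
next
  case True
  have w0: "\<forall>i\<in>{Suc k..<m}. 0 < w i" using w by blast
  obtain e where "is_endpoint \<zeta> w e" using ex_endpoint[OF z w0 True] ..
  then have e0: "y k < e" "\<forall>i\<in>{Suc k..<m}. e < y i" "wlast \<zeta> w e = 0" "0 \<le> vlast \<zeta> w e" "e \<le> y m"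
      and e6: "\<forall>t. y k < t \<and> t < y (Suc k) \<and> 0 < vlast \<zeta> w t \<longleftrightarrow> y k < t \<and> t < e"
    unfolding is_endpoint_def by fast+
  note e = e0(1) bspec[OF e0(2)] e0(3-5)
  note ev = spec[OF e6]
  have set: "{t. y k < t \<and> t < y (Suc k) \<and> 0 < vlast \<zeta> w t} = {y k<..<e}"
    by (rule Set.set_eqI) (simp only: mem_Collect_eq greaterThanLessThan_iff ev)
  have lt: "t < y i" if "t \<le> e" "i \<in> {Suc k..<m}" for t i using e(2)[of i] that by simp
  have vnn: "0 \<le> vlast \<zeta> w t" if "t \<in> {y k..e}" for t
  proof -
    have "t = y k \<or> t = e \<or> y k < t \<and> t < e" using that by auto
    then show ?thesis using True e(4) ev[of t] by (elim disjE) (auto simp: vlast_first)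
  qed
  have ym: "0 < y m - y k" using ylt[of k m] km by simp
  show ?thesis
    unfolding set
  proof (rule nn_integral_substitution_Ioo[OF G e(1)])
    fix t assume t: "t \<in> {y k..e}"
    then show "((\<lambda>t. slack \<zeta> w - wlast \<zeta> w t) has_real_derivative dwfirst \<zeta> w t) (at t)"
      using ykpos by (intro wlast_deriv lt) auto
    have "0 \<le> w i * (y i - y k) / (y i - t)\<^sup>2" if "i \<in> {Suc k..<m}" for i
      using w[OF that] ylt[of k i] that by (intro divide_nonneg_nonneg mult_nonneg_nonneg) auto
    then have "0 \<le> (\<Sum>i\<in>{Suc k..<m}. w i * (y i - y k) / (y i - t)\<^sup>2)" by (intro sum_nonneg)
    moreover have "0 \<le> \<zeta> * y k / t\<^sup>2" using z ykpos by simp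
    ultimately show "0 \<le> dwfirst \<zeta> w t"
      unfolding dwfirst_def using vnn[OF t] t e(5) ym z ykpos by (intro divide_nonneg_pos add_nonneg_nonneg mult_nonneg_nonneg) auto
  next
    show "continuous_on {y k..e} (dwfirst \<zeta> w)"
      unfolding dwfirst_def vlast_def
    proof (intro continuous_intros ballI)
      show "y m - y k \<noteq> 0" for x using ym by simp
      show "x \<noteq> 0" if "x \<in> {y k..e}" for x using that ykpos by auto
      show "y i - x \<noteq> 0" if "x \<in> {y k..e}" "i \<in> {Suc k..<m}" for x i using that lt[of x i] by auto
      show "x\<^sup>2 \<noteq> 0" if "x \<in> {y k..e}" for x using that ykpos by auto
      show "(y i - x)\<^sup>2 \<noteq> 0" if "x \<in> {y k..e}" "i \<in> {Suc k..<m}" for x i using that lt[of x i] by auto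
    qed
  next
    fix t assume t: "t \<in> {y k<..<e}"
    have v: "0 < vlast \<zeta> w t" using ev[of t] t by simp
    have "vlast \<zeta> w t < vlast \<zeta> w (y k)" using t by (intro vlast_less z w lt) auto
    moreover have "wlast \<zeta> w t \<le> vlast \<zeta> w t"
      unfolding wlast_def using v t e(5) ym by (simp add: divide_le_eq mult_mono mult.commute)
    moreover have "0 < wlast \<zeta> w t" unfolding wlast_def using v t e(5) ym by simp
    ultimately show "slack \<zeta> w - wlast \<zeta> w t \<in> {0<..<slack \<zeta> w}" by (simp add: vlast_first)
  qed (use e in \<open>auto simp: wlast_first\<close>)
qed

end

section \<open>Comparison of the integrands before and after the substitution\<close>

context interlace
begin

lemma close_sum_update: "close_sum k m \<zeta> (w(k := t)) = w(k := t, m := slack \<zeta> w - t)"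
proof -
  have "(\<Sum>i\<in>{k..<m}. (w(k := t)) i) = t + (\<Sum>i\<in>{Suc k..<m}. w i)"
    using km by (subst sum.atLeast_Suc_lessThan) (auto intro!: sum.cong)
  then show ?thesis by (simp add: close_sum_def slack_def algebra_simps)
qed

lemma sfun_update:
  "sfun k m \<zeta> F (w(k := \<tau>)) = (if \<forall>i\<in>{Suc k..<m}. 0 < w i then F (w(k := \<tau>, m := slack \<zeta> w - \<tau>)) * indicator {0<..<slack \<zeta> w} \<tau> else 0)"
proof -
  have "{k..m} = insert k (insert m {Suc k..<m})" using km by auto
  then have "(\<forall>i\<in>{k..m}. 0 < (w(k := \<tau>, m := slack \<zeta> w - \<tau>)) i) \<longleftrightarrow> (\<forall>i\<in>{Suc k..<m}. 0 < w i) \<and> \<tau> \<in> {0<..<slack \<zeta> w}"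
    using km by auto
  then show ?thesis by (simp add: sfun_def close_sum_update)
qed

text \<open>The weights of the middle nodes after \<open>x k = t\<close> is split off, in terms of
  the final weights \<open>w\<close>: the factor of \<open>wgt_Suc\<close>, inverted.\<close>

definition inner_w :: "(nat \<Rightarrow> real) \<Rightarrow> real \<Rightarrow> nat \<Rightarrow> real" where
  "inner_w w t = (\<lambda>i\<in>{Suc k..<m}. (y i - y k) / (y i - t) * w i)"

lemma close_sum_inner_w: "close_sum (Suc k) m (\<zeta> * y k / t) (inner_w w t) = (inner_w w t)(m := vlast \<zeta> w t)"
proof -
  have "(\<Sum>i\<in>{Suc k..<m}. inner_w w t i) = (\<Sum>i\<in>{Suc k..<m}. w i * (y i - y k) / (y i - t))"
    by (rule sum.cong[OF refl]) (simp add: inner_w_def mult.commute)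
  then show ?thesis by (simp add: close_sum_def vlast_def)
qed

text \<open>The complete vector of final weights as a function of \<open>t\<close>: the middle ones
  are free, the last is \<open>wlast\<close>, and the first is what the prescribed sum
  leaves.\<close>

definition outer_w :: "real \<Rightarrow> (nat \<Rightarrow> real) \<Rightarrow> real \<Rightarrow> nat \<Rightarrow> real" where
  "outer_w \<zeta> w t = (\<lambda>i\<in>{k..m}. if i = k then slack \<zeta> w - wlast \<zeta> w t else if i = m then wlast \<zeta> w t else w i)"

context
  fixes \<zeta> t :: real and w V :: "nat \<Rightarrow> real"
  assumes t: "y k < t" "t < y (Suc k)"
  defines "V \<equiv> (inner_w w t)(m := vlast \<zeta> w t)"
begin

private lemma ti: "i \<in> {Suc k..m} \<Longrightarrow> t < y i"
  using yle[of "Suc k" i] t by simp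

private lemma V_sum: "(\<Sum>i\<in>{Suc k..m}. V i) = \<zeta> * y k / t - 1"
proof -
  have "{Suc k..m} = insert m {Suc k..<m}" using km by auto
  then have "(\<Sum>i\<in>{Suc k..m}. V i) = V m + (\<Sum>i\<in>{Suc k..<m}. V i)" by simp
  moreover have "(\<Sum>i\<in>{Suc k..<m}. V i) = (\<Sum>i\<in>{Suc k..<m}. w i * (y i - y k) / (y i - t))"
    by (rule sum.cong[OF refl]) (simp add: V_def inner_w_def mult.commute)
  ultimately show ?thesis by (simp add: V_def vlast_def)
qed

private lemma V_w: "i \<in> {Suc k..<m} \<Longrightarrow> V i * (y i - t) / (y i - y k) = w i"
  using ti[of i] ylt[of k i] by (simp add: V_def inner_w_def)

private lemma V_m: "V m * (y m - t) / (y m - y k) = wlast \<zeta> w t"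
  by (simp add: V_def wlast_def mult.commute)

text \<open>Both sides are the weight of node \<open>k\<close>: on the left by Lagrange
  interpolation from the weights \<open>V\<close> of the other nodes, on the right as the remainder
  of the sum \<open>\<zeta> - 1\<close>. Partial fractions reduce the identity to
  \<open>V_sum\<close>.\<close>

private lemma first_coord:
  "(t - y k) / y k * (1 + (\<Sum>i\<in>{Suc k..m}. y i * V i / (y i - y k))) = slack \<zeta> w - wlast \<zeta> w t"
proof -
  have tp: "0 < t" using t ykpos by simp
  have e: "{Suc k..m} = insert m {Suc k..<m}" using km by auto
  have "(\<Sum>i\<in>{Suc k..m}. V i * (y i - t) / (y i - y k)) = V m * (y m - t) / (y m - y k) + (\<Sum>i\<in>{Suc k..<m}. V i * (y i - t) / (y i - y k))"
    unfolding e by (subst sum.insert) auto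
  also have "\<dots> = wlast \<zeta> w t + (\<Sum>i\<in>{Suc k..<m}. w i)"
    unfolding V_m by (intro arg_cong2[of _ _ _ _ "(+)"] refl sum.cong V_w)
  finally have "slack \<zeta> w - wlast \<zeta> w t = \<zeta> - 1 - (\<Sum>i\<in>{Suc k..m}. V i * (y i - t) / (y i - y k))"
    by (simp add: slack_def)
  also have "(\<Sum>i\<in>{Suc k..m}. V i * (y i - t) / (y i - y k)) = (\<Sum>i\<in>{Suc k..m}. V i - (t - y k) * (V i / (y i - y k)))"
  proof (rule sum.cong[OF refl])
    fix i assume "i \<in> {Suc k..m}"
    then have "y i - y k \<noteq> 0" using ylt[of k i] by simp
    then show "V i * (y i - t) / (y i - y k) = V i - (t - y k) * (V i / (y i - y k))"
      by (simp add: divide_eq_eq) (simp add: field_simps)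
  qed
  also have "\<dots> = \<zeta> * y k / t - 1 - (t - y k) * (\<Sum>i\<in>{Suc k..m}. V i / (y i - y k))"
    by (simp add: sum_subtractf sum_distrib_left V_sum)
  finally have R: "slack \<zeta> w - wlast \<zeta> w t = \<zeta> - \<zeta> * y k / t + (t - y k) * (\<Sum>i\<in>{Suc k..m}. V i / (y i - y k))"
    by simp
  have "(\<Sum>i\<in>{Suc k..m}. y i * V i / (y i - y k)) = (\<Sum>i\<in>{Suc k..m}. V i + y k * (V i / (y i - y k)))"
  proof (rule sum.cong[OF refl])
    fix i assume "i \<in> {Suc k..m}"
    then have "y i - y k \<noteq> 0" using ylt[of k i] by simp
    then show "y i * V i / (y i - y k) = V i + y k * (V i / (y i - y k))"
      by (simp add: divide_eq_eq) (simp add: field_simps)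
  qed
  also have "\<dots> = \<zeta> * y k / t - 1 + y k * (\<Sum>i\<in>{Suc k..m}. V i / (y i - y k))"
    by (simp add: sum.distrib sum_distrib_left V_sum)
  finally have L: "(\<Sum>i\<in>{Suc k..m}. y i * V i / (y i - y k)) = \<zeta> * y k / t - 1 + y k * (\<Sum>i\<in>{Suc k..m}. V i / (y i - y k))" .
  have "(t - y k) / y k * (\<zeta> * y k / t + y k * S) = \<zeta> - \<zeta> * y k / t + (t - y k) * S" for S
    using tp ykpos by (simp add: field_simps)
  then show ?thesis unfolding L R by simp
qed

text \<open>Apart from differences of nodes and \<open>t\<close>, the derivative of the new variable
  is the factor produced by \<open>peel\<close>, divided by \<open>t\<close>. This coincidence is
  what reduces the total Jacobian to Vandermonde products.\<close>

private lemma dwfirst_eq: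
  "dwfirst \<zeta> w t = (y m - t) / (y m - y k) * (1 + (\<Sum>i\<in>{Suc k..m}. y i * V i / (y i - t))) / t"
proof -
  have tp: "0 < t" using t ykpos by simp
  have e: "{Suc k..m} = insert m {Suc k..<m}" using km by auto
  have tm: "y m - t \<noteq> 0" using ti[of m] km by simp
  have km': "y m - y k \<noteq> 0" using ylt[of k m] km by simp
  have s: "(\<Sum>i\<in>{Suc k..<m}. w i * (y i - y k) / (y i - t)\<^sup>2) = (\<Sum>i\<in>{Suc k..<m}. V i / (y i - t))" (is "_ = ?S")
    by (rule sum.cong[OF refl]) (simp add: V_def inner_w_def power2_eq_square mult.commute)
  have "(\<Sum>i\<in>{Suc k..m}. y i * V i / (y i - t)) = (\<Sum>i\<in>{Suc k..m}. V i + t * (V i / (y i - t)))"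
  proof (rule sum.cong[OF refl])
    fix i assume "i \<in> {Suc k..m}"
    then have "y i - t \<noteq> 0" using ti[of i] by simp
    then show "y i * V i / (y i - t) = V i + t * (V i / (y i - t))"
      by (simp add: divide_eq_eq) (simp add: field_simps)
  qed
  also have "\<dots> = \<zeta> * y k / t - 1 + t * (\<Sum>i\<in>{Suc k..m}. V i / (y i - t))"
    by (simp add: sum.distrib sum_distrib_left V_sum)
  also have "(\<Sum>i\<in>{Suc k..m}. V i / (y i - t)) = vlast \<zeta> w t / (y m - t) + ?S"
    unfolding e by (subst sum.insert) (auto simp: V_def)
  finally have L: "1 + (\<Sum>i\<in>{Suc k..m}. y i * V i / (y i - t)) = \<zeta> * y k / t + t * (vlast \<zeta> w t / (y m - t) + ?S)"
    by simp
  have "(v + D * (Z / t\<^sup>2 + S)) / K = D / K * (Z / t + t * (v / D + S)) / t" if "D \<noteq> 0" "K \<noteq> 0" for v D Z S K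
    using that tp by (simp add: field_simps power2_eq_square)
  then show ?thesis unfolding dwfirst_def s L using tm km' by simp
qed

text \<open>The factor \<open>1 / t\<close> of the split, the rescaling of the middle weights and
  the factor of \<open>peel\<close> together turn \<open>vdm (Suc k) m y\<close> into
  \<open>vdm k m y\<close> and leave \<open>dwfirst\<close>, the Jacobian of the remaining
  substitution in one variable.\<close>

lemma integrand_step:
  "ennreal (1 / t * vdm (Suc k) m y * (\<Prod>i\<in>{Suc k..<m}. (y i - y k) / (y i - t))) * sfun (Suc k) m (\<zeta> * y k / t) (peel t F) (inner_w w t) =
   ennreal (vdm k m y) * (if (\<forall>i\<in>{Suc k..<m}. 0 < w i) \<and> 0 < vlast \<zeta> w t then F (outer_w \<zeta> w t) * ennreal (dwfirst \<zeta> w t) else 0)"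
proof -
  have tp: "0 < t" using t ykpos by simp
  have e: "{Suc k..m} = insert m {Suc k..<m}" using km by auto
  have tm: "0 < y m - t" using ti[of m] km by simp
  have ykm: "0 < y m - y k" using ylt[of k m] km by simp
  have W: "close_sum (Suc k) m (\<zeta> * y k / t) (inner_w w t) = V" unfolding close_sum_inner_w V_def ..
  have Vi: "0 < V i \<longleftrightarrow> 0 < w i" if "i \<in> {Suc k..<m}" for i
    using that ti[of i] ylt[of k i] by (simp add: V_def inner_w_def zero_less_mult_iff zero_less_divide_iff)
  have "(\<forall>i\<in>{Suc k..m}. 0 < V i) \<longleftrightarrow> 0 < V m \<and> (\<forall>i\<in>{Suc k..<m}. 0 < V i)" unfolding e by blast
  also have "\<dots> \<longleftrightarrow> (\<forall>i\<in>{Suc k..<m}. 0 < w i) \<and> 0 < vlast \<zeta> w t" using Vi by (auto simp: V_def)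
  finally have cond: "(\<forall>i\<in>{Suc k..m}. 0 < V i) \<longleftrightarrow> (\<forall>i\<in>{Suc k..<m}. 0 < w i) \<and> 0 < vlast \<zeta> w t" .
  show ?thesis
  proof (cases "(\<forall>i\<in>{Suc k..<m}. 0 < w i) \<and> 0 < vlast \<zeta> w t")
    case False
    then show ?thesis unfolding sfun_def W cond by (simp only: if_False mult_zero_right)
  next
    case True
    have Vpos: "0 < V i" if "i \<in> {Suc k..m}" for i using cond True that by blast
    have arg: "(\<lambda>i\<in>{k..m}. if i = k then (t - y k) / y k * (1 + (\<Sum>i\<in>{Suc k..m}. y i * V i / (y i - y k)))
         else V i * (y i - t) / (y i - y k)) = outer_w \<zeta> w t"
      unfolding outer_w_def first_coord
    proof (rule restrict_ext)
      fix i assume "i \<in> {k..m}"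
      then have "i = k \<or> i = m \<and> i \<noteq> k \<or> i \<in> {Suc k..<m}" by auto
      then show "(if i = k then slack \<zeta> w - wlast \<zeta> w t else V i * (y i - t) / (y i - y k)) = (if i = k then slack \<zeta> w - wlast \<zeta> w t else if i = m then wlast \<zeta> w t else w i)"
        using V_m V_w[of i] by auto
    qed
    define S where "S = 1 + (\<Sum>i\<in>{Suc k..m}. y i * V i / (y i - t))"
    have Spos: "0 < S"
      unfolding S_def
    proof (intro add_pos_nonneg sum_nonneg)
      fix i assume i: "i \<in> {Suc k..m}"
      show "0 \<le> y i * V i / (y i - t)" using Vpos[OF i] ti[OF i] ypos[of i] i
        by (intro divide_nonneg_nonneg mult_nonneg_nonneg) auto
    qed simp
    have p1: "(\<Prod>i\<in>{Suc k..m}. y i - t) = (y m - t) * (\<Prod>i\<in>{Suc k..<m}. y i - t)"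
      unfolding e by (subst prod.insert) auto
    have p2: "(\<Prod>i\<in>{Suc k..m}. y i - y k) = (y m - y k) * (\<Prod>i\<in>{Suc k..<m}. y i - y k)"
      unfolding e by (subst prod.insert) auto
    have n1: "0 < (\<Prod>i\<in>{Suc k..<m}. y i - t)" using ti by (intro prod_pos) auto
    have n2: "0 < (\<Prod>i\<in>{Suc k..<m}. y i - y k)" using ylt by (intro prod_pos) auto
    have Vp: "0 < vdm (Suc k) m y" unfolding vdm_def using ylt by (intro prod_pos) auto
    have d: "dwfirst \<zeta> w t = (y m - t) / (y m - y k) * S / t" unfolding dwfirst_eq S_def ..
    have dp: "0 \<le> dwfirst \<zeta> w t" unfolding d using tm ykm Spos tp by simp
    have "A * P2 / P1 / t * (D * P1 * S) = A * (K * P2) * (D / K * S / t)"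
      if "P1 \<noteq> 0" "K \<noteq> 0" for A P1 P2 D K :: real using that by simp
    note alg = this
    have eq: "vdm (Suc k) m y * (\<Prod>i\<in>{Suc k..<m}. y i - y k) / (\<Prod>i\<in>{Suc k..<m}. y i - t) / t * ((y m - t) * (\<Prod>i\<in>{Suc k..<m}. y i - t) * S)
      = vdm (Suc k) m y * ((y m - y k) * (\<Prod>i\<in>{Suc k..<m}. y i - y k)) * ((y m - t) / (y m - y k) * S / t)"
      by (rule alg) (use n1 ykm in linarith)+
    have Vk: "vdm k m y = vdm (Suc k) m y * ((y m - y k) * (\<Prod>i\<in>{Suc k..<m}. y i - y k))"
      using vdm_Suc[of k m y] km p2 by simp
    have "ennreal (1 / t * vdm (Suc k) m y * (\<Prod>i\<in>{Suc k..<m}. (y i - y k) / (y i - t))) * ennreal ((\<Prod>i\<in>{Suc k..m}. y i - t) * S)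
      = ennreal (vdm (Suc k) m y * (\<Prod>i\<in>{Suc k..<m}. y i - y k) / (\<Prod>i\<in>{Suc k..<m}. y i - t) / t * ((y m - t) * (\<Prod>i\<in>{Suc k..<m}. y i - t) * S))"
      unfolding p1 prod_dividef using tp Vp n1 n2 tm Spos by (subst ennreal_mult[symmetric]) (auto simp: mult_ac)
    also have "\<dots> = ennreal (vdm k m y) * ennreal (dwfirst \<zeta> w t)"
      unfolding eq Vk[symmetric] d[symmetric] using dp Vp n2 ykm by (subst ennreal_mult) (auto simp: Vk)
    finally have coef: "ennreal (1 / t * vdm (Suc k) m y * (\<Prod>i\<in>{Suc k..<m}. (y i - y k) / (y i - t))) * ennreal ((\<Prod>i\<in>{Suc k..m}. y i - t) * S)
      = ennreal (vdm k m y) * ennreal (dwfirst \<zeta> w t)" .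
    have FT: "peel t F V = ennreal ((\<Prod>i\<in>{Suc k..m}. y i - t) * S) * F (outer_w \<zeta> w t)"
      unfolding peel_def arg S_def ..
    have "ennreal (1 / t * vdm (Suc k) m y * (\<Prod>i\<in>{Suc k..<m}. (y i - y k) / (y i - t))) * peel t F V = (ennreal (vdm k m y) * ennreal (dwfirst \<zeta> w t)) * F (outer_w \<zeta> w t)"
      unfolding FT mult.assoc[symmetric] coef ..
    then show ?thesis
      unfolding sfun_def W cond if_P[OF True] by (simp only: mult_ac)
  qed
qed

end

end

section \<open>Measurability of the integrands\<close>

lemma lebs_component: "i \<in> I \<Longrightarrow> (\<lambda>x. x i) \<in> borel_measurable (lebs I)"
  using measurable_component_singleton[of i I "\<lambda>_. lborel :: real measure"] by simp

lemma lebs_upd_measurable: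
  assumes "k \<le> m" "h \<in> borel_measurable (lebs {k..<m})"
  shows "(\<lambda>x. x(m := h x)) \<in> measurable (lebs {k..<m}) (lebs {k..m})"
  by (rule measurable_fun_upd[where J = "{k..<m}"]) (use assms in \<open>auto simp: measurable_lborel1\<close>)

lemma lfun_measurable:
  assumes km: "k \<le> m" and F: "F \<in> borel_measurable (lebs {k..m})"
  shows "lfun k m y c F \<in> borel_measurable (lebs {k..<m})"
proof -
  note comp = lebs_component[of _ "{k..m}"]
  define H where "H X = (if interlaced k m y X then ennreal (vdm k m X / (\<Prod>i\<in>{k..<m}. X i)) * F (\<lambda>i\<in>{k..m}. wgt k m y X i) else 0)" for X
  have 1: "Measurable.pred (lebs {k..m}) (interlaced k m y)"
    unfolding interlaced_def by (intro pred_intros_logic pred_intros_finite borel_measurable_pred_less comp borel_measurable_const) auto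
  have 2: "vdm k m \<in> borel_measurable (lebs {k..m})"
    unfolding vdm_def by (intro borel_measurable_prod borel_measurable_diff comp) auto
  have 3: "(\<lambda>X. \<lambda>i\<in>{k..m}. wgt k m y X i) \<in> measurable (lebs {k..m}) (lebs {k..m})"
    unfolding wgt_def lagc_def
    by (intro measurable_restrict) (auto intro!: borel_measurable_divide borel_measurable_prod borel_measurable_diff comp simp: measurable_lborel1)
  have 4: "H \<in> borel_measurable (lebs {k..m})"
    unfolding H_def
    by (intro measurable_If 1 borel_measurable_const borel_measurable_times_ennreal measurable_compose[OF 3 F]
        measurable_compose[OF _ measurable_ennreal] borel_measurable_divide 2 borel_measurable_prod comp) (use 1 in auto)
  have X: "close_prod k m c \<in> measurable (lebs {k..<m}) (lebs {k..m})"
    unfolding close_prod_def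
    by (intro lebs_upd_measurable km borel_measurable_divide borel_measurable_const borel_measurable_prod lebs_component)
  have "lfun k m y c F = (\<lambda>x. H (close_prod k m c x))"
  proof
    fix x
    have "(\<Prod>i\<in>{k..<m}. close_prod k m c x i) = (\<Prod>i\<in>{k..<m}. x i)"
      by (rule prod.cong) (auto simp: close_prod_def)
    then show "lfun k m y c F x = H (close_prod k m c x)" by (simp add: lfun_def H_def)
  qed
  then show ?thesis using measurable_compose[OF X 4] by simp
qed

lemma sfun_measurable:
  assumes km: "k \<le> m" and F: "F \<in> borel_measurable (lebs {k..m})"
  shows "sfun k m \<zeta> F \<in> borel_measurable (lebs {k..<m})"
proof -
  note comp = lebs_component[of _ "{k..m}"]
  define H where "H X = (if \<forall>i\<in>{k..m}. 0 < X i then F X else 0)" for X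
  have 1: "Measurable.pred (lebs {k..m}) (\<lambda>X. \<forall>i\<in>{k..m}. 0 < X i)"
    by (intro pred_intros_finite borel_measurable_pred_less comp borel_measurable_const) auto
  have 4: "H \<in> borel_measurable (lebs {k..m})"
    unfolding H_def by (intro measurable_If 1 F borel_measurable_const) (use 1 in auto)
  have X: "close_sum k m \<zeta> \<in> measurable (lebs {k..<m}) (lebs {k..m})"
    unfolding close_sum_def
    by (intro lebs_upd_measurable km borel_measurable_diff borel_measurable_const borel_measurable_sum lebs_component)
  show ?thesis using measurable_compose[OF X 4] unfolding sfun_def[abs_def] H_def .
qed

section \<open>Exchange of one point for its weight\<close>

context interlace
begin

lemma peel_measurable:
  assumes F: "F \<in> borel_measurable (lebs {k..m})"
  shows "peel t F \<in> borel_measurable (lebs {Suc k..m})"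
proof -
  note comp = lebs_component[of _ "{Suc k..m}"]
  have 3: "(\<lambda>v. \<lambda>i\<in>{k..m}. if i = k then (t - y k) / y k * (1 + (\<Sum>i\<in>{Suc k..m}. y i * v i / (y i - y k)))
         else v i * (y i - t) / (y i - y k)) \<in> measurable (lebs {Suc k..m}) (lebs {k..m})"
  proof (rule measurable_restrict)
    fix i assume "i \<in> {k..m}"
    then show "(\<lambda>v. if i = k then (t - y k) / y k * (1 + (\<Sum>i\<in>{Suc k..m}. y i * v i / (y i - y k)))
         else v i * (y i - t) / (y i - y k)) \<in> measurable (lebs {Suc k..m}) lborel"
      unfolding measurable_lborel1
      by (cases "i = k") (auto intro!: borel_measurable_divide borel_measurable_times borel_measurable_add borel_measurable_sum comp)
  qed
  show ?thesis
    unfolding peel_def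
    by (intro borel_measurable_times_ennreal measurable_compose[OF 3 F]
        measurable_compose[OF _ measurable_ennreal] borel_measurable_divide borel_measurable_times borel_measurable_add borel_measurable_sum comp borel_measurable_const)
qed

text \<open>The integrand in mixed coordinates: coordinate \<open>k\<close> is still the point
  \<open>t = x k\<close>, the others are already weights. Its two orders of integration lead to
  \<open>lfun\<close> and to \<open>sfun\<close>.\<close>

definition fibre :: "real \<Rightarrow> ((nat \<Rightarrow> real) \<Rightarrow> ennreal) \<Rightarrow> (nat \<Rightarrow> real) \<Rightarrow> ennreal" where
  "fibre \<zeta> F X = (if y k < X k \<and> X k < y (Suc k) \<and> (\<forall>i\<in>{Suc k..<m}. 0 < X i) \<and> 0 < vlast \<zeta> X (X k)
     then F (outer_w \<zeta> X (X k)) * ennreal (dwfirst \<zeta> X (X k)) else 0)"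

lemma fibre_update:
  "fibre \<zeta> F (w(k := t)) = (if y k < t \<and> t < y (Suc k) then
     (if (\<forall>i\<in>{Suc k..<m}. 0 < w i) \<and> 0 < vlast \<zeta> w t then F (outer_w \<zeta> w t) * ennreal (dwfirst \<zeta> w t) else 0) else 0)"
proof -
  have v: "vlast \<zeta> (w(k := t)) t = vlast \<zeta> w t"
    unfolding vlast_def by (intro arg_cong2[of _ _ _ _ "(-)"] sum.cong) auto
  have M: "slack \<zeta> (w(k := t)) = slack \<zeta> w"
    unfolding slack_def by (intro arg_cong2[of _ _ _ _ "(-)"] sum.cong) auto
  have s: "(\<Sum>i\<in>{Suc k..<m}. (w(k := t)) i * (y i - y k) / (y i - t)\<^sup>2) = (\<Sum>i\<in>{Suc k..<m}. w i * (y i - y k) / (y i - t)\<^sup>2)"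
    by (rule sum.cong) auto
  have d: "dwfirst \<zeta> (w(k := t)) t = dwfirst \<zeta> w t" unfolding dwfirst_def v s ..
  have h: "wlast \<zeta> (w(k := t)) t = wlast \<zeta> w t" unfolding wlast_def v ..
  have outer_w: "outer_w \<zeta> (w(k := t)) t = outer_w \<zeta> w t" unfolding outer_w_def M h by (rule restrict_ext) simp
  have a: "(\<forall>i\<in>{Suc k..<m}. 0 < (w(k := t)) i) \<longleftrightarrow> (\<forall>i\<in>{Suc k..<m}. 0 < w i)" by auto
  show ?thesis unfolding fibre_def fun_upd_same v d outer_w a by auto
qed

lemma fibre_measurable:
  assumes F: "F \<in> borel_measurable (lebs {k..m})"
  shows "fibre \<zeta> F \<in> borel_measurable (lebs {k..<m})"
proof -
  note comp = lebs_component[of _ "{k..<m}"]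
  have k: "k \<in> {k..<m}" using km by simp
  have v: "(\<lambda>X. vlast \<zeta> X (X k)) \<in> borel_measurable (lebs {k..<m})"
    unfolding vlast_def by (intro borel_measurable_diff borel_measurable_divide borel_measurable_times borel_measurable_sum comp borel_measurable_const k) auto
  have h: "(\<lambda>X. wlast \<zeta> X (X k)) \<in> borel_measurable (lebs {k..<m})"
    unfolding wlast_def by (intro v borel_measurable_diff borel_measurable_divide borel_measurable_times comp borel_measurable_const k)
  have M: "slack \<zeta> \<in> borel_measurable (lebs {k..<m})"
    unfolding slack_def by (intro borel_measurable_diff borel_measurable_sum comp borel_measurable_const) auto
  have d: "(\<lambda>X. dwfirst \<zeta> X (X k)) \<in> borel_measurable (lebs {k..<m})"
    unfolding dwfirst_def by (intro v borel_measurable_add borel_measurable_power borel_measurable_diff borel_measurable_divide borel_measurable_times borel_measurable_sum comp borel_measurable_const k) auto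
  have w: "(\<lambda>X. outer_w \<zeta> X (X k)) \<in> measurable (lebs {k..<m}) (lebs {k..m})"
    unfolding outer_w_def
  proof (rule measurable_restrict)
    fix i assume "i \<in> {k..m}"
    then have "i = k \<or> i = m \<and> i \<noteq> k \<or> i \<noteq> k \<and> i \<noteq> m \<and> i \<in> {k..<m}" by auto
    then show "(\<lambda>X. if i = k then slack \<zeta> X - wlast \<zeta> X (X k) else if i = m then wlast \<zeta> X (X k) else X i) \<in> measurable (lebs {k..<m}) lborel"
      unfolding measurable_lborel1 using borel_measurable_diff[OF M h] h comp[of i] by auto
  qed
  have p: "Measurable.pred (lebs {k..<m}) (\<lambda>X. y k < X k \<and> X k < y (Suc k) \<and> (\<forall>i\<in>{Suc k..<m}. 0 < X i) \<and> 0 < vlast \<zeta> X (X k))"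
    by (intro pred_intros_logic pred_intros_finite borel_measurable_pred_less comp borel_measurable_const v k) auto
  show ?thesis
    unfolding fibre_def
    by (intro measurable_If borel_measurable_const borel_measurable_times_ennreal measurable_compose[OF w F] measurable_compose[OF d measurable_ennreal])
      (use p in auto)
qed

lemma nn_integral_fibre:
  assumes z: "0 < \<zeta>" and F: "F \<in> borel_measurable (lebs {k..m})" and w: "w \<in> space (lebs {Suc k..<m})"
  shows "(\<integral>\<^sup>+t. fibre \<zeta> F (w(k := t)) \<partial>lborel) = (\<integral>\<^sup>+\<tau>. sfun k m \<zeta> F (w(k := \<tau>)) \<partial>lborel)"
proof (cases "\<forall>i\<in>{Suc k..<m}. 0 < w i")
  case False
  then have "fibre \<zeta> F (w(k := t)) = 0" "sfun k m \<zeta> F (w(k := t)) = 0" for t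
    unfolding fibre_update sfun_update by (simp_all only: False if_False simp_thms if_cancel)
  then show ?thesis by simp
next
  case True
  define G where "G \<tau> = F (w(k := \<tau>, m := slack \<zeta> w - \<tau>))" for \<tau>
  have "(\<lambda>\<tau>. w(k := \<tau>)) \<in> measurable borel (lebs {k..<m})"
    by (rule measurable_fun_upd[where J = "{Suc k..<m}"]) (use w km in \<open>auto simp: measurable_lborel1\<close>)
  then have "(\<lambda>\<tau>. w(k := \<tau>, m := slack \<zeta> w - \<tau>)) \<in> measurable borel (lebs {k..m})"
    by (rule measurable_fun_upd[where J = "{k..<m}", rotated]) (use km in \<open>auto simp: measurable_lborel1\<close>)
  then have G: "G \<in> borel_measurable borel" unfolding G_def by (rule measurable_compose[OF _ F])
  have outer_w: "F (outer_w \<zeta> w t) = G (slack \<zeta> w - wlast \<zeta> w t)" for t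
  proof -
    have "outer_w \<zeta> w t = w(k := slack \<zeta> w - wlast \<zeta> w t, m := slack \<zeta> w - (slack \<zeta> w - wlast \<zeta> w t))"
    proof
      fix i
      have "w i = undefined" if "i \<notin> {k..m}"
        using w that km by (auto simp: space_PiM PiE_def extensional_def)
      then show "outer_w \<zeta> w t i = (w(k := slack \<zeta> w - wlast \<zeta> w t, m := slack \<zeta> w - (slack \<zeta> w - wlast \<zeta> w t))) i"
        using km by (auto simp: outer_w_def)
    qed
    then show ?thesis by (simp add: G_def)
  qed
  have "(\<integral>\<^sup>+\<tau>. sfun k m \<zeta> F (w(k := \<tau>)) \<partial>lborel) = (\<integral>\<^sup>+\<tau>. G \<tau> * indicator {0<..<slack \<zeta> w} \<tau> \<partial>lborel)"
    unfolding sfun_update if_P[OF True] G_def ..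
  also have "\<dots> = (\<integral>\<^sup>+t. G (slack \<zeta> w - wlast \<zeta> w t) * ennreal (dwfirst \<zeta> w t) * indicator {t. y k < t \<and> t < y (Suc k) \<and> 0 < vlast \<zeta> w t} t \<partial>lborel)"
    using True by (intro nn_integral_first_weight z G) auto
  also have "\<dots> = (\<integral>\<^sup>+t. fibre \<zeta> F (w(k := t)) \<partial>lborel)"
    unfolding fibre_update outer_w using True by (intro nn_integral_cong) (auto simp: indicator_def)
  finally show ?thesis ..
qed

text \<open>For fixed \<open>t\<close> the hypothesis \<open>IH\<close> treats the remaining points
  with \<open>c / t\<close> and \<open>peel t F\<close>, which is why it is required for all
  \<open>c\<close> and \<open>F\<close>. The weights that it yields are then rescaled to the final
  ones.\<close>

lemma nn_integral_lfun_slice: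
  assumes F: "F \<in> borel_measurable (lebs {k..m})"
    and IH: "\<And>c F. 0 < c \<Longrightarrow> F \<in> borel_measurable (lebs {Suc k..m}) \<Longrightarrow>
      (\<integral>\<^sup>+x. lfun (Suc k) m y c F x \<partial>lebs {Suc k..<m}) = ennreal (vdm (Suc k) m y) * (\<integral>\<^sup>+w. sfun (Suc k) m (c / (\<Prod>i\<in>{Suc k..m}. y i)) F w \<partial>lebs {Suc k..<m})"
    and c: "0 < c" and \<zeta>: "\<zeta> = c / (\<Prod>i\<in>{k..m}. y i)"
  shows "(\<integral>\<^sup>+x. lfun k m y c F (x(k := t)) \<partial>lebs {Suc k..<m}) = ennreal (vdm k m y) * (\<integral>\<^sup>+w. fibre \<zeta> F (w(k := t)) \<partial>lebs {Suc k..<m})"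
proof (cases "y k < t \<and> t < y (Suc k)")
  case False
  have "lfun k m y c F (x(k := t)) = 0" for x
  proof -
    have "close_prod k m c (x(k := t)) = (close_prod k m c (x(k := t)))(k := t)" using km by (auto simp: close_prod_def fun_eq_iff)
    then have "\<not> interlaced k m y (close_prod k m c (x(k := t)))" using interlaced_Suc[OF km, of y "close_prod k m c (x(k := t))" t] False by auto
    then show ?thesis by (simp add: lfun_def)
  qed
  then show ?thesis unfolding fibre_update if_not_P[OF False] by simp
next
  case True
  then have t: "y k < t" "t < y (Suc k)" and tp: "0 < t" using ykpos by auto
  have lt: "t < y i" if "i \<in> {Suc k..<m}" for i using yle[of "Suc k" i] t that by auto
  let ?s = "\<lambda>i. (y i - y k) / (y i - t)"
  have s: "0 < ?s i" if "i \<in> {Suc k..<m}" for i using lt[OF that] ylt[of k i] that by auto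
  have ps: "0 < (\<Prod>i\<in>{Suc k..<m}. ?s i)" using s by (intro prod_pos) auto
  have Vp: "0 < vdm (Suc k) m y" unfolding vdm_def using ylt by (intro prod_pos) auto
  have km': "Suc k \<le> m" using km by simp
  have cz: "c / t / (\<Prod>i\<in>{Suc k..m}. y i) = \<zeta> * y k / t"
    using km ykpos by (simp add: \<zeta> prod.atLeast_Suc_atMost)
  have sm: "sfun (Suc k) m (\<zeta> * y k / t) (peel t F) \<in> borel_measurable (lebs {Suc k..<m})"
    by (intro sfun_measurable peel_measurable F km')
  have "(\<integral>\<^sup>+x. lfun k m y c F (x(k := t)) \<partial>lebs {Suc k..<m}) = (\<integral>\<^sup>+x. ennreal (1 / t) * lfun (Suc k) m y (c / t) (peel t F) x \<partial>lebs {Suc k..<m})"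
    by (simp only: lfun_step[OF t])
  also have "\<dots> = ennreal (1 / t) * (\<integral>\<^sup>+x. lfun (Suc k) m y (c / t) (peel t F) x \<partial>lebs {Suc k..<m})"
    by (intro nn_integral_cmult lfun_measurable peel_measurable F km')
  also have "(\<integral>\<^sup>+x. lfun (Suc k) m y (c / t) (peel t F) x \<partial>lebs {Suc k..<m}) = ennreal (vdm (Suc k) m y) * (\<integral>\<^sup>+w. sfun (Suc k) m (\<zeta> * y k / t) (peel t F) w \<partial>lebs {Suc k..<m})"
    unfolding cz[symmetric] using c tp by (intro IH peel_measurable F) auto
  also have "(\<integral>\<^sup>+w. sfun (Suc k) m (\<zeta> * y k / t) (peel t F) w \<partial>lebs {Suc k..<m}) = ennreal (\<Prod>i\<in>{Suc k..<m}. ?s i) * (\<integral>\<^sup>+w. sfun (Suc k) m (\<zeta> * y k / t) (peel t F) (inner_w w t) \<partial>lebs {Suc k..<m})"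
    unfolding inner_w_def by (rule nn_integral_lebs_scale[OF _ s sm]) auto
  also have "ennreal (1 / t) * (ennreal (vdm (Suc k) m y) * (ennreal (\<Prod>i\<in>{Suc k..<m}. ?s i) * (\<integral>\<^sup>+w. sfun (Suc k) m (\<zeta> * y k / t) (peel t F) (inner_w w t) \<partial>lebs {Suc k..<m})))
     = ennreal (1 / t * vdm (Suc k) m y * (\<Prod>i\<in>{Suc k..<m}. ?s i)) * (\<integral>\<^sup>+w. sfun (Suc k) m (\<zeta> * y k / t) (peel t F) (inner_w w t) \<partial>lebs {Suc k..<m})"
  proof -
    have "ennreal (1 / t * vdm (Suc k) m y * (\<Prod>i\<in>{Suc k..<m}. ?s i)) = ennreal (1 / t) * ennreal (vdm (Suc k) m y) * ennreal (\<Prod>i\<in>{Suc k..<m}. ?s i)"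
      using tp Vp ps by (simp only: ennreal_mult less_imp_le mult_nonneg_nonneg zero_le_divide_1_iff)
    then show ?thesis by (simp only: mult.assoc)
  qed
  also have "\<dots> = (\<integral>\<^sup>+w. ennreal (1 / t * vdm (Suc k) m y * (\<Prod>i\<in>{Suc k..<m}. ?s i)) * sfun (Suc k) m (\<zeta> * y k / t) (peel t F) (inner_w w t) \<partial>lebs {Suc k..<m})"
  proof (rule nn_integral_cmult[symmetric], rule measurable_compose[OF _ sm])
    show "(\<lambda>w. inner_w w t) \<in> measurable (lebs {Suc k..<m}) (lebs {Suc k..<m})"
      unfolding inner_w_def by (intro measurable_restrict) (auto intro!: borel_measurable_times lebs_component simp: measurable_lborel1)
  qed
  also have "\<dots> = (\<integral>\<^sup>+w. ennreal (vdm k m y) * fibre \<zeta> F (w(k := t)) \<partial>lebs {Suc k..<m})"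
    unfolding integrand_step[OF t] fibre_update if_P[OF True] ..
  also have "\<dots> = ennreal (vdm k m y) * (\<integral>\<^sup>+w. fibre \<zeta> F (w(k := t)) \<partial>lebs {Suc k..<m})"
  proof (rule nn_integral_cmult, rule measurable_compose[OF _ fibre_measurable[OF F]])
    show "(\<lambda>w. w(k := t)) \<in> measurable (lebs {Suc k..<m}) (lebs {k..<m})"
      by (rule measurable_fun_upd[where J = "{Suc k..<m}"]) (use km in auto)
  qed
  finally show ?thesis .
qed

end

text \<open>Downward induction on \<open>k\<close>. Once the inner integral is transformed for fixed
  \<open>x k\<close>, the order of integration is exchanged, so that \<open>x k\<close> can be
  traded for the weight of node \<open>k\<close> with the other weights fixed. In the base case no
  variable is left, and both integrals are over a one-point space.\<close>

lemma interlacing_change_of_variables: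
  assumes "k \<le> m" and "\<And>i. i \<in> {k..m} \<Longrightarrow> 0 < y i" and "strict_mono_on {k..m} y"
    and "0 < c" and "F \<in> borel_measurable (lebs {k..m})"
  shows "(\<integral>\<^sup>+x. lfun k m y c F x \<partial>lebs {k..<m}) =
    ennreal (vdm k m y) * (\<integral>\<^sup>+w. sfun k m (c / (\<Prod>i\<in>{k..m}. y i)) F w \<partial>lebs {k..<m})"
  using assms
proof (induction arbitrary: c F rule: inc_induct)
  case base
  have ym: "0 < y m" using base by simp
  have W: "close_sum m m (c / y m) u = u(m := c / y m - 1)" for u by (simp add: close_sum_def)
  have "lfun m m y c F u = ennreal (vdm m m y) * sfun m m (c / (\<Prod>i\<in>{m..m}. y i)) F u" if "u = (\<lambda>_. undefined)" for u
  proof -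
    have a: "(\<lambda>i\<in>{m}. wgt m m y (close_prod m m c u) i) = u(m := c / y m - 1)"
      using ym by (auto simp: wgt_def lagc_def close_prod_def that restrict_def diff_divide_distrib)
    have b: "interlaced m m y (close_prod m m c u) \<longleftrightarrow> (\<forall>i\<in>{m..m}. 0 < close_sum m m (c / y m) u i)"
      using ym by (simp add: interlaced_def close_prod_def W less_divide_eq)
    have i: "(\<Prod>i\<in>{m..m}. y i) = y m" "{m..m} = {m}" "{m..<m} = {}" by auto
    show ?thesis
      unfolding lfun_def sfun_def i(1) b unfolding i(2,3) a W by (simp add: vdm_def)
  qed
  then show ?case by (simp add: PiM_empty nn_integral_count_space_finite)
next
  case (step k)
  interpret interlace k m y
    by unfold_locales (use step in auto)
  interpret product_sigma_finite "\<lambda>_::nat. lborel :: real measure" by (rule product_sigma_finite_lborel)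
  define \<zeta> where "\<zeta> = c / (\<Prod>i\<in>{k..m}. y i)"
  have z: "0 < \<zeta>" unfolding \<zeta>_def using step.prems by (intro divide_pos_pos prod_pos) auto
  have ins: "{k..<m} = insert k {Suc k..<m}" using km by auto
  have mono': "strict_mono_on {Suc k..m} y" using ymono by (rule monotone_on_subset) auto
  have Lm: "lfun k m y c F \<in> borel_measurable (lebs (insert k {Suc k..<m}))"
    using lfun_measurable[of k m F y c] km step.prems(4) unfolding ins by simp
  have Km: "fibre \<zeta> F \<in> borel_measurable (lebs (insert k {Suc k..<m}))"
    using fibre_measurable[OF step.prems(4), of \<zeta>] unfolding ins .
  have Sm: "sfun k m \<zeta> F \<in> borel_measurable (lebs (insert k {Suc k..<m}))"
    using sfun_measurable[of k m F \<zeta>] km step.prems(4) unfolding ins by simp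
  have "(\<integral>\<^sup>+x. lfun k m y c F x \<partial>lebs {k..<m}) = (\<integral>\<^sup>+t. \<integral>\<^sup>+x. lfun k m y c F (x(k := t)) \<partial>lebs {Suc k..<m} \<partial>lborel)"
    unfolding ins by (rule product_nn_integral_insert_rev[OF _ _ Lm]) auto
  also have "\<dots> = (\<integral>\<^sup>+t. ennreal (vdm k m y) * (\<integral>\<^sup>+w. fibre \<zeta> F (w(k := t)) \<partial>lebs {Suc k..<m}) \<partial>lborel)"
    by (intro nn_integral_cong nn_integral_lfun_slice step.prems(3,4) \<zeta>_def step.IH mono' ypos) auto
  also have "\<dots> = ennreal (vdm k m y) * (\<integral>\<^sup>+t. \<integral>\<^sup>+w. fibre \<zeta> F (w(k := t)) \<partial>lebs {Suc k..<m} \<partial>lborel)"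
  proof (rule nn_integral_cmult)
    interpret S: sigma_finite_measure "lebs {Suc k..<m}" by (rule sigma_finite) auto
    have "(\<lambda>p. (snd p)(k := fst p)) \<in> measurable (lborel \<Otimes>\<^sub>M lebs {Suc k..<m}) (lebs (insert k {Suc k..<m}))"
      by (rule measurable_fun_upd[where J = "{Suc k..<m}"]) auto
    from measurable_compose[OF this Km]
    show "(\<lambda>t. \<integral>\<^sup>+w. fibre \<zeta> F (w(k := t)) \<partial>lebs {Suc k..<m}) \<in> borel_measurable lborel"
      by (intro S.borel_measurable_nn_integral) (simp add: case_prod_beta)
  qed
  also have "(\<integral>\<^sup>+t. \<integral>\<^sup>+w. fibre \<zeta> F (w(k := t)) \<partial>lebs {Suc k..<m} \<partial>lborel) = (\<integral>\<^sup>+X. fibre \<zeta> F X \<partial>lebs (insert k {Suc k..<m}))"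
    by (rule product_nn_integral_insert_rev[OF _ _ Km, symmetric]) auto
  also have "\<dots> = (\<integral>\<^sup>+w. \<integral>\<^sup>+t. fibre \<zeta> F (w(k := t)) \<partial>lborel \<partial>lebs {Suc k..<m})"
    by (rule product_nn_integral_insert[OF _ _ Km]) auto
  also have "\<dots> = (\<integral>\<^sup>+w. \<integral>\<^sup>+\<tau>. sfun k m \<zeta> F (w(k := \<tau>)) \<partial>lborel \<partial>lebs {Suc k..<m})"
    by (intro nn_integral_cong nn_integral_fibre z step.prems(4))
  also have "\<dots> = (\<integral>\<^sup>+w. sfun k m \<zeta> F w \<partial>lebs (insert k {Suc k..<m}))"
    by (rule product_nn_integral_insert[OF _ _ Sm, symmetric]) auto
  finally show ?case unfolding ins \<zeta>_def .
qed

section \<open>Dirichlet integrals\<close>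

lemma nn_integral_Beta:
  fixes a b r :: real
  assumes a: "0 < a" and b: "0 < b" and r: "0 < r"
  shows "(\<integral>\<^sup>+t. ennreal (t powr (a - 1) * (r - t) powr (b - 1)) * indicator {0<..<r} t \<partial>lborel) = ennreal (r powr (a + b - 1) * Beta a b)"
proof -
  let ?f = "\<lambda>t. t powr (a - 1) * (1 - t) powr (b - 1)"
  have m: "(\<lambda>t. ennreal (t powr (a - 1) * (r - t) powr (b - 1)) * indicator {0<..<r} t) \<in> borel_measurable borel"
    by measurable
  have "(\<integral>\<^sup>+t. ennreal (t powr (a - 1) * (r - t) powr (b - 1)) * indicator {0<..<r} t \<partial>lborel)
    = ennreal r * (\<integral>\<^sup>+t. ennreal ((r * t) powr (a - 1) * (r - r * t) powr (b - 1)) * indicator {0<..<r} (r * t) \<partial>lborel)"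
    using nn_integral_real_affine[OF m, of r 0] r by simp
  also have "(\<integral>\<^sup>+t. ennreal ((r * t) powr (a - 1) * (r - r * t) powr (b - 1)) * indicator {0<..<r} (r * t) \<partial>lborel)
    = (\<integral>\<^sup>+t. ennreal (r powr (a + b - 2)) * ennreal (indicator {0..1} t * ?f t) \<partial>lborel)"
  proof (rule nn_integral_cong)
    fix t :: real
    consider "t \<in> {0<..<1}" | "t = 0 \<or> t = 1" | "t \<notin> {0..1}" by fastforce
    then show "ennreal ((r * t) powr (a - 1) * (r - r * t) powr (b - 1)) * indicator {0<..<r} (r * t) = ennreal (r powr (a + b - 2)) * ennreal (indicator {0..1} t * ?f t)"
    proof cases
      case 1
      have "(r * t) powr (a - 1) * (r - r * t) powr (b - 1) = (r * t) powr (a - 1) * (r * (1 - t)) powr (b - 1)"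
        by (simp add: right_diff_distrib)
      also have "\<dots> = r powr (a - 1) * r powr (b - 1) * ?f t"
        using 1 r by (simp add: powr_mult)
      also have "r powr (a - 1) * r powr (b - 1) = r powr (a + b - 2)"
        unfolding powr_add[symmetric] by (simp add: algebra_simps)
      finally show ?thesis using 1 r by (simp add: ennreal_mult)
    next
      case 2
      then show ?thesis by auto
    next
      case 3
      then have "r * t \<notin> {0<..<r}" using r by (auto simp: zero_less_mult_iff)
      then show ?thesis using 3 by simp
    qed
  qed
  also have "\<dots> = ennreal (r powr (a + b - 2)) * (\<integral>\<^sup>+t. ennreal (indicator {0..1} t * ?f t) \<partial>lborel)"
    by (rule nn_integral_cmult) measurable
  also have "(\<integral>\<^sup>+t. ennreal (indicator {0..1} t * ?f t) \<partial>lborel) = ennreal (Beta a b)"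
  proof (rule nn_integral_has_integral_lebesgue)
    show "(?f has_integral Beta a b) {0..1}" using has_integral_Beta_real[OF a b] .
  qed simp
  also have "ennreal r * (ennreal (r powr (a + b - 2)) * ennreal (Beta a b)) = ennreal (r powr (a + b - 1) * Beta a b)"
  proof -
    have "r * r powr (a + b - 2) = r powr (a + b - 1)"
      using r powr_add[of r 1 "a + b - 2"] by simp
    then show ?thesis using r a b by (simp add: ennreal_mult[symmetric] mult.assoc[symmetric] Beta_def Gamma_real_pos less_imp_le)
  qed
  finally show ?thesis .
qed

definition dir_dens :: "nat \<Rightarrow> nat \<Rightarrow> (nat \<Rightarrow> real) \<Rightarrow> (nat \<Rightarrow> real) \<Rightarrow> ennreal" where
  "dir_dens k m s w = ennreal (\<Prod>i\<in>{k..m}. w i powr (s i - 1))"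

lemma dir_dens_measurable: "dir_dens k m s \<in> borel_measurable (lebs {k..m})"
  unfolding dir_dens_def
  by (intro measurable_compose[OF _ measurable_ennreal] borel_measurable_prod powr_real_measurable lebs_component borel_measurable_const)

lemma sfun_zero:
  assumes "\<zeta> \<le> 1" "k \<le> m"
  shows "sfun k m \<zeta> F w = 0"
proof -
  have "\<not> (\<forall>i\<in>{k..m}. 0 < close_sum k m \<zeta> w i)"
  proof
    assume pos: "\<forall>i\<in>{k..m}. 0 < close_sum k m \<zeta> w i"
    have "{k..m} = insert m {k..<m}" using assms by auto
    then have "(\<Sum>i\<in>{k..m}. close_sum k m \<zeta> w i) = close_sum k m \<zeta> w m + (\<Sum>i\<in>{k..<m}. close_sum k m \<zeta> w i)" by simp
    also have "(\<Sum>i\<in>{k..<m}. close_sum k m \<zeta> w i) = (\<Sum>i\<in>{k..<m}. w i)" by (rule sum.cong) (auto simp: close_sum_def)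
    finally have "(\<Sum>i\<in>{k..m}. close_sum k m \<zeta> w i) \<le> 0" using assms by (simp add: close_sum_def)
    moreover have "0 < (\<Sum>i\<in>{k..m}. close_sum k m \<zeta> w i)" using pos assms by (intro sum_pos) auto
    ultimately show False by simp
  qed
  then show ?thesis unfolding sfun_def by (rule if_not_P)
qed

lemma sfun_dir_dens_update:
  assumes "k < m"
  shows "sfun k m \<zeta> (dir_dens k m s) (w(k := t)) = ennreal (t powr (s k - 1)) * indicator {0<..<\<zeta> - 1} t * sfun (Suc k) m (\<zeta> - t) (dir_dens (Suc k) m s) w"
proof -
  have sum: "(\<Sum>i\<in>{k..<m}. (w(k := t)) i) = t + (\<Sum>i\<in>{Suc k..<m}. w i)"
    using assms by (subst sum.atLeast_Suc_lessThan) (auto intro!: sum.cong)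
  have W: "close_sum k m \<zeta> (w(k := t)) = (close_sum (Suc k) m (\<zeta> - t) w)(k := t)"
    using assms unfolding close_sum_def sum by (auto simp: fun_eq_iff)
  have e: "{k..m} = insert k {Suc k..m}" using assms by auto
  have c: "(\<forall>i\<in>{k..m}. 0 < ((close_sum (Suc k) m (\<zeta> - t) w)(k := t)) i) \<longleftrightarrow> 0 < t \<and> (\<forall>i\<in>{Suc k..m}. 0 < close_sum (Suc k) m (\<zeta> - t) w i)"
    unfolding e by auto
  have p: "(\<Prod>i\<in>{k..m}. ((close_sum (Suc k) m (\<zeta> - t) w)(k := t)) i powr (s i - 1)) = t powr (s k - 1) * (\<Prod>i\<in>{Suc k..m}. close_sum (Suc k) m (\<zeta> - t) w i powr (s i - 1))"
    unfolding e by (subst prod.insert) (auto intro!: prod.cong)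
  have d: "dir_dens k m s (close_sum k m \<zeta> (w(k := t))) = ennreal (t powr (s k - 1)) * dir_dens (Suc k) m s (close_sum (Suc k) m (\<zeta> - t) w)"
    unfolding dir_dens_def W p by (simp add: ennreal_mult prod_nonneg)
  show ?thesis
  proof (cases "t < \<zeta> - 1")
    case False
    then have z: "sfun (Suc k) m (\<zeta> - t) F w = 0" for F using assms by (intro sfun_zero) auto
    then have "\<not> (\<forall>i\<in>{Suc k..m}. 0 < close_sum (Suc k) m (\<zeta> - t) w i)"
      using z[of "\<lambda>_. 1"] by (auto simp: sfun_def split: if_splits)
    then have "sfun k m \<zeta> (dir_dens k m s) (w(k := t)) = 0" unfolding sfun_def unfolding W c by auto
    then show ?thesis using False by simp
  next
    case True
    show ?thesis
      unfolding sfun_def[of k] d unfolding W c sfun_def using True by (auto simp: indicator_def)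
  qed
qed

text \<open>For a fixed first coordinate \<open>t\<close> the integral is one of the same kind with
  total \<open>\<zeta> - 1 - t\<close>; the power of this total combines with
  \<open>t powr (s k - 1)\<close> to a Beta integral.\<close>

lemma Dirichlet_integral:
  assumes "k \<le> m" and "\<And>i. i \<in> {k..m} \<Longrightarrow> 0 < s i" and "1 < \<zeta>"
  shows "(\<integral>\<^sup>+w. sfun k m \<zeta> (dir_dens k m s) w \<partial>lebs {k..<m}) =
    ennreal ((\<zeta> - 1) powr ((\<Sum>i\<in>{k..m}. s i) - 1) * ((\<Prod>i\<in>{k..m}. Gamma (s i)) / Gamma (\<Sum>i\<in>{k..m}. s i)))"
  using assms
proof (induction arbitrary: \<zeta> rule: inc_induct)
  case base
  have "0 < s m" using base by simp
  then have "Gamma (s m) \<noteq> 0" by (metis Gamma_real_pos less_irrefl)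
  moreover have "sfun m m \<zeta> (dir_dens m m s) u = ennreal ((\<zeta> - 1) powr (s m - 1))" for u
    using base by (simp add: sfun_def close_sum_def dir_dens_def)
  ultimately show ?case by (simp add: PiM_empty nn_integral_count_space_finite)
next
  case (step k)
  interpret product_sigma_finite "\<lambda>_::nat. lborel :: real measure" by (rule product_sigma_finite_lborel)
  have ins: "{k..<m} = insert k {Suc k..<m}" "{k..m} = insert k {Suc k..m}" using step by auto
  have km: "Suc k \<le> m" "k \<le> m" using step by auto
  define S where "S = (\<Sum>i\<in>{Suc k..m}. s i)"
  define C where "C = (\<Prod>i\<in>{Suc k..m}. Gamma (s i)) / Gamma S"
  have spos: "0 < s i" if "i \<in> {k..m}" for i using step.prems(1) that by simp
  have Sp: "0 < S" unfolding S_def using km spos by (intro sum_pos) auto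
  have Gp: "0 < (\<Prod>i\<in>{Suc k..m}. Gamma (s i))" using spos by (intro prod_pos Gamma_real_pos) auto
  have Cp: "0 < C" unfolding C_def using Gp Gamma_real_pos[OF Sp] by simp
  have Sm: "sfun k m \<zeta> (dir_dens k m s) \<in> borel_measurable (lebs (insert k {Suc k..<m}))"
    using sfun_measurable[OF km(2) dir_dens_measurable, of \<zeta> s] unfolding ins(1) .
  have "(\<integral>\<^sup>+w. sfun k m \<zeta> (dir_dens k m s) w \<partial>lebs {k..<m}) = (\<integral>\<^sup>+t. \<integral>\<^sup>+w. sfun k m \<zeta> (dir_dens k m s) (w(k := t)) \<partial>lebs {Suc k..<m} \<partial>lborel)"
    unfolding ins(1) by (rule product_nn_integral_insert_rev[OF _ _ Sm]) auto
  also have "\<dots> = (\<integral>\<^sup>+t. ennreal C * (ennreal (t powr (s k - 1) * (\<zeta> - 1 - t) powr (S - 1)) * indicator {0<..<\<zeta> - 1} t) \<partial>lborel)"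
  proof (rule nn_integral_cong)
    fix t :: real
    have "(\<integral>\<^sup>+w. sfun k m \<zeta> (dir_dens k m s) (w(k := t)) \<partial>lebs {Suc k..<m}) = (\<integral>\<^sup>+w. ennreal (t powr (s k - 1)) * indicator {0<..<\<zeta> - 1} t * sfun (Suc k) m (\<zeta> - t) (dir_dens (Suc k) m s) w \<partial>lebs {Suc k..<m})"
      using step.hyps by (simp only: sfun_dir_dens_update)
    also have "\<dots> = ennreal (t powr (s k - 1)) * indicator {0<..<\<zeta> - 1} t * (\<integral>\<^sup>+w. sfun (Suc k) m (\<zeta> - t) (dir_dens (Suc k) m s) w \<partial>lebs {Suc k..<m})"
      by (intro nn_integral_cmult sfun_measurable dir_dens_measurable km)
    also have "\<dots> = ennreal C * (ennreal (t powr (s k - 1) * (\<zeta> - 1 - t) powr (S - 1)) * indicator {0<..<\<zeta> - 1} t)"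
    proof (cases "t \<in> {0<..<\<zeta> - 1}")
      case True
      then have "(\<integral>\<^sup>+w. sfun (Suc k) m (\<zeta> - t) (dir_dens (Suc k) m s) w \<partial>lebs {Suc k..<m}) = ennreal ((\<zeta> - t - 1) powr (S - 1) * C)"
        unfolding S_def C_def using step.prems by (intro step.IH) auto
      moreover have "\<zeta> - t - 1 = \<zeta> - 1 - t" by simp
      ultimately show ?thesis using True Cp by (simp add: ennreal_mult less_imp_le mult_ac)
    qed simp
    finally show "(\<integral>\<^sup>+w. sfun k m \<zeta> (dir_dens k m s) (w(k := t)) \<partial>lebs {Suc k..<m}) = ennreal C * (ennreal (t powr (s k - 1) * (\<zeta> - 1 - t) powr (S - 1)) * indicator {0<..<\<zeta> - 1} t)" .
  qed
  also have "\<dots> = ennreal C * (\<integral>\<^sup>+t. ennreal (t powr (s k - 1) * (\<zeta> - 1 - t) powr (S - 1)) * indicator {0<..<\<zeta> - 1} t \<partial>lborel)"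
    by (rule nn_integral_cmult) measurable
  also have "(\<integral>\<^sup>+t. ennreal (t powr (s k - 1) * (\<zeta> - 1 - t) powr (S - 1)) * indicator {0<..<\<zeta> - 1} t \<partial>lborel) = ennreal ((\<zeta> - 1) powr (s k + S - 1) * Beta (s k) S)"
    using spos[of k] km Sp step.prems(2) by (intro nn_integral_Beta) auto
  also have "ennreal C * \<dots> = ennreal ((\<zeta> - 1) powr (s k + S - 1) * (Beta (s k) S * C))"
    using Cp by (subst ennreal_mult''[symmetric]) (auto simp: Beta_def mult_ac intro!: mult_nonneg_nonneg divide_nonneg_nonneg less_imp_le[OF Gamma_real_pos] add_pos_pos Sp spos km)
  also have "Beta (s k) S * C = (\<Prod>i\<in>{k..m}. Gamma (s i)) / Gamma (s k + S)"
    using Gamma_real_pos[OF Sp] unfolding ins(2) by (simp add: Beta_def C_def)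
  also have "s k + S = (\<Sum>i\<in>{k..m}. s i)" unfolding ins(2) S_def by simp
  finally show ?case .
qed

section \<open>The integral of a monomial in the residues\<close>

text \<open>Interlacing gives \<open>X j - y i\<close> and \<open>y j - y i\<close> the same sign
  for every \<open>j \<noteq> i\<close>.\<close>

lemma lagc_pos:
  assumes interlaced: "interlaced k m y X" and y: "strict_mono_on {k..m} y" and i: "i \<in> {k..m}"
  shows "0 < lagc {k..m} y X i"
proof -
  have lt: "y a < y b" if "a < b" "k \<le> a" "b \<le> m" for a b using strict_mono_onD[OF y, of a b] that by auto
  have le: "y a \<le> y b" if "a \<le> b" "k \<le> a" "b \<le> m" for a b using lt[of a b] that by (cases "a = b") auto
  have "(\<Prod>j\<in>{k..m}. X j - y i) = (X i - y i) * (\<Prod>j\<in>{k..m} - {i}. X j - y i)"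
    using i by (intro prod.remove) auto
  then have "lagc {k..m} y X i = (X i - y i) * (\<Prod>j\<in>{k..m} - {i}. (X j - y i) / (y j - y i))"
    by (simp add: lagc_def prod_dividef)
  moreover have "0 < (\<Prod>j\<in>{k..m} - {i}. (X j - y i) / (y j - y i))"
  proof (intro prod_pos)
    fix j assume j: "j \<in> {k..m} - {i}"
    show "0 < (X j - y i) / (y j - y i)"
    proof (cases "j < i")
      case True
      then have "X j < y (Suc j)" "y (Suc j) \<le> y i" "y j < y i" using interlaced i j le[of "Suc j" i] lt[of j i] by (auto simp: interlaced_def)
      then show ?thesis by (intro divide_neg_neg) auto
    next
      case False
      then have "y i < y j" using lt[of i j] i j by auto
      moreover have "y j < X j" using interlaced j by (auto simp: interlaced_def)
      ultimately show ?thesis by (intro divide_pos_pos) auto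
    qed
  qed
  moreover have "y i < X i" using interlaced i by (auto simp: interlaced_def)
  ultimately show ?thesis by simp
qed

definition ilace_dens :: "nat \<Rightarrow> (nat \<Rightarrow> real) \<Rightarrow> real \<Rightarrow> (nat \<Rightarrow> real) \<Rightarrow> (nat \<Rightarrow> real) \<Rightarrow> real" where
  "ilace_dens m y c s x = (if interlaced 0 m y (close_prod 0 m c x) then
     vdm 0 m (close_prod 0 m c x) / (\<Prod>i\<in>{0..<m}. x i) * (\<Prod>i\<in>{0..m}. wgt 0 m y (close_prod 0 m c x) i powr (s i - 1)) else 0)"

lemma ilace_dens_integral:
  assumes y: "\<And>i. i \<in> {0..m} \<Longrightarrow> 0 < y i" "strict_mono_on {0..m} y" and z: "1 < z" and s: "\<And>i. i \<in> {0..m} \<Longrightarrow> 0 < s i"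
  shows "has_bochner_integral (lebs {0..<m}) (ilace_dens m y (z * (\<Prod>i\<in>{0..m}. y i)) s)
    (vdm 0 m y * ((z - 1) powr ((\<Sum>i\<in>{0..m}. s i) - 1) * ((\<Prod>i\<in>{0..m}. Gamma (s i)) / Gamma (\<Sum>i\<in>{0..m}. s i))))"
proof (rule has_bochner_integral_nn_integral)
  let ?c = "z * (\<Prod>i\<in>{0..m}. y i)"
  have yp: "0 < (\<Prod>i\<in>{0..m}. y i)" using y by (intro prod_pos) auto
  have nn: "0 \<le> ilace_dens m y ?c s x" for x
  proof (cases "interlaced 0 m y (close_prod 0 m ?c x)")
    case True
    have xp: "0 < x i" if "i \<in> {0..<m}" for i
    proof -
      have "y i < close_prod 0 m ?c x i" using True that by (auto simp: interlaced_def)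
      then show ?thesis using y(1)[of i] that by (auto simp: close_prod_def)
    qed
    have "0 < (\<Prod>i\<in>{0..<m}. x i)" using xp by (intro prod_pos) auto
    then show ?thesis using interlaced_vdm_pos[OF True y(2)] by (auto simp: ilace_dens_def intro!: mult_nonneg_nonneg prod_nonneg divide_nonneg_nonneg less_imp_le[OF xp])
  qed (simp add: ilace_dens_def)
  then show "AE x in lebs {0..<m}. 0 \<le> ilace_dens m y ?c s x" by simp
  have L: "ennreal (ilace_dens m y ?c s x) = lfun 0 m y ?c (dir_dens 0 m s) x" for x
  proof (cases "interlaced 0 m y (close_prod 0 m ?c x)")
    case True
    have p: "(\<Prod>i\<in>{0..m}. (\<lambda>i\<in>{0..m}. wgt 0 m y (close_prod 0 m ?c x) i) i powr (s i - 1)) = (\<Prod>i\<in>{0..m}. wgt 0 m y (close_prod 0 m ?c x) i powr (s i - 1))"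
      by (rule prod.cong) auto
    show ?thesis unfolding ilace_dens_def lfun_def dir_dens_def p if_P[OF True] by (intro ennreal_mult'' prod_nonneg) simp
  qed (simp add: ilace_dens_def lfun_def)
  have meas: "lfun 0 m y ?c (dir_dens 0 m s) \<in> borel_measurable (lebs {0..<m})"
    by (intro lfun_measurable dir_dens_measurable) simp
  have "ilace_dens m y ?c s x = enn2real (lfun 0 m y ?c (dir_dens 0 m s) x)" for x
    using nn[of x] L[of x, symmetric] by simp
  then show "ilace_dens m y ?c s \<in> borel_measurable (lebs {0..<m})"
    using meas by (simp add: measurable_cong[of _ "ilace_dens m y ?c s" "\<lambda>x. enn2real (lfun 0 m y ?c (dir_dens 0 m s) x)"])
  have Vp: "0 < vdm 0 m y" unfolding vdm_def using strict_mono_onD[OF y(2)] by (intro prod_pos) auto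
  let ?I = "(z - 1) powr ((\<Sum>i\<in>{0..m}. s i) - 1) * ((\<Prod>i\<in>{0..m}. Gamma (s i)) / Gamma (\<Sum>i\<in>{0..m}. s i))"
  have sp: "0 < (\<Sum>i\<in>{0..m}. s i)" using s by (intro sum_pos) auto
  have Ip: "0 \<le> ?I"
    using s sp by (intro mult_nonneg_nonneg divide_nonneg_nonneg prod_nonneg less_imp_le[OF Gamma_real_pos] ballI) auto
  show "0 \<le> vdm 0 m y * ?I" by (intro mult_nonneg_nonneg Ip less_imp_le[OF Vp])
  have "(\<integral>\<^sup>+x. ennreal (ilace_dens m y ?c s x) \<partial>lebs {0..<m}) = ennreal (vdm 0 m y) * (\<integral>\<^sup>+w. sfun 0 m (?c / (\<Prod>i\<in>{0..m}. y i)) (dir_dens 0 m s) w \<partial>lebs {0..<m})"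
    unfolding L using y z yp by (intro interlacing_change_of_variables dir_dens_measurable) auto
  also have "?c / (\<Prod>i\<in>{0..m}. y i) = z" by (rule nonzero_mult_div_cancel_right) (use yp in linarith)
  also have "(\<integral>\<^sup>+w. sfun 0 m z (dir_dens 0 m s) w \<partial>lebs {0..<m}) = ennreal ?I"
    using s z by (intro Dirichlet_integral) auto
  also have "ennreal (vdm 0 m y) * ennreal ?I = ennreal (vdm 0 m y * ?I)"
    using Vp Ip by (simp only: ennreal_mult less_imp_le)
  finally show "(\<integral>\<^sup>+x. ennreal (ilace_dens m y ?c s x) \<partial>lebs {0..<m}) = ennreal (vdm 0 m y * ?I)" .
qed

section \<open>The surface element\<close>

lemma pderiv_at_prod:
  fixes x :: "nat \<Rightarrow> real"
  assumes "i < n" "x i \<noteq> 0"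
  shows "pderiv_at i (\<lambda>x. (\<Prod>i<n. x i) - c) x = (\<Prod>i<n. x i) / x i"
proof -
  define P where "P = (\<Prod>j\<in>{..<n} - {i}. x j)"
  have upd: "(\<Prod>j<n. (x(i := t)) j) = t * P" for t
  proof -
    have "(\<Prod>j<n. (x(i := t)) j) = (x(i := t)) i * (\<Prod>j\<in>{..<n} - {i}. (x(i := t)) j)"
      using assms(1) by (intro prod.remove) auto
    also have "(\<Prod>j\<in>{..<n} - {i}. (x(i := t)) j) = P" unfolding P_def by (rule prod.cong) auto
    finally show ?thesis by simp
  qed
  have "(\<Prod>i<n. x i) = x i * P" using upd[of "x i"] by simp
  moreover have "((\<lambda>t. t * P - c) has_real_derivative P) (at (x i))"
    by (auto intro!: derivative_eq_intros)
  ultimately show ?thesis unfolding pderiv_at_def upd using assms(2) by (simp add: DERIV_imp_deriv)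
qed

lemma pderiv_at_inverse_prod:
  fixes x :: "nat \<Rightarrow> real"
  assumes "i < n" and nz: "\<And>j. j < n \<Longrightarrow> x j \<noteq> 0"
  shows "pderiv_at i (\<lambda>x. c / (\<Prod>i<n. x i)) x = - (c / (\<Prod>i<n. x i)) / x i"
proof -
  define P where "P = (\<Prod>j\<in>{..<n} - {i}. x j)"
  have upd: "(\<Prod>j<n. (x(i := t)) j) = t * P" for t
  proof -
    have "(\<Prod>j<n. (x(i := t)) j) = (x(i := t)) i * (\<Prod>j\<in>{..<n} - {i}. (x(i := t)) j)"
      using assms(1) by (intro prod.remove) auto
    also have "(\<Prod>j\<in>{..<n} - {i}. (x(i := t)) j) = P" unfolding P_def by (rule prod.cong) auto
    finally show ?thesis by simp
  qed
  have P: "P \<noteq> 0" unfolding P_def using nz by auto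
  have "(\<Prod>i<n. x i) = x i * P" using upd[of "x i"] by simp
  moreover have "((\<lambda>t. c / (t * P)) has_real_derivative - (c / (x i * P)) / x i) (at (x i))"
    using P nz[OF assms(1)] by (auto intro!: derivative_eq_intros simp: field_simps)
  ultimately show ?thesis unfolding pderiv_at_def upd by (simp add: DERIV_imp_deriv)
qed

text \<open>The surface element of a graph divided by the norm of \<open>grad h\<close> is the
  reciprocal of the derivative of \<open>h\<close> in the eliminated direction; here that derivative
  is the product of the other coordinates.\<close>

lemma surface_density:
  fixes x :: "nat \<Rightarrow> real"
  assumes x: "\<And>i. i < m \<Longrightarrow> 0 < x i" and c: "0 < c"
  defines "X \<equiv> x(m := c / (\<Prod>i<m. x i))"
  shows "sqrt (1 + (grad_norm m (\<lambda>x. c / (\<Prod>i<m. x i)) x)\<^sup>2) / grad_norm (Suc m) (\<lambda>x. (\<Prod>i<Suc m. x i) - c) X = 1 / (\<Prod>i<m. x i)"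
proof -
  define P where "P = (\<Prod>i<m. x i)"
  define T where "T = (\<Sum>i<m. (1 / x i)\<^sup>2)"
  have P: "0 < P" unfolding P_def using x by (intro prod_pos) auto
  have Xi: "X i = x i" if "i < m" for i using that by (simp add: X_def)
  have Xm: "X m = c / P" by (simp add: X_def P_def)
  have PX: "(\<Prod>i<Suc m. X i) = c" using P by (simp add: Xi Xm P_def[symmetric])
  have "(\<Sum>i<m. (pderiv_at i (\<lambda>x. c / (\<Prod>i<m. x i)) x)\<^sup>2) = (\<Sum>i<m. (c / P)\<^sup>2 * (1 / x i)\<^sup>2)"
  proof (rule sum.cong[OF refl])
    fix i assume i: "i \<in> {..<m}"
    have "x j \<noteq> 0" if "j < m" for j using x[OF that] by simp
    then have "pderiv_at i (\<lambda>x. c / (\<Prod>i<m. x i)) x = - (c / P) / x i"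
      unfolding P_def using i by (intro pderiv_at_inverse_prod) auto
    then show "(pderiv_at i (\<lambda>x. c / (\<Prod>i<m. x i)) x)\<^sup>2 = (c / P)\<^sup>2 * (1 / x i)\<^sup>2"
      by (simp add: power_divide power_mult_distrib)
  qed
  then have "(grad_norm m (\<lambda>x. c / (\<Prod>i<m. x i)) x)\<^sup>2 = (c / P)\<^sup>2 * T"
    unfolding grad_norm_def T_def sum_distrib_left by (simp add: sum_nonneg)
  moreover have "grad_norm (Suc m) (\<lambda>x. (\<Prod>i<Suc m. x i) - c) X = sqrt (P\<^sup>2 * (1 + (c / P)\<^sup>2 * T))"
  proof -
    have "(\<Sum>i<Suc m. (pderiv_at i (\<lambda>x. (\<Prod>i<Suc m. x i) - c) X)\<^sup>2) = (\<Sum>i<Suc m. c\<^sup>2 * (1 / X i)\<^sup>2)"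
    proof (rule sum.cong[OF refl])
      fix i assume i: "i \<in> {..<Suc m}"
      have "X i \<noteq> 0" using x[of i] c P i by (cases "i = m") (auto simp: Xi Xm)
      then have "pderiv_at i (\<lambda>x. (\<Prod>i<Suc m. x i) - c) X = c / X i"
        using i pderiv_at_prod[of i "Suc m" X c] unfolding PX by auto
      then show "(pderiv_at i (\<lambda>x. (\<Prod>i<Suc m. x i) - c) X)\<^sup>2 = c\<^sup>2 * (1 / X i)\<^sup>2"
        by (simp add: power_divide)
    qed
    also have "\<dots> = c\<^sup>2 * T + c\<^sup>2 * (1 / (c / P))\<^sup>2"
      by (simp add: Xi Xm sum_distrib_left T_def)
    also have "\<dots> = P\<^sup>2 * (1 + (c / P)\<^sup>2 * T)"
      using c P by (simp add: field_simps power2_eq_square)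
    finally show ?thesis unfolding grad_norm_def by simp
  qed
  moreover have "sqrt (P\<^sup>2 * (1 + (c / P)\<^sup>2 * T)) = P * sqrt (1 + (c / P)\<^sup>2 * T)"
    using P by (simp add: real_sqrt_mult)
  moreover have "0 < 1 + (c / P)\<^sup>2 * T"
    unfolding T_def by (intro add_pos_nonneg mult_nonneg_nonneg sum_nonneg) auto
  then have "sqrt (1 + (c / P)\<^sup>2 * T) \<noteq> 0" by simp
  ultimately show ?thesis using P by (simp add: P_def[symmetric])
qed

section \<open>Moments of the operator \<open>Q\<close>\<close>

lemma interlaced_iff_Omega: "interlaced 0 m y X \<longleftrightarrow> X \<in> Omega (Suc m) y"
  by (auto simp: interlaced_def Omega_def less_Suc_eq_le)

lemma vdm_vandermonde: "vdm 0 m x = vandermonde (Suc m) x"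
proof -
  have "{0..m} = {..<Suc m}" by auto
  then show ?thesis unfolding vdm_def vandermonde_def by (simp add: atLeast0LessThan)
qed

text \<open>The moment of \<open>\<Prod>i<n. w i ^ b i\<close> under the symmetric Dirichlet distribution with parameter \<open>g\<close>.\<close>

definition dir_moment :: "nat \<Rightarrow> real \<Rightarrow> (nat \<Rightarrow> nat) \<Rightarrow> real" where
  "dir_moment n g b = Gamma (real n * g) / Gamma g ^ n * ((\<Prod>i<n. Gamma (g + real (b i))) / Gamma (real n * g + real (\<Sum>i<n. b i)))"

text \<open>In \<open>H\<close> the exponents at \<open>i < n\<close> belong to the nodes and those
  at \<open>n + i\<close> to the weights. As \<open>xi\<close> is \<open>y i\<close> times the
  weight, the powers of \<open>y i\<close> in the prefactor cancel and a Dirichlet density remains.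
  Of the powers of \<open>z - 1\<close> only the degree in the weights survives, a natural number;
  this makes the result polynomial in \<open>z\<close>.\<close>

lemma Q_integral_moments:
  fixes H :: mpoly and p :: mpoly and y :: "nat \<Rightarrow> real"
  assumes n: "n = Suc m" and y: "\<And>i. i < n \<Longrightarrow> 0 < y i" "strict_mono_on {..<n} y" and z: "1 < z" and g: "0 < g"
    and H: "\<And>X. X \<in> Omega n y \<Longrightarrow> eval_mpoly (\<lambda>i. of_real (X i)) p =
      (\<Sum>\<mu>\<in>keys H. lookup H \<mu> * (\<Prod>i<n. of_real (y i) ^ lookup \<mu> i) *
         (\<Prod>i<n. of_real (wgt 0 m y X i) ^ lookup \<mu> (n + i)))"
  shows "Q_integral n g z p y = (\<Sum>\<mu>\<in>keys H. lookup H \<mu> * (\<Prod>i<n. of_real (y i) ^ lookup \<mu> i) *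
      of_real ((z - 1) ^ (\<Sum>i<n. lookup \<mu> (n + i)) * dir_moment n g (\<lambda>i. lookup \<mu> (n + i))))"
proof -
  define c where "c = z * (\<Prod>i<n. y i)"
  have nm: "n - 1 = m" using n by simp
  have set: "{0..m} = {..<n}" using n by auto
  have y': "\<And>i. i \<in> {0..m} \<Longrightarrow> 0 < y i" "strict_mono_on {0..m} y" using y unfolding set by auto
  have c: "0 < c" unfolding c_def using y z by (intro mult_pos_pos prod_pos) auto
  have Xeq: "x(m := c / (\<Prod>i<m. x i)) = close_prod 0 m c x" for x
    by (simp add: close_prod_def atLeast0LessThan)
  define Y where "Y = (\<Prod>i<n. y i powr (g - 1))"
  have Yp: "0 < Y"
    unfolding Y_def
  proof (intro prod_pos)
    fix i assume "i \<in> {..<n}"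
    then show "0 < y i powr (g - 1)" using y(1)[of i] by simp
  qed
  define B where "B \<mu> i = lookup \<mu> (n + i)" for \<mu> :: "nat \<Rightarrow>\<^sub>0 nat" and i
  define C where "C \<mu> = lookup H \<mu> * (\<Prod>i<n. of_real (y i) ^ lookup \<mu> i)" for \<mu>
  define s where "s \<mu> i = g + real (B \<mu> i)" for \<mu> i
  have sp: "0 < s \<mu> i" for \<mu> i using g by (simp add: s_def add_pos_nonneg)
  have integrand: "of_real (sqrt (1 + (grad_norm m (\<lambda>x. c / (\<Prod>i<m. x i)) x)\<^sup>2)) *
      (indicator (Omega n y) (close_prod 0 m c x) * (of_real (vandermonde n (close_prod 0 m c x) * (\<Prod>i<n. xi n y (close_prod 0 m c x) i powr (g - 1))) *
          eval_mpoly (\<lambda>i. of_real (close_prod 0 m c x i)) p) / of_real (grad_norm n (\<lambda>x. (\<Prod>i<n. x i) - c) (close_prod 0 m c x)))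
     = (\<Sum>\<mu>\<in>keys H. (C \<mu> * of_real Y) * complex_of_real (ilace_dens m y c (s \<mu>) x))" (is "?L = ?R") for x
  proof (cases "interlaced 0 m y (close_prod 0 m c x)")
    case False
    then have "close_prod 0 m c x \<notin> Omega n y" by (simp add: interlaced_iff_Omega n)
    then show ?thesis using False by (simp add: ilace_dens_def)
  next
    case True
    let ?X = "close_prod 0 m c x"
    have O: "?X \<in> Omega n y" using True by (simp add: interlaced_iff_Omega n)
    have xp: "0 < x i" if "i < m" for i
    proof -
      have "y i < ?X i" using True that by (auto simp: interlaced_def)
      then show ?thesis using y(1)[of i] that n by (auto simp: close_prod_def)
    qed
    have wp: "0 < wgt 0 m y ?X i" if "i < n" for i
      using lagc_pos[OF True y'(2), of i] y(1)[OF that] that n by (auto simp: wgt_def)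
    have xi: "xi n y ?X i = y i * wgt 0 m y ?X i" if "i < n" for i
      using y(1)[OF that] by (simp add: xi_def wgt_def lagc_def set)
    have newton: "(\<Prod>i<n. xi n y ?X i powr (g - 1)) = Y * (\<Prod>i<n. wgt 0 m y ?X i powr (g - 1))"
      unfolding Y_def prod.distrib[symmetric]
    proof (rule prod.cong[OF refl])
      fix i assume "i \<in> {..<n}"
      then show "xi n y ?X i powr (g - 1) = y i powr (g - 1) * wgt 0 m y ?X i powr (g - 1)"
        using xi[of i] y(1)[of i] wp[of i] by (simp add: powr_mult)
    qed
    have dir_dens: "(\<Prod>i<n. wgt 0 m y ?X i powr (g - 1)) * (\<Prod>i<n. wgt 0 m y ?X i ^ B \<mu> i) = (\<Prod>i\<in>{0..m}. wgt 0 m y ?X i powr (s \<mu> i - 1))" for \<mu>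
      unfolding set prod.distrib[symmetric]
    proof (rule prod.cong[OF refl])
      fix i assume i: "i \<in> {..<n}"
      have "wgt 0 m y ?X i ^ B \<mu> i = wgt 0 m y ?X i powr real (B \<mu> i)"
        using wp[of i] i by (simp add: powr_realpow)
      then show "wgt 0 m y ?X i powr (g - 1) * wgt 0 m y ?X i ^ B \<mu> i = wgt 0 m y ?X i powr (s \<mu> i - 1)"
        by (simp add: powr_add[symmetric] s_def algebra_simps)
    qed
    define G1 G2 where "G1 = sqrt (1 + (grad_norm m (\<lambda>x. c / (\<Prod>i<m. x i)) x)\<^sup>2)" and "G2 = grad_norm n (\<lambda>x. (\<Prod>i<n. x i) - c) ?X"
    have G: "G1 / G2 = 1 / (\<Prod>i\<in>{0..<m}. x i)"
      unfolding G1_def G2_def n atLeast0LessThan Xeq[symmetric] by (rule surface_density[OF xp c])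
    have ev: "eval_mpoly (\<lambda>i. of_real (?X i)) p = (\<Sum>\<mu>\<in>keys H. C \<mu> * of_real (\<Prod>i<n. wgt 0 m y ?X i ^ B \<mu> i))"
      using H[OF O] unfolding C_def B_def by simp
    have "?L = of_real (G1 / G2) * (of_real (vandermonde n ?X * (\<Prod>i<n. xi n y ?X i powr (g - 1))) * eval_mpoly (\<lambda>i. of_real (?X i)) p)"
      using O unfolding G1_def[symmetric] G2_def[symmetric] by simp
    also have "\<dots> = (\<Sum>\<mu>\<in>keys H. (C \<mu> * of_real Y) * of_real (G1 / G2 * vandermonde n ?X * ((\<Prod>i<n. wgt 0 m y ?X i powr (g - 1)) * (\<Prod>i<n. wgt 0 m y ?X i ^ B \<mu> i))))"
      unfolding ev newton sum_distrib_left by (rule sum.cong[OF refl]) (simp add: mult_ac)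
    also have "\<dots> = ?R"
      using True unfolding dir_dens G by (simp add: ilace_dens_def vdm_vandermonde n mult_ac)
    finally show ?thesis .
  qed
  define V where "V \<mu> = vdm 0 m y * ((z - 1) powr ((\<Sum>i\<in>{0..m}. s \<mu> i) - 1) * ((\<Prod>i\<in>{0..m}. Gamma (s \<mu> i)) / Gamma (\<Sum>i\<in>{0..m}. s \<mu> i)))" for \<mu>
  have hb: "has_bochner_integral (lebs {0..<m}) (ilace_dens m y c (s \<mu>)) (V \<mu>)" for \<mu>
    using ilace_dens_integral[OF y' z, of "s \<mu>"] sp unfolding V_def set c_def by auto
  have "(LINT x|lebs {0..<m}. (\<Sum>\<mu>\<in>keys H. (C \<mu> * of_real Y) * complex_of_real (ilace_dens m y c (s \<mu>) x)))
    = (\<Sum>\<mu>\<in>keys H. (C \<mu> * of_real Y) * of_real (V \<mu>))"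
    by (intro has_bochner_integral_integral_eq has_bochner_integral_sum has_bochner_integral_mult_right has_bochner_integral_of_real hb)
  then have D: "delta_integral n y c (\<lambda>x. of_real (vandermonde n x * (\<Prod>i<n. xi n y x i powr (g - 1))) * eval_mpoly (\<lambda>i. of_real (x i)) p)
    = (\<Sum>\<mu>\<in>keys H. (C \<mu> * of_real Y) * of_real (V \<mu>))"
    unfolding delta_integral_def graph_integral_def nm Xeq integrand atLeast0LessThan .
  have Vp: "0 < vdm 0 m y" unfolding vdm_def using strict_mono_onD[OF y'(2)] by (intro prod_pos) auto
  have coef: "Gamma (real n * g) / Gamma g ^ n * ((z - 1) powr (1 - real n * g) / (vandermonde n y * Y)) * (Y * V \<mu>)
     = (z - 1) ^ (\<Sum>i<n. B \<mu> i) * dir_moment n g (B \<mu>)" for \<mu>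
  proof -
    have S: "(\<Sum>i\<in>{0..m}. s \<mu> i) = real n * g + real (\<Sum>i<n. B \<mu> i)"
      unfolding set s_def by (simp add: sum.distrib)
    have "(z - 1) powr (1 - real n * g) * (z - 1) powr ((\<Sum>i\<in>{0..m}. s \<mu> i) - 1) = (z - 1) ^ (\<Sum>i<n. B \<mu> i)"
      unfolding S powr_add[symmetric] using z by (simp add: powr_realpow[symmetric])
    note pow = this
    have VV: "vdm 0 m y = vandermonde n y" by (simp add: vdm_vandermonde n)
    have M: "(\<Prod>i\<in>{0..m}. Gamma (s \<mu> i)) / Gamma (\<Sum>i\<in>{0..m}. s \<mu> i) = (\<Prod>i<n. Gamma (g + real (B \<mu> i))) / Gamma (real n * g + real (\<Sum>i<n. B \<mu> i))"
      unfolding S by (simp only: set s_def)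
    have "G * (a / (v * Y)) * (Y * (v * (b * q))) = a * b * (G * q)" if "v \<noteq> 0" for G a b q v
      using that Yp by simp
    note alg = this
    have "vandermonde n y \<noteq> 0" using Vp VV by simp
    then show ?thesis
      unfolding V_def M dir_moment_def VV by (subst alg) (simp_all only: pow not_False_eq_True)
  qed
  show ?thesis
    unfolding Q_integral_def c_def[symmetric] D Y_def[symmetric] sum_distrib_left
  proof (rule sum.cong[OF refl])
    fix \<mu>
    have "of_real (Gamma (real n * g) / Gamma g ^ n * ((z - 1) powr (1 - real n * g) / (vandermonde n y * Y))) * (C \<mu> * of_real Y * of_real (V \<mu>))
      = C \<mu> * complex_of_real (Gamma (real n * g) / Gamma g ^ n * ((z - 1) powr (1 - real n * g) / (vandermonde n y * Y)) * (Y * V \<mu>))"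
      by (simp only: of_real_mult mult_ac)
    then show "of_real (Gamma (real n * g) / Gamma g ^ n * ((z - 1) powr (1 - real n * g) / (vandermonde n y * Y))) * (C \<mu> * of_real Y * of_real (V \<mu>))
      = lookup H \<mu> * (\<Prod>i<n. of_real (y i) ^ lookup \<mu> i) *
      of_real ((z - 1) ^ (\<Sum>i<n. lookup \<mu> (n + i)) * dir_moment n g (\<lambda>i. lookup \<mu> (n + i)))"
      unfolding coef C_def B_def .
  qed
qed

section \<open>Symmetric polynomials as functions of the nodes and the residues\<close>

text \<open>The product of the \<open>1 - x i X\<close> in terms of the nodes \<open>y\<close> and the weights \<open>w\<close>; its coefficients are
  symmetric under simultaneous permutations of \<open>y\<close> and \<open>w\<close>.\<close>

definition esym :: "nat \<Rightarrow> (nat \<Rightarrow> complex) \<Rightarrow> (nat \<Rightarrow> complex) \<Rightarrow> complex fps" where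
  "esym n y w = (\<Prod>i<n. 1 - fps_const (y i) * fps_X) - fps_X * (\<Sum>i<n. fps_const (y i * w i) * (\<Prod>j\<in>{..<n} - {i}. 1 - fps_const (y j) * fps_X))"

lemma bser_minus_one: "bser (-1) c = 1 - fps_const c * fps_X"
proof -
  have "bser (-1) c = (geo c * (1 - fps_const c * fps_X)) * bser (-1) c" by (simp add: geo_inverse)
  also have "\<dots> = (1 - fps_const c * fps_X) * (geo c * bser (-1) c)" by (simp only: mult_ac)
  finally show ?thesis by (simp add: geo_bser)
qed

text \<open>This is \<open>lagrange_poly\<close> at \<open>1 / T\<close>, multiplied by the
  \<open>n\<close>-th power of \<open>- T\<close>; the value at \<open>T = 0\<close> is compared
  separately. Nonzero nodes are needed to pass from residues to weights.\<close>

lemma esym_lagrange: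
  fixes x y :: "nat \<Rightarrow> complex"
  assumes inj: "inj_on y {..<n}" and y: "\<And>i. i < n \<Longrightarrow> y i \<noteq> 0"
  shows "(\<Prod>i<n. 1 - fps_const (x i) * fps_X) = esym n y (\<lambda>i. lagc {..<n} y x i / y i)"
proof -
  let ?A = "\<lambda>x. \<Prod>j<n. [:1, - x j:]"
  let ?S = "\<Sum>i<n. Polynomial.smult (lagc {..<n} y x i) (\<Prod>j\<in>{..<n} - {i}. [:1, - y j:])"
  have poly: "?A x = ?A y - [:0, 1:] * ?S"
  proof (rule poly_ext)
    fix T :: complex
    show "poly (?A x) T = poly (?A y - [:0, 1:] * ?S) T"
    proof (cases "T = 0")
      case False
      have lin: "1 + T * - a = (- T) * (a - 1 / T)" for a using False by (simp add: field_simps)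
      have ins: "(\<Prod>j<n. f j) = f i * (\<Prod>j\<in>{..<n} - {i}. f j)" if "i < n" for f :: "nat \<Rightarrow> complex" and i
        using that by (intro prod.remove) auto
      have "(\<Prod>j<n. x j - 1 / T) = (\<Prod>j<n. y j - 1 / T) + (\<Sum>i<n. lagc {..<n} y x i * (\<Prod>j\<in>{..<n} - {i}. y j - 1 / T))"
        using arg_cong[OF lagrange_poly[OF _ inj, of x], of "\<lambda>p. poly p (1 / T)"] by (simp add: poly_prod poly_sum)
      then have "(\<Prod>j<n. - T) * (\<Prod>j<n. x j - 1 / T) = (\<Prod>j<n. - T) * (\<Prod>j<n. y j - 1 / T) + (\<Sum>i<n. lagc {..<n} y x i * ((\<Prod>j<n. - T) * (\<Prod>j\<in>{..<n} - {i}. y j - 1 / T)))"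
        by (simp only: distrib_left sum_distrib_left mult.left_commute)
      also have "(\<Sum>i<n. lagc {..<n} y x i * ((\<Prod>j<n. - T) * (\<Prod>j\<in>{..<n} - {i}. y j - 1 / T))) = (\<Sum>i<n. lagc {..<n} y x i * ((- T) * (\<Prod>j\<in>{..<n} - {i}. (- T) * (y j - 1 / T))))"
      proof (rule sum.cong[OF refl])
        fix i assume "i \<in> {..<n}"
        then have "(\<Prod>j<n. - T) = (- T) * (\<Prod>j\<in>{..<n} - {i}. - T)" by (intro ins) simp
        then show "lagc {..<n} y x i * ((\<Prod>j<n. - T) * (\<Prod>j\<in>{..<n} - {i}. y j - 1 / T)) = lagc {..<n} y x i * ((- T) * (\<Prod>j\<in>{..<n} - {i}. (- T) * (y j - 1 / T)))"
          by (simp only: prod.distrib mult.assoc)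
      qed
      finally have "(\<Prod>j<n. 1 + T * - x j) = (\<Prod>j<n. 1 + T * - y j) + (\<Sum>i<n. lagc {..<n} y x i * ((- T) * (\<Prod>j\<in>{..<n} - {i}. 1 + T * - y j)))"
        unfolding lin prod.distrib .
      then show ?thesis by (simp add: poly_prod poly_sum sum_distrib_left sum_negf mult_ac)
    qed (simp add: poly_prod)
  qed
  have lin: "fps_of_poly [:1, - a:] = 1 - fps_const a * fps_X" for a :: complex
    by (simp add: fps_of_poly_pCons)
  have X: "fps_of_poly [:0, 1:] = (fps_X :: complex fps)" by (simp add: fps_of_poly_pCons)
  have "fps_of_poly (?A x) = fps_of_poly (?A y) - fps_X * (\<Sum>i<n. fps_const (lagc {..<n} y x i) * (\<Prod>j\<in>{..<n} - {i}. fps_of_poly [:1, - y j:]))"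
    unfolding poly fps_of_poly_diff fps_of_poly_mult X fps_of_poly_sum fps_of_poly_smult fps_of_poly_prod ..
  moreover have "(\<Sum>i<n. fps_const (lagc {..<n} y x i) * F i) = (\<Sum>i<n. fps_const (y i * (lagc {..<n} y x i / y i)) * F i)" for F
    using y by (intro sum.cong) auto
  ultimately show ?thesis unfolding esym_def fps_of_poly_prod lin by simp
qed

text \<open>Newton's identities for the power sums of \<open>x\<close>.\<close>

fun newton :: "nat \<Rightarrow> (nat \<Rightarrow> complex) \<Rightarrow> (nat \<Rightarrow> complex) \<Rightarrow> nat \<Rightarrow> complex" where
  "newton n y w d = - of_nat d * fps_nth (esym n y w) d - (\<Sum>k\<in>{1..<d}. newton n y w k * fps_nth (esym n y w) (d - k))"

declare newton.simps [simp del]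

text \<open>Newton's identities are \<open>kernel_recursion\<close> for the exponent
  \<open>a = -1\<close> and a single \<open>y\<close> equal to 1, where the kernel is the product of
  the \<open>1 - x i X\<close>.\<close>

lemma psum_newton:
  assumes E: "(\<Prod>i<n. 1 - fps_const (x i) * fps_X) = esym n y w" and d: "0 < d"
  shows "psum n d x = newton n y w d"
  using d
proof (induction d rule: less_induct)
  case (less d)
  have E': "(\<Prod>i<n. \<Prod>j<1::nat. bser (-1) (x i * 1)) = esym n y w"
    unfolding E[symmetric] bser_minus_one by simp
  have 0: "fps_nth (esym n y w) 0 = 1" unfolding E[symmetric] by (simp add: fps_prod_nth_0)
  have "of_nat d * fps_nth (esym n y w) d = (\<Sum>k=1..d. -1 * psum n k x * psum 1 k (\<lambda>_. 1) * fps_nth (esym n y w) (d - k))"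
    using kernel_recursion[where d = d and n = n and m = 1 and a = "-1" and x = x and y = "\<lambda>_. 1"] unfolding E' .
  also have "\<dots> = - (\<Sum>k=1..d. psum n k x * fps_nth (esym n y w) (d - k))"
    by (simp add: psum_def sum_negf)
  also have "{1..d} = insert d {1..<d}" using less.prems by auto
  also have "(\<Sum>k\<in>insert d {1..<d}. psum n k x * fps_nth (esym n y w) (d - k)) = psum n d x + (\<Sum>k\<in>{1..<d}. newton n y w k * fps_nth (esym n y w) (d - k))"
    using less by (simp add: 0)
  finally have "of_nat d * fps_nth (esym n y w) d = - (psum n d x + (\<Sum>k\<in>{1..<d}. newton n y w k * fps_nth (esym n y w) (d - k)))" .
  then show ?case by (subst newton.simps) (simp only: mult_minus_left, simp)
qed

section \<open>Polynomial dependence on nodes and weights\<close>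

definition join :: "nat \<Rightarrow> (nat \<Rightarrow> complex) \<Rightarrow> (nat \<Rightarrow> complex) \<Rightarrow> nat \<Rightarrow> complex" where
  "join n y w i = (if i < n then y i else w (i - n))"

text \<open>One polynomial in \<open>2 * n\<close> variables, the nodes first, must serve all
  \<open>y\<close> and \<open>w\<close>. The closure rules below spare its explicit
  construction.\<close>

definition joint_poly :: "nat \<Rightarrow> ((nat \<Rightarrow> complex) \<Rightarrow> (nat \<Rightarrow> complex) \<Rightarrow> complex) \<Rightarrow> bool" where
  "joint_poly n f \<longleftrightarrow> (\<exists>H. in_vars (2 * n) H \<and> (\<forall>y w. eval_mpoly (join n y w) H = f y w))"

lemma joint_poly_const: "joint_poly n (\<lambda>_ _. c)"
  unfolding joint_poly_def by (intro exI[of _ "const c"]) simp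

lemma joint_poly_y: "i < n \<Longrightarrow> joint_poly n (\<lambda>y _. y i)"
  unfolding joint_poly_def by (intro exI[of _ "var i"]) (simp add: join_def)

lemma joint_poly_w: "i < n \<Longrightarrow> joint_poly n (\<lambda>_ w. w i)"
  unfolding joint_poly_def by (intro exI[of _ "var (n + i)"]) (simp add: join_def)

lemma joint_poly_add: "joint_poly n f \<Longrightarrow> joint_poly n h \<Longrightarrow> joint_poly n (\<lambda>y w. f y w + h y w)"
  unfolding joint_poly_def by (metis in_vars_add eval_mpoly_add)

lemma joint_poly_diff: "joint_poly n f \<Longrightarrow> joint_poly n h \<Longrightarrow> joint_poly n (\<lambda>y w. f y w - h y w)"
  unfolding joint_poly_def by (metis in_vars_minus eval_mpoly_minus)

lemma joint_poly_mult: "joint_poly n f \<Longrightarrow> joint_poly n h \<Longrightarrow> joint_poly n (\<lambda>y w. f y w * h y w)"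
  unfolding joint_poly_def by (metis in_vars_mult eval_mpoly_mult)

lemma joint_poly_sum: "(\<And>a. a \<in> A \<Longrightarrow> joint_poly n (f a)) \<Longrightarrow> joint_poly n (\<lambda>y w. \<Sum>a\<in>A. f a y w)"
  by (induction A rule: infinite_finite_induct) (auto intro: joint_poly_const joint_poly_add)

lemma joint_poly_prod_list: "(\<And>a. a \<in> set as \<Longrightarrow> joint_poly n (f a)) \<Longrightarrow> joint_poly n (\<lambda>y w. \<Prod>a\<leftarrow>as. f a y w)"
  by (induction as) (auto intro: joint_poly_const joint_poly_mult)

definition joint_fps :: "nat \<Rightarrow> ((nat \<Rightarrow> complex) \<Rightarrow> (nat \<Rightarrow> complex) \<Rightarrow> complex fps) \<Rightarrow> bool" where
  "joint_fps n F \<longleftrightarrow> (\<forall>d. joint_poly n (\<lambda>y w. fps_nth (F y w) d))"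

lemma joint_fps_const: "joint_poly n f \<Longrightarrow> joint_fps n (\<lambda>y w. fps_const (f y w))"
  unfolding joint_fps_def
proof
  fix d assume "joint_poly n f"
  then show "joint_poly n (\<lambda>y w. fps_nth (fps_const (f y w)) d)" by (cases "d = 0") (simp_all add: joint_poly_const)
qed

lemma joint_fps_X: "joint_fps n (\<lambda>_ _. fps_X)"
  unfolding joint_fps_def by (simp add: joint_poly_const)

lemma joint_fps_one: "joint_fps n (\<lambda>_ _. 1)"
  unfolding joint_fps_def by (simp add: joint_poly_const)

lemma joint_fps_zero: "joint_fps n (\<lambda>_ _. 0)"
  unfolding joint_fps_def by (simp add: joint_poly_const)

lemma joint_fps_diff: "joint_fps n F \<Longrightarrow> joint_fps n G \<Longrightarrow> joint_fps n (\<lambda>y w. F y w - G y w)"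
  unfolding joint_fps_def by (simp add: joint_poly_diff)

lemma joint_fps_add: "joint_fps n F \<Longrightarrow> joint_fps n G \<Longrightarrow> joint_fps n (\<lambda>y w. F y w + G y w)"
  unfolding joint_fps_def by (simp add: joint_poly_add)

lemma joint_fps_mult: "joint_fps n F \<Longrightarrow> joint_fps n G \<Longrightarrow> joint_fps n (\<lambda>y w. F y w * G y w)"
  unfolding joint_fps_def fps_mult_nth by (intro allI joint_poly_sum joint_poly_mult) auto

lemma joint_fps_prod: "(\<And>a. a \<in> A \<Longrightarrow> joint_fps n (F a)) \<Longrightarrow> joint_fps n (\<lambda>y w. \<Prod>a\<in>A. F a y w)"
  by (induction A rule: infinite_finite_induct) (auto intro: joint_fps_one joint_fps_mult)

lemma joint_fps_sum: "(\<And>a. a \<in> A \<Longrightarrow> joint_fps n (F a)) \<Longrightarrow> joint_fps n (\<lambda>y w. \<Sum>a\<in>A. F a y w)"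
  by (induction A rule: infinite_finite_induct) (auto intro: joint_fps_add joint_fps_zero)

lemma joint_fps_esym: "joint_fps n (esym n)"
  unfolding esym_def[abs_def]
  by (intro joint_fps_diff joint_fps_prod joint_fps_mult joint_fps_sum joint_fps_X joint_fps_one joint_fps_const joint_poly_mult joint_poly_y joint_poly_w) auto

lemma joint_poly_newton: "joint_poly n (\<lambda>y w. newton n y w d)"
proof (induction d rule: less_induct)
  case (less d)
  have E: "joint_poly n (\<lambda>y w. fps_nth (esym n y w) k)" for k using joint_fps_esym[of n] by (simp add: joint_fps_def)
  show ?case
    by (subst newton.simps) (intro joint_poly_diff joint_poly_mult joint_poly_sum joint_poly_const E less; simp)
qed

section \<open>Symmetry under simultaneous permutations of nodes and weights\<close>

definition bisym :: "nat \<Rightarrow> ((nat \<Rightarrow> complex) \<Rightarrow> (nat \<Rightarrow> complex) \<Rightarrow> 'a) \<Rightarrow> bool" where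
  "bisym n f \<longleftrightarrow> (\<forall>\<sigma>. \<sigma> permutes {..<n} \<longrightarrow> (\<forall>y w. f (\<lambda>i. y (\<sigma> i)) (\<lambda>i. w (\<sigma> i)) = f y w))"

lemma bisym_esym: "bisym n (esym n)"
  unfolding bisym_def
proof (intro allI impI)
  fix \<sigma> and y w :: "nat \<Rightarrow> complex" assume \<sigma>: "\<sigma> permutes {..<n}"
  let ?l = "\<lambda>j. 1 - fps_const (y j) * fps_X :: complex fps"
  have 1: "(\<Prod>i<n. ?l (\<sigma> i)) = (\<Prod>i<n. ?l i)"
    using prod.permute[OF \<sigma>, of ?l] by (simp add: o_def)
  have 2: "(\<Prod>j\<in>{..<n} - {i}. ?l (\<sigma> j)) = (\<Prod>j\<in>{..<n} - {\<sigma> i}. ?l j)" for i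
  proof (rule prod.reindex_bij_betw)
    have "bij_betw \<sigma> ({..<n} - {i}) (\<sigma> ` ({..<n} - {i}))"
      using permutes_inj_on[OF \<sigma>] by (rule inj_on_imp_bij_betw)
    also have "\<sigma> ` ({..<n} - {i}) = {..<n} - {\<sigma> i}"
      using permutes_image[OF \<sigma>] permutes_inj[OF \<sigma>] by (simp add: image_set_diff)
    finally show "bij_betw \<sigma> ({..<n} - {i}) ({..<n} - {\<sigma> i})" .
  qed
  have 3: "(\<Sum>i<n. fps_const (y (\<sigma> i) * w (\<sigma> i)) * (\<Prod>j\<in>{..<n} - {\<sigma> i}. ?l j)) = (\<Sum>i<n. fps_const (y i * w i) * (\<Prod>j\<in>{..<n} - {i}. ?l j))"
    using sum.permute[OF \<sigma>, of "\<lambda>i. fps_const (y i * w i) * (\<Prod>j\<in>{..<n} - {i}. ?l j)"] by (simp add: o_def)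
  show "esym n (\<lambda>i. y (\<sigma> i)) (\<lambda>i. w (\<sigma> i)) = esym n y w"
    unfolding esym_def 1 2 3 ..
qed

lemma bisym_newton: "\<sigma> permutes {..<n} \<Longrightarrow> newton n (\<lambda>i. y (\<sigma> i)) (\<lambda>i. w (\<sigma> i)) d = newton n y w d"
proof (induction d rule: less_induct)
  case (less d)
  have E: "esym n (\<lambda>i. y (\<sigma> i)) (\<lambda>i. w (\<sigma> i)) = esym n y w"
    using bisym_esym[of n] less.prems by (simp add: bisym_def)
  have "(\<Sum>k\<in>{1..<d}. newton n (\<lambda>i. y (\<sigma> i)) (\<lambda>i. w (\<sigma> i)) k * fps_nth (esym n y w) (d - k)) = (\<Sum>k\<in>{1..<d}. newton n y w k * fps_nth (esym n y w) (d - k))"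
  proof (rule sum.cong[OF refl])
    fix k assume "k \<in> {1..<d}"
    then have "newton n (\<lambda>i. y (\<sigma> i)) (\<lambda>i. w (\<sigma> i)) k = newton n y w k" using less.IH[of k] less.prems by simp
    then show "newton n (\<lambda>i. y (\<sigma> i)) (\<lambda>i. w (\<sigma> i)) k * fps_nth (esym n y w) (d - k) = newton n y w k * fps_nth (esym n y w) (d - k)" by simp
  qed
  then show ?case unfolding newton.simps[of n _ _ d] E by simp
qed

text \<open>Up to \<open>fact n\<close>, a symmetric polynomial is a combination of products of
  power sums, and \<open>newton\<close> obtains these from the product of the
  \<open>1 - x i X\<close>, hence from nodes and weights. Both properties of \<open>f\<close> are
  inherited from \<open>newton\<close>.\<close>

lemma sym_polys_residues:
  assumes p: "p \<in> sym_polys n"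
  shows "\<exists>f. joint_poly n f \<and> bisym n f \<and> (\<forall>x y w. (\<Prod>i<n. 1 - fps_const (x i) * fps_X) = esym n y w \<longrightarrow> eval_mpoly x p = f y w)"
proof -
  define as where "as m = map (lookup m) [0..<n]" for m :: "nat \<Rightarrow>\<^sub>0 nat"
  have "\<forall>m. \<exists>t. \<forall>x. mono_sum n (as m) x = (\<Sum>\<alpha>\<in>compos (sum_list (as m)). t \<alpha> * psl n \<alpha> x)"
    using psum_span_mono_sum[of n] unfolding psum_span_def by fast
  from choice[OF this] obtain t where t0: "\<forall>m x. mono_sum n (as m) x = (\<Sum>\<alpha>\<in>compos (sum_list (as m)). t m \<alpha> * psl n \<alpha> x)" ..
  note t = t0[rule_format]
  define f where "f y w = 1 / fact n * (\<Sum>m\<in>keys p. lookup p m * (\<Sum>\<alpha>\<in>compos (sum_list (as m)). t m \<alpha> * (\<Prod>k\<leftarrow>\<alpha>. newton n y w k)))" for y w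
  have "joint_poly n f"
    unfolding f_def[abs_def] by (intro joint_poly_mult joint_poly_const joint_poly_sum joint_poly_prod_list joint_poly_newton)
  moreover have "bisym n f"
    unfolding bisym_def f_def
  proof (intro allI impI)
    fix \<sigma> and y w :: "nat \<Rightarrow> complex" assume "\<sigma> permutes {..<n}"
    then have "newton n (\<lambda>i. y (\<sigma> i)) (\<lambda>i. w (\<sigma> i)) = newton n y w" by (intro ext bisym_newton)
    then show "1 / fact n * (\<Sum>m\<in>keys p. lookup p m * (\<Sum>\<alpha>\<in>compos (sum_list (as m)). t m \<alpha> * (\<Prod>k\<leftarrow>\<alpha>. newton n (\<lambda>i. y (\<sigma> i)) (\<lambda>i. w (\<sigma> i)) k)))
      = 1 / fact n * (\<Sum>m\<in>keys p. lookup p m * (\<Sum>\<alpha>\<in>compos (sum_list (as m)). t m \<alpha> * (\<Prod>k\<leftarrow>\<alpha>. newton n y w k)))"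
      by simp
  qed
  moreover have "eval_mpoly x p = f y w" if E: "(\<Prod>i<n. 1 - fps_const (x i) * fps_X) = esym n y w" for x y w
  proof -
    have ps: "psl n \<alpha> x = (\<Prod>k\<leftarrow>\<alpha>. newton n y w k)" if "\<alpha> \<in> compos d" for \<alpha> d
      unfolding psl_def using that psum_newton[OF E] by (intro arg_cong[of _ _ prod_list] map_cong) (auto simp: compos_def)
    have "fact n * eval_mpoly x p = (\<Sum>m\<in>keys p. lookup p m * (\<Sum>\<alpha>\<in>compos (sum_list (as m)). t m \<alpha> * (\<Prod>k\<leftarrow>\<alpha>. newton n y w k)))"
      unfolding sym_eval_mono_sum[OF p] as_def[symmetric] t
      by (rule sum.cong[OF refl], rule arg_cong2[of _ _ _ _ "(*)"], rule refl, rule sum.cong[OF refl]) (simp add: ps)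
    then show ?thesis unfolding f_def by (simp add: field_simps)
  qed
  ultimately show ?thesis by blast
qed

section \<open>The polynomial of the operator \<open>Q\<close>\<close>

lemma poly_map_const: "poly (map_poly const P) (const z) = const (poly P z)"
proof (induction P)
  case (pCons a P)
  then show ?case by (simp add: map_poly_pCons const_add[symmetric] const_mult[symmetric])
qed simp

lemma eval_poly_const: "eval_mpoly y (poly r (const z)) = poly (map_poly (eval_mpoly y) r) z"
  by (induction r) (simp_all add: map_poly_pCons eval_mpoly_add eval_mpoly_mult)

lemma eval_coeff: "eval_mpoly y (coeff r k) = coeff (map_poly (eval_mpoly y) r) k"
  by (simp add: coeff_map_poly)

lemma prod_lessThan_add: "(\<Prod>i<a + b. f i) = (\<Prod>i<a. f i) * (\<Prod>i<b. f (a + i :: nat) :: complex)"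
  by (induction b) (simp_all add: mult.assoc)

lemma bisymD: "bisym n f \<Longrightarrow> \<sigma> permutes {..<n} \<Longrightarrow> f (\<lambda>i. y (\<sigma> i)) (\<lambda>i. w (\<sigma> i)) = f y w"
  by (simp add: bisym_def)

definition double_perm :: "nat \<Rightarrow> (nat \<Rightarrow> nat) \<Rightarrow> nat \<Rightarrow> nat" where
  "double_perm n \<sigma> i = (if i < n then \<sigma> i else if i < 2 * n then n + \<sigma> (i - n) else i)"

lemma double_perm_permutes:
  assumes \<sigma>: "\<sigma> permutes {..<n}"
  shows "double_perm n \<sigma> permutes {..<2 * n}"
proof (rule bij_imp_permutes)
  let ?i = "inv_into UNIV \<sigma>"
  have a: "\<sigma> i < n" "?i i < n" if "i < n" for i
    using permutes_in_image[OF \<sigma>, of i] permutes_in_image[OF permutes_inv[OF \<sigma>], of i] that by auto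
  show "bij_betw (double_perm n \<sigma>) {..<2 * n} {..<2 * n}"
    by (rule bij_betw_byWitness[where f' = "double_perm n ?i"])
      (use a a[THEN trans_less_add1, of _ n] permutes_inverses[OF \<sigma>] in \<open>auto simp: double_perm_def mult_2\<close>)
qed (auto simp: double_perm_def)

text \<open>The permuted \<open>H\<close> has the same values, hence the same coefficients. The
  invariance is needed for coefficients because \<open>Q_witness\<close> is built from them term by
  term.\<close>

lemma lookup_double_perm:
  assumes H: "in_vars (2 * n) H" "\<And>y w. eval_mpoly (join n y w) H = f y w" and f: "bisym n f" and \<sigma>: "\<sigma> permutes {..<n}"
  shows "lookup H (map_key (double_perm n \<sigma>) \<mu>) = lookup H \<mu>"
proof -
  note dp = double_perm_permutes[OF \<sigma>]
  have "permute_vars (double_perm n \<sigma>) H = H"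
  proof (rule mpoly_eqI_eval[OF in_vars_permute_vars[OF dp H(1)] H(1)])
    fix x :: "nat \<Rightarrow> real"
    let ?y = "\<lambda>i. complex_of_real (x i)" and ?w = "\<lambda>i. complex_of_real (x (n + i))"
    have a: "\<sigma> i < n" if "i < n" for i using permutes_in_image[OF \<sigma>, of i] that by auto
    have "eval_mpoly (\<lambda>i. complex_of_real (x i)) (permute_vars (double_perm n \<sigma>) H) = eval_mpoly (\<lambda>i. complex_of_real (x (double_perm n \<sigma> i))) H"
      by (rule eval_permute_vars[OF dp])
    also have "\<dots> = eval_mpoly (join n (\<lambda>i. ?y (\<sigma> i)) (\<lambda>i. ?w (\<sigma> i))) H"
      using a by (intro eval_mpoly_cong_in_vars[OF H(1)]) (auto simp: join_def double_perm_def)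
    also have "\<dots> = eval_mpoly (join n ?y ?w) H"
      unfolding H(2) by (rule bisymD[OF f \<sigma>, of ?y ?w])
    also have "\<dots> = eval_mpoly (\<lambda>i. complex_of_real (x i)) H"
      by (intro eval_mpoly_cong_in_vars[OF H(1)]) (auto simp: join_def)
    finally show "eval_mpoly (\<lambda>i. complex_of_real (x i)) (permute_vars (double_perm n \<sigma>) H) = eval_mpoly (\<lambda>i. complex_of_real (x i)) H" .
  qed
  then show ?thesis using lookup_permute_vars[OF dp, of H \<mu>] by simp
qed

text \<open>Every monomial in the weights is replaced by its Dirichlet moment, where
  \<open>z\<close> enters through a power of \<open>z - 1\<close>; the monomials in the nodes stay
  as coefficients.\<close>

definition Q_witness :: "nat \<Rightarrow> real \<Rightarrow> mpoly \<Rightarrow> mpoly poly" where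
  "Q_witness n g H = (\<Sum>\<mu>\<in>keys H. Polynomial.smult
     (const (lookup H \<mu> * of_real (dir_moment n g (\<lambda>i. lookup \<mu> (n + i)))) * (\<Prod>i<n. var i ^ lookup \<mu> i))
     (map_poly const ([:-1, 1:] ^ (\<Sum>i<n. lookup \<mu> (n + i)))))"

lemma eval_Q_witness:
  "eval_mpoly y (poly (Q_witness n g H) (const (of_real z))) = (\<Sum>\<mu>\<in>keys H. lookup H \<mu> * (\<Prod>i<n. y i ^ lookup \<mu> i) *
      of_real ((z - 1) ^ (\<Sum>i<n. lookup \<mu> (n + i)) * dir_moment n g (\<lambda>i. lookup \<mu> (n + i))))"
  unfolding Q_witness_def
  by (simp add: poly_sum eval_mpoly_sum eval_mpoly_mult eval_mpoly_prod eval_mpoly_power poly_map_const mult_ac)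

lemma dir_moment_permute:
  assumes \<sigma>: "\<sigma> permutes {..<n}"
  shows "dir_moment n g (\<lambda>i. b (\<sigma> i)) = dir_moment n g b"
  using prod.permute[OF \<sigma>, of "\<lambda>i. Gamma (g + real (b i))"] sum.permute[OF \<sigma>, of "\<lambda>i. real (b i)"]
  by (simp add: dir_moment_def o_def)

text \<open>Dirichlet moments are symmetric in the exponents of the weights, so once the weights are
  integrated out, the simultaneous symmetry of \<open>H\<close> becomes symmetry in \<open>y\<close>
  alone.\<close>

lemma coeff_Q_witness_sym:
  assumes H: "in_vars (2 * n) H" "\<And>y w. eval_mpoly (join n y w) H = f y w" and f: "bisym n f"
  shows "coeff (Q_witness n g H) k \<in> sym_polys n"
proof -
  define \<phi> where "\<phi> y \<mu> = of_real (dir_moment n g (\<lambda>i. lookup \<mu> (n + i))) * (\<Prod>i<n. y i ^ lookup \<mu> i) *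
    coeff ([:-1, 1:] ^ (\<Sum>i<n. lookup \<mu> (n + i))) k" for y :: "nat \<Rightarrow> complex" and \<mu> :: "nat \<Rightarrow>\<^sub>0 nat"
  have ev: "eval_mpoly y (coeff (Q_witness n g H) k) = (\<Sum>\<mu>\<in>keys H. lookup H \<mu> * \<phi> y \<mu>)" for y
    unfolding Q_witness_def \<phi>_def
    by (simp add: coeff_sum eval_mpoly_sum eval_mpoly_mult eval_mpoly_prod eval_mpoly_power coeff_map_poly mult_ac)
  have inv: "in_vars n (coeff (Q_witness n g H) k)"
    unfolding Q_witness_def coeff_sum coeff_smult
    by (intro in_vars_sum in_vars_mult in_vars_prod in_vars_power in_vars_const) (auto simp: coeff_map_poly)
  show ?thesis
    unfolding sym_polys_eval_iff
  proof (intro conjI inv allI impI)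
    fix \<sigma> and y :: "nat \<Rightarrow> complex" assume \<sigma>: "\<sigma> permutes {..<n}"
    let ?\<tau> = "double_perm n \<sigma>"
    note dp = double_perm_permutes[OF \<sigma>]
    have lk: "lookup (map_key ?\<tau> \<mu>) i = lookup \<mu> (?\<tau> i)" for \<mu> i
      by (simp add: map_key.rep_eq[OF permutes_inj[OF dp]])
    have \<phi>: "\<phi> (\<lambda>i. y (\<sigma> i)) (map_key ?\<tau> \<mu>) = \<phi> y \<mu>" for \<mu>
    proof -
      have a: "(\<Prod>i<n. y (\<sigma> i) ^ lookup \<mu> (?\<tau> i)) = (\<Prod>i<n. y i ^ lookup \<mu> i)"
        using prod.permute[OF \<sigma>, of "\<lambda>i. y i ^ lookup \<mu> i"] by (simp add: double_perm_def o_def)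
      have b: "(\<Sum>i<n. lookup \<mu> (?\<tau> (n + i))) = (\<Sum>i<n. lookup \<mu> (n + i))"
        using sum.permute[OF \<sigma>, of "\<lambda>i. lookup \<mu> (n + i)"] by (simp add: double_perm_def o_def)
      have "dir_moment n g (\<lambda>i. lookup \<mu> (?\<tau> (n + i))) = dir_moment n g (\<lambda>i. lookup \<mu> (n + \<sigma> i))"
        unfolding dir_moment_def by (simp add: double_perm_def)
      also have "\<dots> = dir_moment n g (\<lambda>i. lookup \<mu> (n + i))" by (rule dir_moment_permute[OF \<sigma>, of _ "\<lambda>i. lookup \<mu> (n + i)"])
      finally show ?thesis unfolding \<phi>_def lk a b by simp
    qed
    note lH = lookup_double_perm[OF H f \<sigma>]
    show "eval_mpoly (\<lambda>i. y (\<sigma> i)) (coeff (Q_witness n g H) k) = eval_mpoly y (coeff (Q_witness n g H) k)"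
      unfolding ev
      by (rule sum.reindex_bij_witness[of _ "map_key ?\<tau>" "map_key (inv_into UNIV ?\<tau>)"])
        (use \<phi>[of "map_key (inv_into UNIV ?\<tau>) _"] lH lH[of "map_key (inv_into UNIV ?\<tau>) _"]
         in \<open>simp_all add: in_keys_iff map_key_inv[OF dp]\<close>)
  qed
qed

definition is_Q_poly :: "nat \<Rightarrow> real \<Rightarrow> mpoly \<Rightarrow> mpoly poly \<Rightarrow> bool" where
  "is_Q_poly n g p r \<longleftrightarrow> (\<forall>k. coeff r k \<in> sym_polys n) \<and>
     (\<forall>z y. z > 1 \<and> strict_mono_on {..<n} y \<and> (\<forall>i<n. 0 < y i) \<longrightarrow>
        eval_mpoly (\<lambda>i. of_real (y i)) (poly r (const (of_real z))) = Q_integral n g z p y)"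

lemma is_Q_poly_exists:
  assumes n: "1 \<le> n" and g: "0 < g" and p: "p \<in> sym_polys n"
  shows "\<exists>r. is_Q_poly n g p r"
proof -
  from sym_polys_residues[OF p] obtain f where f: "joint_poly n f" "bisym n f"
    and fe: "\<forall>x y w. (\<Prod>i<n. 1 - fps_const (x i) * fps_X) = esym n y w \<longrightarrow> eval_mpoly x p = f y w" by (elim exE conjE)
  from f(1) obtain H where H: "in_vars (2 * n) H" and He0: "\<forall>y w. eval_mpoly (join n y w) H = f y w"
    unfolding joint_poly_def by (elim exE conjE)
  note He = He0[rule_format]
  obtain m where m: "n = Suc m" using n by (cases n) auto
  have "is_Q_poly n g p (Q_witness n g H)"
    unfolding is_Q_poly_def
  proof (intro conjI allI impI)
    show "coeff (Q_witness n g H) k \<in> sym_polys n" for k by (rule coeff_Q_witness_sym[OF H He f(2)])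
  next
    fix z :: real and y :: "nat \<Rightarrow> real"
    assume asm: "z > 1 \<and> strict_mono_on {..<n} y \<and> (\<forall>i<n. 0 < y i)"
    have set: "{0..m} = {..<n}" using m by auto
    have inj: "inj_on (\<lambda>i. complex_of_real (y i)) {..<n}"
      using strict_mono_on_imp_inj_on[of "{..<n}" y] asm by (auto simp: inj_on_def)
    have "eval_mpoly (\<lambda>i. of_real (X i)) p = (\<Sum>\<mu>\<in>keys H. lookup H \<mu> * (\<Prod>i<n. of_real (y i) ^ lookup \<mu> i) *
         (\<Prod>i<n. of_real (wgt 0 m y X i) ^ lookup \<mu> (n + i)))" for X
    proof -
      let ?x = "\<lambda>i. complex_of_real (X i)" and ?y = "\<lambda>i. complex_of_real (y i)" and ?w = "\<lambda>i. complex_of_real (wgt 0 m y X i)"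
      have w: "(\<lambda>i. lagc {..<n} ?y ?x i / ?y i) = ?w"
        by (simp add: fun_eq_iff wgt_def lagc_def set)
      have "(\<Prod>i<n. 1 - fps_const (?x i) * fps_X) = esym n ?y (\<lambda>i. lagc {..<n} ?y ?x i / ?y i)"
        using asm by (intro esym_lagrange inj) auto
      then have "eval_mpoly ?x p = f ?y ?w" unfolding w by (rule fe[rule_format, of ?x ?y ?w])
      also have "\<dots> = eval_mpoly (join n ?y ?w) H" by (rule He[symmetric])
      also have "\<dots> = (\<Sum>\<mu>\<in>keys H. lookup H \<mu> * meval (join n ?y ?w) \<mu>)"
        by (rule eval_mpoly_superset) auto
      also have "\<dots> = (\<Sum>\<mu>\<in>keys H. lookup H \<mu> * (\<Prod>i<n. ?y i ^ lookup \<mu> i) * (\<Prod>i<n. ?w i ^ lookup \<mu> (n + i)))"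
      proof (rule sum.cong[OF refl])
        fix \<mu> assume "\<mu> \<in> keys H"
        then have k: "keys \<mu> \<subseteq> {..<2 * n}" using H by (auto simp: in_vars_def)
        have "meval (join n ?y ?w) \<mu> = (\<Prod>i<n + n. join n ?y ?w i ^ lookup \<mu> i)"
          using meval_superset[OF _ k] by (simp add: mult_2)
        also have "\<dots> = (\<Prod>i<n. join n ?y ?w i ^ lookup \<mu> i) * (\<Prod>i<n. join n ?y ?w (n + i) ^ lookup \<mu> (n + i))"
          by (rule prod_lessThan_add)
        finally show "lookup H \<mu> * meval (join n ?y ?w) \<mu> = lookup H \<mu> * (\<Prod>i<n. ?y i ^ lookup \<mu> i) * (\<Prod>i<n. ?w i ^ lookup \<mu> (n + i))"
          by (simp add: join_def)
      qed
      finally show ?thesis .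
    qed
    then have "Q_integral n g z p y = (\<Sum>\<mu>\<in>keys H. lookup H \<mu> * (\<Prod>i<n. of_real (y i) ^ lookup \<mu> i) *
      of_real ((z - 1) ^ (\<Sum>i<n. lookup \<mu> (n + i)) * dir_moment n g (\<lambda>i. lookup \<mu> (n + i))))"
      using asm g m by (intro Q_integral_moments) auto
    then show "eval_mpoly (\<lambda>i. of_real (y i)) (poly (Q_witness n g H) (const (of_real z))) = Q_integral n g z p y"
      by (simp only: eval_Q_witness)
  qed
  then show ?thesis by blast
qed

text \<open>For fixed \<open>y\<close> both candidates give polynomials in \<open>z\<close> that
  agree for all real \<open>z > 1\<close>; so their coefficients agree at all admissible
  \<open>y\<close>, which determines them.\<close>

lemma is_Q_poly_unique:
  assumes "is_Q_poly n g p r" "is_Q_poly n g p r'"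
  shows "r = r'"
proof (rule poly_eqI)
  fix k
  have sym: "coeff r k \<in> sym_polys n" "coeff r' k \<in> sym_polys n" using assms by (auto simp: is_Q_poly_def)
  show "coeff r k = coeff r' k"
  proof (rule mpoly_eqI_eval[OF sym[THEN sym_polys_in_vars]])
    fix y :: "nat \<Rightarrow> real"
    assume y: "strict_mono_on {..<n} y" "\<And>i. i < n \<Longrightarrow> 0 < y i"
    let ?e = "eval_mpoly (\<lambda>i. of_real (y i))"
    have "map_poly ?e r = map_poly ?e r'"
    proof (rule ccontr)
      assume "map_poly ?e r \<noteq> map_poly ?e r'"
      then have fin: "finite {z. poly (map_poly ?e r - map_poly ?e r') z = 0}" by (intro poly_roots_finite) simp
      have "complex_of_real ` {1<..} \<subseteq> {z. poly (map_poly ?e r - map_poly ?e r') z = 0}"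
        using assms y by (auto simp: is_Q_poly_def eval_poly_const)
      then have "finite (complex_of_real ` {1<..})" using fin finite_subset by blast
      then show False by (simp add: finite_image_iff inj_on_def infinite_Ioi)
    qed
    then show "?e (coeff r k) = ?e (coeff r' k)" by (simp add: eval_coeff)
  qed
qed

lemma Q_poly_eqI: "is_Q_poly n g p r \<Longrightarrow> Q_poly n g p = r"
  unfolding Q_poly_def is_Q_poly_def[symmetric] using is_Q_poly_unique by (intro the_equality)

text \<open>A scalar leaves the Bochner integral without any integrability condition: a nonzero one
  preserves integrability, and the integral of a function that is not integrable is 0.\<close>

lemma Q_integral_cmult: "Q_integral n g z (const c * p) y = c * Q_integral n g z p y"
proof -
  have a: "of_real u * (indicator A x * (of_real v * eval_mpoly h (const c * p)) / of_real w) = c * (of_real u * (indicator A x * (of_real v * eval_mpoly h p) / of_real w))"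
    for u v w :: real and A and x :: "nat \<Rightarrow> real" and h
    by (simp add: eval_mpoly_mult)
  show ?thesis
    unfolding Q_integral_def delta_integral_def graph_integral_def a integral_mult_right_zero by (simp only: mult.left_commute)
qed

lemma Q_op_cmult:
  assumes n: "1 \<le> n" and g: "0 < g" and p: "p \<in> sym_polys n"
  shows "Q_op n g z (const c * p) = const c * Q_op n g z p"
proof -
  obtain r where r: "is_Q_poly n g p r" using is_Q_poly_exists[OF assms] ..
  have "is_Q_poly n g (const c * p) (Polynomial.smult (const c) r)"
    using r unfolding is_Q_poly_def by (auto simp: Q_integral_cmult eval_mpoly_mult intro!: sym_polys_mult)
  then show ?thesis using r by (simp add: Q_op_def Q_poly_eqI)
qed

lemma foldr_Q_op:
  assumes n: "1 \<le> n" and g: "0 < g" and p: "p \<in> sym_polys n"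
    and eig: "\<And>w. Q_op n g w p = const (q w) * p"
  shows "foldr (\<lambda>k. Q_op n g (z k)) ks p = const (\<Prod>k\<leftarrow>ks. q (z k)) * p"
proof (induction ks)
  case (Cons k ks)
  then show ?case
    by (simp add: Q_op_cmult[OF n g p] eig) (simp add: const_mult mult_ac)
qed simp

theorem theorem6p1:
  fixes n :: nat and g :: real and lam :: "nat list" and q :: "complex \<Rightarrow> complex"
    and z :: "nat \<Rightarrow> complex"
  assumes "n \<ge> 1" and "g > 0" and "is_partition n lam"
    and eigenvalue: "\<And>w. Q_op n g w (jack n g lam) = const (q w) * jack n g lam"
  shows "S_op n g z (jack n g lam) = eval_mpoly (\<lambda>_. 1) (jack n g lam) * (\<Prod>k<n. q (z k)) \<and>
    eval_mpoly (\<lambda>_. 1) (jack n g lam) =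
      (\<Prod>j<n. \<Prod>i<j. pochhammer (of_real (g * real (j - i + 1))) (lam ! i - lam ! j) /
                      pochhammer (of_real (g * real (j - i))) (lam ! i - lam ! j))"
proof
  have sym: "jack n g lam \<in> sym_polys n"
    using jack_properties[OF assms(2,3)] by (simp add: unitri_def)
  have "(\<Prod>k\<leftarrow>[0..<n]. q (z k)) = (\<Prod>k<n. q (z k))"
    by (simp add: prod.distinct_set_conv_list[symmetric] atLeast0LessThan)
  then show "S_op n g z (jack n g lam) = eval_mpoly (\<lambda>_. 1) (jack n g lam) * (\<Prod>k<n. q (z k))"
    unfolding S_op_def foldr_Q_op[OF assms(1,2) sym eigenvalue] by (simp add: eval_mpoly_mult mult.commute)
  show "eval_mpoly (\<lambda>_. 1) (jack n g lam) =
      (\<Prod>j<n. \<Prod>i<j. pochhammer (of_real (g * real (j - i + 1))) (lam ! i - lam ! j) /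
                      pochhammer (of_real (g * real (j - i))) (lam ! i - lam ! j))"
    using eval_jack_one[OF assms(2,3)] unfolding jack_one_def .
qed

end
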